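(* Let $\mathfrak g$ be a symmetrizable Kac–Moody algebra, $(\Gamma_1,\Gamma_2,T)$ a nondegenerate generalized Belavin–Drinfeld triple for $\mathfrak g$, $V_1,\dots,V_r$ $\mathfrak g$-modules from the category $\mathcal O$, and $v_i\in V_i$ homogeneous vectors of weights $\nu_i$ such that $\nu=\sum_i\nu_i\in\mathfrak l^{\perp}$. Let $\lambda\in\mathfrak l^*$ and let $\mu$ be a generic element of the $\mathfrak l^*$-principal homogeneous space $\{\mu\in\mathfrak h^*: (\mu-\nu,\alpha)=(\mu,T\alpha)\ \forall \alpha\in\Gamma_1\}$. Then the function (formal series in $\lambda$) $\mathbb F^{v_1,\dots,v_r}(\lambda,\mu)$ defined in the context satisfies $$\Big(\sum_{j\in I_1}\frac{\partial^2}{\partial x_j^2}-\sum_{l,n=1}^rS_T(\lambda)_{|V_l\otimes V_n}\Big)\mathbb F^{v_1,\dots,v_r}(\lambda,\mu)=(\mu+\rho,\mu+\rho)\,\mathbb F^{v_1,\dots,v_r}(\lambda,\mu),$$ where $$S_T(\lambda)=\sum_{\alpha,t}\sum_{s=0}^\infty\sum_{v=1}^\infty e^{-(s+v)(\alpha,\lambda)}\big(B^sf_\alpha^{(t)}\otimes B^{-v}e_\alpha^{(t)}+B^{-v}e_\alpha^{(t)}\otimes B^sf_\alpha^{(t)}\big)-\sum_{j\in I_2}\frac{1-C_T}{2}x_j\otimes\frac{1-C_T}{2}x_j .$$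
   Context: Kac–Moody data. $A=(a_{ij})$ is a symmetrizable generalized Cartan matrix with realization $(\mathfrak h,\Gamma=\{\alpha_1,\dots,\alpha_n\}\subset\mathfrak h^*,\{h_1,\dots,h_n\}\subset\mathfrak h)$; $\mathfrak g=\mathfrak n_-\oplus\mathfrak h\oplus\mathfrak n_+$ is the Kac–Moody algebra with generators $e_i,f_i,\mathfrak h$; $(\,,)$ is a nondegenerate invariant bilinear form on $\mathfrak g$, used to identify $\mathfrak h$ with $\mathfrak h^*$. $\Delta^+$ is the set of positive roots. For $\alpha\in\Delta^+$ choose bases $e_\alpha^{(t)}$ of $\mathfrak g_\alpha$ and $f_\alpha^{(t)}$ of $\mathfrak g_{-\alpha}$ with $(e_\alpha^{(s)},f_\alpha^{(t)})=\delta_{st}$ (for $\alpha=\alpha_i$ simple: $e_\alpha=e_i$, $f_\alpha=f_i/(e_i,f_i)$); $h_\alpha=[e_\alpha^{(t)},f_\alpha^{(t)}]$. $\rho\in\mathfrak h^*$ satisfies $\langle\rho,h_i\rangle=1$ for all $i$. Sums $\sum_{\alpha,t}$ run over $\alpha\in\Delta^+$, $1\le t\le\dim\mathfrak g_\alpha$. Triples. A generalized Belavin–Drinfeld triple is $(\Gamma_1,\Gamma_2,T)$ with $\Gamma_1,\Gamma_2\subset\Gamma$ and $T:\Gamma_1\to\Gamma_2$ an inner-product-preserving bijection. Put $\mathfrak l=\big(\sum_{\alpha\in\Gamma_1}\mathbb C(\alpha-T\alpha)\big)^\perp\subset\mathfrak h$ and let $\mathfrak h_0=\mathfrak l^\perp$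 be its orthogonal complement in $\mathfrak h$. The triple is nondegenerate if $(\,,)|_{\mathfrak l}$ is nondegenerate; then $\mathfrak h=\mathfrak l\oplus\mathfrak h_0$. Choose an orthonormal basis $(x_j)_{j\in I}$ of $\mathfrak h$, $I=I_1\sqcup I_2$, with $\mathfrak l=\bigoplus_{j\in I_1}\mathbb Cx_j$, $\mathfrak h_0=\bigoplus_{j\in I_2}\mathbb Cx_j$. $\mathfrak l^*$ is regarded as a subspace of $\mathfrak h^*$ via the form. $\Gamma_3\subset\Gamma_1\cap\Gamma_2$ is the set of simple roots returning to themselves after applying $T$ several times; $\langle\Gamma_3\rangle$ is the set of positive roots that are combinations of elements of $\Gamma_3$. Let $\mathfrak h_i$ be the span of $h_\alpha$, $\alpha\in\Gamma_i$. The maps $B$, $B^{-1}$. $B:\mathfrak n_-\oplus\mathfrak h_1\to\mathfrak n_-\oplus\mathfrak h_2$ is the unique Lie algebra homomorphism with $B(f_\alpha)=f_{T\alpha}$, $B(h_\alpha)=h_{T\alpha}$ for $\alpha\in\Gamma_1$ and $B(f_\alpha)=0$ for simple $\alpha\notin\Gamma_1$; $B^{-1}:\mathfrak n_+\oplus\mathfrak h_2\to\mathfrak n_+\oplus\mathfrak h_1$ is the unique homomorphism with $B^{-1}(e_\alpha)=e_{T^{-1}\alpha}$, $B^{-1}(h_\alpha)=h_{T^{-1}\alpha}$ for $\alpha\in\Gamma_2$ and $B^{-1}(e_\alpha)=0$ for simple $\alpha\notin\Gamma_2$; $B^{-v}=(B^{-1})^v$. They are extended to enveloping algebras. $B$ restricts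 to an automorphism of the subalgebra generated by $\mathfrak g_{\pm\alpha}$, $\alpha\in\Gamma_3$; for $\alpha\in\langle\Gamma_3\rangle$, $N_\alpha$ is the length of the orbit of $\alpha$ and the bases are chosen so that $B^{N_\alpha}f_\alpha^{(t)}=\theta_\alpha^{(t)}f_\alpha^{(t)}$, $B^{N_\alpha}e_\alpha^{(t)}=(\theta_\alpha^{(t)})^{-1}e_\alpha^{(t)}$. Cayley transform. $C_T:\mathfrak h_0\to\mathfrak h_0$ is the linear map such that $C_Tx$ is the unique $y\in\mathfrak h_0$ with $(\alpha-T\alpha,y)=(\alpha+T\alpha,x)$ for all $\alpha\in\Gamma_1$. Verma modules, intertwiners, traces. $M_\lambda$ is the Verma module of highest weight $\lambda$ with highest weight vector $v_\lambda$, $M_\lambda^*$ its graded dual, $v_\lambda^*\in M_\lambda^*[-\lambda]$ the vector with $\langle v^*_\lambda,v_\lambda\rangle=1$. For homogeneous $v\in V$ of weight $\kappa$ and $M^*_{\lambda-\kappa}$ irreducible (true for generic parameters), $\Phi^v_\lambda:M_\lambda\to M_{\lambda-\kappa}\otimes V$ is the unique $\mathfrak g$-intertwiner with $\langle v^*_{\lambda-\kappa},\Phi^v_\lambda v_\lambda\rangle=v$. For $\lambda\in\mathfrak h^*$, $e^\lambda$ acts on vectors of weight $\kappa$ by $e^{(\lambda,\kappa)}$. If $(\mu',\alpha)=(\mu,T\alpha)$ for all $\alpha\in\Gamma_1$, the linear map $B:M_{\mu'}\to M_\mu$ is $B(xv_{\mu'})=B(x)v_\mu$, $x\in U\mathfrak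 n_-$. For $\mu$ as in the claim take $\mu'=\mu-\nu$ and define $$F^{v_1,\dots,v_r}(\lambda,\mu)=\mathrm{Tr}\big(\Phi^{v_1}_{\mu-\nu_2-\dots-\nu_r}\cdots\Phi^{v_r}_\mu Be^\lambda\big),$$ the trace over $M_{\mu-\nu}$ of the composition $M_{\mu-\nu}\to M_{\mu-\nu}\otimes V_1\otimes\cdots\otimes V_r$; it is a formal series in $\lambda$ with values in $(V_1\otimes\cdots\otimes V_r)^{\mathfrak l}$. Put $\delta_B(\lambda)=\big(\mathrm{Tr}_{|M_{-\rho}}(Be^\lambda)\big)^{-1}$ and $\mathbb F^{v_1,\dots,v_r}(\lambda,\mu)=\delta_B(\lambda)F^{v_1,\dots,v_r}(\lambda,\mu)$. Notation: $x_{|V_i}$ means $x$ acting on the $i$-th tensor factor; $(a\otimes b)_{|V_l\otimes V_n}=a_{|V_l}b_{|V_n}$, including $l=n$, where it is the product $ab$ acting on $V_l$. $\partial/\partial x_j$ is the derivative with respect to $\lambda\in\mathfrak l^*$ in the direction of $x_j\in\mathfrak l\cong\mathfrak l^*$, so $\frac{\partial}{\partial x_j}e^{(\lambda,\kappa)}=\langle\kappa,x_j\rangle e^{(\lambda,\kappa)}$. *)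

theory Defs
  imports
    "HOL-Analysis.Analysis"
    "HOL-Library.Function_Algebras"
    "HOL-Library.Groups_Big_Fun"
begin

section \<open>Complex vector spaces\<close>

class complex_vec = ab_group_add +
  fixes scaleC :: "complex \<Rightarrow> 'a \<Rightarrow> 'a"  (infixr \<open>*\<^sub>C\<close> 75)
  assumes scaleC_add_right: "a *\<^sub>C (x + y) = a *\<^sub>C x + a *\<^sub>C y"
    and scaleC_add_left: "(a + b) *\<^sub>C x = a *\<^sub>C x + b *\<^sub>C x"
    and scaleC_scaleC: "a *\<^sub>C (b *\<^sub>C x) = (a * b) *\<^sub>C x"
    and scaleC_one: "1 *\<^sub>C x = x"

global_interpretation cvec: vector_space "scaleC :: complex \<Rightarrow> 'a \<Rightarrow> 'a::complex_vec"
  by unfold_locales (simp_all add: scaleC_add_right scaleC_add_left scaleC_scaleC scaleC_one)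

abbreviation clinear :: "('a::complex_vec \<Rightarrow> 'b::complex_vec) \<Rightarrow> bool"
  where "clinear \<equiv> Vector_Spaces.linear scaleC scaleC"

instantiation complex :: complex_vec
begin
definition scaleC_complex :: "complex \<Rightarrow> complex \<Rightarrow> complex"
  where "scaleC_complex a x = a * x"
instance by standard (simp_all add: scaleC_complex_def algebra_simps)
end

instantiation "fun" :: (type, complex_vec) complex_vec
begin
definition scaleC_fun :: "complex \<Rightarrow> ('a \<Rightarrow> 'b) \<Rightarrow> 'a \<Rightarrow> 'b"
  where "scaleC_fun c f = (\<lambda>x. c *\<^sub>C f x)"
instance
  by standard
    (simp_all add: scaleC_fun_def fun_eq_iff scaleC_add_right scaleC_add_left scaleC_scaleC scaleC_one)
end

definition cbilinear :: "('a::complex_vec \<Rightarrow> 'b::complex_vec \<Rightarrow> 'c::complex_vec) \<Rightarrow> bool"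
  where "cbilinear f \<longleftrightarrow> (\<forall>x. clinear (f x)) \<and> (\<forall>y. clinear (\<lambda>x. f x y))"

definition finite_dimensional :: "'a::complex_vec set \<Rightarrow> bool"
  where "finite_dimensional U \<longleftrightarrow> (\<exists>S. finite S \<and> U \<subseteq> cvec.span S)"


section \<open>Symmetrizable Kac--Moody algebras\<close>

text \<open>
  The algebra itself is the whole type \<open>'g\<close>; simple roots are indexed by the finite type \<open>'i\<close>.
  The component \<open>form\<close> is the invariant form, \<open>sroot i\<close> is the simple root as a functional on
  the Cartan subalgebra \<open>cart\<close> (its values outside \<open>cart\<close> are irrelevant).
\<close>

record ('g, 'i) km_algebra =
  gcm :: "'i \<Rightarrow> 'i \<Rightarrow> int"
  lie :: "'g \<Rightarrow> 'g \<Rightarrow> 'g"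
  cart :: "'g set"
  coroot :: "'i \<Rightarrow> 'g"
  sroot :: "'i \<Rightarrow> 'g \<Rightarrow> complex"
  gen_e :: "'i \<Rightarrow> 'g"
  gen_f :: "'i \<Rightarrow> 'g"
  form :: "'g \<Rightarrow> 'g \<Rightarrow> complex"

definition generalized_cartan_matrix :: "('i \<Rightarrow> 'i \<Rightarrow> int) \<Rightarrow> bool"
  where "generalized_cartan_matrix A \<longleftrightarrow>
    (\<forall>i. A i i = 2) \<and> (\<forall>i j. i \<noteq> j \<longrightarrow> A i j \<le> 0) \<and> (\<forall>i j. A i j = 0 \<longrightarrow> A j i = 0)"

definition symmetrizable :: "('i \<Rightarrow> 'i \<Rightarrow> int) \<Rightarrow> bool"
  where "symmetrizable A \<longleftrightarrow>
    (\<exists>d :: 'i \<Rightarrow> complex. (\<forall>i. d i \<noteq> 0) \<and> (\<forall>i j. d i * of_int (A i j) = d j * of_int (A j i)))"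

definition lie_algebra :: "('g::complex_vec, 'i, 'z) km_algebra_scheme \<Rightarrow> bool"
  where "lie_algebra K \<longleftrightarrow> cbilinear (lie K) \<and> (\<forall>x. lie K x x = 0) \<and>
    (\<forall>x y z. lie K x (lie K y z) + lie K y (lie K z x) + lie K z (lie K x y) = 0)"

definition lie_subalgebra :: "('g::complex_vec, 'i, 'z) km_algebra_scheme \<Rightarrow> 'g set \<Rightarrow> bool"
  where "lie_subalgebra K S \<longleftrightarrow> cvec.subspace S \<and> (\<forall>x\<in>S. \<forall>y\<in>S. lie K x y \<in> S)"

definition lie_generated :: "('g::complex_vec, 'i, 'z) km_algebra_scheme \<Rightarrow> 'g set \<Rightarrow> 'g set"
  where "lie_generated K X = \<Inter>{S. lie_subalgebra K S \<and> X \<subseteq> S}"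

definition lie_ideal :: "('g::complex_vec, 'i, 'z) km_algebra_scheme \<Rightarrow> 'g set \<Rightarrow> bool"
  where "lie_ideal K J \<longleftrightarrow> cvec.subspace J \<and> (\<forall>x. \<forall>y\<in>J. lie K x y \<in> J)"

definition realization :: "('g::complex_vec, 'i::finite, 'z) km_algebra_scheme \<Rightarrow> bool"
  where "realization K \<longleftrightarrow>
    cvec.subspace (cart K) \<and> finite_dimensional (cart K) \<and>
    cvec.dim (cart K) + rank ((\<chi> i j. of_int (gcm K i j)) :: complex^'i^'i) = 2 * CARD('i) \<and>
    range (coroot K) \<subseteq> cart K \<and> inj (coroot K) \<and> cvec.independent (range (coroot K)) \<and>
    (\<forall>i. \<forall>x\<in>cart K. \<forall>y\<in>cart K. \<forall>c. sroot K i (x + y) = sroot K i x + sroot K i y \<and>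
        sroot K i (c *\<^sub>C x) = c * sroot K i x) \<and>
    (\<forall>c :: 'i \<Rightarrow> complex. (\<forall>x\<in>cart K. (\<Sum>i\<in>UNIV. c i * sroot K i x) = 0) \<longrightarrow> (\<forall>i. c i = 0)) \<and>
    (\<forall>i j. sroot K j (coroot K i) = of_int (gcm K i j))"

text \<open>
  The last clause is Kac's condition that the maximal ideal meeting the Cartan subalgebra trivially
  has been factored out.
\<close>

definition kac_moody_algebra :: "('g::complex_vec, 'i::finite, 'z) km_algebra_scheme \<Rightarrow> bool"
  where "kac_moody_algebra K \<longleftrightarrow>
    generalized_cartan_matrix (gcm K) \<and> realization K \<and> lie_algebra K \<and>
    (\<forall>x\<in>cart K. \<forall>y\<in>cart K. lie K x y = 0) \<and>
    (\<forall>i j. lie K (gen_e K i) (gen_f K j) = (if i = j then coroot K i else 0)) \<and>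
    (\<forall>x\<in>cart K. \<forall>i. lie K x (gen_e K i) = sroot K i x *\<^sub>C gen_e K i \<and>
        lie K x (gen_f K i) = (- sroot K i x) *\<^sub>C gen_f K i) \<and>
    lie_generated K (cart K \<union> range (gen_e K) \<union> range (gen_f K)) = UNIV \<and>
    (\<forall>J. lie_ideal K J \<and> J \<inter> cart K = {0} \<longrightarrow> J = {0})"

definition nondegenerate_on :: "('g::complex_vec, 'i, 'z) km_algebra_scheme \<Rightarrow> 'g set \<Rightarrow> bool"
  where "nondegenerate_on K U \<longleftrightarrow> (\<forall>x\<in>U. (\<forall>y\<in>U. form K x y = 0) \<longrightarrow> x = 0)"

definition invariant_form :: "('g::complex_vec, 'i, 'z) km_algebra_scheme \<Rightarrow> bool"
  where "invariant_form K \<longleftrightarrow> cbilinear (form K) \<and> (\<forall>x y. form K x y = form K y x) \<and>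
    (\<forall>x y z. form K (lie K x y) z = form K x (lie K y z)) \<and> nondegenerate_on K UNIV"

definition symmetrizable_kac_moody :: "('g::complex_vec, 'i::finite, 'z) km_algebra_scheme \<Rightarrow> bool"
  where "symmetrizable_kac_moody K \<longleftrightarrow>
    kac_moody_algebra K \<and> symmetrizable (gcm K) \<and> invariant_form K"

text \<open>
  From here on the dual of the Cartan subalgebra is identified with the Cartan subalgebra by means
  of the form: all weights are elements of \<open>cart K\<close>, the weight \<open>\<kappa>\<close> being the functional
  \<open>form K \<kappa>\<close>.  In particular \<open>simple K i\<close> is the simple root \<open>\<alpha>\<^sub>i\<close> viewed in \<open>cart K\<close>.
\<close>

definition simple :: "('g::complex_vec, 'i, 'z) km_algebra_scheme \<Rightarrow> 'i \<Rightarrow> 'g"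
  where "simple K i = (THE a. a \<in> cart K \<and> (\<forall>x\<in>cart K. form K a x = sroot K i x))"

definition n_plus :: "('g::complex_vec, 'i, 'z) km_algebra_scheme \<Rightarrow> 'g set"
  where "n_plus K = lie_generated K (range (gen_e K))"

definition n_minus :: "('g::complex_vec, 'i, 'z) km_algebra_scheme \<Rightarrow> 'g set"
  where "n_minus K = lie_generated K (range (gen_f K))"

definition root_space :: "('g::complex_vec, 'i, 'z) km_algebra_scheme \<Rightarrow> 'g \<Rightarrow> 'g set"
  where "root_space K \<alpha> = {x. \<forall>h\<in>cart K. lie K h x = form K \<alpha> h *\<^sub>C x}"

definition comb :: "('g::complex_vec, 'i::finite, 'z) km_algebra_scheme \<Rightarrow> ('i \<Rightarrow> nat) \<Rightarrow> 'g"
  where "comb K n = (\<Sum>i\<in>UNIV. of_nat (n i) *\<^sub>C simple K i)"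

definition Q_plus :: "('g::complex_vec, 'i::finite, 'z) km_algebra_scheme \<Rightarrow> 'g set"
  where "Q_plus K = range (comb K)"

definition pos_roots :: "('g::complex_vec, 'i::finite, 'z) km_algebra_scheme \<Rightarrow> 'g set"
  where "pos_roots K = {\<alpha> \<in> Q_plus K. \<alpha> \<noteq> 0 \<and> root_space K \<alpha> \<noteq> {0}}"

text \<open>For a simple root \<open>\<alpha> = \<alpha>\<^sub>i\<close>: \<open>f\<^sub>\<alpha> = f\<^sub>i / (e\<^sub>i, f\<^sub>i)\<close> and \<open>h\<^sub>\<alpha> = [e\<^sub>i, f\<^sub>\<alpha>]\<close>.\<close>

definition f_simple :: "('g::complex_vec, 'i, 'z) km_algebra_scheme \<Rightarrow> 'i \<Rightarrow> 'g"
  where "f_simple K i = (1 / form K (gen_e K i) (gen_f K i)) *\<^sub>C gen_f K i"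

definition h_simple :: "('g::complex_vec, 'i, 'z) km_algebra_scheme \<Rightarrow> 'i \<Rightarrow> 'g"
  where "h_simple K i = lie K (gen_e K i) (f_simple K i)"


section \<open>Generalized Belavin--Drinfeld triples\<close>

text \<open>The subsets and the bijection are recorded on the index set of the simple roots.\<close>

record ('g, 'i) bd_algebra = "('g, 'i) km_algebra" +
  Gam1 :: "'i set"
  Gam2 :: "'i set"
  bdT :: "'i \<Rightarrow> 'i"

definition gbd_triple :: "('g::complex_vec, 'i, 'z) bd_algebra_scheme \<Rightarrow> bool"
  where "gbd_triple K \<longleftrightarrow> bij_betw (bdT K) (Gam1 K) (Gam2 K) \<and>
    (\<forall>i\<in>Gam1 K. \<forall>j\<in>Gam1 K.
      form K (simple K (bdT K i)) (simple K (bdT K j)) = form K (simple K i) (simple K j))"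

definition l_space :: "('g::complex_vec, 'i, 'z) bd_algebra_scheme \<Rightarrow> 'g set"
  where "l_space K =
    {y \<in> cart K. \<forall>i\<in>Gam1 K. form K (simple K i - simple K (bdT K i)) y = 0}"

definition h0_space :: "('g::complex_vec, 'i, 'z) bd_algebra_scheme \<Rightarrow> 'g set"
  where "h0_space K = {y \<in> cart K. \<forall>z\<in>l_space K. form K y z = 0}"

definition nondegenerate_triple :: "('g::complex_vec, 'i, 'z) bd_algebra_scheme \<Rightarrow> bool"
  where "nondegenerate_triple K \<longleftrightarrow> nondegenerate_on K (l_space K)"

definition adapted_orthonormal_basis ::
    "('g::complex_vec, 'i, 'z) bd_algebra_scheme \<Rightarrow> nat set \<Rightarrow> nat set \<Rightarrow> (nat \<Rightarrow> 'g) \<Rightarrow> bool"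
  where "adapted_orthonormal_basis K I1 I2 x \<longleftrightarrow>
    finite I1 \<and> finite I2 \<and> I1 \<inter> I2 = {} \<and>
    (\<forall>j\<in>I1 \<union> I2. \<forall>k\<in>I1 \<union> I2. form K (x j) (x k) = (if j = k then 1 else 0)) \<and>
    cvec.span (x ` I1) = l_space K \<and> cvec.span (x ` I2) = h0_space K"

definition cayley :: "('g::complex_vec, 'i, 'z) bd_algebra_scheme \<Rightarrow> 'g \<Rightarrow> 'g"
  where "cayley K x = (THE y. y \<in> h0_space K \<and>
    (\<forall>i\<in>Gam1 K. form K (simple K i - simple K (bdT K i)) y =
                 form K (simple K i + simple K (bdT K i)) x))"

definition Gam3 :: "('g, 'i, 'z) bd_algebra_scheme \<Rightarrow> 'i set"
  where "Gam3 K = {i \<in> Gam1 K \<inter> Gam2 K.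
    \<exists>k\<ge>1. (bdT K ^^ k) i = i \<and> (\<forall>m<k. (bdT K ^^ m) i \<in> Gam1 K)}"

definition pos_roots3 :: "('g::complex_vec, 'i::finite, 'z) bd_algebra_scheme \<Rightarrow> 'g set"
  where "pos_roots3 K = {\<alpha> \<in> pos_roots K. \<exists>n. {i. n i \<noteq> 0} \<subseteq> Gam3 K \<and> \<alpha> = comb K n}"

definition orbit_length :: "('g::complex_vec, 'i::finite, 'z) bd_algebra_scheme \<Rightarrow> 'g \<Rightarrow> nat"
  where "orbit_length K \<alpha> = card {\<beta>. \<exists>n k. {i. n i \<noteq> 0} \<subseteq> Gam3 K \<and> \<alpha> = comb K n \<and>
    \<beta> = (\<Sum>i\<in>UNIV. of_nat (n i) *\<^sub>C simple K ((bdT K ^^ k) i))}"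

definition h_span :: "('g::complex_vec, 'i, 'z) km_algebra_scheme \<Rightarrow> 'i set \<Rightarrow> 'g set"
  where "h_span K \<Gamma> = cvec.span (h_simple K ` \<Gamma>)"

definition lie_hom_on ::
    "('g::complex_vec, 'i, 'z) km_algebra_scheme \<Rightarrow> 'g set \<Rightarrow> 'g set \<Rightarrow> ('g \<Rightarrow> 'g) \<Rightarrow> bool"
  where "lie_hom_on K D D' \<phi> \<longleftrightarrow> \<phi> ` D \<subseteq> D' \<and>
    (\<forall>x\<in>D. \<forall>y\<in>D. \<phi> (x + y) = \<phi> x + \<phi> y \<and> \<phi> (lie K x y) = lie K (\<phi> x) (\<phi> y)) \<and>
    (\<forall>c. \<forall>x\<in>D. \<phi> (c *\<^sub>C x) = c *\<^sub>C \<phi> x)"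

definition is_B :: "('g::complex_vec, 'i, 'z) bd_algebra_scheme \<Rightarrow> ('g \<Rightarrow> 'g) \<Rightarrow> bool"
  where "is_B K B \<longleftrightarrow>
    lie_hom_on K {y + h | y h. y \<in> n_minus K \<and> h \<in> h_span K (Gam1 K)}
                 {y + h | y h. y \<in> n_minus K \<and> h \<in> h_span K (Gam2 K)} B \<and>
    (\<forall>i\<in>Gam1 K. B (f_simple K i) = f_simple K (bdT K i) \<and>
                 B (h_simple K i) = h_simple K (bdT K i)) \<and>
    (\<forall>i. i \<notin> Gam1 K \<longrightarrow> B (f_simple K i) = 0)"

definition is_B_inv :: "('g::complex_vec, 'i, 'z) bd_algebra_scheme \<Rightarrow> ('g \<Rightarrow> 'g) \<Rightarrow> bool"
  where "is_B_inv K Bi \<longleftrightarrow>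
    lie_hom_on K {y + h | y h. y \<in> n_plus K \<and> h \<in> h_span K (Gam2 K)}
                 {y + h | y h. y \<in> n_plus K \<and> h \<in> h_span K (Gam1 K)} Bi \<and>
    (\<forall>i\<in>Gam2 K. Bi (gen_e K i) = gen_e K (inv_into (Gam1 K) (bdT K) i) \<and>
                 Bi (h_simple K i) = h_simple K (inv_into (Gam1 K) (bdT K) i)) \<and>
    (\<forall>i. i \<notin> Gam2 K \<longrightarrow> Bi (gen_e K i) = 0)"

definition root_mult :: "('g::complex_vec, 'i, 'z) km_algebra_scheme \<Rightarrow> 'g \<Rightarrow> nat"
  where "root_mult K \<alpha> = cvec.dim (root_space K \<alpha>)"

text \<open>
  On the positive part of the subalgebra generated by the root spaces of \<open>\<plusminus>Gam3\<close>, the automorphism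
  \<open>B\<close> is the inverse of \<open>Bi\<close>; so \<open>B\<^sup>N e = \<theta>\<^sup>-\<^sup>1 e\<close> is written \<open>Bi\<^sup>N e = \<theta> e\<close>.
\<close>

definition root_bases ::
    "('g::complex_vec, 'i::finite, 'z) bd_algebra_scheme \<Rightarrow> ('g \<Rightarrow> 'g) \<Rightarrow> ('g \<Rightarrow> 'g) \<Rightarrow>
     ('g \<Rightarrow> nat \<Rightarrow> 'g) \<Rightarrow> ('g \<Rightarrow> nat \<Rightarrow> 'g) \<Rightarrow> bool"
  where "root_bases K B Bi eb fb \<longleftrightarrow>
    (\<forall>\<alpha>\<in>pos_roots K.
      inj_on (eb \<alpha>) {1..root_mult K \<alpha>} \<and> cvec.independent (eb \<alpha> ` {1..root_mult K \<alpha>}) \<and>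
      cvec.span (eb \<alpha> ` {1..root_mult K \<alpha>}) = root_space K \<alpha> \<and>
      inj_on (fb \<alpha>) {1..root_mult K \<alpha>} \<and> cvec.independent (fb \<alpha> ` {1..root_mult K \<alpha>}) \<and>
      cvec.span (fb \<alpha> ` {1..root_mult K \<alpha>}) = root_space K (- \<alpha>) \<and>
      (\<forall>s\<in>{1..root_mult K \<alpha>}. \<forall>t\<in>{1..root_mult K \<alpha>}.
        form K (eb \<alpha> s) (fb \<alpha> t) = (if s = t then 1 else 0))) \<and>
    (\<forall>i. eb (simple K i) 1 = gen_e K i \<and> fb (simple K i) 1 = f_simple K i) \<and>
    (\<forall>\<alpha>\<in>pos_roots3 K. \<forall>t\<in>{1..root_mult K \<alpha>}. \<exists>\<theta>. \<theta> \<noteq> 0 \<and>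
      (B ^^ orbit_length K \<alpha>) (fb \<alpha> t) = \<theta> *\<^sub>C fb \<alpha> t \<and>
      (Bi ^^ orbit_length K \<alpha>) (eb \<alpha> t) = \<theta> *\<^sub>C eb \<alpha> t)"

definition is_rho :: "('g::complex_vec, 'i, 'z) km_algebra_scheme \<Rightarrow> 'g \<Rightarrow> bool"
  where "is_rho K \<rho> \<longleftrightarrow> \<rho> \<in> cart K \<and> (\<forall>i. form K \<rho> (coroot K i) = 1)"


section \<open>Modules\<close>

definition lie_module ::
    "('g::complex_vec, 'i, 'z) km_algebra_scheme \<Rightarrow> ('g \<Rightarrow> 'v \<Rightarrow> 'v::complex_vec) \<Rightarrow> bool"
  where "lie_module K act \<longleftrightarrow> cbilinear act \<and>
    (\<forall>x y u. act (lie K x y) u = act x (act y u) - act y (act x u))"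

definition weight_space ::
    "('g::complex_vec, 'i, 'z) km_algebra_scheme \<Rightarrow> ('g \<Rightarrow> 'v \<Rightarrow> 'v::complex_vec) \<Rightarrow> 'g \<Rightarrow> 'v set"
  where "weight_space K act \<kappa> = {u. \<forall>h\<in>cart K. act h u = form K \<kappa> h *\<^sub>C u}"

text \<open>
  \<open>V\<close> is a submodule, lying in the category \<open>O\<close>, of an ambient module (the type \<open>'v\<close> with action
  \<open>act\<close>).  Any family of modules can be realized in this way inside its direct sum; no condition
  besides being a module is put on the ambient module.
\<close>

definition category_O ::
    "('g::complex_vec, 'i::finite, 'z) km_algebra_scheme \<Rightarrow> ('g \<Rightarrow> 'v \<Rightarrow> 'v::complex_vec) \<Rightarrow> 'v set \<Rightarrow> bool"
  where "category_O K act V \<longleftrightarrow>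
    cvec.subspace V \<and> (\<forall>x. \<forall>u\<in>V. act x u \<in> V) \<and>
    V = cvec.span (\<Union>\<kappa>\<in>cart K. V \<inter> weight_space K act \<kappa>) \<and>
    (\<forall>\<kappa>\<in>cart K. finite_dimensional (V \<inter> weight_space K act \<kappa>)) \<and>
    (\<exists>\<Lambda>. finite \<Lambda> \<and> \<Lambda> \<subseteq> cart K \<and>
      (\<forall>\<kappa>\<in>cart K. V \<inter> weight_space K act \<kappa> \<noteq> {0} \<longrightarrow> (\<exists>\<omega>\<in>\<Lambda>. \<omega> - \<kappa> \<in> Q_plus K)))"


subsection \<open>Verma modules\<close>

text \<open>
  The free associative algebra on the set \<open>'g\<close> is the span of the words (delta functions on lists),
  i.e. the finitely supported functions on lists.  The enveloping algebra is its quotient by the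
  span of \<open>env_rels\<close>, and the Verma module of highest weight \<open>\<omega>\<close> is the quotient of the enveloping
  algebra by the left ideal generated by \<open>n_plus\<close> and the elements \<open>h - \<omega>(h)\<close>.
\<close>

definition word :: "'g list \<Rightarrow> 'g list \<Rightarrow> complex"
  where "word w = (\<lambda>u. if u = w then 1 else 0)"

definition free_alg :: "('g list \<Rightarrow> complex) set"
  where "free_alg = {p. finite {w. p w \<noteq> 0}}"

definition env_rels :: "('g::complex_vec, 'i, 'z) km_algebra_scheme \<Rightarrow> ('g list \<Rightarrow> complex) set"
  where "env_rels K =
    {word (u @ [x + y] @ w) - word (u @ [x] @ w) - word (u @ [y] @ w) | u w x y. True} \<union>
    {word (u @ [c *\<^sub>C x] @ w) - c *\<^sub>C word (u @ [x] @ w) | u w c x. True} \<union>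
    {word (u @ [x, y] @ w) - word (u @ [y, x] @ w) - word (u @ [lie K x y] @ w) | u w x y. True}"

definition verma_rels ::
    "('g::complex_vec, 'i, 'z) km_algebra_scheme \<Rightarrow> 'g \<Rightarrow> ('g list \<Rightarrow> complex) set"
  where "verma_rels K \<omega> = env_rels K \<union>
    {word (u @ [x]) | u x. x \<in> n_plus K} \<union>
    {word (u @ [h]) - form K \<omega> h *\<^sub>C word u | u h. h \<in> cart K}"

definition free_act ::
    "('g \<Rightarrow> 'm \<Rightarrow> 'm::complex_vec) \<Rightarrow> ('g list \<Rightarrow> complex) \<Rightarrow> 'm \<Rightarrow> 'm"
  where "free_act act p u = (\<Sum>w | p w \<noteq> 0. p w *\<^sub>C foldr act w u)"

definition is_verma ::
    "('g::complex_vec, 'i, 'z) km_algebra_scheme \<Rightarrow> 'g \<Rightarrow> ('g \<Rightarrow> 'm \<Rightarrow> 'm::complex_vec) \<Rightarrow> 'm \<Rightarrow> bool"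
  where "is_verma K \<omega> act vac \<longleftrightarrow> lie_module K act \<and>
    (\<lambda>p. free_act act p vac) ` free_alg = UNIV \<and>
    (\<forall>p\<in>free_alg. free_act act p vac = 0 \<longleftrightarrow> p \<in> cvec.span (verma_rels K \<omega>))"

definition verma_family ::
    "('g::complex_vec, 'i, 'z) km_algebra_scheme \<Rightarrow>
     ('g \<Rightarrow> 'g \<Rightarrow> 'm \<Rightarrow> 'm::complex_vec) \<Rightarrow> ('g \<Rightarrow> 'm) \<Rightarrow> bool"
  where "verma_family K M vac \<longleftrightarrow> (\<forall>\<omega>\<in>cart K. is_verma K \<omega> (M \<omega>) (vac \<omega>))"

definition graded_dual ::
    "('g::complex_vec, 'i, 'z) km_algebra_scheme \<Rightarrow> ('g \<Rightarrow> 'm \<Rightarrow> 'm::complex_vec) \<Rightarrow> ('m \<Rightarrow> complex) set"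
  where "graded_dual K act =
    {\<eta>. clinear \<eta> \<and> finite {\<kappa> \<in> cart K. \<exists>u\<in>weight_space K act \<kappa>. \<eta> u \<noteq> 0}}"

definition graded_dual_irreducible ::
    "('g::complex_vec, 'i, 'z) km_algebra_scheme \<Rightarrow> ('g \<Rightarrow> 'm \<Rightarrow> 'm::complex_vec) \<Rightarrow> bool"
  where "graded_dual_irreducible K act \<longleftrightarrow> graded_dual K act \<noteq> {0} \<and>
    (\<forall>U. cvec.subspace U \<and> U \<subseteq> graded_dual K act \<and> (\<forall>x. \<forall>\<eta>\<in>U. (\<lambda>u. - \<eta> (act x u)) \<in> U) \<longrightarrow>
      U = {0} \<or> U = graded_dual K act)"

text \<open>The vector of weight \<open>-\<omega>\<close> in the graded dual that takes the value 1 on the highest weight vector.\<close>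

definition verma_dual_vec ::
    "('g::complex_vec, 'i, 'z) km_algebra_scheme \<Rightarrow> ('g \<Rightarrow> 'g \<Rightarrow> 'm \<Rightarrow> 'm::complex_vec) \<Rightarrow>
     ('g \<Rightarrow> 'm) \<Rightarrow> 'g \<Rightarrow> 'm \<Rightarrow> complex"
  where "verma_dual_vec K M vac \<omega> = (THE \<eta>. clinear \<eta> \<and> \<eta> (vac \<omega>) = 1 \<and>
    (\<forall>\<kappa>\<in>cart K. \<kappa> \<noteq> \<omega> \<longrightarrow> (\<forall>u\<in>weight_space K (M \<omega>) \<kappa>. \<eta> u = 0)))"

definition verma_B ::
    "('g::complex_vec, 'i, 'z) km_algebra_scheme \<Rightarrow> ('g \<Rightarrow> 'g) \<Rightarrow>
     ('g \<Rightarrow> 'g \<Rightarrow> 'm \<Rightarrow> 'm::complex_vec) \<Rightarrow> ('g \<Rightarrow> 'm) \<Rightarrow> 'g \<Rightarrow> 'g \<Rightarrow> 'm \<Rightarrow> 'm"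
  where "verma_B K B M vac \<mu>' \<mu> = (THE b. clinear b \<and>
    (\<forall>xs\<in>lists (n_minus K). b (foldr (M \<mu>') xs (vac \<mu>')) = foldr (M \<mu>) (map B xs) (vac \<mu>)))"


section \<open>Tensor products\<close>

text \<open>
  Tensors are modelled as functionals on multilinear forms: the pure tensor \<open>w\<^sub>1 \<otimes> \<dots> \<otimes> w\<^sub>r\<close> is
  evaluation of forms at \<open>(w\<^sub>1, \<dots>, w\<^sub>r)\<close>, and the tensor product is the span of the pure tensors.
  Lemma \<open>tensor_universal\<close> below is its universal property.  The second kind of tensors has
  one distinguished factor \<open>'m\<close> in front.
\<close>

type_synonym 'v tens = "('v list \<Rightarrow> complex) \<Rightarrow> complex"
type_synonym ('m, 'v) mtens = "('m \<times> 'v list \<Rightarrow> complex) \<Rightarrow> complex"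

definition eval_at :: "(('x \<Rightarrow> complex) \<Rightarrow> bool) \<Rightarrow> 'x \<Rightarrow> ('x \<Rightarrow> complex) \<Rightarrow> complex"
  where "eval_at P x = (\<lambda>\<phi>. if P \<phi> then \<phi> x else 0)"

definition multilinear :: "('v::complex_vec list \<Rightarrow> 'w::complex_vec) \<Rightarrow> bool"
  where "multilinear \<phi> \<longleftrightarrow> (\<forall>ws. \<forall>i<length ws. clinear (\<lambda>u. \<phi> (ws[i := u])))"

definition mmultilinear :: "('m::complex_vec \<times> 'v::complex_vec list \<Rightarrow> 'w::complex_vec) \<Rightarrow> bool"
  where "mmultilinear \<phi> \<longleftrightarrow>
    (\<forall>ws. clinear (\<lambda>m. \<phi> (m, ws))) \<and> (\<forall>m. multilinear (\<lambda>ws. \<phi> (m, ws)))"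

definition pure :: "'v::complex_vec list \<Rightarrow> 'v tens"
  where "pure = eval_at multilinear"

definition mpure :: "'m::complex_vec \<Rightarrow> 'v::complex_vec list \<Rightarrow> ('m, 'v) mtens"
  where "mpure m ws = eval_at mmultilinear (m, ws)"

text \<open>\<open>tlift g\<close> is the linear map with \<open>x \<mapsto> g x\<close> on pure tensors, for a multilinear family \<open>g\<close> of tensors.\<close>

definition tlift ::
    "('x \<Rightarrow> ('y \<Rightarrow> complex) \<Rightarrow> complex) \<Rightarrow> (('x \<Rightarrow> complex) \<Rightarrow> complex) \<Rightarrow> ('y \<Rightarrow> complex) \<Rightarrow> complex"
  where "tlift g \<xi> = (\<lambda>\<phi>. \<xi> (\<lambda>x. g x \<phi>))"

lemma tlift_eval_at:
  assumes "\<And>\<phi>. P (\<lambda>x. g x \<phi>)"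
  shows "tlift g (eval_at P x) = g x"
  by (simp add: tlift_def eval_at_def assms)

lemma separating_functional:
  fixes w :: "'w::complex_vec"
  assumes "w \<noteq> 0"
  obtains \<theta> :: "'w \<Rightarrow> complex" where "clinear \<theta>" "\<theta> w \<noteq> 0"
proof -
  interpret vp: vector_space_pair "scaleC :: complex \<Rightarrow> 'w \<Rightarrow> 'w" "scaleC :: complex \<Rightarrow> complex \<Rightarrow> complex"
    by unfold_locales
  have ind: "cvec.independent {w}"
    using assms by simp
  show thesis
  proof
    show "clinear (vp.construct {w} (\<lambda>_. 1))"
      by (rule vp.linear_construct[OF ind])
    show "vp.construct {w} (\<lambda>_. 1) w \<noteq> 0"
      using vp.construct_basis[OF ind, of w "\<lambda>_. 1"] by simp
  qed
qed

lemma tensor_universal_aux: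
  fixes g :: "'x \<Rightarrow> 'w::complex_vec"
  assumes "\<And>\<theta> :: 'w \<Rightarrow> complex. clinear \<theta> \<Longrightarrow> P (\<lambda>x. \<theta> (g x))"
  shows "\<exists>h. clinear h \<and> (\<forall>x. h (eval_at P x) = g x)"
proof -
  interpret vp: vector_space_pair
    "scaleC :: complex \<Rightarrow> (('x \<Rightarrow> complex) \<Rightarrow> complex) \<Rightarrow> (('x \<Rightarrow> complex) \<Rightarrow> complex)"
    "scaleC :: complex \<Rightarrow> 'w \<Rightarrow> 'w"
    by unfold_locales
  obtain B where B: "B \<subseteq> range (eval_at P)" "cvec.independent B" "range (eval_at P) \<subseteq> cvec.span B"
    using cvec.maximal_independent_subset[of "range (eval_at P)"] by metis
  define k where "k b = g (SOME x. eval_at P x = b)" for b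
  define h where "h = vp.construct B k"
  have lin: "clinear h"
    unfolding h_def by (rule vp.linear_construct[OF B(2)])
  interpret h: Vector_Spaces.linear scaleC scaleC h by (rule lin)
  have hB: "h b = k b" if "b \<in> B" for b
    unfolding h_def by (rule vp.construct_basis[OF B(2) that])
  have main: "\<theta> (h \<xi>) = \<xi> (\<lambda>x. \<theta> (g x))" if \<theta>: "clinear \<theta>" and \<xi>: "\<xi> \<in> cvec.span B" for \<theta> \<xi>
  proof -
    interpret t: Vector_Spaces.linear scaleC scaleC \<theta> by (rule \<theta>)
    show ?thesis
      using \<xi>
    proof (induction rule: cvec.span_induct_alt)
      case base
      show ?case using h.zero t.zero by (simp add: zero_fun_def)
    next
      case (step c b \<zeta>)
      have "eval_at P (SOME x. eval_at P x = b) = b"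
        using step(1) B(1) by (metis (mono_tags, lifting) imageE someI_ex subsetD)
      moreover have "eval_at P (SOME x. eval_at P x = b) (\<lambda>x. \<theta> (g x)) = \<theta> (k b)"
        using assms[OF \<theta>] by (simp add: eval_at_def k_def)
      moreover have "\<theta> (h (c *\<^sub>C b + \<zeta>)) = c * \<theta> (k b) + \<theta> (h \<zeta>)"
        using step(1) by (simp only: h.add h.scale t.add t.scale hB scaleC_complex_def)
      ultimately show ?case
        using step by (simp add: scaleC_fun_def scaleC_complex_def plus_fun_def)
    qed
  qed
  have "h (eval_at P x) = g x" for x
  proof (rule ccontr)
    assume "h (eval_at P x) \<noteq> g x"
    then obtain \<theta> :: "'w \<Rightarrow> complex" where \<theta>: "clinear \<theta>" "\<theta> (h (eval_at P x) - g x) \<noteq> 0"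
      using separating_functional[of "h (eval_at P x) - g x"] by auto
    interpret t: Vector_Spaces.linear scaleC scaleC \<theta> by (rule \<theta>(1))
    have "\<theta> (h (eval_at P x)) = \<theta> (g x)"
      using main[OF \<theta>(1), of "eval_at P x"] B(3) assms[OF \<theta>(1)] by (auto simp: eval_at_def)
    with \<theta>(2) show False
      by (simp add: t.diff)
  qed
  with lin show ?thesis by blast
qed

lemma multilinear_compose:
  assumes "multilinear g" "clinear \<theta>"
  shows "multilinear (\<lambda>x. \<theta> (g x))"
  using assms Vector_Spaces.linear_compose[of scaleC scaleC _ scaleC \<theta>]
  unfolding multilinear_def comp_def by blast

lemma multilinear_pure: "multilinear pure"
  unfolding multilinear_def
proof (intro allI impI)
  fix ws :: "'a list" and i assume i: "i < length ws"
  have "\<phi> (ws[i := a + b]) = \<phi> (ws[i := a]) + \<phi> (ws[i := b])"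
       "\<phi> (ws[i := c *\<^sub>C a]) = c * \<phi> (ws[i := a])" if "multilinear \<phi>" for \<phi> :: "'a list \<Rightarrow> complex" and a b c
  proof -
    interpret l: Vector_Spaces.linear scaleC scaleC "\<lambda>u. \<phi> (ws[i := u])"
      using that i unfolding multilinear_def by blast
    show "\<phi> (ws[i := a + b]) = \<phi> (ws[i := a]) + \<phi> (ws[i := b])" by (rule l.add)
    show "\<phi> (ws[i := c *\<^sub>C a]) = c * \<phi> (ws[i := a])" by (simp add: l.scale scaleC_complex_def)
  qed
  then show "clinear (\<lambda>u. pure (ws[i := u]))"
    by unfold_locales (auto simp: pure_def eval_at_def fun_eq_iff scaleC_fun_def scaleC_complex_def)
qed

lemma tensor_universal:
  fixes g :: "'v::complex_vec list \<Rightarrow> 'w::complex_vec"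
  assumes "multilinear g"
  shows "\<exists>h. clinear h \<and> (\<forall>ws. h (pure ws) = g ws)"
  unfolding pure_def by (rule tensor_universal_aux) (rule multilinear_compose[OF assms])

lemma mtensor_universal:
  fixes g :: "'m::complex_vec \<times> 'v::complex_vec list \<Rightarrow> 'w::complex_vec"
  assumes "mmultilinear g"
  shows "\<exists>h. clinear h \<and> (\<forall>m ws. h (mpure m ws) = g (m, ws))"
proof -
  have "\<exists>h. clinear h \<and> (\<forall>x. h (eval_at mmultilinear x) = g x)"
  proof (rule tensor_universal_aux)
    fix \<theta> :: "'w \<Rightarrow> complex" assume \<theta>: "clinear \<theta>"
    show "mmultilinear (\<lambda>x. \<theta> (g x))"
      using assms multilinear_compose[OF _ \<theta>] Vector_Spaces.linear_compose[OF _ \<theta>]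
      unfolding mmultilinear_def comp_def by blast
  qed
  then show ?thesis
    unfolding mpure_def by blast
qed

text \<open>Positions in a tensor product are counted from 0.\<close>

definition on_factor :: "nat \<Rightarrow> ('v \<Rightarrow> 'v) \<Rightarrow> 'v::complex_vec tens \<Rightarrow> 'v tens"
  where "on_factor i X = tlift (\<lambda>ws. pure (ws[i := X (ws ! i)]))"

definition on_factors ::
    "('g \<Rightarrow> 'v \<Rightarrow> 'v) \<Rightarrow> nat \<Rightarrow> nat \<Rightarrow> 'g \<Rightarrow> 'g \<Rightarrow> 'v::complex_vec tens \<Rightarrow> 'v tens"
  where "on_factors act l n a b \<xi> = on_factor l (act a) (on_factor n (act b) \<xi>)"

definition contract :: "('m \<Rightarrow> complex) \<Rightarrow> ('m::complex_vec, 'v::complex_vec) mtens \<Rightarrow> 'v tens"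
  where "contract \<eta> = tlift (\<lambda>(m, ws). \<eta> m *\<^sub>C pure ws)"

definition mtens_act ::
    "('g \<Rightarrow> 'm \<Rightarrow> 'm) \<Rightarrow> ('g \<Rightarrow> 'v \<Rightarrow> 'v) \<Rightarrow> 'g \<Rightarrow>
     ('m::complex_vec, 'v::complex_vec) mtens \<Rightarrow> ('m, 'v) mtens"
  where "mtens_act actM actV x = tlift (\<lambda>(m, ws).
    mpure (actM x m) ws + (\<Sum>i<length ws. mpure m (ws[i := actV x (ws ! i)])))"

text \<open>\<open>\<Phi> \<otimes> 1\<close>, where the factors produced by \<open>\<Phi>\<close> are put in front of those already present.\<close>

definition apply_first ::
    "('m \<Rightarrow> ('m, 'v) mtens) \<Rightarrow> ('m::complex_vec, 'v::complex_vec) mtens \<Rightarrow> ('m, 'v) mtens"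
  where "apply_first \<Phi> = tlift (\<lambda>(m', ws). tlift (\<lambda>(m, us). mpure m (us @ ws)) (\<Phi> m'))"


subsection \<open>The operators on pure tensors\<close>

lemma clinear_zero_fun: "clinear (\<lambda>_. 0)"
  by unfold_locales simp_all

lemma clinear_add_fun:
  assumes "clinear f" "clinear g"
  shows "clinear (\<lambda>u. f u + g u)"
proof -
  interpret f: Vector_Spaces.linear scaleC scaleC f by (rule assms(1))
  interpret g: Vector_Spaces.linear scaleC scaleC g by (rule assms(2))
  show ?thesis
    by unfold_locales (simp_all add: f.add g.add f.scale g.scale scaleC_add_right algebra_simps)
qed

lemma clinear_scale_fun:
  assumes "clinear f"
  shows "clinear (\<lambda>u. c *\<^sub>C f u)"
proof -
  interpret f: Vector_Spaces.linear scaleC scaleC f by (rule assms)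
  show ?thesis
    by unfold_locales (simp_all add: f.add f.scale scaleC_add_right scaleC_scaleC mult.commute)
qed

lemma clinear_sum_fun: "(\<And>i. i \<in> S \<Longrightarrow> clinear (f i)) \<Longrightarrow> clinear (\<lambda>u. \<Sum>i\<in>S. f i u)"
  by (induction S rule: infinite_finite_induct) (simp_all add: clinear_zero_fun clinear_add_fun)

lemma multilinear_update:
  assumes "multilinear \<phi>" and X: "clinear X"
  shows "multilinear (\<lambda>ws. \<phi> (ws[i := X (ws ! i)]))"
  unfolding multilinear_def
proof (intro allI impI)
  fix ws :: "'a list" and k assume k: "k < length ws"
  show "clinear (\<lambda>u. \<phi> ((ws[k := u])[i := X (ws[k := u] ! i)]))"
  proof (cases "k = i")
    case True
    with k assms(1) have "clinear (\<lambda>u. \<phi> (ws[i := u]))"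
      unfolding multilinear_def by blast
    from Vector_Spaces.linear_compose[OF X this] show ?thesis
      using k True by (simp add: comp_def)
  next
    case False
    have "clinear (\<lambda>u. \<phi> ((ws[i := X (ws ! i)])[k := u]))"
      using k assms(1) unfolding multilinear_def by simp
    then show ?thesis
      using False by (simp add: list_update_swap)
  qed
qed

lemma multilinear_add: "multilinear f \<Longrightarrow> multilinear g \<Longrightarrow> multilinear (\<lambda>ws. f ws + g ws)"
  by (simp add: multilinear_def clinear_add_fun)

lemma multilinear_scale: "multilinear f \<Longrightarrow> multilinear (\<lambda>ws. c *\<^sub>C f ws)"
  by (simp add: multilinear_def clinear_scale_fun)

lemma multilinear_zero: "multilinear (\<lambda>_. 0)"
  by (simp add: multilinear_def clinear_zero_fun)

lemma mmultilinear_zero: "mmultilinear (\<lambda>_. 0)"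
  by (simp add: mmultilinear_def multilinear_zero clinear_zero_fun)

lemma on_factor_pure:
  assumes "clinear X"
  shows "on_factor i X (pure ws) = pure (ws[i := X (ws ! i)])"
proof -
  have "multilinear (\<lambda>ws. pure (ws[i := X (ws ! i)]) \<phi>)" for \<phi>
    by (cases "multilinear \<phi>") (simp_all add: pure_def eval_at_def multilinear_zero multilinear_update assms)
  then show ?thesis
    unfolding on_factor_def by (subst (2) pure_def) (rule tlift_eval_at)
qed

lemma contract_mpure:
  assumes "clinear \<eta>"
  shows "contract \<eta> (mpure m ws) = \<eta> m *\<^sub>C pure ws"
proof -
  have "mmultilinear (\<lambda>x. case x of (m, ws) \<Rightarrow> (\<eta> m *\<^sub>C pure ws) \<phi>)" for \<phi> :: "'b list \<Rightarrow> complex"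
  proof (cases "multilinear \<phi>")
    case True
    moreover have "clinear (\<lambda>m. \<eta> m * c)" for c
      using clinear_scale_fun[OF assms, of c] by (simp add: scaleC_complex_def mult.commute)
    ultimately show ?thesis
      using multilinear_scale[OF True]
      by (simp add: mmultilinear_def pure_def eval_at_def scaleC_fun_def scaleC_complex_def)
  next
    case False
    then show ?thesis
      by (simp add: mmultilinear_def pure_def eval_at_def scaleC_fun_def scaleC_complex_def
          multilinear_zero clinear_zero_fun)
  qed
  then show ?thesis
    unfolding contract_def mpure_def by (subst tlift_eval_at) (simp_all add: case_prod_unfold)
qed

lemma multilinear_update_sum:
  assumes "multilinear \<phi>" and X: "clinear X"
  shows "multilinear (\<lambda>ws. \<Sum>i<length ws. \<phi> (ws[i := X (ws ! i)]))"
  using multilinear_update[OF assms] unfolding multilinear_def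
  by (auto intro!: clinear_sum_fun)

lemma sum_fun_apply: "(\<Sum>i\<in>S. f i) x = (\<Sum>i\<in>S. f i x)"
  by (induction S rule: infinite_finite_induct) simp_all

lemma mtens_act_mpure:
  assumes "clinear (actM x)" "clinear (actV x)"
  shows "mtens_act actM actV x (mpure m ws) =
    mpure (actM x m) ws + (\<Sum>i<length ws. mpure m (ws[i := actV x (ws ! i)]))"
proof -
  have "mmultilinear (\<lambda>y. (case y of (m, ws) \<Rightarrow>
      mpure (actM x m) ws + (\<Sum>i<length ws. mpure m (ws[i := actV x (ws ! i)]))) \<phi>)"
    for \<phi>
  proof (cases "mmultilinear \<phi>")
    case True
    then have 1: "clinear (\<lambda>m. \<phi> (m, ws))" "multilinear (\<lambda>ws. \<phi> (m, ws))" for m ws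
      by (simp_all add: mmultilinear_def)
    have 2: "clinear (\<lambda>m. \<phi> (actM x m, ws))" for ws
      using Vector_Spaces.linear_compose[OF assms(1) 1(1)] by (simp add: comp_def)
    show ?thesis
      using True by (simp add: mmultilinear_def mpure_def eval_at_def sum_fun_apply 1 2
          multilinear_update_sum[OF 1(2) assms(2)] multilinear_add clinear_add_fun clinear_sum_fun)
  next
    case False
    then show ?thesis
      by (simp add: mpure_def eval_at_def sum_fun_apply mmultilinear_zero case_prod_unfold)
  qed
  then show ?thesis
    unfolding mtens_act_def mpure_def[of m ws] by (subst tlift_eval_at) (simp_all add: case_prod_unfold)
qed

lemma span_mpure_apply_linear:
  assumes "\<xi> \<in> cvec.span (range (case_prod mpure))"
    and "\<And>u. mmultilinear (\<psi> u)" and "\<And>x. clinear (\<lambda>u. \<psi> u x)"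
  shows "clinear (\<lambda>u. \<xi> (\<psi> u))"
  using assms(1)
proof (induction rule: cvec.span_induct_alt)
  case base
  show ?case by (simp add: clinear_zero_fun)
next
  case (step c b \<zeta>)
  then obtain m ws where b: "b = mpure m ws" by auto
  have "clinear (\<lambda>u. c *\<^sub>C (b (\<psi> u)) + \<zeta> (\<psi> u))"
    using assms(2,3) step b by (intro clinear_add_fun clinear_scale_fun) (simp_all add: mpure_def eval_at_def)
  then show ?case by (simp add: scaleC_fun_def plus_fun_def)
qed

lemma multilinear_append:
  assumes "multilinear \<phi>"
  shows "multilinear (\<lambda>us. \<phi> (us @ ws))" "multilinear (\<lambda>ws. \<phi> (us @ ws))"
proof -
  show "multilinear (\<lambda>us. \<phi> (us @ ws))"
    unfolding multilinear_def
  proof (intro allI impI)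
    fix us :: "'a list" and i assume i: "i < length us"
    then have "clinear (\<lambda>u. \<phi> ((us @ ws)[i := u]))"
      using assms unfolding multilinear_def by (simp del: list_update_append)
    with i show "clinear (\<lambda>u. \<phi> (us[i := u] @ ws))"
      by (simp add: list_update_append)
  qed
  show "multilinear (\<lambda>ws. \<phi> (us @ ws))"
    unfolding multilinear_def
  proof (intro allI impI)
    fix ws :: "'a list" and i assume i: "i < length ws"
    then have "clinear (\<lambda>u. \<phi> ((us @ ws)[length us + i := u]))"
      using assms unfolding multilinear_def by (simp del: list_update_append list_update_length)
    with i show "clinear (\<lambda>u. \<phi> (us @ ws[i := u]))"
      by (simp add: list_update_append)
  qed
qed

lemma apply_first_mpure:
  assumes "clinear \<Phi>" and "range \<Phi> \<subseteq> cvec.span (range (case_prod mpure))"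
  shows "apply_first \<Phi> (mpure m ws) = tlift (\<lambda>(m', us). mpure m' (us @ ws)) (\<Phi> m)"
proof -
  have "mmultilinear (\<lambda>y. (case y of (m, ws) \<Rightarrow> tlift (\<lambda>(m', us). mpure m' (us @ ws)) (\<Phi> m)) \<phi>)"
    for \<phi>
  proof (cases "mmultilinear \<phi>")
    case True
    then have 1: "clinear (\<lambda>m. \<phi> (m, ws))" "multilinear (\<lambda>ws. \<phi> (m, ws))" for m ws
      by (simp_all add: mmultilinear_def)
    have 2: "mmultilinear (\<lambda>(m', us). \<phi> (m', us @ ws))" for ws
      by (simp add: mmultilinear_def 1 multilinear_append[OF 1(2)])
    have 3: "clinear (\<lambda>m. \<Phi> m \<psi>)" for \<psi>
    proof -
      interpret Vector_Spaces.linear scaleC scaleC \<Phi> by (rule assms)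
      show ?thesis
        by unfold_locales (simp_all add: add scale scaleC_fun_def)
    qed
    have 4: "multilinear (\<lambda>ws. \<Phi> m (\<lambda>(m', us). \<phi> (m', us @ ws)))" for m
      unfolding multilinear_def
    proof (intro allI impI)
      fix ws :: "'b list" and i assume i: "i < length ws"
      show "clinear (\<lambda>u. \<Phi> m (\<lambda>(m', us). \<phi> (m', us @ ws[i := u])))"
      proof (rule span_mpure_apply_linear[where \<xi> = "\<Phi> m"])
        show "\<Phi> m \<in> cvec.span (range (case_prod mpure))" using assms(2) by blast
        show "clinear (\<lambda>u. case x of (m', us) \<Rightarrow> \<phi> (m', us @ ws[i := u]))" for x
          using multilinear_append(2)[OF 1(2)] i by (cases x) (simp add: multilinear_def)
      qed (rule 2)
    qed
    have "mmultilinear (\<lambda>y. \<Phi> (fst y) (\<lambda>x. \<phi> (fst x, snd x @ snd y)))"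
      using 3 4 unfolding mmultilinear_def by (simp add: case_prod_unfold)
    then show ?thesis
      using True by (simp add: tlift_def mpure_def eval_at_def case_prod_unfold)
  next
    case False
    have "\<xi> (\<lambda>_. 0) = 0" if "\<xi> \<in> cvec.span (range (case_prod mpure))"
      for \<xi> :: "('a, 'b) mtens"
      using that
      by (induction rule: cvec.span_induct_alt)
        (auto simp: mpure_def eval_at_def scaleC_fun_def scaleC_complex_def)
    then have "\<Phi> m (\<lambda>_. 0) = 0" for m
      using assms(2) by blast
    with False show ?thesis
      by (simp add: tlift_def mpure_def eval_at_def case_prod_unfold mmultilinear_zero)
  qed
  then show ?thesis
    unfolding apply_first_def mpure_def[of m ws] by (subst tlift_eval_at) simp_all
qed


section \<open>Intertwiners\<close>

definition intertwiner ::
    "('g::complex_vec, 'i, 'z) km_algebra_scheme \<Rightarrow> ('g \<Rightarrow> 'g \<Rightarrow> 'm \<Rightarrow> 'm::complex_vec) \<Rightarrow>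
     ('g \<Rightarrow> 'm) \<Rightarrow> ('g \<Rightarrow> 'v \<Rightarrow> 'v::complex_vec) \<Rightarrow> 'v set \<Rightarrow> 'g \<Rightarrow> 'g \<Rightarrow> 'v \<Rightarrow> 'm \<Rightarrow> ('m, 'v) mtens"
  where "intertwiner K M vac act V \<omega> \<kappa> v = (THE \<Phi>. clinear \<Phi> \<and>
    range \<Phi> \<subseteq> cvec.span {mpure m [u] | m u. u \<in> V} \<and>
    (\<forall>x m. \<Phi> (M \<omega> x m) = mtens_act (M (\<omega> - \<kappa>)) act x (\<Phi> m)) \<and>
    contract (verma_dual_vec K M vac (\<omega> - \<kappa>)) (\<Phi> (vac \<omega>)) = pure [v])"

text \<open>
  The product of the intertwiners for \<open>v\<^sub>0, \<dots>, v\<^sub>r\<^sub>-\<^sub>1\<close>, starting from the Verma module of highest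
  weight \<open>\<mu>\<close>; the factor for \<open>v\<^sub>i\<close> starts from highest weight \<open>\<mu> - \<nu>\<^sub>i\<^sub>+\<^sub>1 - \<dots> - \<nu>\<^sub>r\<^sub>-\<^sub>1\<close>.
\<close>

definition intertwiner_product ::
    "('g::complex_vec, 'i, 'z) km_algebra_scheme \<Rightarrow> ('g \<Rightarrow> 'g \<Rightarrow> 'm \<Rightarrow> 'm::complex_vec) \<Rightarrow>
     ('g \<Rightarrow> 'm) \<Rightarrow> ('g \<Rightarrow> 'v \<Rightarrow> 'v::complex_vec) \<Rightarrow> nat \<Rightarrow> (nat \<Rightarrow> 'v set) \<Rightarrow> (nat \<Rightarrow> 'g) \<Rightarrow>
     (nat \<Rightarrow> 'v) \<Rightarrow> 'g \<Rightarrow> 'm \<Rightarrow> ('m, 'v) mtens"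
  where "intertwiner_product K M vac act r V \<nu> v \<mu> m =
    foldr (\<lambda>i. apply_first (intertwiner K M vac act (V i) (\<mu> - (\<Sum>j\<in>{i<..<r}. \<nu> j)) (\<nu> i) (v i)))
      [0..<r] (mpure m [])"


section \<open>Formal series in \<open>\<lambda>\<close>\<close>

text \<open>
  A formal series \<open>\<Sum>\<^sub>\<theta> G \<theta> e\<^bsup>(\<lambda>, \<theta>)\<^esup>\<close> in \<open>\<lambda>\<close> ranging over the dual of \<open>l_space\<close> (identified with
  \<open>l_space\<close> by the form) is represented by its coefficient function \<open>G\<close> on exponents
  \<open>\<theta> \<in> l_space K\<close>.  As \<open>\<lambda>\<close> is restricted to the dual of \<open>l_space\<close>, an exponential \<open>e\<^bsup>(\<lambda>, \<kappa>)\<^esup>\<close> with an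
  arbitrary weight \<open>\<kappa>\<close> has exponent \<open>l_proj K \<kappa>\<close>.  Sums that are infinite in total but have, for
  each exponent, only finitely many nonzero contributions are written with \<open>Sum_any\<close>.
\<close>

definition l_proj :: "('g::complex_vec, 'i, 'z) bd_algebra_scheme \<Rightarrow> 'g \<Rightarrow> 'g"
  where "l_proj K \<kappa> = (THE y. y \<in> l_space K \<and> (\<forall>z\<in>l_space K. form K y z = form K \<kappa> z))"

text \<open>Multiplication by \<open>e\<^bsup>(\<lambda>, \<beta>)\<^esup>\<close>, and the derivative in the direction of \<open>x \<in> l_space K\<close>.\<close>

definition exp_mult :: "('g::complex_vec, 'i, 'z) bd_algebra_scheme \<Rightarrow> 'g \<Rightarrow> ('g \<Rightarrow> 'w) \<Rightarrow> 'g \<Rightarrow> 'w"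
  where "exp_mult K \<beta> G = (\<lambda>\<theta>. G (\<theta> - l_proj K \<beta>))"

definition partial :: "('g::complex_vec, 'i, 'z) km_algebra_scheme \<Rightarrow> 'g \<Rightarrow> ('g \<Rightarrow> 'w::complex_vec) \<Rightarrow> 'g \<Rightarrow> 'w"
  where "partial K x G = (\<lambda>\<theta>. form K \<theta> x *\<^sub>C G \<theta>)"

definition series_mult :: "('g::complex_vec \<Rightarrow> complex) \<Rightarrow> ('g \<Rightarrow> 'w::complex_vec) \<Rightarrow> 'g \<Rightarrow> 'w"
  where "series_mult a G = (\<lambda>\<theta>. Sum_any (\<lambda>\<eta>. a \<eta> *\<^sub>C G (\<theta> - \<eta>)))"

definition cone_supported ::
    "('g::complex_vec, 'i::finite, 'z) bd_algebra_scheme \<Rightarrow> ('g \<Rightarrow> complex) \<Rightarrow> bool"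
  where "cone_supported K a \<longleftrightarrow> (\<exists>\<Theta>. finite \<Theta> \<and> \<Theta> \<subseteq> l_space K \<and>
    (\<forall>\<theta>. a \<theta> \<noteq> 0 \<longrightarrow> (\<exists>\<eta>\<in>\<Theta>. \<exists>\<beta>\<in>Q_plus K. \<theta> = \<eta> - l_proj K \<beta>)))"

text \<open>The inverse in the commutative ring of series with support in finitely many cones.\<close>

definition series_inverse ::
    "('g::complex_vec, 'i::finite, 'z) bd_algebra_scheme \<Rightarrow> ('g \<Rightarrow> complex) \<Rightarrow> 'g \<Rightarrow> complex"
  where "series_inverse K a = (THE b. cone_supported K b \<and>
    series_mult b a = (\<lambda>\<theta>. if \<theta> = 0 then 1 else 0))"


section \<open>Trace functions\<close>

definition weight_basis ::
    "('g::complex_vec, 'i, 'z) km_algebra_scheme \<Rightarrow> ('g \<Rightarrow> 'm \<Rightarrow> 'm::complex_vec) \<Rightarrow> 'm set \<Rightarrow> bool"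
  where "weight_basis K act S \<longleftrightarrow> cvec.independent S \<and> cvec.span S = UNIV \<and>
    (\<forall>b\<in>S. \<exists>\<kappa>\<in>cart K. b \<in> weight_space K act \<kappa>)"

text \<open>
  The coefficient of \<open>e\<^bsup>(\<lambda>, \<theta>)\<^esup>\<close> in the trace of \<open>G e\<^sup>\<lambda>\<close> on a Verma module: the sum of the diagonal
  entries of \<open>G\<close> over those members of a weight basis on which \<open>e\<^sup>\<lambda>\<close> acts by \<open>e\<^bsup>(\<lambda>, \<theta>)\<^esup>\<close> (there are
  finitely many).  \<open>diag \<eta> b\<close> is the diagonal entry at the basis vector \<open>b\<close> with coordinate
  functional \<open>\<eta>\<close>; it does not matter which weight basis is used.
\<close>

definition trace_series ::
    "('g::complex_vec, 'i, 'z) bd_algebra_scheme \<Rightarrow> ('g \<Rightarrow> 'm \<Rightarrow> 'm::complex_vec) \<Rightarrow>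
     (('m \<Rightarrow> complex) \<Rightarrow> 'm \<Rightarrow> 'w::complex_vec) \<Rightarrow> 'g \<Rightarrow> 'w"
  where "trace_series K act diag \<theta> =
    (let S = (SOME S. weight_basis K act S) in
     \<Sum>b | b \<in> S \<and> (\<exists>\<kappa>\<in>cart K. b \<in> weight_space K act \<kappa> \<and> l_proj K \<kappa> = \<theta>).
       diag (\<lambda>m. cvec.representation S m b) b)"

definition trace_F ::
    "('g::complex_vec, 'i, 'z) bd_algebra_scheme \<Rightarrow> ('g \<Rightarrow> 'g) \<Rightarrow>
     ('g \<Rightarrow> 'g \<Rightarrow> 'm \<Rightarrow> 'm::complex_vec) \<Rightarrow> ('g \<Rightarrow> 'm) \<Rightarrow> ('g \<Rightarrow> 'v \<Rightarrow> 'v::complex_vec) \<Rightarrow>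
     nat \<Rightarrow> (nat \<Rightarrow> 'v set) \<Rightarrow> (nat \<Rightarrow> 'g) \<Rightarrow> (nat \<Rightarrow> 'v) \<Rightarrow> 'g \<Rightarrow> 'g \<Rightarrow> 'v tens"
  where "trace_F K B M vac act r V \<nu> v \<mu> =
    (let \<mu>' = \<mu> - (\<Sum>i<r. \<nu> i) in
     trace_series K (M \<mu>')
       (\<lambda>\<eta> b. contract \<eta> (intertwiner_product K M vac act r V \<nu> v \<mu> (verma_B K B M vac \<mu>' \<mu> b))))"

definition delta_B ::
    "('g::complex_vec, 'i::finite, 'z) bd_algebra_scheme \<Rightarrow> ('g \<Rightarrow> 'g) \<Rightarrow>
     ('g \<Rightarrow> 'g \<Rightarrow> 'm \<Rightarrow> 'm::complex_vec) \<Rightarrow> ('g \<Rightarrow> 'm) \<Rightarrow> 'g \<Rightarrow> 'g \<Rightarrow> complex"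
  where "delta_B K B M vac \<rho> =
    series_inverse K (trace_series K (M (- \<rho>)) (\<lambda>\<eta> b. \<eta> (verma_B K B M vac (- \<rho>) (- \<rho>) b)))"

definition trace_FF ::
    "('g::complex_vec, 'i::finite, 'z) bd_algebra_scheme \<Rightarrow> ('g \<Rightarrow> 'g) \<Rightarrow> 'g \<Rightarrow>
     ('g \<Rightarrow> 'g \<Rightarrow> 'm \<Rightarrow> 'm::complex_vec) \<Rightarrow> ('g \<Rightarrow> 'm) \<Rightarrow> ('g \<Rightarrow> 'v \<Rightarrow> 'v::complex_vec) \<Rightarrow>
     nat \<Rightarrow> (nat \<Rightarrow> 'v set) \<Rightarrow> (nat \<Rightarrow> 'g) \<Rightarrow> (nat \<Rightarrow> 'v) \<Rightarrow> 'g \<Rightarrow> 'g \<Rightarrow> 'v tens"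
  where "trace_FF K B \<rho> M vac act r V \<nu> v \<mu> =
    series_mult (delta_B K B M vac \<rho>) (trace_F K B M vac act r V \<nu> v \<mu>)"

text \<open>\<open>S_T \<dots> l n\<close> is the operator of the series \<open>S\<^sub>T(\<lambda>)\<close> acting in the factors \<open>l\<close> and \<open>n\<close>.\<close>

definition S_T ::
    "('g::complex_vec, 'i::finite, 'z) bd_algebra_scheme \<Rightarrow> ('g \<Rightarrow> 'g) \<Rightarrow> ('g \<Rightarrow> 'g) \<Rightarrow>
     ('g \<Rightarrow> nat \<Rightarrow> 'g) \<Rightarrow> ('g \<Rightarrow> nat \<Rightarrow> 'g) \<Rightarrow> nat set \<Rightarrow> (nat \<Rightarrow> 'g) \<Rightarrow>
     ('g \<Rightarrow> 'v \<Rightarrow> 'v::complex_vec) \<Rightarrow> nat \<Rightarrow> nat \<Rightarrow> ('g \<Rightarrow> 'v tens) \<Rightarrow> 'g \<Rightarrow> 'v tens"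
  where "S_T K B Bi eb fb I2 x act l n G = (\<lambda>\<theta>.
    Sum_any (\<lambda>(\<alpha>, t, s, v).
      if \<alpha> \<in> pos_roots K \<and> t \<in> {1..root_mult K \<alpha>} \<and> v \<ge> 1
      then let f = (B ^^ s) (fb \<alpha> t); e = (Bi ^^ v) (eb \<alpha> t);
               H = exp_mult K (- (of_nat (s + v) *\<^sub>C \<alpha>)) G \<theta>
           in on_factors act l n f e H + on_factors act l n e f H
      else 0)
    - (\<Sum>j\<in>I2. let y = (1/2) *\<^sub>C (x j - cayley K (x j)) in on_factors act l n y y (G \<theta>)))"

end

theory Submission imports Defs begin

text \<open>
  The Casimir element acts on \<open>M \<mu>\<close> by \<open>(\<mu>, \<mu> + 2\<rho>)\<close>. Its trace against the intertwiners and \<open>B\<close> is computed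
  a second time by moving each factor once around the trace: passing the intertwiners, an element leaves behind
  its action on the tensor factors, and passing \<open>B e\<^sup>\<lambda>\<close> it is twisted by \<open>B\<^sup>-\<^sup>1\<close> and multiplied by an exponential.
  Iteration produces the geometric series of \<open>S_T\<close>, and on the part of the Cartan subalgebra orthogonal to
  \<open>l_space K\<close> the same argument produces the Cayley transform. The result is
  \<open>\<Sum>\<^sub>j (\<partial>\<^sub>j\<^sup>2 + 2 E\<^sub>j \<partial>\<^sub>j) F - S_T F = (\<mu>, \<mu> + 2\<rho>) F\<close>, where the scalar series \<open>E\<^sub>j\<close> do not depend on the modules.
  Without intertwiners, on \<open>M (p - \<rho>)\<close> for \<open>p\<close> in \<open>l_space K\<close>, the trace is the translate by \<open>p\<close> of the trace \<open>D\<close> on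
  \<open>M (- \<rho>)\<close>; comparing the identities for all \<open>p\<close> yields \<open>\<partial>\<^sub>j D = - E\<^sub>j D\<close>. Hence multiplication by
  \<open>delta_B = D\<^sup>-\<^sup>1\<close> removes the first order terms and adds \<open>(\<rho>, \<rho>)\<close> to the eigenvalue.
\<close>

section \<open>Linear algebra\<close>

text \<open>No structure theory is presupposed: the triangular decomposition, the freeness of Verma
  modules over the enveloping algebra of \<open>n_minus\<close> and the existence of intertwiners
  are derived from the generators, the form and Kac's condition on ideals. Two obstacles shape the
  trace computation. The sums over roots and powers of \<open>B\<close> are infinite; but the
  element \<open>d\<close> on which all simple roots equal 1 is orthogonal to every \<alpha> -
  T\<alpha>, so it lies in \<open>l_space K\<close>, and the grading by \<open>d\<close> makes all
  blocks finite and stops every iteration. Moreover, a Cartan element turns into a derivative in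
  \<lambda> only if it lies in \<open>l_space K\<close>, whereas the brackets of
  \<open>Bi\<close>-images of e with f are multiples of roots. Only their sums over all roots with a
  common restriction lie there (\<open>PP_l\<close>); this produces the first order terms and
  removes the commutators between the two orders of factors in \<open>S_T\<close>. The family
  \<open>M (p - \<rho>)\<close> replaces an explicit product formula for \<open>delta_B\<close>:
  after translation by p, the quadratic part in p is absorbed by (p, p), and the linear part is the
  formula for the derivative.\<close>

lemma clinearI:
  assumes "\<And>x y. f (x + y) = f x + f y" "\<And>c x. f (c *\<^sub>C x) = c *\<^sub>C f x"
  shows "clinear f"
  by unfold_locales (simp_all add: assms)

lemma
  assumes "clinear f"
  shows clinear_add: "f (x + y) = f x + f y"
    and clinear_scale: "f (c *\<^sub>C x) = c *\<^sub>C f x"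
    and clinear_zero: "f 0 = 0"
    and clinear_minus: "f (- x) = - f x"
    and clinear_diff: "f (x - y) = f x - f y"
    and clinear_sum: "f (sum g A) = (\<Sum>a\<in>A. f (g a))"
proof -
  interpret Vector_Spaces.linear scaleC scaleC f by (rule assms)
  show "f (x + y) = f x + f y" "f (c *\<^sub>C x) = c *\<^sub>C f x" "f 0 = 0" "f (- x) = - f x"
    "f (x - y) = f x - f y" "f (sum g A) = (\<Sum>a\<in>A. f (g a))"
    by (rule add scale zero neg diff sum)+
qed

lemma clinear_compose: "clinear f \<Longrightarrow> clinear g \<Longrightarrow> clinear (\<lambda>x. g (f x))"
  by (intro clinearI) (simp_all add: clinear_add clinear_scale)

lemma clinear_id_fun: "clinear (\<lambda>x. x)"
  by (intro clinearI) simp_all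

lemma clinear_span_image:
  assumes "clinear f" "x \<in> cvec.span S" "\<And>s. s \<in> S \<Longrightarrow> f s \<in> cvec.span T"
  shows "f x \<in> cvec.span T"
  using assms(2)
  by (induction rule: cvec.span_induct_alt)
    (auto simp: clinear_zero[OF assms(1)] clinear_add[OF assms(1)] clinear_scale[OF assms(1)]
      intro: cvec.span_add cvec.span_scale assms(3) cvec.span_zero)

lemma clinear_eq_on_span:
  assumes "clinear f" "clinear g" "x \<in> cvec.span S" "\<And>s. s \<in> S \<Longrightarrow> f s = g s"
  shows "f x = g x"
  using assms(3)
  by (induction rule: cvec.span_induct_alt)
    (auto simp: clinear_zero[OF assms(1)] clinear_add[OF assms(1)] clinear_scale[OF assms(1)]
      clinear_zero[OF assms(2)] clinear_add[OF assms(2)] clinear_scale[OF assms(2)] assms(4))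

lemma separating_functional_subspace:
  fixes w :: "'w::complex_vec"
  assumes "w \<notin> cvec.span U"
  obtains \<theta> :: "'w \<Rightarrow> complex" where "clinear \<theta>" "\<theta> w = 1" "\<And>u. u \<in> cvec.span U \<Longrightarrow> \<theta> u = 0"
proof -
  interpret vp: vector_space_pair "scaleC :: complex \<Rightarrow> 'w \<Rightarrow> 'w" "scaleC :: complex \<Rightarrow> complex \<Rightarrow> complex"
    by unfold_locales
  obtain B where B: "B \<subseteq> U" "cvec.independent B" "U \<subseteq> cvec.span B"
    using cvec.maximal_independent_subset[of U] by metis
  have sp: "cvec.span B = cvec.span U"
    using B by (metis cvec.span_mono cvec.span_span subset_antisym)
  have ind: "cvec.independent (insert w B)"
    using assms B(2) sp cvec.independent_insertI by auto
  have wB: "w \<notin> B" using assms sp cvec.span_base by blast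
  define \<theta> where "\<theta> = vp.construct (insert w B) (\<lambda>b. if b = w then 1 else 0)"
  have lin: "clinear \<theta>" unfolding \<theta>_def by (rule vp.linear_construct[OF ind])
  have v: "\<theta> b = (if b = w then 1 else 0)" if "b \<in> insert w B" for b
    unfolding \<theta>_def by (rule vp.construct_basis[OF ind that])
  have "\<theta> u = 0" if "u \<in> cvec.span U" for u
    by (rule clinear_eq_on_span[OF lin clinear_zero_fun, of u B]) (use that sp v wB in auto)
  with lin v that show thesis by auto
qed

text \<open>Linearity is asked only on the subspace \<open>P\<close>, because the maps to which this
  is applied, the linear extensions \<open>flin\<close> of maps on words, are additive only on
  finitely supported functions.\<close>

lemma clinear_factor:
  fixes f :: "'p::complex_vec \<Rightarrow> 'm::complex_vec" and g :: "'p \<Rightarrow> 'x::complex_vec"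
  assumes P: "cvec.subspace P"
    and f: "\<And>p q. p \<in> P \<Longrightarrow> q \<in> P \<Longrightarrow> f (p + q) = f p + f q" "\<And>c p. p \<in> P \<Longrightarrow> f (c *\<^sub>C p) = c *\<^sub>C f p"
    and g: "\<And>p q. p \<in> P \<Longrightarrow> q \<in> P \<Longrightarrow> g (p + q) = g p + g q" "\<And>c p. p \<in> P \<Longrightarrow> g (c *\<^sub>C p) = c *\<^sub>C g p"
    and onto: "f ` P = UNIV"
    and ker: "\<And>p. p \<in> P \<Longrightarrow> f p = 0 \<Longrightarrow> g p = 0"
  obtains \<psi> where "clinear \<psi>" "\<And>p. p \<in> P \<Longrightarrow> \<psi> (f p) = g p"
proof
  define \<psi> where "\<psi> m = g (SOME p. p \<in> P \<and> f p = m)" for m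
  have *: "\<psi> (f p) = g p" if "p \<in> P" for p
  proof -
    define q where "q = (SOME q. q \<in> P \<and> f q = f p)"
    have q: "q \<in> P \<and> f q = f p" unfolding q_def by (rule someI[of _ p]) (use that in simp)
    have m: "(-1) *\<^sub>C q \<in> P" using q P cvec.subspace_scale by blast
    have "p + (-1) *\<^sub>C q \<in> P" using m that P cvec.subspace_add by blast
    moreover have "f (p + (-1) *\<^sub>C q) = 0"
      by (subst f(1)[OF that m], subst f(2)) (use q in auto)
    ultimately have "g (p + (-1) *\<^sub>C q) = 0" by (rule ker)
    then have "g p = g q"
      by (subst (asm) g(1)[OF that m], subst (asm) g(2)) (use q in auto)
    then show ?thesis by (simp add: \<psi>_def q_def)
  qed
  show "clinear \<psi>"
  proof (rule clinearI)
    fix x y c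
    obtain p q where "p \<in> P" "q \<in> P" "x = f p" "y = f q" using onto by (metis UNIV_I imageE)
    moreover then have "p + q \<in> P" "c *\<^sub>C p \<in> P" using P cvec.subspace_add cvec.subspace_scale by blast+
    ultimately show "\<psi> (x + y) = \<psi> x + \<psi> y" "\<psi> (c *\<^sub>C x) = c *\<^sub>C \<psi> x"
      using *[of "p + q"] *[of "c *\<^sub>C p"] by (simp_all add: * f g)
  qed
  show "\<psi> (f p) = g p" if "p \<in> P" for p using that by (rule *)
qed

locale bilin =
  fixes f :: "'a::complex_vec \<Rightarrow> 'b::complex_vec \<Rightarrow> 'c::complex_vec"
  assumes bil: "cbilinear f"
begin

lemma lin_r: "clinear (f x)" and lin_l: "clinear (\<lambda>x. f x y)"
  using bil by (auto simp: cbilinear_def)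

lemmas addr = clinear_add[OF lin_r] and scaler = clinear_scale[OF lin_r] and zeror = clinear_zero[OF lin_r]
  and minusr = clinear_minus[OF lin_r] and diffr = clinear_diff[OF lin_r] and sumr = clinear_sum[OF lin_r]
lemmas addl = clinear_add[OF lin_l] and scalel = clinear_scale[OF lin_l] and zerol = clinear_zero[OF lin_l]
  and minusl = clinear_minus[OF lin_l] and diffl = clinear_diff[OF lin_l] and suml = clinear_sum[OF lin_l]
lemmas bisimps = addr scaler zeror minusr diffr addl scalel zerol minusl diffl

end

section \<open>Triangular decomposition\<close>

locale lie_alg = bilin br for br :: "'a::complex_vec \<Rightarrow> 'a \<Rightarrow> 'a" +
  assumes alt: "br x x = 0"
    and jacobi: "br x (br y z) + br y (br z x) + br z (br x y) = 0"
begin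

lemma anti: "br x y = - br y x"
proof -
  have "br (x + y) (x + y) = 0" by (rule alt)
  then have "br x y + br y x = 0" using alt[of x] alt[of y] by (simp add: addl addr add.commute)
  then show ?thesis by (rule eq_neg_iff_add_eq_0[THEN iffD2])
qed

lemma deriv: "br x (br y z) = br (br x y) z + br y (br x z)"
  using jacobi[of x y z] anti[of z "br x y"] anti[of z x] by (simp add: minusr algebra_simps)

lemma deriv_l: "br (br x y) z = br x (br y z) - br y (br x z)"
  using deriv[of x y z] by simp

definition subalg :: "'a set \<Rightarrow> bool"
  where "subalg S \<longleftrightarrow> cvec.subspace S \<and> (\<forall>x\<in>S. \<forall>y\<in>S. br x y \<in> S)"

definition gen :: "'a set \<Rightarrow> 'a set" where "gen X = \<Inter>{S. subalg S \<and> X \<subseteq> S}"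

lemma gen_least: "subalg S \<Longrightarrow> X \<subseteq> S \<Longrightarrow> gen X \<subseteq> S"
  by (auto simp: gen_def)

lemma gen_base: "X \<subseteq> gen X" by (auto simp: gen_def)

lemma subalg_gen: "subalg (gen X)"
  unfolding gen_def subalg_def
  by (auto intro!: cvec.subspace_Inter)

text \<open>Right-normed brackets. The value 0 at the empty word is a default that keeps the
  function total; the degree arguments below set zero monomials aside.\<close>

fun mon :: "('i \<Rightarrow> 'a) \<Rightarrow> 'i list \<Rightarrow> 'a"
  where "mon e [] = 0" | "mon e [i] = e i" | "mon e (i # j # js) = br (e i) (mon e (j # js))"

definition mons :: "('i \<Rightarrow> 'a) \<Rightarrow> 'a set" where "mons e = cvec.span (range (mon e))"

lemma mon_Cons: "js \<noteq> [] \<Longrightarrow> mon e (i # js) = br (e i) (mon e js)"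
  by (cases js) auto

lemma mon_in: "mon e w \<in> mons e"
  by (simp add: mons_def cvec.span_base)

lemma br_gen_mons: "y \<in> mons e \<Longrightarrow> br (e i) y \<in> mons e"
  unfolding mons_def
proof (rule clinear_span_image[OF lin_r])
  fix s assume "s \<in> range (mon e)"
  then obtain w where w: "s = mon e w" by auto
  have "br (e i) s \<in> mons e"
    by (cases "w = []") (simp_all add: w zeror mons_def cvec.span_zero mon_in[unfolded mons_def] flip: mon_Cons)
  then show "br (e i) s \<in> cvec.span (range (mon e))" by (simp add: mons_def)
qed

lemma subspace_mons: "cvec.subspace (mons e)" by (simp add: mons_def)

text \<open>By the Jacobi identity the bracket with a right-normed monomial is a combination of
  iterated brackets with generators, so the span of these monomials is already closed under
  brackets.\<close>

lemma gen_mons: "gen (range e) = mons e"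
proof
  have "br x y \<in> mons e" if "x \<in> mons e" "y \<in> mons e" for x y
  proof -
    have "br (mon e w) y \<in> mons e" if "y \<in> mons e" for w y
      using that
    proof (induction w arbitrary: y)
      case Nil then show ?case by (simp add: zerol cvec.subspace_0 subspace_mons)
    next
      case (Cons i w)
      then show ?case
        by (cases "w = []")
          (simp_all add: mon_Cons deriv_l br_gen_mons cvec.subspace_diff[OF subspace_mons])
    qed
    then show ?thesis
      using that clinear_span_image[OF lin_l[of y], of x "range (mon e)" "range (mon e)"]
      by (auto simp: mons_def)
  qed
  moreover have "range e \<subseteq> mons e" using mon_in[of e "[_]"] by auto
  ultimately show "gen (range e) \<subseteq> mons e"
    by (intro gen_least) (auto simp: subalg_def subspace_mons)
  have "mon e w \<in> gen (range e)" for w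
    using subalg_gen[of "range e"] gen_base[of "range e"]
    by (induction e w rule: mon.induct) (auto simp: subalg_def cvec.subspace_0)
  then show "mons e \<subseteq> gen (range e)"
    unfolding mons_def using subalg_gen[of "range e"]
    by (intro cvec.span_minimal) (auto simp: subalg_def)
qed

end

text \<open>Only the relations that hold before any ideal is factored out. They are instantiated
  three times: for the algebra itself, with the roles of e and f exchanged, and for pairs of
  elements in the square of the algebra, from which the Chevalley involution is built.\<close>

locale chev = lie_alg br for br :: "'a::complex_vec \<Rightarrow> 'a \<Rightarrow> 'a" +
  fixes e f hh :: "'i \<Rightarrow> 'a" and H :: "'a set" and a :: "'i \<Rightarrow> 'a \<Rightarrow> complex"
  assumes H: "cvec.subspace H" "\<And>i. hh i \<in> H" "\<And>x y. x \<in> H \<Longrightarrow> y \<in> H \<Longrightarrow> br x y = 0"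
    and ef: "br (e i) (f j) = (if i = j then hh i else 0)"
    and he: "x \<in> H \<Longrightarrow> br x (e i) = a i x *\<^sub>C e i"
    and hf: "x \<in> H \<Longrightarrow> br x (f i) = (- a i x) *\<^sub>C f i"
begin

lemma swap: "chev br f e (\<lambda>i. - hh i) H (\<lambda>i x. - a i x)"
  using H ef he hf anti[of "f _" "e _"] by unfold_locales (auto simp: cvec.subspace_neg)

lemma h_mon: "x \<in> H \<Longrightarrow> br x (mon e w) = (\<Sum>i\<leftarrow>w. a i x) *\<^sub>C mon e w"
proof (induction w)
  case Nil then show ?case by (simp add: zeror)
next
  case (Cons i w)
  then show ?case
    by (cases "w = []") (simp_all add: he mon_Cons deriv[of x "e i"] scalel scaler scaleC_add_left)
qed

lemma h_mons: "x \<in> H \<Longrightarrow> y \<in> mons e \<Longrightarrow> br x y \<in> mons e"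
  unfolding mons_def by (rule clinear_span_image[OF lin_r]) (auto simp: h_mon cvec.span_base cvec.span_scale)

definition borel where "borel = {h + y | h y. h \<in> H \<and> y \<in> mons e}"

lemma subspace_borel: "cvec.subspace borel"
  unfolding borel_def using cvec.subspace_sums[OF H(1) subspace_mons[of e]] by simp

lemma mons_borel: "mons e \<subseteq> borel" unfolding borel_def using cvec.subspace_0[OF H(1)] by force
lemma H_borel: "H \<subseteq> borel" unfolding borel_def using cvec.subspace_0[OF subspace_mons] by force

lemma e_borel: "y \<in> borel \<Longrightarrow> br (e i) y \<in> mons e"
proof -
  assume "y \<in> borel"
  then obtain h z where y: "y = h + z" "h \<in> H" "z \<in> mons e" by (auto simp: borel_def)
  have "br (e i) h = (- a i h) *\<^sub>C e i" using he[OF y(2)] anti[of "e i" h] by simp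
  also have "\<dots> \<in> mons e" using mon_in[of e "[i]"] by (simp add: cvec.subspace_neg cvec.subspace_scale subspace_mons)
  finally show ?thesis by (simp add: y addr br_gen_mons cvec.subspace_add subspace_mons)
qed

text \<open>By the derivation rule: \<open>br (f j) (e i)\<close> is in \<open>H\<close> and acts on
  a monomial by a scalar, while \<open>e i\<close> carries the Borel part back into the span of
  monomials.\<close>

lemma f_mon: "br (f j) (mon e w) \<in> borel"
proof (induction w)
  case Nil then show ?case by (simp add: zeror cvec.subspace_0 subspace_borel)
next
  case (Cons i w)
  have 1: "br (f j) (e i) \<in> H"
    using anti[of "f j" "e i"] ef[of i j] H(2) cvec.subspace_neg[OF H(1)] cvec.subspace_0[OF H(1)] by auto
  show ?case
  proof (cases "w = []")
    case True then show ?thesis using 1 H_borel by auto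
  next
    case False
    have "br (br (f j) (e i)) (mon e w) \<in> mons e" using 1 by (simp add: h_mons mon_in)
    moreover have "br (e i) (br (f j) (mon e w)) \<in> mons e" using Cons by (rule e_borel)
    ultimately show ?thesis
      using False mons_borel by (auto simp: mon_Cons deriv[of "f j" "e i"] intro!: cvec.subspace_add subspace_borel)
  qed
qed

lemma f_mons: "y \<in> mons e \<Longrightarrow> br (f j) y \<in> borel"
  using clinear_span_image[OF lin_r[of "f j"], of y "range (mon e)" borel] f_mon subspace_borel
  by (auto simp: mons_def cvec.span_eq_iff[THEN iffD2])

end

context chev begin

interpretation sw: chev br f e "\<lambda>i. - hh i" H "\<lambda>i x. - a i x" by (rule swap)

definition tri where "tri = {y + h + x | y h x. y \<in> mons f \<and> h \<in> H \<and> x \<in> mons e}"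

lemma triI: "y \<in> mons f \<Longrightarrow> h \<in> H \<Longrightarrow> x \<in> mons e \<Longrightarrow> y + h + x \<in> tri"
  by (auto simp: tri_def)

lemma subspace_tri: "cvec.subspace tri"
proof -
  have "tri = {z + x | z x. z \<in> {y + h | y h. y \<in> mons f \<and> h \<in> H} \<and> x \<in> mons e}"
    unfolding tri_def by blast
  then show ?thesis
    using cvec.subspace_sums[OF cvec.subspace_sums[OF subspace_mons[of f] H(1)] subspace_mons[of e]] by simp
qed

lemma borel_tri: "borel \<subseteq> tri" "sw.borel \<subseteq> tri" "mons e \<subseteq> tri" "mons f \<subseteq> tri" "H \<subseteq> tri"
proof -
  show 1: "borel \<subseteq> tri"
    using triI[OF cvec.subspace_0[OF subspace_mons[of f]]] by (auto simp: borel_def)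
  show 2: "sw.borel \<subseteq> tri"
    using triI[OF _ _ cvec.subspace_0[OF subspace_mons[of e]]] by (fastforce simp: sw.borel_def add.commute)
  show "mons e \<subseteq> tri" "mons f \<subseteq> tri" "H \<subseteq> tri"
    using 1 2 mons_borel sw.mons_borel H_borel by blast+
qed

text \<open>The elements of \<open>tri\<close> whose brackets with all of \<open>tri\<close> stay in
  \<open>tri\<close> form a subalgebra by the Jacobi identity, so only the generators have to be
  examined.\<close>

lemma gen_tri: "gen (H \<union> range e \<union> range f) \<subseteq> tri"
proof -
  define S where "S = {z \<in> tri. \<forall>w\<in>tri. br z w \<in> tri}"
  have sub: "subalg S"
    unfolding subalg_def
  proof (intro conjI ballI)
    show "cvec.subspace S"
      using subspace_tri unfolding S_def cvec.subspace_def by (simp add: bisimps)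
    show "br x y \<in> S" if "x \<in> S" "y \<in> S" for x y
      using that subspace_tri by (auto simp: S_def deriv_l cvec.subspace_diff)
  qed
  have "H \<union> range e \<union> range f \<subseteq> S"
  proof -
    have *: "z \<in> S" if z: "z \<in> tri" and "\<And>y. y \<in> mons f \<Longrightarrow> br z y \<in> tri" "\<And>y. y \<in> H \<Longrightarrow> br z y \<in> tri"
      "\<And>y. y \<in> mons e \<Longrightarrow> br z y \<in> tri" for z
      unfolding S_def
    proof (safe intro!: z)
      fix w assume "w \<in> tri"
      then obtain y h x where "w = y + h + x" "y \<in> mons f" "h \<in> H" "x \<in> mons e" by (auto simp: tri_def)
      then show "br z w \<in> tri" using that subspace_tri by (simp add: addr cvec.subspace_add)
    qed
    have e: "e i \<in> S" for i
    proof (rule *)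
      show "e i \<in> tri" using mon_in[of e "[i]"] borel_tri(3) by auto
      show "br (e i) y \<in> tri" if "y \<in> mons f" for y using sw.f_mons[OF that] borel_tri(2) by blast
      show "br (e i) y \<in> tri" if "y \<in> H" for y using e_borel[of y] that H_borel borel_tri(3) by blast
      show "br (e i) y \<in> tri" if "y \<in> mons e" for y using e_borel[of y] that mons_borel borel_tri(3) by blast
    qed
    have f: "f i \<in> S" for i
    proof (rule *)
      show "f i \<in> tri" using mon_in[of f "[i]"] borel_tri(4) by auto
      show "br (f i) y \<in> tri" if "y \<in> mons e" for y using f_mons[OF that] borel_tri(1) by blast
      show "br (f i) y \<in> tri" if "y \<in> H" for y using sw.e_borel[of y] that sw.H_borel borel_tri(4) by blast
      show "br (f i) y \<in> tri" if "y \<in> mons f" for y using sw.e_borel[of y] that sw.mons_borel borel_tri(4) by blast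
    qed
    have h: "h \<in> S" if h: "h \<in> H" for h
    proof (rule *)
      show "h \<in> tri" using h borel_tri(5) by blast
      show "br h y \<in> tri" if "y \<in> mons e" for y using h_mons[OF h that] borel_tri(3) by blast
      show "br h y \<in> tri" if "y \<in> mons f" for y using sw.h_mons[OF h that] borel_tri(4) by blast
      show "br h y \<in> tri" if "y \<in> H" for y using H(3)[OF h that] subspace_tri by (simp add: cvec.subspace_0)
    qed
    with e f show ?thesis by auto
  qed
  with sub have "gen (H \<union> range e \<union> range f) \<subseteq> S" by (rule gen_least)
  then show ?thesis by (auto simp: S_def)
qed

end

section \<open>Kac--Moody algebras\<close>

locale km =
  fixes K :: "('g::complex_vec, 'i::finite, 'z) km_algebra_scheme"
  assumes K: "symmetrizable_kac_moody K"
begin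

abbreviation "br \<equiv> lie K"
abbreviation "ip \<equiv> form K"
abbreviation "H \<equiv> cart K"
abbreviation "e \<equiv> gen_e K"
abbreviation "f \<equiv> gen_f K"
abbreviation "al \<equiv> simple K"

lemma kac: "kac_moody_algebra K" and gcmK: "generalized_cartan_matrix (gcm K)" and real: "realization K"
  and invK: "invariant_form K"
  using K by (simp_all add: symmetrizable_kac_moody_def kac_moody_algebra_def)

end

sublocale km \<subseteq> chev "lie K" "gen_e K" "gen_f K" "coroot K" "cart K" "sroot K"
  using K
  by unfold_locales
    (auto simp: symmetrizable_kac_moody_def kac_moody_algebra_def lie_algebra_def realization_def)

sublocale km \<subseteq> ip: bilin "form K"
  using K by unfold_locales (auto simp: symmetrizable_kac_moody_def invariant_form_def)

sublocale km \<subseteq> sw: chev "lie K" "gen_f K" "gen_e K" "\<lambda>i. - coroot K i" "cart K" "\<lambda>i x. - sroot K i x"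
  by (rule swap)

context km begin

lemma ip_sym: "ip x y = ip y x"
  and ip_inv: "ip (br x y) z = ip x (br y z)"
  and ip_nondeg: "(\<And>y. ip x y = 0) \<Longrightarrow> x = 0"
  using invK by (auto simp: invariant_form_def nondegenerate_on_def)

lemma ip_inv': "ip x (br y z) = - ip (br y x) z"
  by (metis ip_inv anti ip.minusl)

lemma lie_generated_gen: "lie_generated K X = gen X"
  by (simp add: lie_generated_def gen_def lie_subalgebra_def subalg_def)

lemma n_plus_mons: "n_plus K = mons e" and n_minus_mons: "n_minus K = mons f"
  by (simp_all add: n_plus_def n_minus_def lie_generated_gen gen_mons)

lemma tri_UNIV: "tri = UNIV"
proof -
  have "gen (H \<union> range e \<union> range f) = UNIV"
    using kac by (simp add: kac_moody_algebra_def lie_generated_gen)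
  then show ?thesis using gen_tri by auto
qed

lemma tri_cases:
  obtains y h x where "z = y + h + x" "y \<in> n_minus K" "h \<in> H" "x \<in> n_plus K"
proof -
  have "z \<in> tri" by (simp add: tri_UNIV)
  then show thesis using that by (auto simp: tri_def n_plus_mons n_minus_mons)
qed

lemma subspace_n_plus: "cvec.subspace (n_plus K)" and subspace_n_minus: "cvec.subspace (n_minus K)"
  by (simp_all add: n_plus_mons n_minus_mons subspace_mons)

lemma n_plus_br: "x \<in> n_plus K \<Longrightarrow> y \<in> n_plus K \<Longrightarrow> br x y \<in> n_plus K"
  and n_minus_br: "x \<in> n_minus K \<Longrightarrow> y \<in> n_minus K \<Longrightarrow> br x y \<in> n_minus K"
  using subalg_gen by (auto simp: n_plus_def n_minus_def lie_generated_gen subalg_def)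

lemma e_n_plus: "e i \<in> n_plus K" and f_n_minus: "f i \<in> n_minus K"
  using gen_base[of "range e"] gen_base[of "range f"] by (auto simp: n_plus_def n_minus_def lie_generated_gen)

lemma sroot_add: "x \<in> H \<Longrightarrow> y \<in> H \<Longrightarrow> sroot K i (x + y) = sroot K i x + sroot K i y"
  and sroot_scale: "x \<in> H \<Longrightarrow> sroot K i (c *\<^sub>C x) = c * sroot K i x"
  and sroot_indep: "(\<And>x. x \<in> H \<Longrightarrow> (\<Sum>i\<in>UNIV. k i * sroot K i x) = 0) \<Longrightarrow> k i = 0"
  and sroot_coroot: "sroot K j (coroot K i) = of_int (gcm K i j)"
  using real by (auto simp: realization_def)

text \<open>Dual to the linear independence of the simple roots: a functional vanishing on all value
  vectors of elements of \<open>H\<close>, but not at \<open>c\<close>, would be a nontrivial linear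
  relation among the roots.\<close>

lemma dual_element: "\<exists>h\<in>H. \<forall>i. sroot K i h = c i"
proof (rule ccontr)
  assume no: "\<not> ?thesis"
  define U where "U = (\<lambda>h i. sroot K i h) ` H"
  have sub: "cvec.subspace U"
    unfolding cvec.subspace_def
  proof (intro conjI ballI allI)
    have "sroot K i 0 = 0" for i
      using sroot_scale[of 0 i 0] cvec.subspace_0[OF H(1)] by simp
    then show "0 \<in> U" unfolding U_def using cvec.subspace_0[OF H(1)] by (force simp: fun_eq_iff)
    show "x + y \<in> U" if "x \<in> U" "y \<in> U" for x y
    proof -
      obtain a b where "a \<in> H" "b \<in> H" "x = (\<lambda>i. sroot K i a)" "y = (\<lambda>i. sroot K i b)" using \<open>x \<in> U\<close> \<open>y \<in> U\<close> by (auto simp: U_def)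
      then show ?thesis unfolding U_def
        by (intro image_eqI[of _ _ "a + b"]) (auto simp: sroot_add cvec.subspace_add[OF H(1)])
    qed
    show "k *\<^sub>C x \<in> U" if "x \<in> U" for x k
    proof -
      obtain a where "a \<in> H" "x = (\<lambda>i. sroot K i a)" using \<open>x \<in> U\<close> by (auto simp: U_def)
      then show ?thesis unfolding U_def
        by (intro image_eqI[of _ _ "k *\<^sub>C a"]) (auto simp: sroot_scale scaleC_fun_def scaleC_complex_def cvec.subspace_scale[OF H(1)])
    qed
  qed
  have "c \<notin> cvec.span U"
    using no sub by (auto simp: cvec.span_eq_iff[THEN iffD2] U_def fun_eq_iff)
  then obtain \<theta> :: "('i \<Rightarrow> complex) \<Rightarrow> complex" where \<theta>: "clinear \<theta>" "\<theta> c = 1" "\<And>u. u \<in> cvec.span U \<Longrightarrow> \<theta> u = 0"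
    using separating_functional_subspace by blast
  define k where "k i = \<theta> (\<lambda>j. if j = i then 1 else 0)" for i
  have rep: "\<theta> u = (\<Sum>i\<in>UNIV. k i * u i)" for u
  proof -
    have "u = (\<Sum>i\<in>UNIV. u i *\<^sub>C (\<lambda>j. if j = i then 1 else 0))"
      by (auto simp: fun_eq_iff sum_fun_apply scaleC_fun_def scaleC_complex_def if_distrib[of "\<lambda>x. _ * x"] cong: if_cong)
    then have "\<theta> u = \<theta> (\<Sum>i\<in>UNIV. u i *\<^sub>C (\<lambda>j. if j = i then 1 else 0))" by simp
    then show ?thesis by (simp add: clinear_sum[OF \<theta>(1)] clinear_scale[OF \<theta>(1)] k_def scaleC_complex_def mult.commute)
  qed
  have "k i = 0" for i
    by (rule sroot_indep[of k]) (use \<theta>(3) rep in \<open>auto simp: U_def intro!: cvec.span_base\<close>)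
  then show False using rep[of c] \<theta>(2) by simp
qed

text \<open>Grading element: its adjoint action is the principal grading, in which every simple root
  has degree 1. All finiteness arguments for roots, weights and series measure heights by pairing
  with \<open>d\<close>.\<close>

definition d :: 'g where "d = (SOME h. h \<in> H \<and> (\<forall>i. sroot K i h = 1))"

lemma d_in: "d \<in> H" and sroot_d: "sroot K i d = 1"
  using someI_ex[of "\<lambda>h. h \<in> H \<and> (\<forall>i. sroot K i h = 1)"] dual_element[of "\<lambda>_. 1"] unfolding d_def by blast+

lemma ip_coroot: "h \<in> H \<Longrightarrow> ip (coroot K i) h = sroot K i h * ip (e i) (f i)"
proof -
  assume h: "h \<in> H"
  have "ip (coroot K i) h = ip (e i) (br (f i) h)" using ef[of i i] ip_inv by (metis (full_types))
  also have "br (f i) h = sroot K i h *\<^sub>C f i" using hf[OF h, of i] anti[of "f i" h] by simp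
  finally show ?thesis by (simp add: ip.scaler scaleC_complex_def)
qed

lemma eigen_orth:
  assumes "br h x = a *\<^sub>C x" "br h y = b *\<^sub>C y" "a + b \<noteq> 0"
  shows "ip x y = 0"
proof -
  have "ip (br h x) y + ip x (br h y) = 0"
    using ip_inv'[of x h y] by simp
  then have "(a + b) * ip x y = 0" by (simp add: assms ip.scalel ip.scaler scaleC_complex_def algebra_simps)
  then show ?thesis using assms(3) by simp
qed

text \<open>A spanning set of joint eigenvectors of \<open>H\<close>. Nondegeneracy of the form
  therefore needs to be tested on \<open>T\<close> only.\<close>

definition T where "T = H \<union> range (mon e) \<union> range (mon f)"

lemma span_T: "cvec.span T = UNIV"
proof -
  have "H \<subseteq> T" "range (mon e) \<subseteq> T" "range (mon f) \<subseteq> T" unfolding T_def by blast+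
  then have *: "H \<subseteq> cvec.span T" "mons e \<subseteq> cvec.span T" "mons f \<subseteq> cvec.span T"
    unfolding mons_def using cvec.span_superset cvec.span_mono by blast+
  have "z \<in> cvec.span T" for z
  proof -
    have "z \<in> tri" by (simp add: tri_UNIV)
    then obtain y h x where "z = y + h + x" "y \<in> mons f" "h \<in> H" "x \<in> mons e" by (auto simp: tri_def)
    then show ?thesis using * by (auto intro!: cvec.span_add)
  qed
  then show ?thesis by auto
qed

lemma sum_list_minus: "(\<Sum>i\<leftarrow>w. - g i) = - (\<Sum>i\<leftarrow>w. (g i :: complex))"
  by (induction w) auto

lemma h_monf: "x \<in> H \<Longrightarrow> br x (mon f w) = (- (\<Sum>i\<leftarrow>w. sroot K i x)) *\<^sub>C mon f w"
  using sw.h_mon[of x w] by (simp add: sum_list_minus)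

lemma T_eigen: "t \<in> T \<Longrightarrow> h \<in> H \<Longrightarrow> \<exists>a. br h t = a *\<^sub>C t"
  unfolding T_def using h_mon[of h] h_monf[of h] H(3)[of h] by (auto intro: exI[of _ 0] simp del: cvec.scale_minus_left)

lemma ip_ext: "(\<And>t. t \<in> T \<Longrightarrow> ip x t = 0) \<Longrightarrow> x = 0"
proof (rule ip_nondeg)
  fix y assume "\<And>t. t \<in> T \<Longrightarrow> ip x t = 0"
  then show "ip x y = 0"
    using clinear_eq_on_span[OF ip.lin_r clinear_zero_fun, of y T x] by (simp add: span_T)
qed

text \<open>Split \<open>z\<close> into a combination of members of \<open>T\<close> with the right
  eigenvalues and a rest. The rest has the eigenvalues of \<open>z\<close> but is spanned by vectors
  with other eigenvalues, so by \<open>eigen_orth\<close> it is orthogonal to all of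
  \<open>T\<close>. The form thus takes the place of the independence of different
  eigenspaces.\<close>

lemma eigen_span:
  assumes D: "D \<subseteq> H" and z: "\<And>h. h \<in> D \<Longrightarrow> br h z = kk h *\<^sub>C z"
  shows "z \<in> cvec.span {t \<in> T. \<forall>h\<in>D. br h t = kk h *\<^sub>C t}"
proof -
  define T1 where "T1 = {t \<in> T. \<forall>h\<in>D. br h t = kk h *\<^sub>C t}"
  have "z \<in> cvec.span (T1 \<union> (T - T1))" using span_T by (simp add: T1_def Un_absorb1 Collect_conj_eq)
  then obtain z1 z2 where zz: "z = z1 + z2" "z1 \<in> cvec.span T1" "z2 \<in> cvec.span (T - T1)"
    unfolding cvec.span_Un by auto
  have 1: "br h z1 = kk h *\<^sub>C z1" if "h \<in> D" for h
    by (rule clinear_eq_on_span[OF lin_r clinear_scale_fun[OF clinear_id_fun] zz(2)]) (use that in \<open>auto simp: T1_def\<close>)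
  have 2: "br h z2 = kk h *\<^sub>C z2" if "h \<in> D" for h
    using z[OF that] 1[OF that] zz(1) by (simp add: addr scaleC_add_right)
  have "z2 = 0"
  proof (rule ip_ext)
    fix t assume t: "t \<in> T"
    show "ip z2 t = 0"
    proof (cases "\<exists>h\<in>D. br h t \<noteq> (- kk h) *\<^sub>C t")
      case True
      then obtain h where h: "h \<in> D" "br h t \<noteq> (- kk h) *\<^sub>C t" by auto
      then obtain a where a: "br h t = a *\<^sub>C t" using T_eigen[OF t, of h] D by auto
      then have "kk h + a \<noteq> 0" using h(2) by (metis add_eq_0_iff)
      then show ?thesis using eigen_orth[OF 2[OF h(1)] a] by simp
    next
      \<comment> \<open>Now \<open>t\<close> has exactly the eigenvalues opposite to those of
        \<open>z2\<close>; here it is the single members of \<open>T - T1\<close> that are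
        orthogonal to \<open>t\<close>.\<close>
      case False
      have "ip t2 t = 0" if t2: "t2 \<in> T - T1" for t2
      proof -
        obtain h where h: "h \<in> D" "br h t2 \<noteq> kk h *\<^sub>C t2" using t2 by (auto simp: T1_def)
        obtain a where a: "br h t2 = a *\<^sub>C t2" using T_eigen[of t2 h] h(1) t2 D by auto
        with h(2) have "a + - kk h \<noteq> 0" by auto
        then show ?thesis using eigen_orth[OF a, of t "- kk h"] False h(1) by auto
      qed
      then show ?thesis
        using clinear_eq_on_span[OF ip.lin_l clinear_zero_fun zz(3)] by auto
    qed
  qed
  with zz show ?thesis by (simp add: T1_def)
qed

section \<open>The principal grading and orthogonality of its components\<close>

lemma sum_list_1: "(\<Sum>i\<leftarrow>w. (1::complex)) = of_nat (length w)"
  by (induction w) auto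

lemma d_mon: "br d (mon e w) = of_nat (length w) *\<^sub>C mon e w"
  and d_monf: "br d (mon f w) = (- of_nat (length w)) *\<^sub>C mon f w"
  by (simp_all add: h_mon h_monf d_in sroot_d sum_list_1)

lemma mon_degree_unique:
  "mon e w \<noteq> 0 \<Longrightarrow> br d (mon e w) = c *\<^sub>C mon e w \<Longrightarrow> c = of_nat (length w)"
  "mon f w \<noteq> 0 \<Longrightarrow> br d (mon f w) = c *\<^sub>C mon f w \<Longrightarrow> c = - of_nat (length w)"
  by (simp_all add: d_mon d_monf flip: cvec.scale_minus_left)

lemma d_H: "h \<in> H \<Longrightarrow> br d h = 0" using H(3) d_in by auto

lemma degree_0:
  assumes "br d z = 0" shows "z \<in> H"
proof -
  have "z \<in> cvec.span {t \<in> T. \<forall>h\<in>{d}. br h t = 0 *\<^sub>C t}"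
    by (rule eigen_span) (use assms d_in in auto)
  moreover have "{t \<in> T. \<forall>h\<in>{d}. br h t = 0 *\<^sub>C t} \<subseteq> H"
  proof -
    have "mon e w \<in> H" if "br d (mon e w) = 0" for w
      using that mon_degree_unique(1)[of w 0] cvec.subspace_0[OF H(1)] by (cases "w = []"; cases "mon e w = 0") auto
    moreover have "mon f w \<in> H" if "br d (mon f w) = 0" for w
      using that mon_degree_unique(2)[of w 0] cvec.subspace_0[OF H(1)] by (cases "w = []"; cases "mon f w = 0") auto
    ultimately show ?thesis by (auto simp: T_def)
  qed
  ultimately show ?thesis using cvec.span_minimal[OF _ H(1)] by blast
qed

lemma degree_pos:
  assumes "br d z = of_nat n *\<^sub>C z" "n > 0" shows "z \<in> n_plus K"
proof -
  have "z \<in> cvec.span {t \<in> T. \<forall>h\<in>{d}. br h t = of_nat n *\<^sub>C t}"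
    by (rule eigen_span) (use assms d_in in auto)
  moreover have "{t \<in> T. \<forall>h\<in>{d}. br h t = of_nat n *\<^sub>C t} \<subseteq> n_plus K"
  proof -
    have "mon f w \<in> n_plus K" if "br d (mon f w) = of_nat n *\<^sub>C mon f w" for w
    proof (cases "mon f w = 0")
      case False
      from mon_degree_unique(2)[OF False that] have "of_nat n + of_nat (length w) = (0::complex)" by simp
      then have "n + length w = 0" by (metis of_nat_add of_nat_eq_0_iff)
      with assms(2) show ?thesis by simp
    qed (use cvec.subspace_0[OF subspace_n_plus] in auto)
    moreover have "h \<in> n_plus K" if "h \<in> H" "br d h = of_nat n *\<^sub>C h" for h
      using that d_H[of h] assms(2) cvec.subspace_0[OF subspace_n_plus] by auto
    moreover have "mon e w \<in> n_plus K" for w by (simp add: n_plus_mons mon_in)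
    ultimately show ?thesis by (auto simp: T_def)
  qed
  ultimately show ?thesis using cvec.span_minimal[OF _ subspace_n_plus] by blast
qed

lemma degree_neg:
  assumes "br d z = (- of_nat n) *\<^sub>C z" "n > 0" shows "z \<in> n_minus K"
proof -
  have "z \<in> cvec.span {t \<in> T. \<forall>h\<in>{d}. br h t = (- of_nat n) *\<^sub>C t}"
    by (rule eigen_span) (use assms d_in in auto)
  moreover have "{t \<in> T. \<forall>h\<in>{d}. br h t = (- of_nat n) *\<^sub>C t} \<subseteq> n_minus K"
  proof -
    have "mon e w \<in> n_minus K" if "br d (mon e w) = (- of_nat n) *\<^sub>C mon e w" for w
    proof (cases "mon e w = 0")
      case False
      from mon_degree_unique(1)[OF False that] have "of_nat n + of_nat (length w) = (0::complex)"
        by (metis add.right_inverse)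
      then have "n + length w = 0" by (metis of_nat_add of_nat_eq_0_iff)
      with assms(2) show ?thesis by simp
    qed (use cvec.subspace_0[OF subspace_n_minus] in auto)
    moreover have "h \<in> n_minus K" if "h \<in> H" "br d h = (- of_nat n) *\<^sub>C h" for h
      using that d_H[of h] assms(2) cvec.subspace_0[OF subspace_n_minus] by auto
    moreover have "mon f w \<in> n_minus K" for w by (simp add: n_minus_mons mon_in)
    ultimately show ?thesis by (auto simp: T_def)
  qed
  ultimately show ?thesis using cvec.span_minimal[OF _ subspace_n_minus] by blast
qed

lemma ip_n_H: "x \<in> n_plus K \<Longrightarrow> h \<in> H \<Longrightarrow> ip x h = 0" "y \<in> n_minus K \<Longrightarrow> h \<in> H \<Longrightarrow> ip y h = 0"
proof -
  assume h: "h \<in> H"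
  have 0: "br d h = 0 *\<^sub>C h" using d_H[OF h] by simp
  have "ip (mon e w) h = 0" for w
    using eigen_orth[OF d_mon[of w] 0] by (cases "w = []") (auto simp: ip.zerol)
  then show "x \<in> n_plus K \<Longrightarrow> ip x h = 0"
    using clinear_eq_on_span[OF ip.lin_l clinear_zero_fun, of x "range (mon e)" h] by (auto simp: n_plus_mons mons_def)
  have "ip (mon f w) h = 0" for w
    using eigen_orth[OF d_monf[of w] 0] by (cases "w = []") (auto simp: ip.zerol)
  then show "y \<in> n_minus K \<Longrightarrow> ip y h = 0"
    using clinear_eq_on_span[OF ip.lin_l clinear_zero_fun, of y "range (mon f)" h] by (auto simp: n_minus_mons mons_def)
qed

lemma ip_n_n: "x \<in> n_plus K \<Longrightarrow> y \<in> n_plus K \<Longrightarrow> ip x y = 0"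
proof -
  have 1: "ip (mon e w) (mon e u) = 0" for w u
  proof (cases "w = []")
    case False
    then have "of_nat (length w) + of_nat (length u) \<noteq> (0::complex)"
      by (metis add_is_0 length_0_conv of_nat_add of_nat_eq_0_iff)
    then show ?thesis using eigen_orth[OF d_mon[of w] d_mon[of u]] by auto
  qed (simp add: ip.zerol)
  have 2: "ip (mon e w) y = 0" if "y \<in> n_plus K" for w y
    using clinear_eq_on_span[OF ip.lin_r clinear_zero_fun, of y "range (mon e)" "mon e w"] that 1
    by (auto simp: n_plus_mons mons_def)
  assume "x \<in> n_plus K" "y \<in> n_plus K"
  then show ?thesis
    using clinear_eq_on_span[OF ip.lin_l clinear_zero_fun, of x "range (mon e)" y] 2
    by (auto simp: n_plus_mons mons_def)
qed

lemma ip_n_n': "x \<in> n_minus K \<Longrightarrow> y \<in> n_minus K \<Longrightarrow> ip x y = 0"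
proof -
  have 1: "ip (mon f w) (mon f u) = 0" for w u
  proof (cases "w = []")
    case False
    then have "of_nat (length w) + of_nat (length u) \<noteq> (0::complex)"
      by (metis add_is_0 length_0_conv of_nat_add of_nat_eq_0_iff)
    then have "- of_nat (length w) + - of_nat (length u) \<noteq> (0::complex)"
      by (metis add.inverse_distrib_swap add.commute neg_equal_0_iff_equal)
    then show ?thesis using eigen_orth[OF d_monf[of w] d_monf[of u]] by auto
  qed (simp add: ip.zerol)
  have 2: "ip (mon f w) y = 0" if "y \<in> n_minus K" for w y
    using clinear_eq_on_span[OF ip.lin_r clinear_zero_fun, of y "range (mon f)" "mon f w"] that 1
    by (auto simp: n_minus_mons mons_def)
  assume "x \<in> n_minus K" "y \<in> n_minus K"
  then show ?thesis
    using clinear_eq_on_span[OF ip.lin_l clinear_zero_fun, of x "range (mon f)" y] 2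
    by (auto simp: n_minus_mons mons_def)
qed

lemma H_nondeg: "x \<in> H \<Longrightarrow> (\<And>y. y \<in> H \<Longrightarrow> ip x y = 0) \<Longrightarrow> x = 0"
proof (rule ip_nondeg)
  fix z assume x: "x \<in> H" "\<And>y. y \<in> H \<Longrightarrow> ip x y = 0"
  obtain y h u where "z = y + h + u" "y \<in> n_minus K" "h \<in> H" "u \<in> n_plus K" by (rule tri_cases)
  then show "ip x z = 0" using x ip_n_H[of _ x] by (simp add: ip.addr ip_sym[of x])
qed

lemma H_eq: "x \<in> H \<Longrightarrow> y \<in> H \<Longrightarrow> (\<And>h. h \<in> H \<Longrightarrow> ip x h = ip y h) \<Longrightarrow> x = y"
  using H_nondeg[of "x - y"] cvec.subspace_diff[OF H(1)] by (simp add: ip.diffl)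

text \<open>Pairing with \<open>H\<close> sees only \<open>h\<close>. Then \<open>x = - y\<close>
  lies in both nilpotent parts, each of which is isotropic and orthogonal to \<open>H\<close>, so it
  is orthogonal to everything.\<close>

lemma tri_direct:
  assumes "y + h + x = 0" "y \<in> n_minus K" "h \<in> H" "x \<in> n_plus K"
  shows "y = 0" "h = 0" "x = 0"
proof -
  have "ip h z = 0" if "z \<in> H" for z
  proof -
    have "ip (y + h + x) z = 0" by (simp only: assms(1) ip.zerol)
    then show ?thesis using ip_n_H(1)[OF assms(4) that] ip_n_H(2)[OF assms(2) that] by (simp add: ip.addl)
  qed
  then show h: "h = 0" by (rule H_nondeg[OF assms(3)])
  have xy: "x = - y" using assms(1) h by (simp add: eq_neg_iff_add_eq_0 add.commute)
  have "x = 0"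
  proof (rule ip_nondeg)
    fix z
    obtain y' h' x' where z: "z = y' + h' + x'" "y' \<in> n_minus K" "h' \<in> H" "x' \<in> n_plus K" by (rule tri_cases)
    have "ip x y' = - ip y y'" by (simp add: xy ip.minusl)
    then show "ip x z = 0" using z assms ip_n_H ip_n_n ip_n_n' by (simp add: ip.addr)
  qed
  then show "x = 0" "y = 0" using xy by auto
qed

text \<open>Otherwise \<open>ip_coroot\<close> would make the coroot orthogonal to \<open>H\<close>,
  hence zero, although the simple root takes the value 2 on it.\<close>

lemma ef_nz: "ip (e i) (f i) \<noteq> 0"
proof
  assume "ip (e i) (f i) = 0"
  then have "coroot K i = 0" using H_nondeg[OF H(2)] ip_coroot by simp
  then have "sroot K i (coroot K i) = 0" using sroot_scale[of 0 i 0] cvec.subspace_0[OF H(1)] by simp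
  then show False using sroot_coroot[of i i] gcmK by (simp add: generalized_cartan_matrix_def)
qed

text \<open>Makes the identification of the Cartan subalgebra with its dual explicit: a simple root
  is a rescaled coroot, and the normalization of \<open>f_simple\<close> is such that it coincides
  with \<open>h_simple\<close> (\<open>h_simple_al\<close>). From here on simple roots are handled
  as elements of \<open>H\<close>.\<close>

lemma simple_coroot: "al i = (1 / ip (e i) (f i)) *\<^sub>C coroot K i"
  unfolding simple_def
proof (rule the_equality)
  show *: "(1 / ip (e i) (f i)) *\<^sub>C coroot K i \<in> H \<and> (\<forall>x\<in>H. ip ((1 / ip (e i) (f i)) *\<^sub>C coroot K i) x = sroot K i x)"
    using ef_nz[of i] by (auto simp: ip.scalel ip_coroot scaleC_complex_def H cvec.subspace_scale)
  show "a = (1 / ip (e i) (f i)) *\<^sub>C coroot K i" if "a \<in> H \<and> (\<forall>x\<in>H. ip a x = sroot K i x)" for a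
    using that * by (intro H_eq) auto
qed

lemma al_in: "al i \<in> H"
  by (simp add: simple_coroot H cvec.subspace_scale)

lemma sroot_al: "h \<in> H \<Longrightarrow> sroot K i h = ip (al i) h"
  using ef_nz[of i] by (simp add: simple_coroot ip.scalel ip_coroot scaleC_complex_def)

lemma coroot_al: "coroot K i = ip (e i) (f i) *\<^sub>C al i"
  using ef_nz[of i] by (simp add: simple_coroot)

lemma h_simple_al: "h_simple K i = al i"
  by (simp add: h_simple_def f_simple_def scaler ef simple_coroot)

lemma ip_al_d: "ip (al i) d = 1" using sroot_al[OF d_in] sroot_d by simp

lemma e_fs: "br (e i) (f_simple K j) = (if i = j then al i else 0)"
  by (simp add: f_simple_def scaler ef simple_coroot)

lemma ip_e_fs: "ip (e i) (f_simple K j) = (if i = j then 1 else 0)"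
proof (cases "i = j")
  case False
  obtain h where h: "h \<in> H" "\<And>k. sroot K k h = (if k = i then 1 else 0)" using dual_element[of "\<lambda>k. if k = i then 1 else 0"] by auto
  have "ip (e i) (f j) = 0" using eigen_orth[OF he[OF h(1), of i] hf[OF h(1), of j]] False h(2) by auto
  then show ?thesis using False by (simp add: f_simple_def ip.scaler)
qed (simp add: f_simple_def ip.scaler ef_nz scaleC_complex_def)

lemma norm_al: "ip (al i) (al i) * ip (e i) (f i) = 2"
proof -
  have "ip (al i) (coroot K i) = 2" using sroot_al[OF H(2)[of i], of i] sroot_coroot[of i i] gcmK by (simp add: generalized_cartan_matrix_def)
  then show ?thesis by (simp add: coroot_al ip.scaler scaleC_complex_def mult.commute)
qed

text \<open>The value 1 on coroots becomes half of the squared length after the rescaling. In this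
  form \<rho> enters the Casimir computation.\<close>

lemma rho_al: "is_rho K \<rho> \<Longrightarrow> 2 * ip \<rho> (al i) = ip (al i) (al i)"
proof -
  assume "is_rho K \<rho>"
  then have "ip \<rho> (coroot K i) = 1" by (simp add: is_rho_def)
  then have "ip \<rho> (al i) * ip (e i) (f i) = 1" by (simp add: coroot_al ip.scaler scaleC_complex_def mult.commute)
  then have "(2 * ip \<rho> (al i)) * ip (e i) (f i) = ip (al i) (al i) * ip (e i) (f i)" using norm_al[of i] by simp
  then show ?thesis using ef_nz[of i] by (simp only: mult_cancel_right) auto
qed

section \<open>The cone of nonnegative integral combinations of simple roots, and heights\<close>

lemma comb_in: "comb K n \<in> H"
  unfolding comb_def by (intro cvec.subspace_sum cvec.subspace_scale H(1) al_in)

lemma ip_comb: "ip (comb K n) h = (\<Sum>i\<in>UNIV. of_nat (n i) * ip (al i) h)"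
  by (simp add: comb_def ip.suml ip.scalel scaleC_complex_def)

lemma ht_comb: "ip (comb K n) d = of_nat (\<Sum>i\<in>UNIV. n i)"
  by (simp add: ip_comb ip_al_d)

lemma al_comb: "al i = comb K (\<lambda>j. if j = i then 1 else 0)"
  by (simp add: comb_def if_distrib[of of_nat] if_distrib[of "\<lambda>x. x *\<^sub>C _"] cong: if_cong)

lemma comb_add: "comb K m + comb K n = comb K (\<lambda>i. m i + n i)"
  by (simp add: comb_def scaleC_add_left sum.distrib)

lemma Q_add: "x \<in> Q_plus K \<Longrightarrow> y \<in> Q_plus K \<Longrightarrow> x + y \<in> Q_plus K"
  by (auto simp: Q_plus_def comb_add)

lemma Q_0: "0 \<in> Q_plus K" by (auto simp: Q_plus_def comb_def intro!: image_eqI[of _ _ "\<lambda>_. 0"])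
lemma Q_al: "al i \<in> Q_plus K" by (auto simp: Q_plus_def al_comb)
lemma Q_in: "x \<in> Q_plus K \<Longrightarrow> x \<in> H" by (auto simp: Q_plus_def comb_in)
lemma Q_sum_list: "(\<Sum>i\<leftarrow>w. al i) \<in> Q_plus K" by (induction w) (auto simp: Q_0 Q_add Q_al)

definition ht where "ht \<alpha> = (THE n. ip \<alpha> d = of_nat n)"

lemma ht: "x \<in> Q_plus K \<Longrightarrow> ip x d = of_nat (ht x)"
proof -
  assume "x \<in> Q_plus K"
  then obtain n where "ip x d = of_nat n" unfolding Q_plus_def using ht_comb by blast
  then show ?thesis unfolding ht_def by (intro theI'[of "\<lambda>n. ip x d = of_nat n"]) auto
qed

lemma ht_unique: "ip x d = of_nat n \<Longrightarrow> ht x = n" unfolding ht_def by auto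

lemma Q_ht_finite: "finite {x \<in> Q_plus K. ht x \<le> N}"
proof -
  have "{x \<in> Q_plus K. ht x \<le> N} \<subseteq> comb K ` (PiE UNIV (\<lambda>_. {..N}))"
  proof
    fix x assume "x \<in> {x \<in> Q_plus K. ht x \<le> N}"
    then obtain n where n: "x = comb K n" "ht x \<le> N" by (auto simp: Q_plus_def)
    have "(\<Sum>i\<in>UNIV. n i) \<le> N" using n ht_unique[of x, OF trans[OF _ ht_comb]] by simp
    moreover have "n i \<le> (\<Sum>i\<in>UNIV. n i)" for i by (rule member_le_sum) auto
    ultimately show "x \<in> comb K ` (PiE UNIV (\<lambda>_. {..N}))" using n(1) by (intro image_eqI[of _ _ n]) (auto simp: PiE_def intro: le_trans)
  qed
  then show ?thesis by (rule finite_subset) (simp add: finite_PiE)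
qed

lemma Q_ht_0: "x \<in> Q_plus K \<Longrightarrow> ht x = 0 \<Longrightarrow> x = 0"
proof -
  assume x: "x \<in> Q_plus K" "ht x = 0"
  then obtain n where n: "x = comb K n" by (auto simp: Q_plus_def)
  then have "(\<Sum>i\<in>UNIV. n i) = 0" using x(2) ht_unique[of x, OF trans[OF _ ht_comb]] by simp
  then show ?thesis using n by (simp add: comb_def)
qed

lemma sum_list_al: "h \<in> H \<Longrightarrow> (\<Sum>i\<leftarrow>w. sroot K i h) = ip (\<Sum>i\<leftarrow>w. al i) h"
  by (induction w) (auto simp: ip.zerol ip.addl sroot_al)

text \<open>The bracket has degree 0, so it lies in \<open>H\<close> by \<open>degree_0\<close> and
  is determined by its pairings with \<open>H\<close>, which invariance of the form reduces to the
  weight of \<open>x\<close>.\<close>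

lemma centralize_pairing:
  assumes "x \<in> root_space K \<alpha>" "\<alpha> \<in> H" "br d (br z x) = 0"
  shows "br z x = (- ip z x) *\<^sub>C \<alpha>"
proof (rule H_eq)
  show "br z x \<in> H" using degree_0 assms(3) by blast
  show "(- ip z x) *\<^sub>C \<alpha> \<in> H" using assms(2) H(1) cvec.subspace_scale by blast
  fix h assume h: "h \<in> H"
  have "ip (br z x) h = ip z (br x h)" by (rule ip_inv)
  also have "br x h = - (ip \<alpha> h *\<^sub>C x)" using assms(1) h anti[of x h] by (simp add: root_space_def)
  finally show "ip (br z x) h = ip ((- ip z x) *\<^sub>C \<alpha>) h" by (simp add: ip.bisimps scaleC_complex_def)
qed

end

lemma clinear_span_subspace:
  assumes "clinear f" "x \<in> cvec.span S" "cvec.subspace U" "\<And>s. s \<in> S \<Longrightarrow> f s \<in> U"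
  shows "f x \<in> U"
  using clinear_span_image[OF assms(1,2), of U] assms(3,4) by (simp add: cvec.span_eq_iff[THEN iffD2])

section \<open>The Chevalley involution\<close>

instantiation prod :: (complex_vec, complex_vec) complex_vec
begin
definition scaleC_prod :: "complex \<Rightarrow> 'a \<times> 'b \<Rightarrow> 'a \<times> 'b"
  where "scaleC_prod c p = (c *\<^sub>C fst p, c *\<^sub>C snd p)"
instance
  by standard (simp_all add: scaleC_prod_def prod_eq_iff scaleC_add_right scaleC_add_left scaleC_scaleC scaleC_one)
end

lemma fst_scaleC [simp]: "fst (c *\<^sub>C p) = c *\<^sub>C fst p" and snd_scaleC [simp]: "snd (c *\<^sub>C p) = c *\<^sub>C snd p"
  by (simp_all add: scaleC_prod_def)

context km begin

lemma km_induct [case_names H e f add scale br]: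
  assumes "\<And>h. h \<in> H \<Longrightarrow> P h" "\<And>i. P (e i)" "\<And>i. P (f i)"
    and "\<And>x y. P x \<Longrightarrow> P y \<Longrightarrow> P (x + y)" "\<And>c x. P x \<Longrightarrow> P (c *\<^sub>C x)"
    and "\<And>x y. P x \<Longrightarrow> P y \<Longrightarrow> P (br x y)"
  shows "P x"
proof -
  have "subalg {x. P x}"
    using assms(1)[OF cvec.subspace_0[OF H(1)]] assms(4-6) by (auto simp: subalg_def cvec.subspace_def)
  then have "gen (H \<union> range e \<union> range f) \<subseteq> {x. P x}"
    by (rule gen_least) (use assms(1-3) in auto)
  moreover have "gen (H \<union> range e \<union> range f) = UNIV"
    using kac by (simp add: kac_moody_algebra_def lie_generated_gen)
  ultimately show ?thesis by auto
qed

text \<open>The Chevalley involution is constructed through its graph, the subalgebra of the square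
  of the algebra generated by the pairs of a generator and its prospective image. The task is to
  show that this subalgebra is the graph of a function.\<close>

definition br2 :: "'g \<times> 'g \<Rightarrow> 'g \<times> 'g \<Rightarrow> 'g \<times> 'g" where "br2 p q = (br (fst p) (fst q), br (snd p) (snd q))"
definition e2 :: "'i \<Rightarrow> 'g \<times> 'g" where "e2 i = (e i, - f i)"
definition f2 :: "'i \<Rightarrow> 'g \<times> 'g" where "f2 i = (f i, - e i)"
definition H2 :: "('g \<times> 'g) set" where "H2 = (\<lambda>h. (h, - h)) ` H"

lemma chev2: "chev br2 e2 f2 (\<lambda>i. (coroot K i, - coroot K i)) H2 (\<lambda>i p. sroot K i (fst p))"
proof unfold_locales
  show "cbilinear br2"
    unfolding cbilinear_def
    by (intro conjI allI clinearI) (simp_all add: br2_def bisimps prod_eq_iff)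
  show "br2 x x = 0" for x by (simp add: br2_def alt prod_eq_iff)
  show "br2 x (br2 y z) + br2 y (br2 z x) + br2 z (br2 x y) = 0" for x y z
    by (simp add: br2_def jacobi prod_eq_iff)
  show "cvec.subspace H2"
    unfolding cvec.subspace_def
  proof (intro conjI ballI allI)
    show "0 \<in> H2" using cvec.subspace_0[OF H(1)] by (force simp: H2_def prod_eq_iff)
    show "x + y \<in> H2" if "x \<in> H2" "y \<in> H2" for x y
      using that cvec.subspace_add[OF H(1)] by (fastforce simp: H2_def)
    show "c *\<^sub>C x \<in> H2" if "x \<in> H2" for c x
      using that cvec.subspace_scale[OF H(1)] by (fastforce simp: H2_def scaleC_prod_def)
  qed
  show "(coroot K i, - coroot K i) \<in> H2" for i using H(2)[of i] by (auto simp: H2_def)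
  show "br2 x y = 0" if "x \<in> H2" "y \<in> H2" for x y
    using that H(3) by (auto simp: H2_def br2_def bisimps prod_eq_iff)
  show "br2 (e2 i) (f2 j) = (if i = j then (coroot K i, - coroot K i) else 0)" for i j
    using ef[of i j] ef[of j i] anti[of "f i" "e j"] by (auto simp: br2_def e2_def f2_def bisimps prod_eq_iff)
  show "br2 x (e2 i) = sroot K i (fst x) *\<^sub>C e2 i" if "x \<in> H2" for x i
    using that he hf by (auto simp: H2_def br2_def e2_def bisimps prod_eq_iff)
  show "br2 x (f2 i) = - sroot K i (fst x) *\<^sub>C f2 i" if "x \<in> H2" for x i
    using that he hf by (auto simp: H2_def br2_def f2_def bisimps prod_eq_iff)
qed

interpretation p2: chev br2 e2 f2 "\<lambda>i. (coroot K i, - coroot K i)" H2 "\<lambda>i p. sroot K i (fst p)"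
  by (rule chev2)

lemma H_neg: "h \<in> H \<Longrightarrow> - h \<in> H" by (rule cvec.subspace_neg[OF H(1)])

definition chvG :: "('g \<times> 'g) set" where "chvG = p2.gen (H2 \<union> range e2 \<union> range f2)"

lemma chvG_sub: "cvec.subspace chvG" and chvG_br: "(x, y) \<in> chvG \<Longrightarrow> (x', y') \<in> chvG \<Longrightarrow> (br x x', br y y') \<in> chvG"
  and chvG_gens: "h \<in> H \<Longrightarrow> (h, - h) \<in> chvG" "(e i, - f i) \<in> chvG" "(f i, - e i) \<in> chvG"
proof -
  have *: "p2.subalg chvG" "H2 \<union> range e2 \<union> range f2 \<subseteq> chvG"
    unfolding chvG_def by (rule p2.subalg_gen p2.gen_base)+
  then show "cvec.subspace chvG" by (simp add: p2.subalg_def)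
  show "(x, y) \<in> chvG \<Longrightarrow> (x', y') \<in> chvG \<Longrightarrow> (br x x', br y y') \<in> chvG"
    using * by (force simp: p2.subalg_def br2_def)
  have "e2 i \<in> chvG" "f2 i \<in> chvG" "h \<in> H \<Longrightarrow> (h, - h) \<in> chvG"
    using *(2) unfolding H2_def by blast+
  then show "h \<in> H \<Longrightarrow> (h, - h) \<in> chvG" "(e i, - f i) \<in> chvG" "(f i, - e i) \<in> chvG"
    by (simp_all add: e2_def f2_def)
qed

lemma clinear_fst: "clinear fst" and clinear_snd: "clinear snd"
  by (intro clinearI; simp)+

lemma e2_f2_simps: "fst (e2 i) = e i" "snd (e2 i) = - f i" "fst (f2 i) = f i" "snd (f2 i) = - e i"
    "fst (br2 p q) = br (fst p) (fst q)" "snd (br2 p q) = br (snd p) (snd q)"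
  by (simp_all add: e2_def f2_def br2_def)

lemma p2_mons:
  "p \<in> p2.mons e2 \<Longrightarrow> fst p \<in> n_plus K \<and> snd p \<in> n_minus K"
  "p \<in> p2.mons f2 \<Longrightarrow> fst p \<in> n_minus K \<and> snd p \<in> n_plus K"
proof -
  have e: "fst (p2.mon e2 w) \<in> n_plus K \<and> snd (p2.mon e2 w) \<in> n_minus K" for w
    by (induction w rule: induct_list012)
      (auto simp: e2_f2_simps e_n_plus f_n_minus cvec.subspace_0 subspace_n_plus subspace_n_minus
        intro!: n_plus_br n_minus_br cvec.subspace_neg)
  have f: "fst (p2.mon f2 w) \<in> n_minus K \<and> snd (p2.mon f2 w) \<in> n_plus K" for w
    by (induction w rule: induct_list012)
      (auto simp: e2_f2_simps e_n_plus f_n_minus cvec.subspace_0 subspace_n_plus subspace_n_minus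
        intro!: n_plus_br n_minus_br cvec.subspace_neg)
  show "fst p \<in> n_plus K \<and> snd p \<in> n_minus K" if "p \<in> p2.mons e2"
    using that clinear_span_subspace[OF clinear_fst _ subspace_n_plus] clinear_span_subspace[OF clinear_snd _ subspace_n_minus] e
    unfolding p2.mons_def by blast
  show "fst p \<in> n_minus K \<and> snd p \<in> n_plus K" if "p \<in> p2.mons f2"
    using that clinear_span_subspace[OF clinear_fst _ subspace_n_minus] clinear_span_subspace[OF clinear_snd _ subspace_n_plus] f
    unfolding p2.mons_def by blast
qed

lemma chvG_total: "\<exists>y. (x, y) \<in> chvG" and chvG_onto: "\<exists>x. (x, y) \<in> chvG"
proof -
  show "\<exists>y. (x, y) \<in> chvG"
  proof (induction x rule: km_induct)
    case (add x y) then show ?case using cvec.subspace_add[OF chvG_sub] by fastforce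
  next
    case (scale c x) then show ?case using cvec.subspace_scale[OF chvG_sub, of _ c] by (force simp: scaleC_prod_def)
  qed (use chvG_gens chvG_br in blast)+
  show "\<exists>x. (x, y) \<in> chvG"
  proof (induction y rule: km_induct)
    case (H h) then have "- h \<in> cart K" by (rule H_neg) then show ?case using chvG_gens(1)[of "- h"] by auto
  next
    case (e i) then show ?case using cvec.subspace_neg[OF chvG_sub chvG_gens(3)[of i]] by auto
  next
    case (f i) then show ?case using cvec.subspace_neg[OF chvG_sub chvG_gens(2)[of i]] by auto
  next
    case (add x y) then show ?case using cvec.subspace_add[OF chvG_sub] by fastforce
  next
    case (scale c x) then show ?case using cvec.subspace_scale[OF chvG_sub, of _ c] by (force simp: scaleC_prod_def)
  qed (use chvG_br in blast)
qed

text \<open>The elements paired with 0 form an ideal, because the second projection of the graph is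
  onto. The graph satisfies the Chevalley relations and so has its own triangular decomposition;
  comparing it with that of the algebra in both coordinates shows that the ideal meets
  \<open>H\<close> only in 0. Kac's condition then makes it vanish.\<close>

lemma chvG_0: "(0, y) \<in> chvG \<Longrightarrow> y = 0"
proof -
  define J where "J = {y. (0, y) \<in> chvG}"
  have "lie_ideal K J"
    unfolding lie_ideal_def
  proof (intro conjI allI ballI)
    show "cvec.subspace J"
      unfolding cvec.subspace_def J_def
      using cvec.subspace_0[OF chvG_sub] cvec.subspace_add[OF chvG_sub, of "(0, _)" "(0, _)"]
        cvec.subspace_scale[OF chvG_sub, of "(0, _)"]
      by (simp add: zero_prod_def scaleC_prod_def)
    show "br x y \<in> J" if y: "y \<in> J" for x y
    proof -
      obtain z where "(z, x) \<in> chvG" using chvG_onto by blast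
      from chvG_br[OF this, of 0 y] y show ?thesis by (simp add: J_def zeror)
    qed
  qed
  moreover have "J \<inter> H = {0}"
  proof
    show "{0} \<subseteq> J \<inter> H" using cvec.subspace_0[OF chvG_sub] cvec.subspace_0[OF H(1)] by (auto simp: J_def zero_prod_def)
    show "J \<inter> H \<subseteq> {0}"
    proof
      fix y assume "y \<in> J \<inter> H"
      then have "(0, y) \<in> p2.tri" and yH: "y \<in> H" using p2.gen_tri by (auto simp: J_def chvG_def)
      then obtain a b c where abc: "(0, y) = a + b + c" "a \<in> p2.mons f2" "b \<in> H2" "c \<in> p2.mons e2"
        by (auto simp: p2.tri_def)
      then obtain h where h: "b = (h, - h)" "h \<in> H" by (auto simp: H2_def)
      have "fst a + h + fst c = 0" using abc(1) h by (metis fst_add fst_conv)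
      then have h0: "h = 0" using tri_direct(2) p2_mons abc h by blast
      have "y = snd a + (- h) + snd c" using abc(1) h by (metis snd_add snd_conv)
      then have "snd c + (- y) + snd a = 0" using h0 by simp
      then have "- y = 0" using tri_direct(2)[of "snd c" "- y" "snd a"] p2_mons abc yH cvec.subspace_neg[OF H(1)] by blast
      then show "y \<in> {0}" by simp
    qed
  qed
  ultimately have "J = {0}" using kac by (simp add: kac_moody_algebra_def)
  then show "(0, y) \<in> chvG \<Longrightarrow> y = 0" by (auto simp: J_def)
qed

definition chv :: "'g \<Rightarrow> 'g" where "chv x = (THE y. (x, y) \<in> chvG)"

lemma chv_eq: "(x, y) \<in> chvG \<Longrightarrow> chv x = y"
  unfolding chv_def
proof (rule the_equality)
  fix z assume "(x, y) \<in> chvG" "(x, z) \<in> chvG"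
  then have "(x, z) - (x, y) \<in> chvG" by (intro cvec.subspace_diff[OF chvG_sub])
  then show "z = y" using chvG_0[of "z - y"] by simp
qed

lemma chv_G: "(x, chv x) \<in> chvG"
  using chvG_total chv_eq by metis

lemma chv_e: "chv (e i) = - f i" and chv_f: "chv (f i) = - e i" and chv_H: "h \<in> H \<Longrightarrow> chv h = - h"
  using chv_eq chvG_gens by auto

lemma chv_br: "chv (br x y) = br (chv x) (chv y)"
  by (intro chv_eq chvG_br chv_G)

lemma chv_lin: "clinear chv"
proof (rule clinearI)
  show "chv (x + y) = chv x + chv y" for x y
    using cvec.subspace_add[OF chvG_sub chv_G[of x] chv_G[of y]] by (auto intro: chv_eq)
  show "chv (c *\<^sub>C x) = c *\<^sub>C chv x" for c x
    using cvec.subspace_scale[OF chvG_sub chv_G[of x], of c] by (auto intro: chv_eq simp: scaleC_prod_def)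
qed

lemma chv_chv: "chv (chv x) = x"
  by (induction x rule: km_induct)
    (simp_all add: chv_e chv_f chv_H chv_br clinear_minus[OF chv_lin] clinear_add[OF chv_lin] clinear_scale[OF chv_lin])

end

section \<open>Verma modules are free over the enveloping algebra of the lower part\<close>

text \<open>Linear extension of a map on words to the free algebra. The sum runs over the support,
  hence additivity holds for finitely supported functions only.\<close>

definition flin :: "('a list \<Rightarrow> 'x::complex_vec) \<Rightarrow> ('a list \<Rightarrow> complex) \<Rightarrow> 'x"
  where "flin a p = (\<Sum>w | p w \<noteq> 0. p w *\<^sub>C a w)"

definition words_on :: "'a set \<Rightarrow> ('a list \<Rightarrow> complex) set"
  where "words_on N = cvec.span (word ` lists N)"

lemma flin_superset: "finite A \<Longrightarrow> {w. p w \<noteq> 0} \<subseteq> A \<Longrightarrow> flin a p = (\<Sum>w\<in>A. p w *\<^sub>C a w)"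
  unfolding flin_def by (rule sum.mono_neutral_left) auto

lemma flin_add: "p \<in> free_alg \<Longrightarrow> q \<in> free_alg \<Longrightarrow> flin a (p + q) = flin a p + flin a q"
proof -
  assume "p \<in> free_alg" "q \<in> free_alg"
  then have f: "finite ({w. p w \<noteq> 0} \<union> {w. q w \<noteq> 0})" (is "finite ?A") by (simp add: free_alg_def)
  show ?thesis
    by (subst (1 2 3) flin_superset[OF f]) (auto simp: scaleC_add_left sum.distrib)
qed

lemma flin_scale: "p \<in> free_alg \<Longrightarrow> flin a (c *\<^sub>C p) = c *\<^sub>C flin a p"
proof -
  assume "p \<in> free_alg"
  then have f: "finite {w. p w \<noteq> 0}" (is "finite ?A") by (simp add: free_alg_def)
  show ?thesis
    by (subst (1 2) flin_superset[OF f]) (auto simp: scaleC_fun_def scaleC_complex_def cvec.scale_sum_right)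
qed

lemma flin_word: "flin a (word w) = a w"
  by (subst flin_superset[of "{w}"]) (auto simp: word_def)

lemma subspace_free_alg: "cvec.subspace free_alg"
  unfolding cvec.subspace_def free_alg_def
proof (safe, goal_cases)
  case (2 p q)
  then show ?case by (auto intro: finite_subset[of _ "{w. p w \<noteq> 0} \<union> {w. q w \<noteq> 0}"])
next
  case (3 c p) then show ?case by (auto intro: finite_subset[of _ "{w. p w \<noteq> 0}"] simp: scaleC_fun_def scaleC_complex_def)
qed simp

lemma word_free: "word w \<in> free_alg" by (simp add: word_def free_alg_def)

lemma words_on_free: "words_on N \<subseteq> free_alg"
  unfolding words_on_def by (rule cvec.span_minimal) (auto simp: word_free subspace_free_alg)

lemma subspace_words_on: "cvec.subspace (words_on N)" by (simp add: words_on_def)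

lemma word_words_on: "w \<in> lists N \<Longrightarrow> word w \<in> words_on N"
  by (auto simp: words_on_def intro: cvec.span_base)

lemma flin_diff: "p \<in> free_alg \<Longrightarrow> q \<in> free_alg \<Longrightarrow> flin a (p - q) = flin a p - flin a q"
  using flin_add[of p "(-1) *\<^sub>C q" a] flin_scale[of q a "-1"] cvec.subspace_neg[OF subspace_free_alg, of q]
  by (simp add: diff_conv_add_uminus del: add_uminus_conv_diff)

lemma flin_span_subspace:
  assumes "p \<in> cvec.span S" "S \<subseteq> free_alg" "cvec.subspace U" "\<And>s. s \<in> S \<Longrightarrow> flin a s \<in> U"
  shows "flin a p \<in> U"
proof -
  have "p \<in> free_alg \<and> flin a p \<in> U"
    using assms(1)
  proof (induction rule: cvec.span_induct_alt)
    case base show ?case using cvec.subspace_0[OF assms(3)] cvec.subspace_0[OF subspace_free_alg] by (simp add: flin_def zero_fun_def)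
  next
    case (step c x y)
    moreover have "x \<in> free_alg" using step assms(2) by auto
    moreover have "c *\<^sub>C x \<in> free_alg" using \<open>x \<in> free_alg\<close> subspace_free_alg cvec.subspace_scale by blast
    ultimately have "c *\<^sub>C x + y \<in> free_alg" "flin a (c *\<^sub>C x + y) = c *\<^sub>C flin a x + flin a y"
      using step cvec.subspace_add[OF subspace_free_alg] by (blast, simp only: flin_add flin_scale)
    then show ?case using step assms(3,4) cvec.subspace_add cvec.subspace_scale by metis
  qed
  then show ?thesis ..
qed

text \<open>Left multiplication by the letter \<open>y\<close> in the free algebra.\<close>

definition prep :: "'a \<Rightarrow> ('a list \<Rightarrow> complex) \<Rightarrow> 'a list \<Rightarrow> complex"
  where "prep y p = (\<lambda>l. case l of [] \<Rightarrow> 0 | z # l' \<Rightarrow> if z = y then p l' else 0)"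

lemma prep_lin: "clinear (prep y)"
  by (intro clinearI) (auto simp: prep_def fun_eq_iff scaleC_fun_def scaleC_complex_def split: list.splits)

lemma prep_word: "prep y (word w) = word (y # w)"
  by (auto simp: prep_def word_def fun_eq_iff split: list.splits)

lemma preps_lin: "clinear (foldr prep u)"
proof (induction u)
  case Nil show ?case by (intro clinearI) (simp_all add: fun_eq_iff)
next
  case (Cons y u) then show ?case using clinear_compose[OF Cons prep_lin] by (simp add: comp_def)
qed

lemmas preps_simps = clinear_add[OF preps_lin] clinear_diff[OF preps_lin] clinear_scale[OF preps_lin]
lemmas prep_simps = clinear_add[OF prep_lin] clinear_diff[OF prep_lin] clinear_scale[OF prep_lin] clinear_zero[OF prep_lin]
  clinear_minus[OF prep_lin]

section \<open>The module induced from the Borel subalgebra, realized on words over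
  \<open>n_minus\<close>\<close>

locale verma_weight = km K for K :: "('g::complex_vec, 'i::finite, 'z) km_algebra_scheme" +
  fixes om :: 'g
  assumes om: "om \<in> cart K"
begin

abbreviation "N \<equiv> n_minus K"

definition pm :: "'g \<Rightarrow> 'g" where "pm x = (THE y. y \<in> N \<and> (\<exists>h u. h \<in> H \<and> u \<in> n_plus K \<and> x = y + h + u))"
definition ph :: "'g \<Rightarrow> 'g" where "ph x = (THE h. h \<in> H \<and> (\<exists>y u. y \<in> N \<and> u \<in> n_plus K \<and> x = y + h + u))"

lemma tri_unique:
  assumes "y + h + x = y' + h' + x'" "y \<in> N" "h \<in> H" "x \<in> n_plus K" "y' \<in> N" "h' \<in> H" "x' \<in> n_plus K"
  shows "y = y'" "h = h'"
proof -
  have "(y - y') + (h - h') + (x - x') = 0" using assms(1) by (simp add: algebra_simps)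
  from tri_direct[OF this] assms show "y = y'" "h = h'"
    by (auto intro: cvec.subspace_diff subspace_n_plus subspace_n_minus H(1))
qed

lemma pm_ph_eq:
  assumes "y \<in> N" "h \<in> H" "x \<in> n_plus K"
  shows "pm (y + h + x) = y" "ph (y + h + x) = h"
proof -
  show "pm (y + h + x) = y"
    unfolding pm_def
  proof (rule the_equality)
    show "y \<in> N \<and> (\<exists>h' u. h' \<in> H \<and> u \<in> n_plus K \<and> y + h + x = y + h' + u)" using assms by blast
  qed (use tri_unique(1)[OF _ _ _ _ assms] in metis)
  show "ph (y + h + x) = h"
    unfolding ph_def
  proof (rule the_equality)
    show "h \<in> H \<and> (\<exists>y' u. y' \<in> N \<and> u \<in> n_plus K \<and> y + h + x = y' + h + u)" using assms by blast
  qed (use tri_unique(2)[OF _ _ _ _ assms] in metis)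
qed

lemma pm_ph:
  obtains u where "pm x \<in> N" "ph x \<in> H" "u \<in> n_plus K" "x = pm x + ph x + u"
proof -
  obtain y h u where "x = y + h + u" "y \<in> N" "h \<in> H" "u \<in> n_plus K" by (rule tri_cases)
  then show thesis using that pm_ph_eq by metis
qed

lemma pm_N: "pm x \<in> N"
  by (rule pm_ph)

lemma pm_lin: "clinear pm" and ph_lin: "clinear ph"
proof -
  have 1: "pm (x + y) = pm x + pm y \<and> ph (x + y) = ph x + ph y" for x y
  proof -
    obtain u where u: "pm x \<in> N" "ph x \<in> H" "u \<in> n_plus K" "x = pm x + ph x + u" by (rule pm_ph)
    obtain v where v: "pm y \<in> N" "ph y \<in> H" "v \<in> n_plus K" "y = pm y + ph y + v" by (rule pm_ph)
    have "x + y = (pm x + ph x + u) + (pm y + ph y + v)" by (rule arg_cong2[OF u(4) v(4)])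
    also have "\<dots> = (pm x + pm y) + (ph x + ph y) + (u + v)" by (simp add: algebra_simps)
    finally show ?thesis
      using pm_ph_eq[of "pm x + pm y" "ph x + ph y" "u + v"] u(1-3) v(1-3)
      by (metis cvec.subspace_add subspace_n_plus subspace_n_minus H(1))
  qed
  have 2: "pm (c *\<^sub>C x) = c *\<^sub>C pm x \<and> ph (c *\<^sub>C x) = c *\<^sub>C ph x" for c x
  proof -
    obtain u where u: "pm x \<in> N" "ph x \<in> H" "u \<in> n_plus K" "x = pm x + ph x + u" by (rule pm_ph)
    have "c *\<^sub>C x = c *\<^sub>C (pm x + ph x + u)" by (rule arg_cong[OF u(4)])
    also have "\<dots> = c *\<^sub>C pm x + c *\<^sub>C ph x + c *\<^sub>C u" by (simp add: scaleC_add_right)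
    finally show ?thesis
      using pm_ph_eq[of "c *\<^sub>C pm x" "c *\<^sub>C ph x" "c *\<^sub>C u"] u(1-3)
      by (metis cvec.subspace_scale subspace_n_plus subspace_n_minus H(1))
  qed
  show "clinear pm" "clinear ph" using 1 2 by (auto intro: clinearI)
qed

lemma pm_id: "y \<in> N \<Longrightarrow> pm y = y" "y \<in> N \<Longrightarrow> ph y = 0"
  using pm_ph_eq[of y 0 0, OF _ cvec.subspace_0[OF H(1)] cvec.subspace_0[OF subspace_n_plus]] by simp_all

lemma pm_borel: "h \<in> H \<Longrightarrow> u \<in> n_plus K \<Longrightarrow> pm (h + u) = 0" "h \<in> H \<Longrightarrow> u \<in> n_plus K \<Longrightarrow> ph (h + u) = h"
  using pm_ph_eq[of 0 h u, OF cvec.subspace_0[OF subspace_n_minus]] by simp_all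

text \<open>The component in the Borel subalgebra \<open>H\<close> plus \<open>n_plus\<close> along
  the triangular decomposition.\<close>

definition bp where "bp x = x - pm x"

lemma bp_simps: "bp (x + y) = bp x + bp y" "bp (c *\<^sub>C x) = c *\<^sub>C bp x"
  by (simp_all add: bp_def clinear_add[OF pm_lin] clinear_scale[OF pm_lin] cvec.scale_right_diff_distrib)

lemma bp_borel: obtains h u where "bp x = h + u" "h \<in> H" "u \<in> n_plus K" "h = ph x"
proof -
  obtain u where u: "pm x \<in> N" "ph x \<in> H" "u \<in> n_plus K" "x = pm x + ph x + u" by (rule pm_ph)
  then show thesis using that[of "ph x" u] by (simp add: bp_def) (metis add_diff_cancel_left' add.assoc)
qed

lemma bp_br_plus: "br (bp x) (bp y) \<in> n_plus K"
proof -
  obtain h u where x: "bp x = h + u" "h \<in> H" "u \<in> n_plus K" by (rule bp_borel)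
  obtain k v where y: "bp y = k + v" "k \<in> H" "v \<in> n_plus K" by (rule bp_borel)
  have "br h v \<in> n_plus K" "br k u \<in> n_plus K" using x y h_mons by (auto simp: n_plus_mons)
  then show ?thesis using x y n_plus_br[of u v] H(3)[of h k] anti[of u k]
    by (auto simp: addl addr intro!: cvec.subspace_add cvec.subspace_diff subspace_n_plus)
qed

text \<open>
  The action of \<open>x\<close> on the module induced from the Borel subalgebra, lifted from the enveloping
  algebra of the lower part to the words on that part.  On the enveloping algebra it is determined
  by \<open>x (y u) = y (x u) + [x, y] u\<close>.
\<close>

primrec ind :: "'g list \<Rightarrow> 'g \<Rightarrow> 'g list \<Rightarrow> complex"
  where "ind [] = (\<lambda>x. word [pm x] + ip om (ph x) *\<^sub>C word [])"
  | "ind (y # w) = (\<lambda>x. word (pm x # y # w) + prep y (ind w (bp x)) + ind w (br (bp x) y))"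

declare ind.simps [simp del]

lemma ind_simps [simp]:
  "ind [] x = word [pm x] + ip om (ph x) *\<^sub>C word []"
  "ind (y # w) x = word (pm x # y # w) + prep y (ind w (bp x)) + ind w (br (bp x) y)"
  by (simp_all add: ind.simps fun_eq_iff)

text \<open>Defining relations of the enveloping algebra of \<open>n_minus\<close>, with all letters
  taken from \<open>n_minus\<close>. Words over \<open>n_minus\<close> modulo their span
  \<open>nI\<close> are this enveloping algebra, and \<open>eqI\<close> below is equality in
  it.\<close>

definition nrels :: "('g list \<Rightarrow> complex) set"
  where "nrels =
    {word (u @ [x + y] @ w) - word (u @ [x] @ w) - word (u @ [y] @ w) | u w x y. u \<in> lists N \<and> w \<in> lists N \<and> x \<in> N \<and> y \<in> N} \<union>
    {word (u @ [c *\<^sub>C x] @ w) - c *\<^sub>C word (u @ [x] @ w) | u w c x. u \<in> lists N \<and> w \<in> lists N \<and> x \<in> N} \<union>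
    {word (u @ [x, y] @ w) - word (u @ [y, x] @ w) - word (u @ [br x y] @ w) | u w x y. u \<in> lists N \<and> w \<in> lists N \<and> x \<in> N \<and> y \<in> N}"

definition nI where "nI = cvec.span nrels"

lemma subspace_nI: "cvec.subspace nI" by (simp add: nI_def)

abbreviation "T0 \<equiv> words_on N"

lemma N_simps: "x \<in> N \<Longrightarrow> y \<in> N \<Longrightarrow> x + y \<in> N" "x \<in> N \<Longrightarrow> c *\<^sub>C x \<in> N" "0 \<in> N"
  by (auto intro: cvec.subspace_add cvec.subspace_scale cvec.subspace_0 subspace_n_minus)

lemma nrels_T0: "nrels \<subseteq> T0"
  unfolding nrels_def
  by (safe; intro cvec.subspace_diff cvec.subspace_scale subspace_words_on word_words_on; simp add: N_simps n_minus_br in_lists_conv_set ball_Un)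

lemma nI_T0: "nI \<subseteq> T0"
  unfolding nI_def by (rule cvec.span_minimal[OF nrels_T0 subspace_words_on])

definition eqI (infix "\<doteq>" 50) where "p \<doteq> q \<longleftrightarrow> p - q \<in> nI"

lemma eqI_refl [simp]: "p \<doteq> p" by (simp add: eqI_def cvec.subspace_0 subspace_nI)
lemma eqI_add: "p \<doteq> q \<Longrightarrow> p' \<doteq> q' \<Longrightarrow> p + p' \<doteq> q + q'"
  unfolding eqI_def add_diff_add by (rule cvec.subspace_add[OF subspace_nI])
lemma eqI_scale: "p \<doteq> q \<Longrightarrow> c *\<^sub>C p \<doteq> c *\<^sub>C q"
  unfolding eqI_def cvec.scale_right_diff_distrib[symmetric] by (rule cvec.subspace_scale[OF subspace_nI])
lemma eqI_sym: "p \<doteq> q \<Longrightarrow> q \<doteq> p"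
  using cvec.subspace_neg[OF subspace_nI, of "p - q"] by (simp add: eqI_def)
lemma eqI_trans [trans]: "p \<doteq> q \<Longrightarrow> q \<doteq> s \<Longrightarrow> p \<doteq> s"
  using cvec.subspace_add[OF subspace_nI, of "p - q" "q - s"] by (simp add: eqI_def)
lemma eqI_eq [trans]: "p \<doteq> q \<Longrightarrow> q = s \<Longrightarrow> p \<doteq> s" "p = q \<Longrightarrow> q \<doteq> s \<Longrightarrow> p \<doteq> s" by auto
lemma eqI_diff: "p \<doteq> q \<Longrightarrow> p' \<doteq> q' \<Longrightarrow> p - p' \<doteq> q - q'"
  using eqI_add[of p q "(-1) *\<^sub>C p'" "(-1) *\<^sub>C q'"] eqI_scale[of p' q' "-1"] by simp
lemma eqI_0: "p \<doteq> 0 \<longleftrightarrow> p \<in> nI" by (simp add: eqI_def)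

lemma preps_word: "foldr prep u (word w) = word (u @ w)"
  by (induction u) (auto simp: prep_word)

lemma nI_rel_add: "u \<in> lists N \<Longrightarrow> w \<in> lists N \<Longrightarrow> x \<in> N \<Longrightarrow> y \<in> N \<Longrightarrow> word (u @ (x + y) # w) \<doteq> word (u @ x # w) + word (u @ y # w)"
  unfolding eqI_def nI_def nrels_def by (rule cvec.span_base) (simp add: diff_diff_eq, blast)
lemma nI_rel_scale: "u \<in> lists N \<Longrightarrow> w \<in> lists N \<Longrightarrow> x \<in> N \<Longrightarrow> word (u @ (c *\<^sub>C x) # w) \<doteq> c *\<^sub>C word (u @ x # w)"
  unfolding eqI_def nI_def nrels_def by (rule cvec.span_base) (simp, blast)
lemma nI_rel_br: "u \<in> lists N \<Longrightarrow> w \<in> lists N \<Longrightarrow> x \<in> N \<Longrightarrow> y \<in> N \<Longrightarrow> word (u @ x # y # w) \<doteq> word (u @ y # x # w) + word (u @ br x y # w)"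
  unfolding eqI_def nI_def nrels_def by (rule cvec.span_base) (simp add: diff_diff_eq, blast)

lemma prep_T0: "y \<in> N \<Longrightarrow> p \<in> T0 \<Longrightarrow> prep y p \<in> T0"
proof (rule clinear_span_subspace[OF prep_lin _ subspace_words_on])
  show "p \<in> T0 \<Longrightarrow> p \<in> cvec.span (word ` lists N)" by (simp add: words_on_def)
  fix s assume y: "y \<in> N" and "s \<in> word ` lists N"
  then obtain w where w: "s = word w" "w \<in> lists N" by blast
  then have "y # w \<in> lists N" using y by simp
  then show "prep y s \<in> T0" unfolding w(1) prep_word by (rule word_words_on)
qed

lemma prep_nI: "y \<in> N \<Longrightarrow> p \<in> nI \<Longrightarrow> prep y p \<in> nI"
  unfolding nI_def
proof (rule clinear_span_image[OF prep_lin])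
  fix s assume y: "y \<in> N" and "s \<in> nrels"
  then have "prep y s \<in> nrels"
    unfolding nrels_def
  proof (elim UnE, goal_cases)
    case 1
    then obtain u w x z where *: "s = word (u @ [x + z] @ w) - word (u @ [x] @ w) - word (u @ [z] @ w)"
      "u \<in> lists N" "w \<in> lists N" "x \<in> N" "z \<in> N" by blast
    then have "prep y s = word ((y # u) @ [x + z] @ w) - word ((y # u) @ [x] @ w) - word ((y # u) @ [z] @ w)" "y # u \<in> lists N"
      using y by (simp_all add: prep_simps prep_word)
    with * show ?case by blast
  next
    case 2
    then obtain u w c x where *: "s = word (u @ [c *\<^sub>C x] @ w) - c *\<^sub>C word (u @ [x] @ w)"
      "u \<in> lists N" "w \<in> lists N" "x \<in> N" by blast
    then have "prep y s = word ((y # u) @ [c *\<^sub>C x] @ w) - c *\<^sub>C word ((y # u) @ [x] @ w)" "y # u \<in> lists N"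
      using y by (simp_all add: prep_simps prep_word)
    with * show ?case by blast
  next
    case 3
    then obtain u w x z where *: "s = word (u @ [x, z] @ w) - word (u @ [z, x] @ w) - word (u @ [br x z] @ w)"
      "u \<in> lists N" "w \<in> lists N" "x \<in> N" "z \<in> N" by blast
    then have "prep y s = word ((y # u) @ [x, z] @ w) - word ((y # u) @ [z, x] @ w) - word ((y # u) @ [br x z] @ w)" "y # u \<in> lists N"
      using y by (simp_all add: prep_simps prep_word)
    with * show ?case by blast
  qed
  then show "prep y s \<in> cvec.span nrels" by (rule cvec.span_base)
qed

lemma eqI_prep: "y \<in> N \<Longrightarrow> p \<doteq> q \<Longrightarrow> prep y p \<doteq> prep y q"
  unfolding eqI_def using prep_nI by (metis clinear_diff prep_lin)

lemma eqI_flin: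
  assumes "p \<in> T0" "\<And>w. w \<in> lists N \<Longrightarrow> F w \<doteq> G w"
  shows "flin F p \<doteq> flin G p"
proof -
  have "flin (\<lambda>w. F w - G w) p \<in> nI"
    by (rule flin_span_subspace[of _ "word ` lists N"])
      (use assms in \<open>auto simp: words_on_def word_free subspace_nI flin_word eqI_def in_lists_conv_set\<close>)
  moreover have "flin (\<lambda>w. F w - G w) p = flin F p - flin G p"
    by (simp add: flin_def cvec.scale_right_diff_distrib sum_subtractf)
  ultimately show ?thesis by (simp add: eqI_def)
qed

lemma flin_prep: "p \<in> T0 \<Longrightarrow> flin (\<lambda>w. F (y # w)) p = flin F (prep y p)"
proof -
  assume "p \<in> T0"
  then have "p \<in> free_alg" using words_on_free by auto
  then have f: "finite {w. p w \<noteq> 0}" by (simp add: free_alg_def)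
  have "flin F (prep y p) = (\<Sum>w\<in>(#) y ` {w. p w \<noteq> 0}. prep y p w *\<^sub>C F w)"
  proof (rule flin_superset)
    show "{w. prep y p w \<noteq> 0} \<subseteq> (#) y ` {w. p w \<noteq> 0}"
    proof
      fix w assume "w \<in> {w. prep y p w \<noteq> 0}"
      then show "w \<in> (#) y ` {w. p w \<noteq> 0}" by (cases w) (auto simp: prep_def split: if_splits)
    qed
  qed (use f in simp)
  also have "\<dots> = flin (\<lambda>w. F (y # w)) p"
    by (subst sum.reindex) (auto simp: prep_def flin_def)
  finally show ?thesis by simp
qed

lemma flin_lin_out: "clinear L \<Longrightarrow> flin (\<lambda>w. L (F w)) p = L (flin F p)"
  by (simp add: flin_def clinear_sum clinear_scale)

lemma flin_add_out: "flin (\<lambda>w. F w + G w) p = flin F p + flin G p"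
  and flin_scale_out: "flin (\<lambda>w. c *\<^sub>C F w) p = c *\<^sub>C flin F p"
  by (simp_all add: flin_def scaleC_add_right sum.distrib cvec.scale_sum_right mult.commute)

lemma flin_id: "p \<in> T0 \<Longrightarrow> flin word p = p"
proof -
  assume "p \<in> T0"
  then have "p \<in> free_alg" using words_on_free by auto
  then have f: "finite {w. p w \<noteq> 0}" by (simp add: free_alg_def)
  show ?thesis
  proof
    fix l
    have "flin word p l = (\<Sum>w | p w \<noteq> 0. if w = l then p l else 0)"
      unfolding flin_def sum_fun_apply by (rule sum.cong) (auto simp: scaleC_fun_def scaleC_complex_def word_def)
    also have "\<dots> = p l" using f by simp
    finally show "flin word p l = p l" .
  qed
qed

lemma prep_add: "p \<in> T0 \<Longrightarrow> x \<in> N \<Longrightarrow> y \<in> N \<Longrightarrow> prep (x + y) p \<doteq> prep x p + prep y p"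
  and prep_scale: "p \<in> T0 \<Longrightarrow> x \<in> N \<Longrightarrow> prep (c *\<^sub>C x) p \<doteq> c *\<^sub>C prep x p"
  and prep_br: "p \<in> T0 \<Longrightarrow> x \<in> N \<Longrightarrow> y \<in> N \<Longrightarrow> prep x (prep y p) \<doteq> prep y (prep x p) + prep (br x y) p"
proof -
  assume p: "p \<in> T0"
  have *: "prep z p = flin (\<lambda>w. word (z # w)) p" for z
    using flin_lin_out[OF prep_lin, of z word p] flin_id[OF p] by (simp add: prep_word)
  have **: "prep x (prep z p) = flin (\<lambda>w. word (x # z # w)) p" for x z
    using flin_lin_out[OF prep_lin, of x "\<lambda>w. word (z # w)" p] by (simp add: prep_word *)
  show "prep (x + y) p \<doteq> prep x p + prep y p" if "x \<in> N" "y \<in> N"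
    unfolding * flin_add_out[symmetric] using nI_rel_add[of "[]"] that by (intro eqI_flin p) simp
  show "prep (c *\<^sub>C x) p \<doteq> c *\<^sub>C prep x p" if "x \<in> N"
    unfolding * flin_scale_out[symmetric] using nI_rel_scale[of "[]"] that by (intro eqI_flin p) simp
  show "prep x (prep y p) \<doteq> prep y (prep x p) + prep (br x y) p" if "x \<in> N" "y \<in> N"
    unfolding ** unfolding * flin_add_out[symmetric] using nI_rel_br[of "[]"] that by (intro eqI_flin p) simp
qed

lemma ind_T0: "w \<in> lists N \<Longrightarrow> ind w x \<in> T0"
proof (induction w arbitrary: x)
  case Nil show ?case unfolding ind_simps
    by (intro cvec.subspace_add cvec.subspace_scale subspace_words_on word_words_on) (simp_all add: pm_N)
next
  case (Cons y w) then show ?case unfolding ind_simps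
    by (intro cvec.subspace_add subspace_words_on word_words_on prep_T0) (simp_all add: pm_N)
qed

lemma ind_add: "w \<in> lists N \<Longrightarrow> ind w (x + y) \<doteq> ind w x + ind w y"
proof (induction w arbitrary: x y)
  case Nil
  have "word [pm x + pm y] \<doteq> word [pm x] + word [pm y]" using nI_rel_add[of "[]" "[]"] pm_N by simp
  then have "word [pm x + pm y] + ip om (ph (x + y)) *\<^sub>C word [] \<doteq> (word [pm x] + word [pm y]) + ip om (ph (x + y)) *\<^sub>C word []"
    by (rule eqI_add) simp
  then show ?case unfolding ind_simps
    by (simp only: clinear_add[OF pm_lin] clinear_add[OF ph_lin] ip.addr scaleC_add_left ac_simps)
next
  case (Cons z w)
  then have w: "z \<in> N" "w \<in> lists N" by auto
  have "ind (z # w) (x + y) = word ((pm x + pm y) # z # w) + prep z (ind w (bp x + bp y)) + ind w (br (bp x) z + br (bp y) z)"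
    by (simp add: clinear_add[OF pm_lin] bp_simps addl)
  also have "\<dots> \<doteq> (word (pm x # z # w) + word (pm y # z # w)) + prep z (ind w (bp x) + ind w (bp y)) + (ind w (br (bp x) z) + ind w (br (bp y) z))"
    using w nI_rel_add[of "[]" "z # w"] pm_N by (intro eqI_add eqI_prep Cons.IH) auto
  also have "\<dots> = ind (z # w) x + ind (z # w) y" by (simp add: prep_simps)
  finally show ?case .
qed

lemma ind_scale: "w \<in> lists N \<Longrightarrow> ind w (c *\<^sub>C x) \<doteq> c *\<^sub>C ind w x"
proof (induction w arbitrary: x)
  case Nil
  have "word [c *\<^sub>C pm x] \<doteq> c *\<^sub>C word [pm x]" using nI_rel_scale[of "[]" "[]"] pm_N by simp
  then have "word [c *\<^sub>C pm x] + ip om (ph (c *\<^sub>C x)) *\<^sub>C word [] \<doteq> c *\<^sub>C word [pm x] + ip om (ph (c *\<^sub>C x)) *\<^sub>C word []"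
    by (rule eqI_add) simp
  then show ?case unfolding ind_simps
    by (simp only: clinear_scale[OF pm_lin] clinear_scale[OF ph_lin] ip.scaler scaleC_add_right scaleC_complex_def scaleC_scaleC)
next
  case (Cons z w)
  then have w: "z \<in> N" "w \<in> lists N" by auto
  have "ind (z # w) (c *\<^sub>C x) = word ((c *\<^sub>C pm x) # z # w) + prep z (ind w (c *\<^sub>C bp x)) + ind w (c *\<^sub>C br (bp x) z)"
    by (simp add: clinear_scale[OF pm_lin] bp_simps scalel)
  also have "\<dots> \<doteq> c *\<^sub>C word (pm x # z # w) + prep z (c *\<^sub>C ind w (bp x)) + c *\<^sub>C ind w (br (bp x) z)"
    using w nI_rel_scale[of "[]" "z # w"] pm_N by (intro eqI_add eqI_prep Cons.IH) auto
  also have "\<dots> = c *\<^sub>C ind (z # w) x" by (simp add: prep_simps scaleC_add_right)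
  finally show ?case .
qed

lemma ind_0: "w \<in> lists N \<Longrightarrow> ind w 0 \<doteq> 0"
  using ind_scale[of w 0 0] by simp

lemma ind_N: "w \<in> lists N \<Longrightarrow> x \<in> N \<Longrightarrow> ind w x \<doteq> word (x # w)"
proof (cases w)
  case (Cons z v)
  assume w: "w \<in> lists N" "x \<in> N"
  have "ind w x = word (x # z # v) + prep z (ind v 0) + ind v 0"
    using w Cons by (simp add: pm_id bp_def zerol)
  also have "\<dots> \<doteq> word (x # z # v) + prep z 0 + 0"
    using w Cons by (intro eqI_add eqI_prep ind_0) auto
  finally show ?thesis using Cons by (simp add: prep_simps)
qed (simp add: pm_id ip.zeror)

text \<open>The recursion defining \<open>ind\<close> moves only the Borel part of the acting
  element past the first letter. For the part in \<open>n_minus\<close> the same rule is a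
  commutator relation of the enveloping algebra, so the full rule x(yu) = y(xu) + [x, y]u holds
  modulo \<open>nI\<close>.\<close>

lemma ind_Cons: "w \<in> lists N \<Longrightarrow> z \<in> N \<Longrightarrow> ind (z # w) a \<doteq> prep z (ind w a) + ind w (br a z)"
proof -
  assume w: "w \<in> lists N" "z \<in> N"
  have a: "a = pm a + bp a" by (simp add: bp_def)
  have "prep z (ind w a) \<doteq> prep z (ind w (pm a) + ind w (bp a))"
    using w ind_add[of w "pm a" "bp a"] a by (intro eqI_prep) auto
  also have "\<dots> \<doteq> prep z (word (pm a # w) + ind w (bp a))"
    using w by (intro eqI_prep eqI_add ind_N pm_N) auto
  finally have 1: "prep z (ind w a) \<doteq> word (z # pm a # w) + prep z (ind w (bp a))" by (simp add: prep_simps prep_word)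
  have "br a z = br (pm a) z + br (bp a) z" using a by (metis addl)
  then have "ind w (br a z) \<doteq> ind w (br (pm a) z) + ind w (br (bp a) z)" using ind_add[OF w(1)] by simp
  also have "\<dots> \<doteq> word (br (pm a) z # w) + ind w (br (bp a) z)"
    using w by (intro eqI_add ind_N) (auto simp: n_minus_br pm_N)
  finally have 2: "ind w (br a z) \<doteq> word (br (pm a) z # w) + ind w (br (bp a) z)" .
  have "ind (z # w) a = word (pm a # z # w) + prep z (ind w (bp a)) + ind w (br (bp a) z)" by simp
  also have "\<dots> \<doteq> (word (z # pm a # w) + word (br (pm a) z # w)) + prep z (ind w (bp a)) + ind w (br (bp a) z)"
    using nI_rel_br[of "[]" w "pm a" z] w pm_N by (intro eqI_add) auto
  also have "\<dots> = (word (z # pm a # w) + prep z (ind w (bp a))) + (word (br (pm a) z # w) + ind w (br (bp a) z))"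
    by (simp add: algebra_simps)
  also have "\<dots> \<doteq> prep z (ind w a) + ind w (br a z)"
    using eqI_sym[OF 1] eqI_sym[OF 2] by (rule eqI_add)
  finally show ?thesis .
qed

definition indl :: "'g \<Rightarrow> ('g list \<Rightarrow> complex) \<Rightarrow> 'g list \<Rightarrow> complex" where "indl a p = flin (\<lambda>w. ind w a) p"

lemma indl_word: "indl a (word w) = ind w a" by (simp add: indl_def flin_word)

lemma indl_T0: "p \<in> T0 \<Longrightarrow> indl a p \<in> T0"
  unfolding indl_def by (rule flin_span_subspace[of _ "word ` lists N"])
    (auto simp: words_on_def[symmetric] word_free subspace_words_on flin_word in_lists_conv_set intro!: ind_T0)

lemma indl_lin: "p \<in> T0 \<Longrightarrow> q \<in> T0 \<Longrightarrow> indl a (p + q) = indl a p + indl a q" "p \<in> T0 \<Longrightarrow> indl a (c *\<^sub>C p) = c *\<^sub>C indl a p"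
  "p \<in> T0 \<Longrightarrow> q \<in> T0 \<Longrightarrow> indl a (p - q) = indl a p - indl a q"
  unfolding indl_def using words_on_free[of N] by (auto intro!: flin_add flin_scale flin_diff)

lemma indl_prep: "p \<in> T0 \<Longrightarrow> z \<in> N \<Longrightarrow> indl a (prep z p) \<doteq> prep z (indl a p) + indl (br a z) p"
proof -
  assume p: "p \<in> T0" "z \<in> N"
  have "indl a (prep z p) = flin (\<lambda>w. ind (z # w) a) p" using flin_prep[OF p(1), of "\<lambda>w. ind w a"] by (simp add: indl_def)
  also have "\<dots> \<doteq> flin (\<lambda>w. prep z (ind w a) + ind w (br a z)) p" by (intro eqI_flin p ind_Cons)
  also have "\<dots> = prep z (indl a p) + indl (br a z) p" by (simp add: indl_def flin_add_out flin_lin_out[OF prep_lin])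
  finally show ?thesis .
qed

lemma indl_add: "p \<in> T0 \<Longrightarrow> indl (x + y) p \<doteq> indl x p + indl y p"
  unfolding indl_def flin_add_out[symmetric] by (intro eqI_flin ind_add)

lemma indl_scale: "p \<in> T0 \<Longrightarrow> indl (c *\<^sub>C x) p \<doteq> c *\<^sub>C indl x p"
  unfolding indl_def flin_scale_out[symmetric] by (intro eqI_flin ind_scale)

text \<open>The operators descend to the enveloping algebra of \<open>n_minus\<close>. For a
  relation at the front of a word this follows from \<open>ind_Cons\<close> and, for the commutator
  relation, from the Jacobi identity.\<close>

lemma indl_nI: "p \<in> nI \<Longrightarrow> indl a p \<in> nI"
proof -
  \<comment> \<open>Letters in front of a relation are stripped by \<open>indl_prep\<close>. The
    commutator term it creates has a different acting element, which is why the hypothesis on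
    \<open>p\<close> is required for all \<open>a\<close> at once.\<close>
  have *: "indl a (foldr prep u p) \<in> nI" if "u \<in> lists N" "p \<in> nI" "\<And>a. indl a p \<in> nI" for u p a
    using that(1)
  proof (induction u arbitrary: a)
    case (Cons z u)
    have "set u \<subseteq> N" using Cons by auto
    then have nI: "foldr prep u p \<in> nI"
      by (induction u) (use that(2) in \<open>auto intro: prep_nI\<close>)
    then have T: "foldr prep u p \<in> T0" using nI_T0 by auto
    have "indl a (prep z (foldr prep u p)) \<doteq> prep z (indl a (foldr prep u p)) + indl (br a z) (foldr prep u p)"
      using T Cons by (intro indl_prep) auto
    also have "\<dots> \<doteq> prep z 0 + 0" using Cons by (intro eqI_add eqI_prep) (auto simp: eqI_0)
    finally show ?case by (simp add: prep_simps eqI_0)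
  qed (use that in simp)
  have gen: "indl a s \<in> nI" if "s \<in> nrels" for s
    using that unfolding nrels_def
  proof (elim UnE, goal_cases)
    case 1
    then obtain u w x y where s: "s = word (u @ [x + y] @ w) - word (u @ [x] @ w) - word (u @ [y] @ w)"
      and uw: "u \<in> lists N" "w \<in> lists N" "x \<in> N" "y \<in> N" by blast
    define p where "p = word ((x + y) # w) - (word (x # w) + word (y # w))"
    have sp: "s = foldr prep u p"
      by (simp only: s p_def preps_word preps_simps append_Cons append_Nil diff_diff_eq)
    have "p \<in> nI" using nI_rel_add[of "[]" w x y] uw by (simp add: p_def eqI_def)
    moreover have "indl a p \<in> nI" for a
    proof -
      have "indl a p = ind ((x + y) # w) a - (ind (x # w) a + ind (y # w) a)"
        unfolding p_def using uw
        by (subst indl_lin, (intro cvec.subspace_add subspace_words_on word_words_on; simp add: N_simps)+)+ (simp add: indl_word del: ind_simps)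
      also have "\<dots> \<doteq> (prep (x + y) (ind w a) + ind w (br a (x + y))) - ((prep x (ind w a) + ind w (br a x)) + (prep y (ind w a) + ind w (br a y)))"
        using uw by (intro eqI_diff eqI_add ind_Cons) (auto simp: N_simps)
      also have "\<dots> \<doteq> ((prep x (ind w a) + prep y (ind w a)) + (ind w (br a x) + ind w (br a y))) - ((prep x (ind w a) + ind w (br a x)) + (prep y (ind w a) + ind w (br a y)))"
        unfolding addr using uw by (intro eqI_diff eqI_add prep_add ind_add eqI_refl ind_T0)
      also have "\<dots> = 0" by simp
      finally show ?thesis by (simp add: eqI_0)
    qed
    ultimately show ?case using * uw sp by blast
  next
    case 2
    then obtain u w c x where s: "s = word (u @ [c *\<^sub>C x] @ w) - c *\<^sub>C word (u @ [x] @ w)"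
      and uw: "u \<in> lists N" "w \<in> lists N" "x \<in> N" by blast
    define p where "p = word ((c *\<^sub>C x) # w) - c *\<^sub>C word (x # w)"
    have sp: "s = foldr prep u p"
      by (simp only: s p_def preps_word preps_simps append_Cons append_Nil)
    have "p \<in> nI" using nI_rel_scale[of "[]" w x c] uw by (simp add: p_def eqI_def)
    moreover have "indl a p \<in> nI" for a
    proof -
      have "indl a p = ind ((c *\<^sub>C x) # w) a - c *\<^sub>C ind (x # w) a"
        unfolding p_def using uw
        by (subst indl_lin, (intro cvec.subspace_scale subspace_words_on word_words_on; simp add: N_simps)+)+ (simp add: indl_word del: ind_simps)
      also have "\<dots> \<doteq> (prep (c *\<^sub>C x) (ind w a) + ind w (br a (c *\<^sub>C x))) - c *\<^sub>C (prep x (ind w a) + ind w (br a x))"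
        using uw by (intro eqI_diff eqI_scale ind_Cons) (auto simp: N_simps)
      also have "\<dots> \<doteq> (c *\<^sub>C prep x (ind w a) + c *\<^sub>C ind w (br a x)) - c *\<^sub>C (prep x (ind w a) + ind w (br a x))"
        unfolding scaler using uw by (intro eqI_diff eqI_add prep_scale ind_scale eqI_refl ind_T0)
      also have "\<dots> = 0" by (simp add: scaleC_add_right)
      finally show ?thesis by (simp add: eqI_0)
    qed
    ultimately show ?case using * uw sp by blast
  next
    case 3
    then obtain u w x y where s: "s = word (u @ [x, y] @ w) - word (u @ [y, x] @ w) - word (u @ [br x y] @ w)"
      and uw: "u \<in> lists N" "w \<in> lists N" "x \<in> N" "y \<in> N" by blast
    define p where "p = word (x # y # w) - (word (y # x # w) + word (br x y # w))"
    have sp: "s = foldr prep u p"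
      by (simp only: s p_def preps_word preps_simps append_Cons append_Nil diff_diff_eq)
    have "p \<in> nI" using nI_rel_br[of "[]" w x y] uw by (simp add: p_def eqI_def)
    moreover have "indl a p \<in> nI" for a
    proof -
      have two: "ind (x # y # w) a \<doteq> prep x (prep y (ind w a)) + prep x (ind w (br a y)) + (prep y (ind w (br a x)) + ind w (br (br a x) y))"
        if "x \<in> N" "y \<in> N" for x y
      proof -
        have "ind (x # y # w) a \<doteq> prep x (ind (y # w) a) + ind (y # w) (br a x)"
          using that uw by (intro ind_Cons) auto
        also have "\<dots> \<doteq> prep x (prep y (ind w a) + ind w (br a y)) + (prep y (ind w (br a x)) + ind w (br (br a x) y))"
          using that uw by (intro eqI_add eqI_prep ind_Cons) auto
        finally show ?thesis by (simp add: prep_simps)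
      qed
      have jac: "br (br a x) y = br (br a y) x + br a (br x y)"
        using deriv[of a x y] anti[of "br a y" x] by simp
      have "indl a p = ind (x # y # w) a - (ind (y # x # w) a + ind (br x y # w) a)"
        unfolding p_def using uw
        by (subst indl_lin, (intro cvec.subspace_add subspace_words_on word_words_on; simp add: N_simps n_minus_br)+)+ (simp add: indl_word del: ind_simps)
      also have "\<dots> \<doteq> (prep x (prep y (ind w a)) + prep x (ind w (br a y)) + (prep y (ind w (br a x)) + ind w (br (br a x) y)))
        - ((prep y (prep x (ind w a)) + prep y (ind w (br a x)) + (prep x (ind w (br a y)) + ind w (br (br a y) x)))
         + (prep (br x y) (ind w a) + ind w (br a (br x y))))"
        using uw by (intro eqI_diff eqI_add two ind_Cons) (auto simp: n_minus_br)
      also have "\<dots> \<doteq> ((prep y (prep x (ind w a)) + prep (br x y) (ind w a)) + prep x (ind w (br a y)) + (prep y (ind w (br a x)) + (ind w (br (br a y) x) + ind w (br a (br x y)))))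
        - ((prep y (prep x (ind w a)) + prep y (ind w (br a x)) + (prep x (ind w (br a y)) + ind w (br (br a y) x)))
         + (prep (br x y) (ind w a) + ind w (br a (br x y))))"
        unfolding jac using uw by (intro eqI_diff eqI_add eqI_refl prep_br ind_add ind_T0)
      also have "\<dots> = 0" by simp
      finally show ?thesis by (simp add: eqI_0)
    qed
    ultimately show ?case using * uw sp by blast
  qed
  assume "p \<in> nI"
  then show ?thesis
    unfolding nI_def indl_def
    by (rule flin_span_subspace) (use nrels_T0 words_on_free gen in \<open>auto simp: indl_def nI_def\<close>)
qed

lemma eqI_indl: "p \<in> T0 \<Longrightarrow> q \<in> T0 \<Longrightarrow> p \<doteq> q \<Longrightarrow> indl a p \<doteq> indl a q"
  using indl_nI[of "p - q" a] by (simp add: eqI_def indl_lin)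

lemma indl_br_words: "w \<in> lists N \<Longrightarrow> indl a (ind w b) \<doteq> indl b (ind w a) + ind w (br a b)"
proof (induction w arbitrary: a b)
  case Nil
  define u where "u c = ip om (ph c)" for c
  have 0: "word [0] \<doteq> 0" using nI_rel_scale[of "[]" "[]" 0 0] by (simp add: N_simps)
  have step: "indl a (ind [] b) \<doteq> word [pm b, pm a] + u a *\<^sub>C word [pm b] + ind [] (br a (pm b)) + u b *\<^sub>C (word [pm a] + u a *\<^sub>C word [])" for a b
  proof -
    have "indl a (ind [] b) = ind [pm b] a + u b *\<^sub>C ind [] a"
      unfolding ind_simps(1)[of b]
      by (subst indl_lin, auto intro!: cvec.subspace_scale subspace_words_on word_words_on pm_N simp: indl_lin word_words_on indl_word u_def simp del: ind_simps)
    also have "\<dots> \<doteq> (prep (pm b) (ind [] a) + ind [] (br a (pm b))) + u b *\<^sub>C ind [] a"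
      by (intro eqI_add eqI_refl ind_Cons) (auto simp: pm_N)
    also have "\<dots> = word [pm b, pm a] + u a *\<^sub>C word [pm b] + ind [] (br a (pm b)) + u b *\<^sub>C (word [pm a] + u a *\<^sub>C word [])"
      by (simp add: prep_simps prep_word u_def)
    finally show ?thesis .
  qed
  \<comment> \<open>The bracket of two Borel elements lies in \<open>n_plus\<close>, where both the
    projection to \<open>n_minus\<close> and the character given by \<open>om\<close> vanish: the
    character is a homomorphism on the Borel subalgebra.\<close>
  have "ind [] (br (bp a) (bp b)) = word [0] + 0"
    using pm_borel[of 0 "br (bp a) (bp b)"] bp_br_plus cvec.subspace_0[OF H(1)] by (simp add: ip.zeror)
  then have bb: "ind [] (br (bp a) (bp b)) \<doteq> 0" using 0 by simp
  have dec: "br a b + br b (pm a) = br a (pm b) + br (pm b) (pm a) + br (bp a) (bp b)"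
  proof -
    have "br a b = br (pm a) b + br (bp a) b" "br (bp a) b = br (bp a) (pm b) + br (bp a) (bp b)"
      "br a (pm b) = br (pm a) (pm b) + br (bp a) (pm b)"
      by (simp_all add: bp_def bisimps)
    then show ?thesis using anti[of b "pm a"] anti[of "pm b" "pm a"] by simp
  qed
  have "ind [] (br a b) + ind [] (br b (pm a)) \<doteq> ind [] (br a b + br b (pm a))" by (rule eqI_sym, rule ind_add) simp
  also have "\<dots> = ind [] (br a (pm b) + br (pm b) (pm a) + br (bp a) (bp b))" by (simp only: dec)
  also have "\<dots> \<doteq> ind [] (br a (pm b) + br (pm b) (pm a)) + ind [] (br (bp a) (bp b))" by (rule ind_add) simp
  also have "\<dots> \<doteq> (ind [] (br a (pm b)) + ind [] (br (pm b) (pm a))) + 0" by (intro eqI_add bb ind_add) simp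
  also have "\<dots> \<doteq> (ind [] (br a (pm b)) + word [br (pm b) (pm a)]) + 0" by (intro eqI_add eqI_refl ind_N) (auto simp: pm_N n_minus_br)
  finally have A: "ind [] (br a b) + ind [] (br b (pm a)) \<doteq> ind [] (br a (pm b)) + word [br (pm b) (pm a)]" by simp
  have "indl a (ind [] b) \<doteq> word [pm b, pm a] + u a *\<^sub>C word [pm b] + ind [] (br a (pm b)) + u b *\<^sub>C (word [pm a] + u a *\<^sub>C word [])" by (rule step)
  also have "\<dots> \<doteq> (word [pm a, pm b] + word [br (pm b) (pm a)]) + u a *\<^sub>C word [pm b] + ind [] (br a (pm b)) + u b *\<^sub>C (word [pm a] + u a *\<^sub>C word [])"
    using nI_rel_br[of "[]" "[]" "pm b" "pm a"] pm_N by (intro eqI_add eqI_refl) simp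
  also have "\<dots> = (ind [] (br a (pm b)) + word [br (pm b) (pm a)]) + (word [pm a, pm b] + u a *\<^sub>C word [pm b] + u b *\<^sub>C (word [pm a] + u a *\<^sub>C word []))"
    by (simp add: algebra_simps del: ind_simps)
  also have "\<dots> \<doteq> (ind [] (br a b) + ind [] (br b (pm a))) + (word [pm a, pm b] + u a *\<^sub>C word [pm b] + u b *\<^sub>C (word [pm a] + u a *\<^sub>C word []))"
    using eqI_sym[OF A] by (rule eqI_add) simp
  also have "\<dots> = (word [pm a, pm b] + u b *\<^sub>C word [pm a] + ind [] (br b (pm a)) + u a *\<^sub>C (word [pm b] + u b *\<^sub>C word [])) + ind [] (br a b)"
    by (simp add: algebra_simps scaleC_add_right scaleC_scaleC del: ind_simps)
  also have "\<dots> \<doteq> indl b (ind [] a) + ind [] (br a b)"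
    using eqI_sym[OF step[of b a]] by (rule eqI_add) simp
  finally show ?case .
next
  case (Cons z w)
  then have w: "z \<in> N" "w \<in> lists N" "z # w \<in> lists N" by auto
  note T = ind_T0[OF w(2)] ind_T0[OF w(3)] prep_T0[OF w(1) ind_T0[OF w(2)]]
  have step: "indl a (ind (z # w) b) \<doteq> prep z (indl a (ind w b)) + indl (br a z) (ind w b) + indl a (ind w (br b z))" for a b
  proof -
    have "indl a (ind (z # w) b) \<doteq> indl a (prep z (ind w b) + ind w (br b z))"
      using w by (intro eqI_indl ind_Cons T cvec.subspace_add subspace_words_on)
    also have "\<dots> = indl a (prep z (ind w b)) + indl a (ind w (br b z))" using T by (intro indl_lin) auto
    also have "\<dots> \<doteq> (prep z (indl a (ind w b)) + indl (br a z) (ind w b)) + indl a (ind w (br b z))"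
      by (intro eqI_add eqI_refl indl_prep T w)
    finally show ?thesis .
  qed
  have jac: "br (br a b) z = br (br a z) b + br a (br b z)"
    using deriv[of a b z] anti[of "br a z" b] deriv_l[of a b z] by simp
  have "ind (z # w) (br a b) \<doteq> prep z (ind w (br a b)) + ind w (br (br a z) b + br a (br b z))"
    using ind_Cons[OF w(2,1), of "br a b"] unfolding jac .
  also have "\<dots> \<doteq> prep z (ind w (br a b)) + (ind w (br (br a z) b) + ind w (br a (br b z)))"
    using w by (intro eqI_add eqI_refl ind_add)
  finally have B: "ind (z # w) (br a b) \<doteq> prep z (ind w (br a b)) + (ind w (br (br a z) b) + ind w (br a (br b z)))" .
  have "indl a (ind (z # w) b) \<doteq> prep z (indl a (ind w b)) + indl (br a z) (ind w b) + indl a (ind w (br b z))" by (rule step)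
  also have "\<dots> \<doteq> prep z (indl b (ind w a) + ind w (br a b)) + (indl b (ind w (br a z)) + ind w (br (br a z) b)) + (indl (br b z) (ind w a) + ind w (br a (br b z)))"
    using w by (intro eqI_add eqI_prep Cons.IH)
  also have "\<dots> = (prep z (indl b (ind w a)) + indl (br b z) (ind w a) + indl b (ind w (br a z))) + (prep z (ind w (br a b)) + (ind w (br (br a z) b) + ind w (br a (br b z))))"
    by (simp add: prep_simps algebra_simps)
  also have "\<dots> \<doteq> indl b (ind (z # w) a) + ind (z # w) (br a b)"
    using eqI_sym[OF step[of b a]] eqI_sym[OF B] by (rule eqI_add)
  finally show ?case .
qed

lemma indl_br: "p \<in> T0 \<Longrightarrow> indl a (indl b p) \<doteq> indl b (indl a p) + indl (br a b) p"
proof -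
  assume p: "p \<in> T0"
  have *: "indl a (indl b p) = flin (\<lambda>w. indl a (ind w b)) p" for a b
  proof -
    have "p \<in> T0 \<and> indl a (indl b p) = flin (\<lambda>w. indl a (ind w b)) p" using p unfolding words_on_def
    proof (induction rule: cvec.span_induct_alt)
      case base show ?case
        using cvec.subspace_0[OF subspace_words_on, of N] by (simp add: words_on_def indl_def flin_def zero_fun_def)
    next
      case (step c x y)
      then obtain w where w: "x = word w" "w \<in> lists N" by auto
      have x: "x \<in> T0" "x \<in> free_alg" unfolding w(1) by (rule word_words_on[OF w(2)], rule word_free)
      have y: "y \<in> T0" "y \<in> free_alg" using step words_on_free by (auto simp: words_on_def)
      have cx: "c *\<^sub>C x \<in> T0" "c *\<^sub>C x \<in> free_alg" using x cvec.subspace_scale subspace_words_on words_on_free by blast+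
      have "indl a (indl b (c *\<^sub>C x + y)) = c *\<^sub>C indl a (indl b x) + indl a (indl b y)"
        using x y cx cvec.subspace_scale[OF subspace_words_on indl_T0[OF x(1)]] by (simp add: indl_lin indl_T0)
      moreover have "flin (\<lambda>w. indl a (ind w b)) (c *\<^sub>C x + y) = c *\<^sub>C flin (\<lambda>w. indl a (ind w b)) x + flin (\<lambda>w. indl a (ind w b)) y"
        using x y cx by (simp add: flin_add flin_scale)
      moreover have "c *\<^sub>C x + y \<in> T0" by (rule cvec.subspace_add[OF subspace_words_on cx(1) y(1)])
      ultimately have "c *\<^sub>C x + y \<in> T0 \<and> indl a (indl b (c *\<^sub>C x + y)) = flin (\<lambda>w. indl a (ind w b)) (c *\<^sub>C x + y)"
        using step(2) by (simp add: w flin_word indl_word)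
      then show ?case by (simp add: words_on_def plus_fun_def)
    qed
    then show ?thesis ..
  qed
  have "flin (\<lambda>w. indl a (ind w b)) p \<doteq> flin (\<lambda>w. indl b (ind w a) + ind w (br a b)) p"
    using p by (intro eqI_flin indl_br_words)
  then show ?thesis by (simp add: * flin_add_out) (simp add: indl_def)
qed

text \<open>The result of letting a word in arbitrary letters act on the highest weight vector of
  the realized module.\<close>

definition Th :: "'g list \<Rightarrow> 'g list \<Rightarrow> complex" where "Th w = foldr indl w (word [])"

lemma foldr_indl_T0: "p \<in> T0 \<Longrightarrow> foldr indl u p \<in> T0"
  by (induction u) (auto intro: indl_T0)

lemma Th_T0: "Th w \<in> T0"
  unfolding Th_def by (intro foldr_indl_T0 word_words_on) simp

lemma foldr_indl_eqI: "p \<in> T0 \<Longrightarrow> q \<in> T0 \<Longrightarrow> p \<doteq> q \<Longrightarrow> foldr indl u p \<doteq> foldr indl u q"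
  by (induction u) (auto intro: eqI_indl foldr_indl_T0)

lemma foldr_indl_lin:
  "p \<in> T0 \<Longrightarrow> q \<in> T0 \<Longrightarrow> foldr indl u (p + q) = foldr indl u p + foldr indl u q"
  "p \<in> T0 \<Longrightarrow> foldr indl u (c *\<^sub>C p) = c *\<^sub>C foldr indl u p"
  by (induction u) (simp_all add: indl_lin foldr_indl_T0)

lemma Th_append: "Th (u @ w) = foldr indl u (Th w)" by (simp add: Th_def)

lemma env_rels_free: "env_rels K \<subseteq> free_alg"
  unfolding env_rels_def by (safe; intro cvec.subspace_diff cvec.subspace_scale subspace_free_alg word_free)

lemma verma_rels_free: "verma_rels K om \<subseteq> free_alg"
  unfolding verma_rels_def using env_rels_free
  by (auto intro!: cvec.subspace_diff cvec.subspace_scale subspace_free_alg word_free)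

lemma flin_Th_diff: "flin Th (word a - word b - word c) = Th a - (Th b + Th c)"
  and flin_Th_scale: "flin Th (word a - k *\<^sub>C word b) = Th a - k *\<^sub>C Th b"
  unfolding diff_diff_eq
  by (simp_all add: flin_diff flin_add flin_scale word_free flin_word cvec.subspace_add cvec.subspace_scale subspace_free_alg)

lemma Th_rels: "s \<in> verma_rels K om \<Longrightarrow> flin Th s \<in> nI"
  unfolding verma_rels_def env_rels_def
proof (elim UnE, goal_cases)
  case 1
  then obtain u w x y where s: "s = word (u @ [x + y] @ w) - word (u @ [x] @ w) - word (u @ [y] @ w)" by blast
  have "foldr indl u (indl (x + y) (Th w)) \<doteq> foldr indl u (indl x (Th w) + indl y (Th w))"
    by (intro foldr_indl_eqI indl_T0 Th_T0 cvec.subspace_add subspace_words_on indl_add)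
  then show ?case unfolding s flin_Th_diff by (simp add: Th_append foldr_indl_lin indl_T0 Th_T0 eqI_def) (simp add: Th_def)
next
  case 2
  then obtain u w c x where s: "s = word (u @ [c *\<^sub>C x] @ w) - c *\<^sub>C word (u @ [x] @ w)" by blast
  have "foldr indl u (indl (c *\<^sub>C x) (Th w)) \<doteq> foldr indl u (c *\<^sub>C indl x (Th w))"
    by (intro foldr_indl_eqI indl_T0 Th_T0 cvec.subspace_scale subspace_words_on indl_scale)
  then show ?case unfolding s flin_Th_scale by (simp add: Th_append foldr_indl_lin indl_T0 Th_T0 eqI_def) (simp add: Th_def)
next
  case 3
  then obtain u w x y where s: "s = word (u @ [x, y] @ w) - word (u @ [y, x] @ w) - word (u @ [br x y] @ w)" by blast
  have "foldr indl u (indl x (indl y (Th w))) \<doteq> foldr indl u (indl y (indl x (Th w)) + indl (br x y) (Th w))"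
    by (intro foldr_indl_eqI indl_T0 Th_T0 cvec.subspace_add subspace_words_on indl_br)
  then show ?case unfolding s flin_Th_diff by (simp add: Th_append foldr_indl_lin indl_T0 Th_T0 eqI_def) (simp add: Th_def)
next
  case 4
  then obtain u x where s: "s = word (u @ [x])" "x \<in> n_plus K" by blast
  have 0: "word [0] \<doteq> 0" using nI_rel_scale[of "[]" "[]" 0 0] by (simp add: N_simps)
  have "pm x = 0" "ph x = 0" using pm_borel[of 0 x] s(2) cvec.subspace_0[OF H(1)] by auto
  then have "indl x (word []) \<doteq> 0" using 0 by (simp add: indl_word ip.zeror)
  then have "foldr indl u (indl x (word [])) \<doteq> foldr indl u 0"
    by (intro foldr_indl_eqI indl_T0 word_words_on cvec.subspace_0 subspace_words_on) auto
  moreover have "foldr indl u 0 = 0" using foldr_indl_lin(2)[of 0 u 0] by (simp add: cvec.subspace_0 subspace_words_on)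
  ultimately show ?case by (simp add: s flin_word Th_def eqI_0)
next
  case 5
  then obtain u h where s: "s = word (u @ [h]) - ip om h *\<^sub>C word u" "h \<in> H" by blast
  have 0: "word [0] \<doteq> 0" using nI_rel_scale[of "[]" "[]" 0 0] by (simp add: N_simps)
  have "pm h = 0" "ph h = h" using pm_borel[of h 0] s(2) cvec.subspace_0[OF subspace_n_plus] by auto
  then have "indl h (word []) \<doteq> ip om h *\<^sub>C word []" using eqI_add[OF 0 eqI_refl] by (simp add: indl_word)
  then have "foldr indl u (indl h (word [])) \<doteq> foldr indl u (ip om h *\<^sub>C word [])"
    by (intro foldr_indl_eqI indl_T0 word_words_on cvec.subspace_scale subspace_words_on) auto
  then show ?case unfolding s flin_Th_scale by (simp add: Th_def foldr_indl_lin word_words_on eqI_def)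
qed

lemma Th_N: "w \<in> lists N \<Longrightarrow> Th w \<doteq> word w"
proof (induction w)
  case (Cons y w)
  have "Th (y # w) = indl y (Th w)" by (simp add: Th_def)
  also have "\<dots> \<doteq> indl y (word w)" using Cons by (intro eqI_indl Th_T0 word_words_on) auto
  also have "\<dots> \<doteq> word (y # w)" using Cons by (simp add: indl_word ind_N)
  finally show ?case .
qed (simp add: Th_def)

text \<open>\<open>Th\<close> sends the Verma relations into \<open>nI\<close>, because the realized
  module has a highest weight vector of weight \<open>om\<close>, and it is the identity modulo
  \<open>nI\<close> on words over \<open>n_minus\<close>. So no new relations arise among these
  words: the Verma module is free of rank one over the enveloping algebra of
  \<open>n_minus\<close>.\<close>

theorem free_over_n_minus:
  assumes "p \<in> T0" "p \<in> cvec.span (verma_rels K om)"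
  shows "p \<in> nI"
proof -
  have "flin Th p \<in> nI"
    by (rule flin_span_subspace[OF assms(2) verma_rels_free subspace_nI Th_rels])
  moreover have "flin Th p \<doteq> p"
    using eqI_flin[OF assms(1), of Th word] Th_N flin_id[OF assms(1)] by simp
  ultimately show ?thesis
    unfolding eqI_def by (metis cvec.subspace_diff subspace_nI diff_diff_eq2 add_diff_cancel_left')
qed

end

section \<open>Verma modules\<close>

text \<open>Counterpart of \<open>eigen_span\<close> for modules. Without a nondegenerate form to
  test against, the vectors with wrong eigenvalues are removed one at a time from a finite
  combination.\<close>

lemma eigen_span_general:
  fixes A :: "'h \<Rightarrow> 'a::complex_vec \<Rightarrow> 'a"
  assumes lin: "\<And>h. h \<in> D \<Longrightarrow> clinear (A h)"
    and eig: "\<And>t h. t \<in> S \<Longrightarrow> h \<in> D \<Longrightarrow> \<exists>a. A h t = a *\<^sub>C t"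
    and u: "u \<in> cvec.span S" "\<And>h. h \<in> D \<Longrightarrow> A h u = k h *\<^sub>C u"
  shows "u \<in> cvec.span {t \<in> S. \<forall>h\<in>D. A h t = k h *\<^sub>C t}"
proof -
  define S1 where "S1 = {t \<in> S. \<forall>h\<in>D. A h t = k h *\<^sub>C t}"
  have "u \<in> cvec.span (S1 \<union> (S - S1))" using u(1) by (simp add: S1_def Un_absorb1 Collect_conj_eq)
  then obtain u1 u2 where uu: "u = u1 + u2" "u1 \<in> cvec.span S1" "u2 \<in> cvec.span (S - S1)"
    unfolding cvec.span_Un by auto
  have 1: "A h u1 = k h *\<^sub>C u1" if "h \<in> D" for h
    by (rule clinear_eq_on_span[OF lin clinear_scale_fun[OF clinear_id_fun] uu(2)]) (use that in \<open>auto simp: S1_def\<close>)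
  have 2: "A h u2 = k h *\<^sub>C u2" if "h \<in> D" for h
    using u(2)[OF that] 1[OF that] uu(1) by (simp add: clinear_add[OF lin[OF that]] scaleC_add_right)
  have *: "w = 0" if "finite F" "F \<subseteq> S - S1" "w \<in> cvec.span F" "\<And>h. h \<in> D \<Longrightarrow> A h w = k h *\<^sub>C w" for F w
    using that
  proof (induction F rule: finite_induct)
    case (insert t F)
    obtain h where h: "h \<in> D" "A h t \<noteq> k h *\<^sub>C t" using insert.prems(1) by (auto simp: S1_def)
    obtain a where a: "A h t = a *\<^sub>C t" using eig[of t h] h insert.prems(1) by auto
    have kh: "k h \<noteq> a" using a h by auto
    obtain c where c: "w - c *\<^sub>C t \<in> cvec.span F" using insert.prems(2) cvec.span_insert by blast
    \<comment> \<open>The span of \<open>F\<close> is stable under \<open>A h\<close>. Applying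
      \<open>A h - a\<close> to \<open>w - c *\<^sub>C t\<close> therefore stays in it and gives
      \<open>(k h - a) *\<^sub>C w\<close>, where the scalar is nonzero.\<close>
    have "A h (w - c *\<^sub>C t) \<in> cvec.span F"
    proof (rule clinear_span_image[OF lin[OF h(1)] c])
      fix s assume "s \<in> F"
      then obtain b where "A h s = b *\<^sub>C s" using eig[of s h] h insert.prems(1) by auto
      then show "A h s \<in> cvec.span F" using \<open>s \<in> F\<close> by (simp add: cvec.span_base cvec.span_scale)
    qed
    moreover have "A h (w - c *\<^sub>C t) = k h *\<^sub>C w - a *\<^sub>C (c *\<^sub>C t)"
      using insert.prems(3)[OF h(1)]
      by (simp add: clinear_diff[OF lin[OF h(1)]] clinear_scale[OF lin[OF h(1)]] a mult.commute)
    ultimately have "(k h *\<^sub>C w - a *\<^sub>C (c *\<^sub>C t)) - a *\<^sub>C (w - c *\<^sub>C t) \<in> cvec.span F"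
      using c by (metis cvec.span_diff cvec.span_scale)
    then have "(k h - a) *\<^sub>C w \<in> cvec.span F" by (simp add: cvec.scale_right_diff_distrib cvec.scale_left_diff_distrib)
    then have "(1 / (k h - a)) *\<^sub>C ((k h - a) *\<^sub>C w) \<in> cvec.span F" by (rule cvec.span_scale)
    then have "w \<in> cvec.span F" using kh by simp
    then show ?case using insert by simp
  qed simp
  obtain F r where F: "finite F" "F \<subseteq> S - S1" "u2 = (\<Sum>a\<in>F. r a *\<^sub>C a)"
    using uu(3) unfolding cvec.span_explicit by blast
  then have "u2 \<in> cvec.span F" by (auto intro: cvec.span_sum cvec.span_scale cvec.span_base)
  then have "u2 = 0" using *[of F u2] F 2 by blast
  with uu show ?thesis by (simp add: S1_def)
qed

section \<open>Verma modules: spanning words, universal properties and weights\<close>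

locale verma = verma_weight K om for K :: "('g::complex_vec, 'i::finite, 'z) km_algebra_scheme" and om :: 'g +
  fixes act :: "'g \<Rightarrow> 'm \<Rightarrow> 'm::complex_vec" and vac :: 'm
  assumes verma: "is_verma K om act vac"

sublocale verma \<subseteq> act: bilin act
  using verma by unfold_locales (simp add: is_verma_def lie_module_def)

context verma begin

lemma act_br: "act (br x y) u = act x (act y u) - act y (act x u)"
  using verma by (simp add: is_verma_def lie_module_def)

lemma free_act_flin: "free_act act p u = flin (\<lambda>w. foldr act w u) p"
  by (simp add: free_act_def flin_def)

lemma surj: "\<exists>p\<in>free_alg. flin (\<lambda>w. foldr act w vac) p = u"
  using verma by (force simp: is_verma_def free_act_flin image_iff)

lemma ker: "p \<in> free_alg \<Longrightarrow> flin (\<lambda>w. foldr act w vac) p = 0 \<longleftrightarrow> p \<in> cvec.span (verma_rels K om)"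
  using verma by (simp add: is_verma_def free_act_flin)

lemma vac_n: "x \<in> n_plus K \<Longrightarrow> act x vac = 0"
proof -
  assume "x \<in> n_plus K"
  then have "word ([] @ [x]) \<in> verma_rels K om" unfolding verma_rels_def by blast
  then have "flin (\<lambda>w. foldr act w vac) (word [x]) = 0" using ker[OF word_free] by (simp add: cvec.span_base)
  then show ?thesis by (simp add: flin_word)
qed

lemma vac_h: "h \<in> H \<Longrightarrow> act h vac = ip om h *\<^sub>C vac"
proof -
  assume "h \<in> H"
  then have "word ([] @ [h]) - ip om h *\<^sub>C word [] \<in> verma_rels K om" unfolding verma_rels_def by blast
  moreover have "ip om h *\<^sub>C word [] \<in> free_alg" using cvec.subspace_scale[OF subspace_free_alg word_free] .
  moreover then have "word [h] - ip om h *\<^sub>C word [] \<in> free_alg" using cvec.subspace_diff[OF subspace_free_alg word_free] by blast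
  ultimately have "flin (\<lambda>w. foldr act w vac) (word [h] - ip om h *\<^sub>C word []) = 0"
    using ker by (simp add: cvec.span_base)
  then show ?thesis using flin_diff[OF word_free \<open>ip om h *\<^sub>C word [] \<in> free_alg\<close>, of "\<lambda>w. foldr act w vac" "[h]"]
    by (simp add: flin_word flin_scale word_free)
qed

definition fw :: "'i list \<Rightarrow> 'm" where "fw w = foldr (\<lambda>i. act (f i)) w vac"

lemma fw_simps [simp]: "fw [] = vac" "fw (i # w) = act (f i) (fw w)" by (simp_all add: fw_def)

lemma h_act_f: "h \<in> H \<Longrightarrow> act h (act (f i) m) = act (f i) (act h m) - sroot K i h *\<^sub>C act (f i) m"
  using act_br[of h "f i" m] hf[of h i] by (simp add: act.bisimps algebra_simps)

lemma e_act_f: "act (e j) (act (f i) m) = act (f i) (act (e j) m) + (if i = j then act (coroot K i) m else 0)"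
  using act_br[of "e j" "f i" m] ef[of j i] by (auto simp: act.bisimps algebra_simps)

lemma h_fw: "h \<in> H \<Longrightarrow> act h (fw w) = ip (om - (\<Sum>i\<leftarrow>w. al i)) h *\<^sub>C fw w"
proof (induction w)
  case Nil then show ?case by (simp add: vac_h)
next
  case (Cons i w)
  then have "act h (fw (i # w)) = (ip (om - (\<Sum>i\<leftarrow>w. al i)) h - ip (al i) h) *\<^sub>C fw (i # w)"
    by (simp add: h_act_f sroot_al act.scaler cvec.scale_left_diff_distrib)
  also have "ip (om - (\<Sum>i\<leftarrow>w. al i)) h - ip (al i) h = ip (om - (\<Sum>i\<leftarrow>i # w. al i)) h"
    by (simp add: ip.diffl ip.addl)
  finally show ?case .
qed

text \<open>The span of the words in the f is stable under the generators, since each e moves to the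
  right through the f up to Cartan elements and finally kills the highest weight vector. Stability
  passes to brackets, hence to the whole algebra.\<close>

lemma span_fw: "cvec.span (range fw) = UNIV"
proof -
  define U where "U = cvec.span (range fw)"
  have sub: "cvec.subspace U" by (simp add: U_def)
  have fwU: "fw w \<in> U" for w by (simp add: U_def cvec.span_base)
  have *: "act x u \<in> U" if "\<And>w. act x (fw w) \<in> U" "u \<in> U" for x u
  proof (rule clinear_span_subspace[OF act.lin_r _ sub])
    show "u \<in> cvec.span (range fw)" using that(2) by (simp only: U_def)
    show "act x s \<in> U" if "s \<in> range fw" for s using that \<open>\<And>w. act x (fw w) \<in> U\<close> by blast
  qed
  have cl: "\<forall>u\<in>U. act x u \<in> U" if "\<And>w. act x (fw w) \<in> U" for x using *[OF that] by blast
  have "\<forall>u\<in>U. act x u \<in> U" for x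
  proof (induction x rule: km_induct)
    case (H h) then show ?case by (intro cl) (auto simp: h_fw fwU cvec.subspace_scale sub)
  next
    case (e i)
    have hU: "act h (fw w) \<in> U" if "h \<in> H" for h w using that by (simp add: h_fw fwU cvec.subspace_scale sub)
    have fU: "act (f j) u \<in> U" if "u \<in> U" for j u using fwU[of "j # _"] by (intro *[OF _ that]) simp
    have "act (gen_e K i) (fw w) \<in> U" for w
    proof (induction w)
      case Nil show ?case by (simp add: vac_n e_n_plus cvec.subspace_0 sub)
    next
      case (Cons j w)
      then show ?case using hU[OF H(2), of j w] fU by (auto simp: e_act_f intro: cvec.subspace_add sub)
    qed
    then show ?case by (rule cl)
  next
    case (f i)
    have "act (gen_f K i) (fw w) \<in> U" for w using fwU[of "i # w"] by simp
    then show ?case by (rule cl)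
  next
    case (add x y) then show ?case by (auto simp: act.addl intro: cvec.subspace_add sub)
  next
    case (scale c x) then show ?case by (auto simp: act.scalel intro: cvec.subspace_scale sub)
  next
    case (br x y) then show ?case by (auto simp: act_br intro: cvec.subspace_diff sub)
  qed
  then have "foldr act w vac \<in> U" for w
    using fwU[of "[]"] by (induction w) auto
  then have "flin (\<lambda>w. foldr act w vac) p \<in> U" for p
    unfolding flin_def by (intro cvec.subspace_sum cvec.subspace_scale sub)
  then have "u \<in> U" for u using surj by metis
  then show ?thesis by (auto simp: U_def)
qed

lemma verma_induct [case_names zero add scale vac f]:
  assumes "P 0" "\<And>a b. P a \<Longrightarrow> P b \<Longrightarrow> P (a + b)" "\<And>c a. P a \<Longrightarrow> P (c *\<^sub>C a)"
    and "P vac" "\<And>i m. P m \<Longrightarrow> P (act (f i) m)"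
  shows "P m"
proof -
  have fw: "P (fw w)" for w by (induction w) (auto intro: assms)
  have "m \<in> cvec.span (range fw)" by (simp add: span_fw)
  then show ?thesis
    by (induction rule: cvec.span_induct_alt) (auto intro: assms fw)
qed

lemma foldr_R_lin: "(\<And>x. x \<in> set u \<Longrightarrow> clinear (R x)) \<Longrightarrow> clinear (foldr R u)"
proof (induction u)
  case Nil show ?case by (auto intro: clinearI)
next
  case (Cons y u)
  then have "clinear (foldr R u)" "clinear (R y)" by auto
  from clinear_compose[OF this] show ?case by (simp add: comp_def)
qed

text \<open>A map equivariant under \<open>n_minus\<close> may be prescribed by the image of the
  highest weight vector alone. The representation property of \<open>R\<close> is demanded only on
  the subspace \<open>U\<close>, because for operators on tensors or on functionals it holds only
  there.\<close>

lemma free_hom: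
  fixes R :: "'g \<Rightarrow> 'x \<Rightarrow> 'x::complex_vec"
  assumes U: "cvec.subspace U" "u0 \<in> U" "\<And>y u. y \<in> N \<Longrightarrow> u \<in> U \<Longrightarrow> R y u \<in> U"
    and lin: "\<And>y. y \<in> N \<Longrightarrow> clinear (R y)"
    and add: "\<And>x y u. x \<in> N \<Longrightarrow> y \<in> N \<Longrightarrow> u \<in> U \<Longrightarrow> R (x + y) u = R x u + R y u"
    and scale: "\<And>c x u. x \<in> N \<Longrightarrow> u \<in> U \<Longrightarrow> R (c *\<^sub>C x) u = c *\<^sub>C R x u"
    and br: "\<And>x y u. x \<in> N \<Longrightarrow> y \<in> N \<Longrightarrow> u \<in> U \<Longrightarrow> R (br x y) u = R x (R y u) - R y (R x u)"
  obtains \<psi> where "clinear \<psi>" "\<psi> vac = u0" "\<And>m. \<psi> m \<in> U" "\<And>y m. y \<in> N \<Longrightarrow> \<psi> (act y m) = R y (\<psi> m)"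
proof -
  define F where "F = (\<lambda>p. flin (\<lambda>w. foldr act w vac) p)"
  define G where "G = (\<lambda>p. flin (\<lambda>w. foldr R w u0) p)"
  have T0f: "p \<in> T0 \<Longrightarrow> p \<in> free_alg" for p using words_on_free by auto
  have RU: "foldr R w u \<in> U" if "w \<in> lists N" "u \<in> U" for w u using that by (induction w) (auto intro: U)
  have Rlin: "clinear (foldr R u)" if "u \<in> lists N" for u by (rule foldr_R_lin) (use that lin in auto)
  have F_prep: "F (prep y p) = act y (F p)" if "p \<in> T0" for y p
    using flin_prep[OF that, of "\<lambda>w. foldr act w vac" y] flin_lin_out[OF act.lin_r, of y "\<lambda>w. foldr act w vac" p] by (simp add: F_def)
  have G_prep: "G (prep y p) = R y (G p)" if "p \<in> T0" "y \<in> N" for y p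
    using flin_prep[OF that(1), of "\<lambda>w. foldr R w u0" y] flin_lin_out[OF lin[OF that(2)], of "\<lambda>w. foldr R w u0" p] by (simp add: G_def)
  have GU: "G p \<in> U" if "p \<in> T0" for p
  proof -
    have "p \<in> cvec.span (word ` lists N)" using that by (simp add: words_on_def)
    then show ?thesis unfolding G_def
      by (rule flin_span_subspace[OF _ _ U(1)]) (use RU U(2) in \<open>auto simp: word_free flin_word in_lists_conv_set\<close>)
  qed
  have onto: "F ` T0 = UNIV"
  proof -
    have "m \<in> F ` T0" for m
    proof (induction m rule: verma_induct)
      case zero show ?case using cvec.subspace_0[OF subspace_words_on] by (rule rev_image_eqI) (simp add: F_def flin_def)
    next
      case (add a b)
      then obtain p q where "p \<in> T0" "q \<in> T0" "a = F p" "b = F q" by auto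
      moreover have "p + q \<in> T0" by (rule cvec.subspace_add[OF subspace_words_on]) fact+
      ultimately have "a + b = F (p + q)" by (simp add: F_def flin_add T0f)
      then show ?case using \<open>p + q \<in> T0\<close> by blast
    next
      case (scale c a)
      then obtain p where "p \<in> T0" "a = F p" by auto
      moreover have "c *\<^sub>C p \<in> T0" by (rule cvec.subspace_scale[OF subspace_words_on]) fact+
      ultimately have "c *\<^sub>C a = F (c *\<^sub>C p)" by (simp add: F_def flin_scale T0f)
      then show ?case using \<open>c *\<^sub>C p \<in> T0\<close> by blast
    next
      case vac show ?case by (intro image_eqI[of _ _ "word []"]) (auto simp: F_def flin_word word_words_on)
    next
      case (f i m)
      then obtain p where "p \<in> T0" "m = F p" by auto
      then show ?case by (intro image_eqI[of _ _ "prep (gen_f K i) p"]) (auto simp: F_prep prep_T0 f_n_minus)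
    qed
    then show ?thesis by auto
  qed
  have kerG: "G p = 0" if "p \<in> T0" "F p = 0" for p
  proof -
    \<comment> \<open>Here freeness enters: the kernel of evaluation at the highest weight vector,
      for words over \<open>n_minus\<close>, consists of relations of the enveloping algebra, and
      \<open>R\<close> respects these.\<close>
    have "p \<in> nI" using ker[OF T0f[OF that(1)]] that by (intro free_over_n_minus) (auto simp: F_def)
    then have "p \<in> cvec.span nrels" by (simp add: nI_def)
    then have "G p \<in> {0}" unfolding G_def
    proof (rule flin_span_subspace)
      show "nrels \<subseteq> free_alg" using nrels_T0 T0f by auto
      show "cvec.subspace {0}" by simp
      fix s assume "s \<in> nrels"
      then show "flin (\<lambda>w. foldr R w u0) s \<in> {0}" unfolding nrels_def
      proof (elim UnE, goal_cases)
        case 1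
        then obtain u w x y where s: "s = word (u @ [x + y] @ w) - word (u @ [x] @ w) - word (u @ [y] @ w)"
          and uw: "u \<in> lists N" "w \<in> lists N" "x \<in> N" "y \<in> N" by blast
        have "flin (\<lambda>w. foldr R w u0) s = foldr R u (R (x + y) (foldr R w u0)) - (foldr R u (R x (foldr R w u0)) + foldr R u (R y (foldr R w u0)))"
          unfolding s diff_diff_eq
          by (simp add: flin_diff flin_add word_free flin_word cvec.subspace_add subspace_free_alg)
        also have "\<dots> = 0" using uw by (simp add: add RU U(2) clinear_add[OF Rlin])
        finally show ?case by simp
      next
        case 2
        then obtain u w c x where s: "s = word (u @ [c *\<^sub>C x] @ w) - c *\<^sub>C word (u @ [x] @ w)"
          and uw: "u \<in> lists N" "w \<in> lists N" "x \<in> N" by blast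
        have "flin (\<lambda>w. foldr R w u0) s = foldr R u (R (c *\<^sub>C x) (foldr R w u0)) - c *\<^sub>C foldr R u (R x (foldr R w u0))"
          unfolding s by (simp add: flin_diff flin_scale word_free flin_word cvec.subspace_scale subspace_free_alg)
        also have "\<dots> = 0" using uw by (simp add: scale RU U(2) clinear_scale[OF Rlin])
        finally show ?case by simp
      next
        case 3
        then obtain u w x y where s: "s = word (u @ [x, y] @ w) - word (u @ [y, x] @ w) - word (u @ [lie K x y] @ w)"
          and uw: "u \<in> lists N" "w \<in> lists N" "x \<in> N" "y \<in> N" by blast
        have "flin (\<lambda>w. foldr R w u0) s = foldr R u (R x (R y (foldr R w u0))) - (foldr R u (R y (R x (foldr R w u0))) + foldr R u (R (lie K x y) (foldr R w u0)))"
          unfolding s diff_diff_eq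
          by (simp add: flin_diff flin_add word_free flin_word cvec.subspace_add subspace_free_alg)
        also have "\<dots> = 0" using uw by (simp add: br RU U(2) clinear_diff[OF Rlin])
        finally show ?case by simp
      qed
    qed
    then show ?thesis by simp
  qed
  obtain \<psi> where \<psi>: "clinear \<psi>" "\<And>p. p \<in> T0 \<Longrightarrow> \<psi> (F p) = G p"
  proof (rule clinear_factor[of T0 F G])
    show "F (p + q) = F p + F q" "G (p + q) = G p + G q" if "p \<in> T0" "q \<in> T0" for p q
      using that by (simp_all add: F_def G_def flin_add T0f)
    show "F (c *\<^sub>C p) = c *\<^sub>C F p" "G (c *\<^sub>C p) = c *\<^sub>C G p" if "p \<in> T0" for c p
      using that by (simp_all add: F_def G_def flin_scale T0f)
  qed (use onto kerG subspace_words_on in auto)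
  show thesis
  proof
    show "clinear \<psi>" by (rule \<psi>)
    have "word [] \<in> T0" by (rule word_words_on) simp
    from \<psi>(2)[OF this] show "\<psi> vac = u0" by (simp add: F_def G_def flin_word)
    show "\<psi> m \<in> U" for m
    proof -
      obtain p where "p \<in> T0" "m = F p" using onto by blast
      then show ?thesis using \<psi>(2) GU by simp
    qed
    show "\<psi> (act y m) = R y (\<psi> m)" if "y \<in> N" for y m
    proof -
      obtain p where p: "p \<in> T0" "m = F p" using onto by blast
      then show ?thesis using \<psi>(2) prep_T0[OF that p(1)] that by (simp flip: F_prep add: G_prep)
    qed
  qed
qed

text \<open>If the target vector is singular of weight \<open>om\<close>, the map from
  \<open>free_hom\<close> is equivariant under everything: compatibility with \<open>H\<close>, and
  then with each e, is propagated along words in the f, and compatible elements are closed under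
  brackets.\<close>

lemma hom:
  fixes R :: "'g \<Rightarrow> 'x \<Rightarrow> 'x::complex_vec"
  assumes U: "cvec.subspace U" "u0 \<in> U" "\<And>y u. u \<in> U \<Longrightarrow> R y u \<in> U"
    and lin: "\<And>y. clinear (R y)"
    and add: "\<And>x y u. u \<in> U \<Longrightarrow> R (x + y) u = R x u + R y u"
    and scale: "\<And>c x u. u \<in> U \<Longrightarrow> R (c *\<^sub>C x) u = c *\<^sub>C R x u"
    and br: "\<And>x y u. u \<in> U \<Longrightarrow> R (br x y) u = R x (R y u) - R y (R x u)"
    and e: "\<And>i. R (e i) u0 = 0" and h: "\<And>h. h \<in> H \<Longrightarrow> R h u0 = ip om h *\<^sub>C u0"
  obtains \<psi> where "clinear \<psi>" "\<psi> vac = u0" "\<And>m. \<psi> m \<in> U" "\<And>x m. \<psi> (act x m) = R x (\<psi> m)"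
proof -
  obtain \<psi> where \<psi>: "clinear \<psi>" "\<psi> vac = u0" "\<And>m. \<psi> m \<in> U" "\<And>y m. y \<in> N \<Longrightarrow> \<psi> (act y m) = R y (\<psi> m)"
    using free_hom[of U u0 R] assms(1-7) by blast
  note l = clinear_add[OF \<psi>(1)] clinear_scale[OF \<psi>(1)] clinear_zero[OF \<psi>(1)] clinear_diff[OF \<psi>(1)]
    and r = clinear_add[OF lin] clinear_scale[OF lin] clinear_zero[OF lin] clinear_diff[OF lin]
  have rf: "R h (R (f i) u) = R (f i) (R h u) - sroot K i h *\<^sub>C R (f i) u" if "h \<in> H" "u \<in> U" for h i u
  proof -
    have "R h (R (f i) u) = R (f i) (R h u) + R (lie K h (f i)) u" using br[OF that(2), of h "f i"] by simp
    also have "R (lie K h (f i)) u = (- sroot K i h) *\<^sub>C R (f i) u" unfolding hf[OF that(1)] by (rule scale[OF that(2)])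
    finally show ?thesis by simp
  qed
  have \<psi>h: "\<psi> (act h m) = R h (\<psi> m)" if "h \<in> H" for h m
    by (induction m rule: verma_induct)
      (simp_all add: act.bisimps l r vac_h h \<psi> that h_act_f rf f_n_minus)
  have re: "R (gen_e K j) (R (f i) u) = R (f i) (R (gen_e K j) u) + (if i = j then R (coroot K i) u else 0)" if "u \<in> U" for i j u
    using br[OF that, of "gen_e K j" "f i"] ef[of j i] scale[OF that, of 0 0] by (auto simp: algebra_simps)
  have \<psi>e: "\<psi> (act (gen_e K j) m) = R (gen_e K j) (\<psi> m)" for j m
    by (induction m rule: verma_induct)
      (simp_all add: act.bisimps l r vac_n e_n_plus e \<psi> e_act_f re f_n_minus \<psi>h H(2))
  have "\<forall>m. \<psi> (act x m) = R x (\<psi> m)" for x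
    by (induction x rule: km_induct)
      (simp_all add: \<psi>h \<psi>e \<psi> f_n_minus act.addl act.scalel act_br l add scale br)
  then show thesis using that[OF \<psi>(1-3)] by blast
qed

lemma nI_Nil: "p \<in> nI \<Longrightarrow> p [] = 0"
proof -
  assume "p \<in> nI"
  then have "p \<in> cvec.span nrels" by (simp add: nI_def)
  moreover have "clinear (\<lambda>p :: 'g list \<Rightarrow> complex. p [])" by (intro clinearI) (simp_all add: scaleC_fun_def)
  moreover have "s [] = 0" if "s \<in> nrels" for s
    using that unfolding nrels_def by (auto simp: word_def scaleC_fun_def scaleC_complex_def)
  ultimately show ?thesis using clinear_eq_on_span[OF _ clinear_zero_fun, of "\<lambda>p. p []" p nrels] by auto
qed

text \<open>Every relation of the enveloping algebra of \<open>n_minus\<close> has coefficient 0 at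
  the empty word, so 1 is not a relation, and freeness transfers this to the module.\<close>

lemma vac_nz: "vac \<noteq> 0"
proof
  assume "vac = 0"
  then have "word [] \<in> cvec.span (verma_rels K om)" using ker[OF word_free, of "[]"] by (simp add: flin_word)
  then have "word [] \<in> nI" by (intro free_over_n_minus word_words_on) auto
  from nI_Nil[OF this] show False by (simp add: word_def)
qed

lemma eigen_fw:
  assumes "D \<subseteq> H" "\<And>h. h \<in> D \<Longrightarrow> act h u = k h *\<^sub>C u"
  shows "u \<in> cvec.span {t \<in> range fw. \<forall>h\<in>D. act h t = k h *\<^sub>C t}"
proof (rule eigen_span_general)
  show "\<exists>a. act h t = a *\<^sub>C t" if "t \<in> range fw" "h \<in> D" for t h using that assms(1) h_fw by blast
qed (use assms act.lin_r span_fw in auto)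

lemma weight_Q:
  assumes "u \<in> weight_space K act \<kappa>" "u \<noteq> 0" "\<kappa> \<in> H"
  shows "om - \<kappa> \<in> Q_plus K"
proof -
  have "u \<in> cvec.span {t \<in> range fw. \<forall>h\<in>H. act h t = ip \<kappa> h *\<^sub>C t}"
    by (rule eigen_fw) (use assms in \<open>auto simp: weight_space_def\<close>)
  then obtain t where t: "t \<in> range fw" "t \<noteq> 0" "\<forall>h\<in>H. act h t = ip \<kappa> h *\<^sub>C t"
    using assms(2) clinear_eq_on_span[OF clinear_id_fun clinear_zero_fun] by (smt (verit) mem_Collect_eq)
  then obtain w where w: "t = fw w" by auto
  have "ip (om - (\<Sum>i\<leftarrow>w. al i)) h = ip \<kappa> h" if "h \<in> H" for h
    using t(2,3) h_fw[OF that, of w] that w by auto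
  then have "om - (\<Sum>i\<leftarrow>w. al i) = \<kappa>"
    using assms(3) om Q_in[OF Q_sum_list] by (intro H_eq) (auto intro: cvec.subspace_diff H(1))
  then have "om - \<kappa> = (\<Sum>i\<leftarrow>w. al i)" by auto
  then show ?thesis using Q_sum_list by simp
qed

lemma ht_sum_list: "ip (\<Sum>i\<leftarrow>w. al i) d = of_nat (length w)"
  by (induction w) (auto simp: ip.bisimps ip_al_d)

lemma d_fw: "act d (fw w) = (ip om d - of_nat (length w)) *\<^sub>C fw w"
  by (simp add: h_fw d_in ip.diffl ht_sum_list)

lemma finite_indep_d:
  assumes "cvec.independent S" "\<And>b. b \<in> S \<Longrightarrow> act d b = c *\<^sub>C b"
  shows "finite S"
proof -
  define T where "T = {t \<in> range fw. act d t = c *\<^sub>C t}"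
  \<comment> \<open>A nonzero word vector with eigenvalue \<open>c\<close> has length equal to
    \<open>ip om d - c\<close>; the real part and the floor only extract this number as a natural
    number.\<close>
  have "T \<subseteq> insert 0 (fw ` {w. length w = nat \<lfloor>Re (ip om d - c)\<rfloor>})"
  proof
    fix t assume "t \<in> T"
    then obtain w where w: "t = fw w" "act d t = c *\<^sub>C t" by (auto simp: T_def)
    show "t \<in> insert 0 (fw ` {w. length w = nat \<lfloor>Re (ip om d - c)\<rfloor>})"
    proof (cases "t = 0")
      case False
      then have "ip om d - of_nat (length w) = c" using d_fw[of w] w by auto
      then have "ip om d - c = of_nat (length w)" by auto
      then show ?thesis using w by auto
    qed simp
  qed
  moreover have "finite {w :: 'i list. length w = n}" for n
    using finite_lists_length_eq[of "UNIV :: 'i set" n] by simp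
  ultimately have "finite T" by (meson finite.insertI finite_imageI finite_subset)
  moreover have "S \<subseteq> cvec.span T"
  proof
    fix b assume "b \<in> S"
    then have "b \<in> cvec.span {t \<in> range fw. \<forall>h\<in>{d}. act h t = c *\<^sub>C t}"
      using assms(2) d_in by (intro eigen_fw) auto
    then show "b \<in> cvec.span T" by (simp add: T_def)
  qed
  ultimately show ?thesis using cvec.independent_span_bound[OF _ assms(1)] by blast
qed

text \<open>The dual highest weight vector is the map equivariant under \<open>n_minus\<close> into
  the one-dimensional trivial module.\<close>

lemma dual_vec_exists:
  obtains \<eta> where "clinear \<eta>" "\<eta> vac = (1::complex)" "\<And>y m. y \<in> N \<Longrightarrow> \<eta> (act y m) = 0"
proof -
  obtain \<eta> :: "'m \<Rightarrow> complex" where "clinear \<eta>" "\<eta> vac = 1" "\<And>y m. y \<in> N \<Longrightarrow> \<eta> (act y m) = (\<lambda>_. 0) (\<eta> m)"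
    using free_hom[of UNIV 1 "\<lambda>_ _. 0"] by (auto simp: clinear_zero_fun)
  then show thesis using that by blast
qed

definition vd :: "'m \<Rightarrow> complex" where "vd = (SOME \<eta>. clinear \<eta> \<and> \<eta> vac = 1 \<and> (\<forall>y\<in>N. \<forall>m. \<eta> (act y m) = 0))"

lemma vd: "clinear vd" "vd vac = 1" "y \<in> N \<Longrightarrow> vd (act y m) = 0"
proof -
  have "\<exists>\<eta>. clinear \<eta> \<and> \<eta> vac = (1::complex) \<and> (\<forall>y\<in>N. \<forall>m. \<eta> (act y m) = 0)" using dual_vec_exists by metis
  from someI_ex[OF this] show "clinear vd" "vd vac = 1" "y \<in> N \<Longrightarrow> vd (act y m) = 0"
    unfolding vd_def by blast+
qed

lemma vd_unique:
  assumes "clinear \<eta>" "\<eta> vac = (1::complex)" "\<And>w. w \<noteq> [] \<Longrightarrow> \<eta> (fw w) = 0"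
  shows "\<eta> = vd"
proof
  fix m
  have "vd (fw w) = 0" if "w \<noteq> []" for w using that vd(3) f_n_minus by (cases w) auto
  then have "\<eta> (fw w) = vd (fw w)" for w using assms vd(2) by (cases "w = []") auto
  then show "\<eta> m = vd m" using clinear_eq_on_span[OF assms(1) vd(1), of m "range fw"] span_fw by auto
qed

lemma sum_list_al_nz: "w \<noteq> [] \<Longrightarrow> (\<Sum>i\<leftarrow>w. al i) \<noteq> 0"
  using ht_sum_list[of w] by (metis ip.zerol length_0_conv of_nat_eq_0_iff)

lemma fw_weight: "fw w \<in> weight_space K act (om - (\<Sum>i\<leftarrow>w. al i))"
  by (simp add: weight_space_def h_fw)

lemma vd_weight: "u \<in> weight_space K act \<kappa> \<Longrightarrow> \<kappa> \<in> H \<Longrightarrow> \<kappa> \<noteq> om \<Longrightarrow> vd u = 0"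
proof -
  assume u: "u \<in> weight_space K act \<kappa>" "\<kappa> \<in> H" "\<kappa> \<noteq> om"
  have "vd t = 0" if t: "t \<in> {t \<in> range fw. \<forall>h\<in>H. act h t = ip \<kappa> h *\<^sub>C t}" for t
  proof -
    obtain w where w: "t = fw w" using t by auto
    show ?thesis
    proof (cases "w = []")
      case True
      have "ip om h = ip \<kappa> h" if "h \<in> H" for h
        using t that vac_nz vac_h[OF that] by (auto simp: w True)
      then show ?thesis using H_eq[OF om u(2)] u(3) by auto
    qed (use w vd(3) f_n_minus in \<open>cases w; auto\<close>)
  qed
  moreover have "u \<in> cvec.span {t \<in> range fw. \<forall>h\<in>H. act h t = ip \<kappa> h *\<^sub>C t}"
    by (rule eigen_fw) (use u in \<open>auto simp: weight_space_def\<close>)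
  ultimately show ?thesis using clinear_eq_on_span[OF vd(1) clinear_zero_fun] by blast
qed

lemma om_minus_in: "om - (\<Sum>i\<leftarrow>w. al i) \<in> H"
  by (intro cvec.subspace_diff[OF H(1)] om Q_in Q_sum_list)

lemma verma_dual_vec_eq:
  assumes "M om = act" "vc om = vac" shows "verma_dual_vec K M vc om = vd"
  unfolding verma_dual_vec_def assms
proof (rule the_equality)
  show "clinear vd \<and> vd vac = 1 \<and> (\<forall>\<kappa>\<in>H. \<kappa> \<noteq> om \<longrightarrow> (\<forall>u\<in>weight_space K act \<kappa>. vd u = 0))"
    using vd vd_weight by blast
  fix \<eta> :: "'m \<Rightarrow> complex" assume \<eta>: "clinear \<eta> \<and> \<eta> vac = 1 \<and> (\<forall>\<kappa>\<in>H. \<kappa> \<noteq> om \<longrightarrow> (\<forall>u\<in>weight_space K act \<kappa>. \<eta> u = 0))"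
  show "\<eta> = vd"
  proof (rule vd_unique)
    fix w :: "'i list" assume "w \<noteq> []"
    then have "om - (\<Sum>i\<leftarrow>w. al i) \<noteq> om" using sum_list_al_nz by auto
    then show "\<eta> (fw w) = 0" using \<eta> fw_weight om_minus_in by blast
  qed (use \<eta> in auto)
qed

lemma weight_basis_exists: "\<exists>S. weight_basis K act S"
proof -
  obtain S where S: "S \<subseteq> range fw" "cvec.independent S" "range fw \<subseteq> cvec.span S"
    using cvec.maximal_independent_subset[of "range fw"] by metis
  then have "cvec.span S = UNIV" using span_fw by (metis cvec.span_minimal cvec.subspace_span top.extremum_unique)
  moreover have "\<exists>\<kappa>\<in>H. b \<in> weight_space K act \<kappa>" if "b \<in> S" for b
    using that S(1) fw_weight om_minus_in by blast
  ultimately show ?thesis using S(2) by (auto simp: weight_basis_def)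
qed

end

section \<open>Coordinates in a weight basis\<close>

locale vec_basis =
  fixes S :: "'m::complex_vec set"
  assumes indep: "cvec.independent S" and span: "cvec.span S = UNIV"
begin

definition co :: "'m \<Rightarrow> 'm \<Rightarrow> complex" where "co b = (\<lambda>m. cvec.representation S m b)"

lemma co_lin: "clinear (co b)"
  by (intro clinearI) (simp_all add: co_def cvec.representation_add cvec.representation_scale indep span scaleC_complex_def)

lemma co_basis: "b' \<in> S \<Longrightarrow> co b b' = (if b = b' then 1 else 0)"
  by (simp add: co_def cvec.representation_basis indep)

lemma co_finite: "finite {b. co b m \<noteq> 0}"
  by (simp add: co_def cvec.finite_representation)

lemma co_in: "co b m \<noteq> 0 \<Longrightarrow> b \<in> S"
  using cvec.representation_ne_zero[of S m b] by (simp add: co_def)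

lemma co_sum: "finite A \<Longrightarrow> {b. co b m \<noteq> 0} \<subseteq> A \<Longrightarrow> m = (\<Sum>b\<in>A. co b m *\<^sub>C b)"
proof -
  assume A: "finite A" "{b. co b m \<noteq> 0} \<subseteq> A"
  have "m = (\<Sum>b | co b m \<noteq> 0. co b m *\<^sub>C b)"
    unfolding co_def by (rule cvec.sum_nonzero_representation_eq[symmetric]) (simp_all add: indep span)
  also have "\<dots> = (\<Sum>b\<in>A. co b m *\<^sub>C b)" by (rule sum.mono_neutral_left) (use A in auto)
  finally show ?thesis .
qed

lemma co_span_subset: "m \<in> cvec.span S' \<Longrightarrow> S' \<subseteq> S \<Longrightarrow> b \<notin> S' \<Longrightarrow> co b m = 0"
proof -
  assume m: "m \<in> cvec.span S'" "S' \<subseteq> S" "b \<notin> S'"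
  have "co b s = 0" if "s \<in> S'" for s using that m by (auto simp: co_basis subset_iff)
  then show ?thesis using clinear_eq_on_span[OF co_lin clinear_zero_fun m(1)] by auto
qed

lemma functional_expand:
  assumes "clinear \<eta>" "finite A" "A \<subseteq> S" "\<And>b. b \<in> S \<Longrightarrow> b \<notin> A \<Longrightarrow> \<eta> b = 0"
  shows "\<eta> = (\<lambda>m. \<Sum>b\<in>A. \<eta> b * co b m)"
proof
  fix m
  have lin: "clinear (\<lambda>m. \<Sum>b\<in>A. \<eta> b * co b m)"
    using clinear_scale_fun[OF co_lin] by (intro clinear_sum_fun) (simp add: scaleC_complex_def)
  have "\<eta> s = (\<Sum>b\<in>A. \<eta> b * co b s)" if "s \<in> S" for s
  proof -
    have "(\<Sum>b\<in>A. \<eta> b * co b s) = (\<Sum>b\<in>A. if b = s then \<eta> s else 0)"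
      by (rule sum.cong) (use that in \<open>auto simp: co_basis\<close>)
    then show ?thesis using assms(2,4) that by auto
  qed
  then show "\<eta> m = (\<Sum>b\<in>A. \<eta> b * co b m)"
    using clinear_eq_on_span[OF assms(1) lin, of m S] span by auto
qed

end

text \<open>
  Invariance of the trace: both sides are the trace of \<open>Q\<close> composed with \<open>y\<close>, computed on
  the blocks \<open>A\<close> and \<open>A'\<close> of two bases.
\<close>

lemma trace_cyclic:
  fixes Q :: "('m::complex_vec \<Rightarrow> complex) \<Rightarrow> 'n::complex_vec \<Rightarrow> 'w::complex_vec"
  assumes "vec_basis S" "vec_basis S'" and y: "clinear (y :: 'm \<Rightarrow> 'n)"
    and A: "finite A" "A \<subseteq> S" and A': "finite A'" "A' \<subseteq> S'"
    and in_blk: "\<And>b b'. b \<in> A \<Longrightarrow> b' \<notin> A' \<Longrightarrow> vec_basis.co S' b' (y b) = 0"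
    and out: "\<And>b b'. b \<in> S \<Longrightarrow> b \<notin> A \<Longrightarrow> b' \<in> A' \<Longrightarrow> vec_basis.co S' b' (y b) = 0"
    and Q1: "\<And>\<eta>. clinear \<eta> \<Longrightarrow> clinear (Q \<eta>)"
    and Q2: "\<And>\<eta> \<eta>' n. clinear \<eta> \<Longrightarrow> clinear \<eta>' \<Longrightarrow> Q (\<lambda>m. \<eta> m + \<eta>' m) n = Q \<eta> n + Q \<eta>' n"
      "\<And>c \<eta> n. clinear \<eta> \<Longrightarrow> Q (\<lambda>m. c * \<eta> m) n = c *\<^sub>C Q \<eta> n"
  shows "(\<Sum>b\<in>A. Q (vec_basis.co S b) (y b)) = (\<Sum>b'\<in>A'. Q (\<lambda>m. vec_basis.co S' b' (y m)) b')"
proof -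
  interpret s: vec_basis S by (rule assms(1))
  interpret s': vec_basis S' by (rule assms(2))
  have Q0: "Q (\<lambda>m. 0) n = 0" for n using Q2(2)[of "\<lambda>_. 0" 0 n] by (simp add: clinear_zero_fun)
  have Qsum: "Q (\<lambda>m. \<Sum>b\<in>B. c b * s.co b m) n = (\<Sum>b\<in>B. c b *\<^sub>C Q (s.co b) n)" if "finite B" for B c n
    using that
  proof (induction B)
    case (insert b B)
    have "clinear (\<lambda>m. c b * s.co b m)" "clinear (\<lambda>m. \<Sum>b\<in>B. c b * s.co b m)"
      using clinear_scale_fun[OF s.co_lin] by (auto intro!: clinear_sum_fun simp: scaleC_complex_def)
    then show ?case using insert by (simp add: Q2 s.co_lin)
  qed (simp add: Q0)
  have "(\<Sum>b\<in>A. Q (s.co b) (y b)) = (\<Sum>b\<in>A. \<Sum>b'\<in>A'. s'.co b' (y b) *\<^sub>C Q (s.co b) b')"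
  proof (rule sum.cong[OF refl])
    fix b assume b: "b \<in> A"
    have "y b = (\<Sum>b'\<in>A'. s'.co b' (y b) *\<^sub>C b')" by (rule s'.co_sum[OF A'(1)]) (use in_blk[OF b] in auto)
    then have "Q (s.co b) (y b) = Q (s.co b) (\<Sum>b'\<in>A'. s'.co b' (y b) *\<^sub>C b')" by simp
    also have "\<dots> = (\<Sum>b'\<in>A'. s'.co b' (y b) *\<^sub>C Q (s.co b) b')"
      by (simp add: clinear_sum[OF Q1[OF s.co_lin]] clinear_scale[OF Q1[OF s.co_lin]])
    finally show "Q (s.co b) (y b) = (\<Sum>b'\<in>A'. s'.co b' (y b) *\<^sub>C Q (s.co b) b')" .
  qed
  also have "\<dots> = (\<Sum>b'\<in>A'. \<Sum>b\<in>A. s'.co b' (y b) *\<^sub>C Q (s.co b) b')" by (rule sum.swap)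
  also have "\<dots> = (\<Sum>b'\<in>A'. Q (\<lambda>m. s'.co b' (y m)) b')"
  proof (rule sum.cong[OF refl])
    fix b' assume b': "b' \<in> A'"
    have "(\<lambda>m. s'.co b' (y m)) = (\<lambda>m. \<Sum>b\<in>A. s'.co b' (y b) * s.co b m)"
      by (rule s.functional_expand[OF clinear_compose[OF y s'.co_lin] A]) (use out b' in auto)
    then show "(\<Sum>b\<in>A. s'.co b' (y b) *\<^sub>C Q (s.co b) b') = Q (\<lambda>m. s'.co b' (y m)) b'"
      using Qsum[OF A(1)] by simp
  qed
  finally show ?thesis .
qed

section \<open>Tensor products\<close>

lemma tlift_lin: "clinear (tlift g)"
  by (intro clinearI) (simp_all add: tlift_def fun_eq_iff scaleC_fun_def)

lemma on_factor_lin: "clinear (on_factor i X)" unfolding on_factor_def by (rule tlift_lin)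
lemma contract_lin: "clinear (contract \<eta>)" unfolding contract_def by (rule tlift_lin)
lemma mtens_act_lin: "clinear (mtens_act actM actV x)" unfolding mtens_act_def by (rule tlift_lin)
lemma apply_first_lin: "clinear (apply_first \<Phi>)" unfolding apply_first_def by (rule tlift_lin)

lemma eval_at_lin:
  assumes "\<And>\<phi>. P \<phi> \<Longrightarrow> clinear (\<lambda>u. \<phi> (k u))"
  shows "clinear (\<lambda>u. eval_at P (k u))"
  by (intro clinearI)
    (auto simp: eval_at_def fun_eq_iff scaleC_fun_def clinear_add[OF assms] clinear_scale[OF assms])

lemma mpure_lin: "clinear (\<lambda>m. mpure m ws)"
  unfolding mpure_def by (rule eval_at_lin) (simp add: mmultilinear_def)

lemma mpure_multilinear: "multilinear (mpure m)"
  unfolding multilinear_def mpure_def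
  by (intro allI impI eval_at_lin) (auto simp: mmultilinear_def multilinear_def)

lemma mpure_lin_single: "clinear (\<lambda>u. mpure m [u])"
  using mpure_multilinear[of m] unfolding multilinear_def by (auto dest: spec[of _ "[undefined]"])

lemma pure_lin_single: "clinear (\<lambda>u. pure [u])"
  using multilinear_pure unfolding multilinear_def by (auto dest: spec[of _ "[undefined]"])

lemma clinear_eval: "clinear (\<lambda>\<xi> :: 'a \<Rightarrow> 'b::complex_vec. \<xi> \<phi>)"
  by (intro clinearI) (simp_all add: scaleC_fun_def)

lemma multilinear_eval: "multilinear g \<Longrightarrow> multilinear (\<lambda>ws. g ws \<phi>)"
  by (rule multilinear_compose[where \<theta> = "\<lambda>\<xi>. \<xi> \<phi>", OF _ clinear_eval])

text \<open>Lists of all lengths share one tensor type; \<open>mspan r\<close> and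
  \<open>tspan r\<close> cut out the tensors with exactly \<open>r\<close> vector factors.\<close>

definition mspan :: "nat \<Rightarrow> ('m::complex_vec, 'v::complex_vec) mtens set"
  where "mspan r = cvec.span {mpure m ws | m ws. length ws = r}"

definition tspan :: "nat \<Rightarrow> 'v::complex_vec tens set"
  where "tspan r = cvec.span {pure ws | ws. length ws = r}"

lemma subspace_mspan: "cvec.subspace (mspan r)" and subspace_tspan: "cvec.subspace (tspan r)"
  by (simp_all add: mspan_def tspan_def)

lemma mspan_mpure: "mspan r \<subseteq> cvec.span (range (case_prod mpure))"
  unfolding mspan_def by (rule cvec.span_mono) auto

lemma mpure_mspan: "length ws = r \<Longrightarrow> mpure m ws \<in> mspan r"
  by (auto simp: mspan_def intro: cvec.span_base)

lemma pure_tspan: "length ws = r \<Longrightarrow> pure ws \<in> tspan r"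
  by (auto simp: tspan_def intro: cvec.span_base)

lemma mspan_eq:
  assumes "clinear F" "clinear G" "\<xi> \<in> mspan r" "\<And>m ws. length ws = r \<Longrightarrow> F (mpure m ws) = G (mpure m ws)"
  shows "F \<xi> = G \<xi>"
  using assms(3) unfolding mspan_def by (rule clinear_eq_on_span[OF assms(1,2)]) (use assms(4) in auto)

lemma tspan_eq:
  assumes "clinear F" "clinear G" "\<xi> \<in> tspan r" "\<And>ws. length ws = r \<Longrightarrow> F (pure ws) = G (pure ws)"
  shows "F \<xi> = G \<xi>"
  using assms(3) unfolding tspan_def by (rule clinear_eq_on_span[OF assms(1,2)]) (use assms(4) in auto)

lemma contract_tspan: "clinear \<eta> \<Longrightarrow> \<xi> \<in> mspan r \<Longrightarrow> contract \<eta> \<xi> \<in> tspan r"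
  unfolding mspan_def
  by (rule clinear_span_subspace[OF contract_lin _ subspace_tspan])
    (auto simp: contract_mpure intro!: cvec.subspace_scale subspace_tspan pure_tspan)

lemma contract_add: "clinear \<eta> \<Longrightarrow> clinear \<eta>' \<Longrightarrow> \<xi> \<in> mspan r \<Longrightarrow> contract (\<lambda>m. \<eta> m + \<eta>' m) \<xi> = contract \<eta> \<xi> + contract \<eta>' \<xi>"
  by (rule mspan_eq[OF contract_lin clinear_add_fun[OF contract_lin contract_lin]])
    (simp_all add: contract_mpure clinear_add_fun scaleC_add_left)

lemma contract_scale: "clinear \<eta> \<Longrightarrow> \<xi> \<in> mspan r \<Longrightarrow> contract (\<lambda>m. c * \<eta> m) \<xi> = c *\<^sub>C contract \<eta> \<xi>"
proof (rule mspan_eq[OF contract_lin clinear_scale_fun[OF contract_lin]])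
  assume "clinear \<eta>"
  moreover from clinear_scale_fun[OF this, of c] have "clinear (\<lambda>m. c * \<eta> m)" by (simp add: scaleC_complex_def)
  ultimately show "contract (\<lambda>m. c * \<eta> m) (mpure m ws) = c *\<^sub>C contract \<eta> (mpure m ws)" for m ws
    by (simp add: contract_mpure)
qed

text \<open>Total action on the tensor factors. An update outside a list leaves it unchanged, so
  \<open>on_factor\<close> beyond the length is the identity and not zero; hence linearity in
  \<open>x\<close> and the bracket rule below are stated on \<open>tspan r\<close>.\<close>

definition wact :: "('g \<Rightarrow> 'v \<Rightarrow> 'v) \<Rightarrow> nat \<Rightarrow> 'g \<Rightarrow> 'v::complex_vec tens \<Rightarrow> 'v tens"
  where "wact act r x \<xi> = (\<Sum>l<r. on_factor l (act x) \<xi>)"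

lemma wact_lin: "clinear (wact act r x)"
  unfolding wact_def by (intro clinear_sum_fun on_factor_lin)

context
  fixes act :: "'g::complex_vec \<Rightarrow> 'v \<Rightarrow> 'v::complex_vec"
  assumes bil: "cbilinear act"
begin

lemma act_r: "clinear (act x)" and act_l: "clinear (\<lambda>x. act x u)" using bil by (auto simp: cbilinear_def)

lemma on_factor_pure': "on_factor i (act x) (pure ws) = pure (ws[i := act x (ws ! i)])"
  by (rule on_factor_pure[OF act_r])

lemma pure_act_lin: "i < length ws \<Longrightarrow> clinear (\<lambda>x. pure (ws[i := act x (ws ! i)]))"
  by (rule clinear_compose[OF act_l[of "ws ! i"], of "\<lambda>u. pure (ws[i := u])"])
    (rule multilinear_pure[unfolded multilinear_def, rule_format])

lemma on_factor_tspan: "\<xi> \<in> tspan r \<Longrightarrow> on_factor i (act x) \<xi> \<in> tspan r"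
  unfolding tspan_def
  by (rule clinear_span_image[OF on_factor_lin]) (auto simp: on_factor_pure' intro!: cvec.span_base)

lemma wact_tspan: "\<xi> \<in> tspan r \<Longrightarrow> wact act r x \<xi> \<in> tspan r"
  unfolding wact_def by (intro cvec.subspace_sum subspace_tspan on_factor_tspan)

lemma wact_add: "\<xi> \<in> tspan r \<Longrightarrow> wact act r (x + y) \<xi> = wact act r x \<xi> + wact act r y \<xi>"
  by (rule tspan_eq[OF wact_lin clinear_add_fun[OF wact_lin wact_lin]])
    (assumption, simp add: wact_def on_factor_pure' clinear_add[OF pure_act_lin] flip: sum.distrib)

lemma wact_scale: "\<xi> \<in> tspan r \<Longrightarrow> wact act r (c *\<^sub>C x) \<xi> = c *\<^sub>C wact act r x \<xi>"
  by (rule tspan_eq[OF wact_lin clinear_scale_fun[OF wact_lin]])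
    (assumption, simp add: wact_def on_factor_pure' clinear_scale[OF pure_act_lin] cvec.scale_sum_right)

lemma wact_wact: "wact act r x (wact act r y \<xi>) = (\<Sum>l<r. \<Sum>n<r. on_factors act l n x y \<xi>)"
  by (simp add: wact_def on_factors_def clinear_sum[OF on_factor_lin])

text \<open>Operators in different positions commute, so only the diagonal terms of the double sum
  survive in the commutator.\<close>

lemma wact_br:
  assumes br: "\<And>u. act (b x y) u = act x (act y u) - act y (act x u)"
  shows "\<xi> \<in> tspan r \<Longrightarrow> wact act r (b x y) \<xi> = wact act r x (wact act r y \<xi>) - wact act r y (wact act r x \<xi>)"
proof (rule tspan_eq[OF wact_lin])
  show "clinear (\<lambda>\<xi>. wact act r x (wact act r y \<xi>) - wact act r y (wact act r x \<xi>))"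
    by (intro clinearI) (simp_all add: clinear_add[OF wact_lin] clinear_scale[OF wact_lin] cvec.scale_right_diff_distrib)
  fix ws :: "'v list" assume ws: "length ws = r"
  have *: "wact act r x (wact act r y (pure ws)) = (\<Sum>l<r. \<Sum>n<r. pure ((ws[n := act y (ws ! n)])[l := act x (ws[n := act y (ws ! n)] ! l)]))" for x y
    unfolding wact_wact on_factors_def on_factor_pure' ..
  have "wact act r x (wact act r y (pure ws)) - wact act r y (wact act r x (pure ws))
      = (\<Sum>l<r. \<Sum>n<r. pure ((ws[n := act y (ws ! n)])[l := act x (ws[n := act y (ws ! n)] ! l)])
          - pure ((ws[l := act x (ws ! l)])[n := act y (ws[l := act x (ws ! l)] ! n)]))"
    unfolding * by (subst (2) sum.swap) (simp add: sum_subtractf)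
  also have "\<dots> = (\<Sum>l<r. \<Sum>n<r. if n = l then pure (ws[l := act (b x y) (ws ! l)]) else 0)"
  proof (intro sum.cong refl)
    fix l n assume ln: "l \<in> {..<r}" "n \<in> {..<r}"
    show "pure ((ws[n := act y (ws ! n)])[l := act x (ws[n := act y (ws ! n)] ! l)])
          - pure ((ws[l := act x (ws ! l)])[n := act y (ws[l := act x (ws ! l)] ! n)])
        = (if n = l then pure (ws[l := act (b x y) (ws ! l)]) else 0)"
    proof (cases "n = l")
      case True
      have "clinear (\<lambda>u. pure (ws[l := u]))" using multilinear_pure ln ws unfolding multilinear_def by blast
      from clinear_diff[OF this] show ?thesis using True ln ws by (simp add: br)
    next
      case False
      then show ?thesis using ln ws by (simp add: list_update_swap)
    qed
  qed
  also have "\<dots> = wact act r (b x y) (pure ws)" by (simp add: wact_def on_factor_pure')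
  finally show "wact act r (b x y) (pure ws) = wact act r x (wact act r y (pure ws)) - wact act r y (wact act r x (pure ws))" ..
qed

lemma mtens_act_mspan:
  fixes \<xi> :: "('m::complex_vec, 'v) mtens"
  shows "\<xi> \<in> mspan r \<Longrightarrow> clinear (actM x) \<Longrightarrow> mtens_act actM act x \<xi> \<in> mspan r"
proof (rule clinear_span_subspace[OF mtens_act_lin _ subspace_mspan])
  show "\<xi> \<in> mspan r \<Longrightarrow> \<xi> \<in> cvec.span {mpure m ws | m ws. length ws = r}" by (simp add: mspan_def)
  fix s :: "('m, 'v) mtens"
  assume M: "clinear (actM x)" and "s \<in> {mpure m ws | m ws. length ws = r}"
  then obtain m ws where s: "s = mpure m ws" "length ws = r" by blast
  then show "mtens_act actM act x s \<in> mspan r"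
    by (auto simp: mtens_act_mpure M act_r intro!: cvec.subspace_add cvec.subspace_sum subspace_mspan mpure_mspan)
qed

text \<open>The form in which intertwining enters the traces: after contraction of the module
  factor, the action on the product splits into the transposed action on the functional and the
  action on the remaining factors.\<close>

lemma contract_mtens_act:
  assumes "\<xi> \<in> mspan r" "clinear \<eta>" "clinear (actM x)"
  shows "contract \<eta> (mtens_act actM act x \<xi>) = contract (\<lambda>m. \<eta> (actM x m)) \<xi> + wact act r x (contract \<eta> \<xi>)"
proof (rule mspan_eq[OF _ _ assms(1)])
  show "clinear (\<lambda>\<xi>. contract \<eta> (mtens_act actM act x \<xi>))"
    by (rule clinear_compose[of "mtens_act actM act x" "contract \<eta>", OF mtens_act_lin contract_lin])
  show "clinear (\<lambda>\<xi>. contract (\<lambda>m. \<eta> (actM x m)) \<xi> + wact act r x (contract \<eta> \<xi>))"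
    by (intro clinear_add_fun contract_lin clinear_compose[OF contract_lin wact_lin])
  fix m and ws :: "'v list" assume "length ws = r"
  then show "contract \<eta> (mtens_act actM act x (mpure m ws)) = contract (\<lambda>m. \<eta> (actM x m)) (mpure m ws) + wact act r x (contract \<eta> (mpure m ws))"
    by (simp add: mtens_act_mpure act_r assms clinear_add[OF contract_lin] clinear_sum[OF contract_lin] contract_mpure
        clinear_compose[OF assms(3,2)] clinear_scale[OF wact_lin])
      (simp add: wact_def on_factor_pure' cvec.scale_sum_right)
qed

definition join :: "'v list \<Rightarrow> ('m::complex_vec, 'v) mtens \<Rightarrow> ('m, 'v) mtens"
  where "join ws = tlift (\<lambda>(m, us). mpure m (us @ ws))"

lemma join_mpure: "join ws (mpure (m :: 'm::complex_vec) us) = mpure m (us @ ws)"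
proof -
  have "mmultilinear (\<lambda>y. (case y of (m, us) \<Rightarrow> mpure m (us @ ws)) \<phi>)" for \<phi> :: "'m \<times> 'v list \<Rightarrow> complex"
    unfolding mmultilinear_def
    by (simp add: multilinear_eval[OF multilinear_append(1)[OF mpure_multilinear]] clinear_compose[OF mpure_lin clinear_eval])
  then show ?thesis
    unfolding join_def by (subst (2) mpure_def) (subst tlift_eval_at; simp add: case_prod_unfold)
qed

lemma join_lin: "clinear (join ws)" unfolding join_def by (rule tlift_lin)

lemma join_mspan: "\<xi> \<in> mspan n \<Longrightarrow> join ws \<xi> \<in> mspan (n + length ws)"
  unfolding mspan_def[of n]
  by (rule clinear_span_subspace[OF join_lin _ subspace_mspan]) (auto simp: join_mpure intro!: mpure_mspan)

lemma join_act:
  fixes \<zeta> :: "('m::complex_vec, 'v) mtens"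
  assumes M: "\<And>x. clinear (actM x)" and \<zeta>: "\<zeta> \<in> mspan n"
  shows "mtens_act actM act x (join ws \<zeta>) =
    join ws (mtens_act actM act x \<zeta>) + (\<Sum>i<length ws. join (ws[i := act x (ws ! i)]) \<zeta>)"
proof (rule mspan_eq[OF _ _ \<zeta>])
  show "clinear (\<lambda>\<zeta>. mtens_act actM act x (join ws \<zeta>))" by (rule clinear_compose[OF join_lin mtens_act_lin])
  show "clinear (\<lambda>\<zeta>. join ws (mtens_act actM act x \<zeta>) + (\<Sum>i<length ws. join (ws[i := act x (ws ! i)]) \<zeta>))"
    by (intro clinear_add_fun clinear_sum_fun join_lin clinear_compose[OF mtens_act_lin join_lin])
  fix m :: 'm and us :: "'v list"
  have "(\<Sum>i<length us + length ws. mpure m ((us @ ws)[i := act x ((us @ ws) ! i)]))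
      = (\<Sum>i<length us. mpure m (us[i := act x (us ! i)] @ ws)) + (\<Sum>i<length ws. mpure m (us @ ws[i := act x (ws ! i)]))"
  proof -
    have split: "(\<Sum>i<a + b. g i) = (\<Sum>i<a. g i) + (\<Sum>i<b. g (a + i))" for a b and g :: "nat \<Rightarrow> ('m, 'v) mtens"
      by (induction b) (simp_all add: add.assoc)
    show ?thesis unfolding split by (simp add: nth_append list_update_append)
  qed
  then show "mtens_act actM act x (join ws (mpure m us)) =
      join ws (mtens_act actM act x (mpure m us)) + (\<Sum>i<length ws. join (ws[i := act x (ws ! i)]) (mpure m us))"
    by (simp add: join_mpure mtens_act_mpure M act_r clinear_add[OF join_lin] clinear_sum[OF join_lin])
qed

lemma apply_first_join:
  fixes \<Phi> :: "'m::complex_vec \<Rightarrow> ('m, 'v) mtens"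
  assumes "clinear \<Phi>" "\<And>m. \<Phi> m \<in> mspan 1"
  shows "apply_first \<Phi> (mpure m ws) = join ws (\<Phi> m)"
  using apply_first_mpure[of \<Phi> m ws] assms mspan_mpure by (auto simp: join_def)

lemma apply_first_mspan:
  fixes \<Phi> :: "'m::complex_vec \<Rightarrow> ('m, 'v) mtens"
  assumes "clinear \<Phi>" "\<And>m. \<Phi> m \<in> mspan 1" "\<xi> \<in> mspan n"
  shows "apply_first \<Phi> \<xi> \<in> mspan (Suc n)"
  using assms(3) unfolding mspan_def[of n]
  by (rule clinear_span_subspace[OF apply_first_lin _ subspace_mspan])
    (use join_mspan[of "\<Phi> _" 1, OF assms(2)] in \<open>auto simp: apply_first_join[OF assms(1,2)]\<close>)

text \<open>On a pure tensor the factors produced by \<open>\<Phi>\<close> and those already present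
  receive separate parts of the action; \<open>join_act\<close> adds them up.\<close>

lemma apply_first_act:
  fixes \<Phi> :: "'m::complex_vec \<Rightarrow> ('m, 'v) mtens"
  assumes \<Phi>: "clinear \<Phi>" "\<And>m. \<Phi> m \<in> mspan 1" and M: "\<And>x. clinear (M1 x)" "\<And>x. clinear (M2 x)"
    and eq: "\<And>x m. \<Phi> (M1 x m) = mtens_act M2 act x (\<Phi> m)" and \<xi>: "\<xi> \<in> mspan n"
  shows "apply_first \<Phi> (mtens_act M1 act x \<xi>) = mtens_act M2 act x (apply_first \<Phi> \<xi>)"
proof (rule mspan_eq[OF _ _ \<xi>])
  show "clinear (\<lambda>\<xi>. apply_first \<Phi> (mtens_act M1 act x \<xi>))" "clinear (\<lambda>\<xi>. mtens_act M2 act x (apply_first \<Phi> \<xi>))"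
    by (rule clinear_compose[of "mtens_act M1 act x" "apply_first \<Phi>", OF mtens_act_lin apply_first_lin],
        rule clinear_compose[of "apply_first \<Phi>" "mtens_act M2 act x", OF apply_first_lin mtens_act_lin])
  show "apply_first \<Phi> (mtens_act M1 act x (mpure m ws)) = mtens_act M2 act x (apply_first \<Phi> (mpure m ws))" for m ws
    by (simp add: mtens_act_mpure M act_r clinear_add[OF apply_first_lin] clinear_sum[OF apply_first_lin]
        apply_first_join[OF \<Phi>] join_act[OF M(2) \<Phi>(2)] eq)
qed

end

definition ins :: "'m::complex_vec \<Rightarrow> 'v::complex_vec tens \<Rightarrow> ('m, 'v) mtens"
  where "ins b = tlift (\<lambda>ws. mpure b ws)"

lemma ins_lin: "clinear (ins b)" unfolding ins_def by (rule tlift_lin)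

lemma ins_pure: "ins b (pure ws) = mpure b ws"
  unfolding ins_def pure_def by (rule tlift_eval_at) (rule multilinear_eval[OF mpure_multilinear])

text \<open>Expansion of the module factor in the basis. The set of basis vectors may be enlarged
  freely, because the induction adds tensors that need different sets.\<close>

lemma (in vec_basis) mspan_expand:
  fixes \<xi> :: "('m, 'v::complex_vec) mtens"
  assumes "\<xi> \<in> mspan r"
  shows "\<exists>B. finite B \<and> (\<forall>B'. finite B' \<and> B \<subseteq> B' \<longrightarrow> \<xi> = (\<Sum>b\<in>B'. ins b (contract (co b) \<xi>)))"
  using assms unfolding mspan_def
proof (induction rule: cvec.span_induct_alt)
  case base
  have "(0 :: ('m, 'v) mtens) = (\<Sum>b\<in>B'. ins b (contract (co b) 0))" for B'
    by (simp add: clinear_zero[OF contract_lin] clinear_zero[OF ins_lin])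
  then show ?case by (intro exI[of _ "{}"]) (simp add: zero_fun_def)
next
  case (step c x \<zeta>)
  then obtain m ws where x: "x = mpure m ws" by auto
  obtain B where B: "finite B" "\<And>B'. finite B' \<Longrightarrow> B \<subseteq> B' \<Longrightarrow> \<zeta> = (\<Sum>b\<in>B'. ins b (contract (co b) \<zeta>))"
    using step by metis
  let ?B = "B \<union> {b. co b m \<noteq> 0}"
  have "c *\<^sub>C x + \<zeta> = (\<Sum>b\<in>B'. ins b (contract (co b) (c *\<^sub>C x + \<zeta>)))" if "finite B'" "?B \<subseteq> B'" for B'
  proof -
    have "x = (\<Sum>b\<in>B'. ins b (contract (co b) x))"
    proof -
      have "m = (\<Sum>b\<in>B'. co b m *\<^sub>C b)" by (rule co_sum) (use that in auto)
      then have "mpure m ws = mpure (\<Sum>b\<in>B'. co b m *\<^sub>C b) ws" by (rule arg_cong)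
      also have "\<dots> = (\<Sum>b\<in>B'. co b m *\<^sub>C mpure b ws)"
        by (simp add: clinear_sum[OF mpure_lin] clinear_scale[OF mpure_lin])
      finally have 1: "(\<Sum>b\<in>B'. co b m *\<^sub>C mpure b ws) = mpure m ws" ..
      have 2: "ins b (contract (co b) (mpure m ws)) = co b m *\<^sub>C mpure b ws" for b
        by (simp add: contract_mpure co_lin clinear_scale[OF ins_lin] ins_pure)
      show ?thesis unfolding x 2 1 ..
    qed
    moreover have "\<zeta> = (\<Sum>b\<in>B'. ins b (contract (co b) \<zeta>))" by (rule B(2)) (use that in auto)
    moreover have "(\<Sum>b\<in>B'. ins b (contract (co b) (c *\<^sub>C x + \<zeta>)))
        = c *\<^sub>C (\<Sum>b\<in>B'. ins b (contract (co b) x)) + (\<Sum>b\<in>B'. ins b (contract (co b) \<zeta>))"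
      by (simp add: clinear_add[OF contract_lin] clinear_scale[OF contract_lin] clinear_add[OF ins_lin] clinear_scale[OF ins_lin]
          sum.distrib cvec.scale_sum_right)
    ultimately show ?thesis by simp
  qed
  then show ?case using B(1) co_finite[of m] by (intro exI[of _ ?B]) (simp add: plus_fun_def)
qed

text \<open>Allows identities between tensors with a module factor to be checked by contracting with
  coordinate functionals.\<close>

lemma (in vec_basis) mspan_separate:
  assumes "\<xi> \<in> mspan r" "\<And>b. b \<in> S \<Longrightarrow> contract (co b) \<xi> = 0"
  shows "\<xi> = 0"
proof -
  obtain B where "finite B" "\<xi> = (\<Sum>b\<in>B. ins b (contract (co b) \<xi>))" using mspan_expand[OF assms(1)] by blast
  moreover have "contract (co b) \<xi> = 0" for b
  proof (cases "b \<in> S")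
    case False
    then have "co b = (\<lambda>_. 0)" using co_in by fastforce
    then have "contract (co b) \<xi> = contract (\<lambda>m. 0 * co b m) \<xi>" by simp
    then show ?thesis using contract_scale[OF co_lin assms(1), of 0] by simp
  qed (rule assms(2))
  ultimately show ?thesis by (simp add: clinear_zero[OF ins_lin])
qed

section \<open>The Shapovalov form and intertwiners\<close>

context verma begin

text \<open>The dual action twisted by the Chevalley involution. The twist turns the dual highest
  weight vector, which is a lowest weight vector, into a highest weight vector of weight
  \<open>om\<close>.\<close>

definition chiR :: "'g \<Rightarrow> ('m \<Rightarrow> complex) \<Rightarrow> 'm \<Rightarrow> complex" where "chiR x \<eta> = (\<lambda>u. - \<eta> (act (chv x) u))"

lemma vd_h: "h \<in> H \<Longrightarrow> vd (act h m) = ip om h * vd m"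
  by (induction m rule: verma_induct)
    (simp_all add: act.bisimps vac_h h_act_f vd f_n_minus clinear_add[OF vd(1)] clinear_scale[OF vd(1)] clinear_zero[OF vd(1)]
      clinear_diff[OF vd(1)] scaleC_complex_def algebra_simps)

text \<open>By the twist the universal property applies and yields a module map from the Verma
  module to its twisted dual; read as a form in two arguments this is the Shapovalov form.\<close>

lemma shapovalov_exists:
  obtains \<psi> where "clinear \<psi>" "\<psi> vac = vd" "\<And>m. clinear (\<psi> m)" "\<And>x m. \<psi> (act x m) = chiR x (\<psi> m)"
proof -
  obtain \<psi> where "clinear \<psi>" "\<psi> vac = vd" "\<And>m. \<psi> m \<in> {\<eta> :: 'm \<Rightarrow> complex. clinear \<eta>}" "\<And>x m. \<psi> (act x m) = chiR x (\<psi> m)"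
  proof (rule hom[of "{\<eta> :: 'm \<Rightarrow> complex. clinear \<eta>}" vd chiR])
    show "cvec.subspace {\<eta> :: 'm \<Rightarrow> complex. clinear \<eta>}"
      unfolding cvec.subspace_def
      by (auto simp: zero_fun_def plus_fun_def scaleC_fun_def clinear_zero_fun clinear_add_fun clinear_scale_fun)
    show "chiR y u \<in> {\<eta>. clinear \<eta>}" if "u \<in> {\<eta>. clinear \<eta>}" for y u
      using clinear_scale_fun[OF clinear_compose[OF act.lin_r[of "chv y"], of u], of "-1"] that
      by (simp add: chiR_def scaleC_complex_def)
    show "clinear (chiR y)" for y
      by (intro clinearI) (simp_all add: chiR_def fun_eq_iff scaleC_fun_def scaleC_complex_def)
    show "chiR (x + y) u = chiR x u + chiR y u" if "u \<in> {\<eta>. clinear \<eta>}" for x y u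
      using that by (auto simp: chiR_def clinear_add[OF chv_lin] act.addl clinear_add)
    show "chiR (c *\<^sub>C x) u = c *\<^sub>C chiR x u" if "u \<in> {\<eta>. clinear \<eta>}" for c x u
      using that by (auto simp: chiR_def clinear_scale[OF chv_lin] act.scalel clinear_scale scaleC_fun_def scaleC_complex_def)
    show "chiR (lie K x y) u = chiR x (chiR y u) - chiR y (chiR x u)" if "u \<in> {\<eta>. clinear \<eta>}" for x y u
      using that by (auto simp: chiR_def chv_br act_br clinear_diff)
    show "chiR (e i) vd = 0" for i
      by (auto simp: chiR_def chv_e act.minusl clinear_minus[OF vd(1)] vd(3) f_n_minus)
    show "chiR h vd = ip om h *\<^sub>C vd" if "h \<in> H" for h
      using that by (auto simp: chiR_def chv_H act.minusl clinear_minus[OF vd(1)] vd_h scaleC_fun_def scaleC_complex_def)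
  qed (use vd(1) in auto)
  then show thesis using that by auto
qed

definition chi :: "'m \<Rightarrow> 'm \<Rightarrow> complex" where
  "chi = (SOME \<psi>. clinear \<psi> \<and> \<psi> vac = vd \<and> (\<forall>m. clinear (\<psi> m)) \<and> (\<forall>x m. \<psi> (act x m) = chiR x (\<psi> m)))"

lemma chi: "clinear chi" "chi vac = vd" "clinear (chi m)" "chi (act x m) = chiR x (chi m)"
proof -
  have "\<exists>\<psi>. clinear \<psi> \<and> \<psi> vac = vd \<and> (\<forall>m. clinear (\<psi> m)) \<and> (\<forall>x m. \<psi> (act x m) = chiR x (\<psi> m))"
    using shapovalov_exists by metis
  from someI_ex[OF this] show "clinear chi" "chi vac = vd" "clinear (chi m)" "chi (act x m) = chiR x (chi m)"
    unfolding chi_def by blast+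
qed

lemma chi_f: "chi (act (f i) m) = (\<lambda>u. chi m (act (e i) u))"
  by (simp add: chi(4) chiR_def chv_f act.minusl clinear_minus[OF chi(3)])

lemma chi_h: "h \<in> H \<Longrightarrow> chi (act h m) = (\<lambda>u. chi m (act h u))"
  by (simp add: chi(4) chiR_def chv_H act.minusl clinear_minus[OF chi(3)])

lemma chi_e: "chi (act (e i) m) = (\<lambda>u. chi m (act (f i) u))"
  by (simp add: chi(4) chiR_def chv_e act.minusl clinear_minus[OF chi(3)])

lemma chi_simps: "chi 0 = 0" "chi (a + b) = chi a + chi b" "chi (c *\<^sub>C a) = c *\<^sub>C chi a"
  by (simp_all add: clinear_zero[OF chi(1)] clinear_add[OF chi(1)] clinear_scale[OF chi(1)])

text \<open>The operators of \<open>e i\<close> and \<open>f i\<close> are adjoint to each other for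
  the form, so the letters of a word can be moved to the other argument; for the highest weight
  vector both sides are its coefficient in the other argument.\<close>

lemma chi_sym: "chi m m' = chi m' m"
proof -
  have 1: "vd m' = chi m' vac" for m'
  proof (induction m' rule: verma_induct)
    case (f i m)
    then show ?case by (simp add: vd(3) f_n_minus chi_f vac_n e_n_plus clinear_zero[OF chi(3)])
  qed (simp_all add: clinear_zero[OF vd(1)] clinear_add[OF vd(1)] clinear_scale[OF vd(1)] chi_simps vd chi(2) scaleC_fun_def)
  have "\<forall>m'. chi m m' = chi m' m"
  proof (induction m rule: verma_induct)
    case (f i m)
    show ?case
    proof
      fix m'
      have "chi (act (gen_f K i) m) m' = chi m (act (e i) m')" by (simp add: chi_f)
      also have "\<dots> = chi (act (e i) m') m" using f by simp
      also have "\<dots> = chi m' (act (gen_f K i) m)" by (simp add: chi_e)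
      finally show "chi (act (gen_f K i) m) m' = chi m' (act (gen_f K i) m)" .
    qed
  qed (simp_all add: chi_simps clinear_zero[OF chi(3)] clinear_add[OF chi(3)] clinear_scale[OF chi(3)] 1 chi(2) scaleC_fun_def)
  then show ?thesis by blast
qed

lemma e_weight: "u \<in> weight_space K act \<kappa> \<Longrightarrow> act (e i) u \<in> weight_space K act (\<kappa> + al i)"
  unfolding weight_space_def
proof safe
  fix h assume u: "\<forall>h\<in>H. act h u = ip \<kappa> h *\<^sub>C u" and h: "h \<in> H"
  have "act h (act (e i) u) = act (e i) (act h u) + act (br h (e i)) u" using act_br[of h "e i" u] by simp
  then show "act h (act (e i) u) = ip (\<kappa> + al i) h *\<^sub>C act (e i) u"
    using u h by (simp add: he sroot_al act.scaler act.scalel ip.addl scaleC_add_left)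
qed

lemma subspace_gd: "cvec.subspace (graded_dual K act)"
  unfolding cvec.subspace_def graded_dual_def
proof (safe, goal_cases)
  case 1 show ?case by (simp add: zero_fun_def clinear_zero_fun)
next
  case 2 show ?case by simp
next
  case (3 x y) then show ?case by (simp add: plus_fun_def clinear_add_fun)
next
  case (4 x y)
  from 4(2,4) show ?case by (rule finite_subset[rotated, OF finite_UnI]) auto
next
  case (5 c x) then show ?case by (simp add: scaleC_fun_def clinear_scale_fun)
next
  case (6 c x)
  from 6(2) show ?case by (rule finite_subset[rotated]) (auto simp: scaleC_fun_def scaleC_complex_def)
qed

lemma chi_gd: "chi m \<in> graded_dual K act"
proof (induction m rule: verma_induct)
  case zero show ?case unfolding chi_simps by (rule cvec.subspace_0[OF subspace_gd])
next
  case (add a b) then show ?case unfolding chi_simps by (rule cvec.subspace_add[OF subspace_gd])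
next
  case (scale c a) then show ?case unfolding chi_simps by (rule cvec.subspace_scale[OF subspace_gd])
next
  case vac
  have "{\<kappa> \<in> H. \<exists>u\<in>weight_space K act \<kappa>. vd u \<noteq> 0} \<subseteq> {om}" using vd_weight by auto
  then have "finite {\<kappa> \<in> H. \<exists>u\<in>weight_space K act \<kappa>. vd u \<noteq> 0}" by (rule finite_subset) simp
  then show ?case by (simp add: graded_dual_def chi vd(1))
next
  case (f i m)
  have "{\<kappa> \<in> H. \<exists>u\<in>weight_space K act \<kappa>. chi m (act (e i) u) \<noteq> 0} \<subseteq> (\<lambda>\<kappa>. \<kappa> - al i) ` {\<kappa> \<in> H. \<exists>u\<in>weight_space K act \<kappa>. chi m u \<noteq> 0}"
  proof
    fix \<kappa> assume "\<kappa> \<in> {\<kappa> \<in> H. \<exists>u\<in>weight_space K act \<kappa>. chi m (act (e i) u) \<noteq> 0}"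
    then have "\<kappa> + al i \<in> {\<kappa> \<in> H. \<exists>u\<in>weight_space K act \<kappa>. chi m u \<noteq> 0}"
      using e_weight al_in cvec.subspace_add[OF H(1)] by blast
    then show "\<kappa> \<in> (\<lambda>\<kappa>. \<kappa> - al i) ` {\<kappa> \<in> H. \<exists>u\<in>weight_space K act \<kappa>. chi m u \<noteq> 0}" by (rule rev_image_eqI) simp
  qed
  moreover have "finite {\<kappa> \<in> H. \<exists>u\<in>weight_space K act \<kappa>. chi m u \<noteq> 0}" using f by (simp add: graded_dual_def)
  ultimately have "finite {\<kappa> \<in> H. \<exists>u\<in>weight_space K act \<kappa>. chi m (act (e i) u) \<noteq> 0}" by (meson finite_imageI finite_subset)
  moreover have "clinear (\<lambda>u. chi m (act (e i) u))" by (rule clinear_compose[OF act.lin_r chi(3)])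
  ultimately show ?case by (simp add: graded_dual_def chi_f)
qed

end

section \<open>Coordinates in a basis of weight vectors\<close>

locale verma_basis = verma K om act vac
  for K :: "('g::complex_vec, 'i::finite, 'z) km_algebra_scheme" and om :: 'g and act :: "'g \<Rightarrow> 'm \<Rightarrow> 'm::complex_vec" and vac :: 'm +
  fixes S :: "'m set"
  assumes wb: "weight_basis K act S"

sublocale verma_basis \<subseteq> vec_basis S
  using wb by unfold_locales (auto simp: weight_basis_def)

context verma_basis begin

definition wt :: "'m \<Rightarrow> 'g" where "wt b = (SOME \<kappa>. \<kappa> \<in> H \<and> b \<in> weight_space K act \<kappa>)"

lemma wt: "b \<in> S \<Longrightarrow> wt b \<in> H" "b \<in> S \<Longrightarrow> b \<in> weight_space K act (wt b)"
  using wb someI_ex[of "\<lambda>\<kappa>. \<kappa> \<in> H \<and> b \<in> weight_space K act \<kappa>"] unfolding weight_basis_def wt_def by blast+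

lemma S_nz: "b \<in> S \<Longrightarrow> b \<noteq> 0"
  using indep cvec.dependent_zero by blast

lemma wt_eq: "b \<in> S \<Longrightarrow> \<kappa> \<in> H \<Longrightarrow> b \<in> weight_space K act \<kappa> \<Longrightarrow> \<kappa> = wt b"
proof -
  assume b: "b \<in> S" "\<kappa> \<in> H" "b \<in> weight_space K act \<kappa>"
  have "ip \<kappa> h = ip (wt b) h" if "h \<in> H" for h
  proof -
    have "act h b = ip \<kappa> h *\<^sub>C b" "act h b = ip (wt b) h *\<^sub>C b"
      using b(3) wt(2)[OF b(1)] that unfolding weight_space_def by blast+
    then show ?thesis using S_nz[OF b(1)] cvec.scale_cancel_right by metis
  qed
  then show ?thesis using H_eq wt b by blast
qed

lemma h_basis: "b \<in> S \<Longrightarrow> h \<in> H \<Longrightarrow> act h b = ip (wt b) h *\<^sub>C b"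
  using wt by (simp add: weight_space_def)

lemma wt_Q: "b \<in> S \<Longrightarrow> om - wt b \<in> Q_plus K"
  using weight_Q[OF wt(2) S_nz wt(1)] by simp

text \<open>A joint eigenvector involves only basis vectors with the same eigenvalues. The set
  \<open>D\<close> is kept free, since the traces use weights restricted to
  \<open>l_space K\<close>, while the graded dual uses all of \<open>H\<close>.\<close>

lemma co_eigen:
  assumes "D \<subseteq> H" "\<And>h. h \<in> D \<Longrightarrow> act h u = k h *\<^sub>C u" "co b u \<noteq> 0" "h \<in> D"
  shows "ip (wt b) h = k h"
proof -
  have "u \<in> cvec.span {t \<in> S. \<forall>h\<in>D. act h t = k h *\<^sub>C t}"
  proof (rule eigen_span_general)
    show "\<exists>a. act h t = a *\<^sub>C t" if "t \<in> S" "h \<in> D" for t h using that assms(1) h_basis by blast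
  qed (use assms act.lin_r span in auto)
  then have "b \<in> {t \<in> S. \<forall>h\<in>D. act h t = k h *\<^sub>C t}" using co_span_subset assms(3) by blast
  then have bS: "b \<in> S" and "act h b = k h *\<^sub>C b" using assms(4) by blast+
  moreover have "act h b = ip (wt b) h *\<^sub>C b" using h_basis[OF bS] assms(1,4) by blast
  ultimately have "ip (wt b) h *\<^sub>C b = k h *\<^sub>C b" by simp
  then show ?thesis using S_nz[OF bS] by (simp add: cvec.scale_cancel_right)
qed

lemma co_h: "b \<in> S \<Longrightarrow> h \<in> H \<Longrightarrow> co b (act h u) = ip (wt b) h * co b u"
proof -
  assume b: "b \<in> S" "h \<in> H"
  have "co b (act h s) = ip (wt b) h *\<^sub>C co b s" if "s \<in> S" for s
    using that b by (auto simp: h_basis clinear_scale[OF co_lin] co_basis scaleC_complex_def)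
  moreover have "clinear (\<lambda>u. co b (act h u))" by (rule clinear_compose[OF act.lin_r co_lin])
  moreover have "clinear (\<lambda>u. ip (wt b) h *\<^sub>C co b u)" by (rule clinear_scale_fun[OF co_lin])
  ultimately have "co b (act h u) = ip (wt b) h *\<^sub>C co b u"
    using clinear_eq_on_span[of "\<lambda>u. co b (act h u)" "\<lambda>u. ip (wt b) h *\<^sub>C co b u" u S] span by simp
  then show ?thesis by (simp add: scaleC_complex_def)
qed

lemma finite_d: "finite {b \<in> S. ip (wt b) d = c}"
proof (rule finite_indep_d)
  show "cvec.independent {b \<in> S. ip (wt b) d = c}" by (rule cvec.independent_mono[OF indep]) auto
  show "act d b = c *\<^sub>C b" if "b \<in> {b \<in> S. ip (wt b) d = c}" for b using that h_basis[OF _ d_in] by auto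
qed

lemma co_gd: "b \<in> S \<Longrightarrow> co b \<in> graded_dual K act"
proof -
  assume b: "b \<in> S"
  have "{\<kappa> \<in> H. \<exists>u\<in>weight_space K act \<kappa>. co b u \<noteq> 0} \<subseteq> {wt b}"
  proof
    fix \<kappa> assume "\<kappa> \<in> {\<kappa> \<in> H. \<exists>u\<in>weight_space K act \<kappa>. co b u \<noteq> 0}"
    then obtain u where u: "\<kappa> \<in> H" "u \<in> weight_space K act \<kappa>" "co b u \<noteq> 0" by auto
    have "ip (wt b) h = ip \<kappa> h" if "h \<in> H" for h
      by (rule co_eigen[of H u "ip \<kappa>"]) (use u that in \<open>auto simp: weight_space_def\<close>)
    then show "\<kappa> \<in> {wt b}" using H_eq wt b u by blast
  qed
  then have "finite {\<kappa> \<in> H. \<exists>u\<in>weight_space K act \<kappa>. co b u \<noteq> 0}" by (rule finite_subset) simp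
  then show ?thesis using co_lin by (simp add: graded_dual_def)
qed

lemma gd_finite: "\<eta> \<in> graded_dual K act \<Longrightarrow> finite {b \<in> S. \<eta> b \<noteq> 0}"
proof -
  assume "\<eta> \<in> graded_dual K act"
  then have "finite {\<kappa> \<in> H. \<exists>u\<in>weight_space K act \<kappa>. \<eta> u \<noteq> 0}" (is "finite ?W") by (simp add: graded_dual_def)
  moreover have "{b \<in> S. \<eta> b \<noteq> 0} \<subseteq> (\<Union>\<kappa>\<in>?W. {b \<in> S. ip (wt b) d = ip \<kappa> d})"
    using wt by auto
  ultimately show ?thesis using finite_d by (meson finite_UN_I finite_subset)
qed

end

section \<open>Nondegeneracy of the Shapovalov form in the irreducible case\<close>

locale irr_verma = verma_basis K om act vac S
  for K :: "('g::complex_vec, 'i::finite, 'z) km_algebra_scheme" and om :: 'g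
    and act :: "'g \<Rightarrow> 'm \<Rightarrow> 'm::complex_vec" and vac :: 'm and S :: "'m set" +
  assumes irr: "graded_dual_irreducible K act"
begin

text \<open>Since the Chevalley involution has order two, the image of the Shapovalov map is stable
  under the untwisted dual action. It is nonzero because the highest weight vector pairs to 1 with
  itself.\<close>

lemma range_chi: "range chi = graded_dual K act"
proof -
  have sub: "cvec.subspace (range chi)"
    unfolding cvec.subspace_def
  proof (safe, goal_cases)
    case 1 show ?case using chi_simps(1) by (metis rangeI)
  next
    case (2 x y a b) then show ?case by (simp flip: chi_simps(2))
  next
    case (3 c x a) then show ?case by (simp flip: chi_simps(3))
  qed
  have inv: "(\<lambda>u. - \<eta> (act x u)) \<in> range chi" if eta: "\<eta> \<in> range chi" for x \<eta>
  proof -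
    obtain m where "\<eta> = chi m" using eta by auto
    then have "(\<lambda>u. - \<eta> (act x u)) = chi (act (chv x) m)" by (simp add: chi(4) chiR_def chv_chv)
    then show ?thesis by simp
  qed
  have "range chi = {0} \<or> range chi = graded_dual K act"
    using irr[unfolded graded_dual_irreducible_def, THEN conjunct2, THEN spec, of "range chi"] sub inv chi_gd
    by (simp add: image_subset_iff)
  moreover have "range chi \<noteq> {0}"
  proof
    assume "range chi = {0}"
    then have "chi vac vac = 0" by (metis rangeI singletonD zero_fun_apply)
    then show False using chi(2) vd(2) by simp
  qed
  ultimately show ?thesis by blast
qed

text \<open>By symmetry a vector in the kernel is annihilated by the image, that is, by the whole
  graded dual, which contains the coordinate functionals.\<close>

lemma chi_inj: "chi m = 0 \<Longrightarrow> m = 0"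
proof -
  assume "chi m = 0"
  then have "chi m' m = 0" for m' using chi_sym[of m' m] by simp
  then have gd0: "\<eta> m = 0" if "\<eta> \<in> graded_dual K act" for \<eta>
    using that unfolding range_chi[symmetric] by auto
  have "co b m = 0" if "b \<in> S" for b by (rule gd0[OF co_gd[OF that]])
  then have "{b. co b m \<noteq> 0} \<subseteq> {}" using co_in by blast
  from co_sum[OF _ this] show ?thesis by simp
qed

definition chinv :: "('m \<Rightarrow> complex) \<Rightarrow> 'm" where "chinv \<eta> = (SOME m. chi m = \<eta>)"

lemma chi_chinv: "\<eta> \<in> graded_dual K act \<Longrightarrow> chi (chinv \<eta>) = \<eta>"
proof -
  assume "\<eta> \<in> graded_dual K act"
  then have "\<exists>m. chi m = \<eta>" unfolding range_chi[symmetric] by auto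
  then show ?thesis unfolding chinv_def by (rule someI_ex)
qed

lemma chinv_chi: "chinv (chi m) = m"
proof -
  have "chi (chinv (chi m) - m) = chi (chinv (chi m)) - chi m" by (rule clinear_diff[OF chi(1)])
  then have "chi (chinv (chi m) - m) = 0" using chi_chinv[OF chi_gd] by simp
  from chi_inj[OF this] show ?thesis by simp
qed

end

section \<open>Singular vectors in the product of a Verma module with a module from category
  O\<close>

locale int_setup = irr_verma K om act vac S
  for K :: "('g::complex_vec, 'i::finite, 'z) km_algebra_scheme" and om :: 'g
    and act :: "'g \<Rightarrow> 'm \<Rightarrow> 'm::complex_vec" and vac :: 'm and S :: "'m set" +
  fixes actV :: "'g \<Rightarrow> 'v \<Rightarrow> 'v::complex_vec" and V :: "'v set" and v0 :: 'v and ka :: 'g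
  assumes modV: "lie_module K actV" and catO: "category_O K actV V" and ka: "ka \<in> cart K"
    and v0: "v0 \<in> V" "v0 \<in> weight_space K actV ka"

sublocale int_setup \<subseteq> av: bilin actV
  using modV by unfold_locales (simp add: lie_module_def)

context int_setup begin

lemma av_br: "actV (br x y) u = actV x (actV y u) - actV y (actV x u)"
  using modV by (simp add: lie_module_def)

lemma av_bil: "cbilinear actV" using modV by (simp add: lie_module_def)

lemma V_sub: "cvec.subspace V" and V_act: "u \<in> V \<Longrightarrow> actV x u \<in> V"
  using catO by (simp_all add: category_O_def)

text \<open>A singular vector amounts to a map \<open>J\<close> from the graded dual to
  \<open>V\<close> that intertwines the operators of the e. Pulled back along the Shapovalov map,
  this becomes a map on the Verma module with a condition on the f only, and such a map exists by
  freeness.\<close>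

lemma phi_exists:
  obtains \<psi> where "clinear \<psi>" "\<psi> vac = v0" "\<And>m. \<psi> m \<in> V" "\<And>y m. y \<in> N \<Longrightarrow> \<psi> (act y m) = actV (chv y) (\<psi> m)"
proof (rule free_hom[of V v0 "\<lambda>y. actV (chv y)"])
  show "actV (chv (lie K x y)) u = actV (chv x) (actV (chv y) u) - actV (chv y) (actV (chv x) u)" for x y u
    by (simp add: chv_br av_br)
qed (use that V_sub v0 V_act av.lin_r in \<open>auto simp: clinear_add[OF chv_lin] clinear_scale[OF chv_lin] av.addl av.scalel\<close>)

definition phi :: "'m \<Rightarrow> 'v" where
  "phi = (SOME \<psi>. clinear \<psi> \<and> \<psi> vac = v0 \<and> (\<forall>m. \<psi> m \<in> V) \<and> (\<forall>y\<in>N. \<forall>m. \<psi> (act y m) = actV (chv y) (\<psi> m)))"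

lemma phi: "clinear phi" "phi vac = v0" "phi m \<in> V" "y \<in> N \<Longrightarrow> phi (act y m) = actV (chv y) (phi m)"
proof -
  have "\<exists>\<psi>. clinear \<psi> \<and> \<psi> vac = v0 \<and> (\<forall>m. \<psi> m \<in> V) \<and> (\<forall>y\<in>N. \<forall>m. \<psi> (act y m) = actV (chv y) (\<psi> m))"
    using phi_exists by metis
  from someI_ex[OF this] show "clinear phi" "phi vac = v0" "phi m \<in> V" "y \<in> N \<Longrightarrow> phi (act y m) = actV (chv y) (phi m)"
    unfolding phi_def by blast+
qed

lemma phi_f: "phi (act (f i) m) = - actV (e i) (phi m)"
  by (simp add: phi(4) f_n_minus chv_f av.minusl)

lemma phi_h: "h \<in> H \<Longrightarrow> phi (act h m) = ip (ka + om) h *\<^sub>C phi m - actV h (phi m)"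
proof (induction m rule: verma_induct)
  case vac
  then show ?case using v0(2)
    by (simp add: vac_h clinear_scale[OF phi(1)] phi(2) weight_space_def ip.addl scaleC_add_left)
next
  case (f i m)
  have "actV h (actV (e i) (phi m)) = actV (e i) (actV h (phi m)) + sroot K i h *\<^sub>C actV (e i) (phi m)"
    using av_br[of h "e i" "phi m"] he[OF f(2), of i] by (simp add: av.scalel algebra_simps)
  moreover have "phi (act h m) = ip (ka + om) h *\<^sub>C phi m - actV h (phi m)" using f by simp
  ultimately show ?case using f(2)
    by (simp add: h_act_f clinear_diff[OF phi(1)] clinear_scale[OF phi(1)] phi_f av.bisimps)
qed (simp_all add: act.bisimps av.bisimps clinear_zero[OF phi(1)] clinear_add[OF phi(1)] clinear_scale[OF phi(1)] scaleC_add_right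
    cvec.scale_right_diff_distrib mult.commute)

definition J :: "('m \<Rightarrow> complex) \<Rightarrow> 'v" where "J \<eta> = phi (chinv \<eta>)"

abbreviation "GD \<equiv> graded_dual K act"

lemma J_chi: "J (chi m) = phi m" by (simp add: J_def chinv_chi)

lemma J_V: "J \<eta> \<in> V" by (simp add: J_def phi)

lemma GD_chi: "\<eta> \<in> GD \<Longrightarrow> \<exists>m. \<eta> = chi m" using chi_chinv[of \<eta>] by (intro exI[of _ "chinv \<eta>"]) simp

lemma J_add: "\<eta> \<in> GD \<Longrightarrow> \<eta>' \<in> GD \<Longrightarrow> J (\<eta> + \<eta>') = J \<eta> + J \<eta>'"
  by (auto dest!: GD_chi simp: J_chi clinear_add[OF phi(1)] simp flip: chi_simps(2))

lemma J_scale: "\<eta> \<in> GD \<Longrightarrow> J (c *\<^sub>C \<eta>) = c *\<^sub>C J \<eta>"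
  by (auto dest!: GD_chi simp: J_chi clinear_scale[OF phi(1)] simp flip: chi_simps(3))

lemma J_0: "J 0 = 0" using J_chi[of 0] by (simp add: chi_simps clinear_zero[OF phi(1)])

lemma J_vd: "J vd = v0" using J_chi[of vac] by (simp add: chi(2) phi(2))

lemma J_e: "\<eta> \<in> GD \<Longrightarrow> (\<lambda>u. \<eta> (act (e i) u)) \<in> GD \<and> J (\<lambda>u. \<eta> (act (e i) u)) = - actV (e i) (J \<eta>)"
  using chi_gd by (auto dest!: GD_chi simp: J_chi phi_f simp flip: chi_f)

lemma J_h: "\<eta> \<in> GD \<Longrightarrow> h \<in> H \<Longrightarrow> (\<lambda>u. \<eta> (act h u)) \<in> GD \<and> J (\<lambda>u. \<eta> (act h u)) = ip (ka + om) h *\<^sub>C J \<eta> - actV h (J \<eta>)"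
  using chi_gd by (auto dest!: GD_chi simp: J_chi phi_h simp flip: chi_h)

lemma J_sum: "finite A \<Longrightarrow> A \<subseteq> S \<Longrightarrow> (\<Sum>b\<in>A. c b *\<^sub>C co b) \<in> GD \<and> J (\<Sum>b\<in>A. c b *\<^sub>C co b) = (\<Sum>b\<in>A. c b *\<^sub>C J (co b))"
proof (induction A rule: finite_induct)
  case empty show ?case using J_0 cvec.subspace_0[OF subspace_gd] by (simp add: zero_fun_def)
next
  case (insert b A)
  then have "c b *\<^sub>C co b \<in> GD" using co_gd cvec.subspace_scale[OF subspace_gd] by blast
  then have "c b *\<^sub>C co b + (\<Sum>b\<in>A. c b *\<^sub>C co b) \<in> GD"
    "J (c b *\<^sub>C co b + (\<Sum>b\<in>A. c b *\<^sub>C co b)) = c b *\<^sub>C J (co b) + (\<Sum>b\<in>A. c b *\<^sub>C J (co b))"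
    using insert by (blast intro: cvec.subspace_add[OF subspace_gd], simp only: J_add J_scale co_gd insert_subset)
  then show ?case using insert(1,2) by (simp add: plus_fun_def)
qed

lemma J_co_weight: "b \<in> S \<Longrightarrow> J (co b) \<in> weight_space K actV (ka + (om - wt b))"
  unfolding weight_space_def
proof safe
  fix h assume b: "b \<in> S" "h \<in> H"
  have "(\<lambda>u. co b (act h u)) = ip (wt b) h *\<^sub>C co b"
    using co_h[OF b] by (simp add: fun_eq_iff scaleC_fun_def scaleC_complex_def)
  then have "ip (wt b) h *\<^sub>C J (co b) = ip (ka + om) h *\<^sub>C J (co b) - actV h (J (co b))"
    using J_h[OF co_gd b(2)] b(1) J_scale[OF co_gd] by metis
  then show "actV h (J (co b)) = ip (ka + (om - wt b)) h *\<^sub>C J (co b)"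
    by (simp add: ip.bisimps scaleC_add_left cvec.scale_left_diff_distrib algebra_simps)
qed

definition A where "A = {b \<in> S. J (co b) \<noteq> 0}"

text \<open>The value of \<open>J\<close> at a coordinate functional has weight
  \<open>ka + (om - wt b)\<close> in \<open>V\<close>. In category O weights are bounded above, so
  only finitely many depths of \<open>b\<close> contribute.\<close>

lemma A_finite: "finite A"
proof -
  obtain \<Lambda> where L: "finite \<Lambda>" "\<Lambda> \<subseteq> H" "\<And>\<kappa>. \<kappa> \<in> H \<Longrightarrow> V \<inter> weight_space K actV \<kappa> \<noteq> {0} \<Longrightarrow> \<exists>\<omega>\<in>\<Lambda>. \<omega> - \<kappa> \<in> Q_plus K"
    using catO by (auto simp: category_O_def)
  \<comment> \<open>If a contributing weight of \<open>V\<close> lies below \<open>\<omega>\<close>,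
    then \<open>\<omega> - ka\<close> takes at \<open>d\<close> the value of a sum of two heights,
    one of them the height of \<open>om - wt b\<close>; so this number bounds that height.\<close>
  define n where "n \<omega> = nat \<lfloor>Re (ip (\<omega> - ka) d)\<rfloor>" for \<omega>
  have "A \<subseteq> (\<Union>\<omega>\<in>\<Lambda>. \<Union>k\<in>{..n \<omega>}. {b \<in> S. ip (wt b) d = ip om d - of_nat k})"
  proof
    fix b assume "b \<in> A"
    then have b: "b \<in> S" "J (co b) \<noteq> 0" by (auto simp: A_def)
    have inH: "ka + (om - wt b) \<in> H" using ka om wt(1)[OF b(1)] by (intro cvec.subspace_add cvec.subspace_diff H(1))
    have "V \<inter> weight_space K actV (ka + (om - wt b)) \<noteq> {0}" using J_co_weight[OF b(1)] J_V b(2) by blast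
    then obtain \<omega> where w: "\<omega> \<in> \<Lambda>" "\<omega> - (ka + (om - wt b)) \<in> Q_plus K" using L(3)[OF inH] by blast
    have 1: "ip (om - wt b) d = of_nat (ht (om - wt b))" by (rule ht[OF wt_Q[OF b(1)]])
    have "ip (\<omega> - (ka + (om - wt b))) d = of_nat (ht (\<omega> - (ka + (om - wt b))))" by (rule ht[OF w(2)])
    then have "ip (\<omega> - ka) d = of_nat (ht (\<omega> - (ka + (om - wt b)))) + of_nat (ht (om - wt b))"
      using 1 by (simp add: ip.bisimps algebra_simps)
    then have "ip (\<omega> - ka) d = of_nat (ht (\<omega> - (ka + (om - wt b))) + ht (om - wt b))" by simp
    then have "n \<omega> = ht (\<omega> - (ka + (om - wt b))) + ht (om - wt b)" unfolding n_def by (simp del: of_nat_add)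
    then have "ht (om - wt b) \<le> n \<omega>" by simp
    moreover have "ip (wt b) d = ip om d - of_nat (ht (om - wt b))" using 1 by (simp add: ip.diffl algebra_simps)
    ultimately show "b \<in> (\<Union>\<omega>\<in>\<Lambda>. \<Union>k\<in>{..n \<omega>}. {b \<in> S. ip (wt b) d = ip om d - of_nat k})" using w b by blast
  qed
  then show ?thesis using L(1) finite_d by (meson finite_UN_I finite_atMost finite_subset)
qed

text \<open>The tensor that represents \<open>J\<close>. It is the singular vector to which the
  intertwiner sends the highest weight vector.\<close>

definition w0 :: "('m, 'v) mtens" where "w0 = (\<Sum>b\<in>A. mpure b [J (co b)])"

lemma w0_span: "w0 \<in> cvec.span {mpure m [u] | m u. u \<in> V}"
  unfolding w0_def using J_V by (intro cvec.span_sum cvec.span_base) blast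

lemma span_mspan: "cvec.span {mpure m [u] | m u. u \<in> V} \<subseteq> mspan 1"
  unfolding mspan_def
proof (rule cvec.span_mono, safe)
  fix m u show "\<exists>m' ws. mpure m [u] = mpure m' ws \<and> length ws = 1" by (intro exI[of _ m] exI[of _ "[u]"]) simp
qed

lemma contract_w0: "\<eta> \<in> GD \<Longrightarrow> contract \<eta> w0 = pure [J \<eta>]"
proof -
  assume eta: "\<eta> \<in> GD"
  then have lin: "clinear \<eta>" by (simp add: graded_dual_def)
  define A' where "A' = A \<union> {b \<in> S. \<eta> b \<noteq> 0}"
  have A': "finite A'" "A' \<subseteq> S" unfolding A'_def using A_finite gd_finite[OF eta] by (auto simp: A_def)
  have 1: "\<eta> = (\<lambda>m. \<Sum>b\<in>A'. \<eta> b * co b m)" by (rule functional_expand[OF lin A']) (auto simp: A'_def)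
  have 2: "\<eta> = (\<Sum>b\<in>A'. \<eta> b *\<^sub>C co b)"
    unfolding fun_eq_iff sum_fun_apply scaleC_fun_def scaleC_complex_def by (intro allI fun_cong[OF 1])
  have "J \<eta> = J (\<Sum>b\<in>A'. \<eta> b *\<^sub>C co b)" by (rule arg_cong[OF 2])
  also have "\<dots> = (\<Sum>b\<in>A'. \<eta> b *\<^sub>C J (co b))" using J_sum[OF A', of \<eta>] by blast
  also have "\<dots> = (\<Sum>b\<in>A. \<eta> b *\<^sub>C J (co b))" by (rule sum.mono_neutral_right) (use A' in \<open>auto simp: A_def A'_def\<close>)
  finally have "pure [J \<eta>] = (\<Sum>b\<in>A. \<eta> b *\<^sub>C pure [J (co b)])"
    by (simp add: clinear_sum[OF pure_lin_single] clinear_scale[OF pure_lin_single])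
  then show ?thesis by (simp add: w0_def clinear_sum[OF contract_lin] contract_mpure[OF lin])
qed

lemma wact_single: "wact actV (Suc 0) x (pure [u]) = pure [actV x u]"
  by (simp add: wact_def on_factor_pure'[OF av_bil])

lemma w0_e: "mtens_act act actV (e i) w0 = 0"
proof (rule mspan_separate)
  show "mtens_act act actV (e i) w0 \<in> mspan 1"
    using w0_span span_mspan by (intro mtens_act_mspan[OF av_bil] act.lin_r) auto
  fix b assume b: "b \<in> S"
  have "contract (co b) (mtens_act act actV (e i) w0) = contract (\<lambda>m. co b (act (e i) m)) w0 + wact actV 1 (e i) (contract (co b) w0)"
    using w0_span span_mspan by (intro contract_mtens_act[OF av_bil] act.lin_r co_lin) auto
  also have "\<dots> = 0"
    using J_e[OF co_gd[OF b], of i] by (simp add: contract_w0 co_gd b wact_single clinear_minus[OF pure_lin_single])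
  finally show "contract (co b) (mtens_act act actV (e i) w0) = 0" .
qed

lemma w0_h: "h \<in> H \<Longrightarrow> mtens_act act actV h w0 = ip (ka + om) h *\<^sub>C w0"
proof -
  assume h: "h \<in> H"
  have w0m: "w0 \<in> mspan 1" using w0_span span_mspan by auto
  have "mtens_act act actV h w0 - ip (ka + om) h *\<^sub>C w0 = 0"
  proof (rule mspan_separate)
    show "mtens_act act actV h w0 - ip (ka + om) h *\<^sub>C w0 \<in> mspan 1"
      using w0m by (intro cvec.subspace_diff cvec.subspace_scale subspace_mspan mtens_act_mspan[OF av_bil] act.lin_r) auto
    fix b assume b: "b \<in> S"
    have "contract (co b) (mtens_act act actV h w0) = contract (\<lambda>m. co b (act h m)) w0 + wact actV 1 h (contract (co b) w0)"
      using w0m by (intro contract_mtens_act[OF av_bil] act.lin_r co_lin) auto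
    also have "\<dots> = ip (ka + om) h *\<^sub>C contract (co b) w0"
      using J_h[OF co_gd[OF b] h]
      by (simp add: contract_w0 co_gd b wact_single clinear_diff[OF pure_lin_single] clinear_scale[OF pure_lin_single])
    finally show "contract (co b) (mtens_act act actV h w0 - ip (ka + om) h *\<^sub>C w0) = 0"
      by (simp add: clinear_diff[OF contract_lin] clinear_scale[OF contract_lin])
  qed
  then show ?thesis by simp
qed

text \<open>Contraction with the Shapovalov functional of \<open>m\<close> vanishes by induction on
  \<open>m\<close>: passing from \<open>m\<close> to \<open>act (f i) m\<close> composes the
  functional with \<open>e i\<close>, which kills the tensor up to the action on a contraction that
  is already zero. Irreducibility makes every coordinate functional of this kind.\<close>

lemma singular_unique:
  assumes "\<xi> \<in> mspan 1" "\<And>i. mtens_act act actV (e i) \<xi> = 0" "contract vd \<xi> = 0"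
  shows "\<xi> = 0"
proof (rule mspan_separate[OF assms(1)])
  have "contract (chi m) \<xi> = 0" for m
  proof (induction m rule: verma_induct)
    case zero show ?case using contract_scale[OF vd(1) assms(1), of 0] by (simp add: chi_simps zero_fun_def)
  next
    case (add a b) then show ?case using contract_add[OF chi(3) chi(3) assms(1), of a b] by (simp add: chi_simps plus_fun_def)
  next
    case (scale c a) then show ?case using contract_scale[OF chi(3) assms(1), of c a] by (simp add: chi_simps scaleC_fun_def scaleC_complex_def)
  next
    case vac show ?case by (simp add: chi(2) assms(3))
  next
    case (f i m)
    have "contract (chi m) (mtens_act act actV (e i) \<xi>) = contract (\<lambda>u. chi m (act (e i) u)) \<xi> + wact actV 1 (e i) (contract (chi m) \<xi>)"
      by (rule contract_mtens_act[OF av_bil assms(1) chi(3) act.lin_r])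
    moreover have "contract (chi m) \<xi> = 0" using f by (simp add: zero_fun_def)
    ultimately have "contract (chi (act (gen_f K i) m)) \<xi> = 0"
      by (simp only: assms(2) clinear_zero[OF contract_lin] clinear_zero[OF wact_lin] chi_f add_0_right)
    then show ?case by (simp add: zero_fun_def)
  qed
  then show "contract (co b) \<xi> = 0" if "b \<in> S" for b using GD_chi[OF co_gd[OF that]] by metis
qed

lemma mtens_lie:
  assumes "\<xi> \<in> mspan 1"
  shows "mtens_act act actV (x + y) \<xi> = mtens_act act actV x \<xi> + mtens_act act actV y \<xi>"
    "mtens_act act actV (c *\<^sub>C x) \<xi> = c *\<^sub>C mtens_act act actV x \<xi>"
    "mtens_act act actV (br x y) \<xi> = mtens_act act actV x (mtens_act act actV y \<xi>) - mtens_act act actV y (mtens_act act actV x \<xi>)"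
proof -
  have 1: "mtens_act act actV x (mpure m [u]) = mpure (act x m) [u] + mpure m [actV x u]" for x m u
    by (simp add: mtens_act_mpure act.lin_r av.lin_r)
  have len: "\<exists>u. ws = [u]" if "length ws = Suc 0" for ws :: "'v list" using that by (cases ws) auto
  show "mtens_act act actV (x + y) \<xi> = mtens_act act actV x \<xi> + mtens_act act actV y \<xi>"
    by (rule mspan_eq[OF mtens_act_lin clinear_add_fun[OF mtens_act_lin mtens_act_lin] assms])
      (auto simp: 1 act.addl av.addl clinear_add[OF mpure_lin] clinear_add[OF mpure_lin_single] dest!: len)
  show "mtens_act act actV (c *\<^sub>C x) \<xi> = c *\<^sub>C mtens_act act actV x \<xi>"
    by (rule mspan_eq[OF mtens_act_lin clinear_scale_fun[OF mtens_act_lin] assms])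
      (auto simp: 1 act.scalel av.scalel clinear_scale[OF mpure_lin] clinear_scale[OF mpure_lin_single] scaleC_add_right dest!: len)
  have "clinear (\<lambda>\<xi>. mtens_act act actV x (mtens_act act actV y \<xi>) - mtens_act act actV y (mtens_act act actV x \<xi>))"
    by (intro clinearI) (simp_all add: clinear_add[OF mtens_act_lin] clinear_scale[OF mtens_act_lin] cvec.scale_right_diff_distrib)
  then show "mtens_act act actV (br x y) \<xi> = mtens_act act actV x (mtens_act act actV y \<xi>) - mtens_act act actV y (mtens_act act actV x \<xi>)"
    by (rule mspan_eq[OF mtens_act_lin _ assms])
      (auto simp: 1 act_br av_br clinear_add[OF mtens_act_lin] clinear_diff[OF mpure_lin] clinear_diff[OF mpure_lin_single] dest!: len)
qed

end

section \<open>Existence and uniqueness of the intertwiner\<close>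

locale intertwining = int_setup K om act vac S actV V v0 ka + src: verma K om1 act1 vac1
  for K :: "('g::complex_vec, 'i::finite, 'z) km_algebra_scheme" and om :: 'g
    and act :: "'g \<Rightarrow> 'm \<Rightarrow> 'm::complex_vec" and vac :: 'm and S :: "'m set"
    and actV :: "'g \<Rightarrow> 'v \<Rightarrow> 'v::complex_vec" and V :: "'v set" and v0 :: 'v and ka :: 'g
    and om1 :: 'g and act1 :: "'g \<Rightarrow> 'm \<Rightarrow> 'm" and vac1 :: 'm +
  assumes om1: "om1 = om + ka"
begin

definition is_int :: "('m \<Rightarrow> ('m, 'v) mtens) \<Rightarrow> bool" where
  "is_int \<Phi> \<longleftrightarrow> clinear \<Phi> \<and> range \<Phi> \<subseteq> cvec.span {mpure m [u] | m u. u \<in> V} \<and>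
    (\<forall>x m. \<Phi> (act1 x m) = mtens_act act actV x (\<Phi> m)) \<and> contract vd (\<Phi> vac1) = pure [v0]"

lemma int_exists: "\<exists>\<Phi>. is_int \<Phi>"
proof -
  obtain \<Phi> where "clinear \<Phi>" "\<Phi> vac1 = w0" "\<And>m. \<Phi> m \<in> cvec.span {mpure m [u] | m u. u \<in> V}"
    "\<And>x m. \<Phi> (act1 x m) = mtens_act act actV x (\<Phi> m)"
  proof (rule src.hom[of "cvec.span {mpure m [u] | m u. u \<in> V}" w0 "mtens_act act actV"])
    show "mtens_act act actV y u \<in> cvec.span {mpure m [u] | m u. u \<in> V}" if "u \<in> cvec.span {mpure m [u] | m u. u \<in> V}" for y and u :: "('m, 'v) mtens"
    proof (rule clinear_span_image[OF mtens_act_lin that])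
      fix s :: "('m, 'v) mtens" assume "s \<in> {mpure m [u] | m u. u \<in> V}"
      then obtain m u where s: "s = mpure m [u]" "u \<in> V" by blast
      have "mtens_act act actV y s = mpure (act y m) [u] + mpure m [actV y u]"
        by (simp add: s mtens_act_mpure act.lin_r av.lin_r)
      moreover have "mpure m [u] \<in> cvec.span {mpure m [u] | m u. u \<in> V}" if "u \<in> V" for m :: 'm and u
        by (rule cvec.span_base) (use that in blast)
      ultimately show "mtens_act act actV y s \<in> cvec.span {mpure m [u] | m u. u \<in> V}"
        using s(2) V_act by (simp add: cvec.span_add)
    qed
    show "mtens_act act actV (x + y) u = mtens_act act actV x u + mtens_act act actV y u"
      "mtens_act act actV (c *\<^sub>C x) u = c *\<^sub>C mtens_act act actV x u"
      "mtens_act act actV (lie K x y) u = mtens_act act actV x (mtens_act act actV y u) - mtens_act act actV y (mtens_act act actV x u)"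
      if "u \<in> cvec.span {mpure m [u] | m u. u \<in> V}" for x y c and u :: "('m, 'v) mtens"
      using mtens_lie span_mspan that by blast+
    show "mtens_act act actV h w0 = ip om1 h *\<^sub>C w0" if "h \<in> cart K" for h
      using w0_h[OF that] by (simp add: om1 add.commute)
  qed (use w0_span w0_e mtens_act_lin in auto)
  moreover have "vd \<in> GD" using chi_gd[of vac] by (simp add: chi(2))
  ultimately have "is_int \<Phi>" by (auto simp: is_int_def contract_w0 J_vd)
  then show ?thesis by blast
qed

lemma int_unique: "is_int \<Phi> \<Longrightarrow> is_int \<Phi>' \<Longrightarrow> \<Phi> = \<Phi>'"
proof
  assume p: "is_int \<Phi>" "is_int \<Phi>'"
  have m1: "\<Phi> m \<in> mspan 1" "\<Phi>' m \<in> mspan 1" for m using p span_mspan unfolding is_int_def by blast+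
  have "\<Phi> vac1 - \<Phi>' vac1 = 0"
  proof (rule singular_unique)
    show "\<Phi> vac1 - \<Phi>' vac1 \<in> mspan 1" using m1 by (intro cvec.subspace_diff subspace_mspan)
    show "mtens_act act actV (e i) (\<Phi> vac1 - \<Phi>' vac1) = 0" for i
    proof -
      have "mtens_act act actV (e i) (\<Phi> vac1) = \<Phi> (act1 (e i) vac1)" "mtens_act act actV (e i) (\<Phi>' vac1) = \<Phi>' (act1 (e i) vac1)"
        using p by (simp_all add: is_int_def)
      moreover have "\<Phi> 0 = 0" "\<Phi>' 0 = 0" using p clinear_zero unfolding is_int_def by blast+
      ultimately show ?thesis by (simp add: clinear_diff[OF mtens_act_lin] src.vac_n e_n_plus)
    qed
    show "contract vd (\<Phi> vac1 - \<Phi>' vac1) = 0" using p by (simp add: is_int_def clinear_diff[OF contract_lin])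
  qed
  then have v: "\<Phi> vac1 = \<Phi>' vac1" by simp
  fix m
  have l: "clinear \<Phi>" "clinear \<Phi>'" using p by (simp_all add: is_int_def)
  show "\<Phi> m = \<Phi>' m"
    by (induction m rule: src.verma_induct)
      (use p in \<open>simp_all add: clinear_zero[OF l(1)] clinear_zero[OF l(2)] clinear_add[OF l(1)] clinear_add[OF l(2)]
        clinear_scale[OF l(1)] clinear_scale[OF l(2)] v is_int_def\<close>)
qed

lemma intertwiner_spec:
  assumes "M om1 = act1" "M om = act" "vc om1 = vac1" "vc om = vac"
  shows "is_int (intertwiner K M vc actV V om1 ka v0)"
proof -
  have om': "om1 - ka = om" by (simp add: om1)
  have "intertwiner K M vc actV V om1 ka v0 = (THE \<Phi>. is_int \<Phi>)"
    unfolding intertwiner_def om' assms verma_dual_vec_eq[of M vc, OF assms(2,4)] is_int_def ..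
  moreover have "is_int (THE \<Phi>. is_int \<Phi>)" using int_exists int_unique by (metis the_equality)
  ultimately show ?thesis by simp
qed

end

section \<open>The maps attached to a Belavin--Drinfeld triple\<close>

text \<open>\<open>B\<close> and \<open>Bi\<close> are functions on the whole algebra but are
  constrained only on their domains, so their linearity is a statement about subspaces.\<close>

definition lin_on :: "'a::complex_vec set \<Rightarrow> ('a \<Rightarrow> 'b::complex_vec) \<Rightarrow> bool"
  where "lin_on U F \<longleftrightarrow> (\<forall>x\<in>U. \<forall>y\<in>U. F (x + y) = F x + F y) \<and> (\<forall>c. \<forall>x\<in>U. F (c *\<^sub>C x) = c *\<^sub>C F x)"

lemma lin_on_sum:
  assumes "lin_on U F" "cvec.subspace U" "\<And>a. a \<in> A \<Longrightarrow> k a \<in> U"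
  shows "F (\<Sum>a\<in>A. c a *\<^sub>C k a) = (\<Sum>a\<in>A. c a *\<^sub>C F (k a))"
proof -
  have 0: "F 0 = 0" using assms(1) cvec.subspace_0[OF assms(2)] unfolding lin_on_def by (metis cvec.scale_zero_left)
  show ?thesis
    using assms(3)
  proof (induction A rule: infinite_finite_induct)
    case (insert a A)
    have "(\<Sum>a\<in>A. c a *\<^sub>C k a) \<in> U" "c a *\<^sub>C k a \<in> U"
      using insert by (auto intro!: cvec.subspace_sum cvec.subspace_scale assms(2))
    then show ?case using insert assms(1) by (simp add: lin_on_def)
  qed (simp_all add: 0)
qed

lemma lin_on_compose: "lin_on U F \<Longrightarrow> F ` U \<subseteq> U' \<Longrightarrow> lin_on U' G \<Longrightarrow> lin_on U (\<lambda>x. G (F x))"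
  unfolding lin_on_def by (simp add: image_subset_iff)

lemma clinear_lin_on: "clinear F \<Longrightarrow> lin_on U F"
  by (simp add: lin_on_def clinear_add clinear_scale)

lemma lin_on_0: "lin_on U F \<Longrightarrow> 0 \<in> U \<Longrightarrow> F 0 = 0"
  unfolding lin_on_def by (metis cvec.scale_zero_left)

context km begin

lemma f_fs: "f i = form K (e i) (f i) *\<^sub>C f_simple K i"
  using ef_nz[of i] by (simp add: f_simple_def)

lemma fs_n_minus: "f_simple K i \<in> n_minus K"
  by (simp add: f_simple_def cvec.subspace_scale subspace_n_minus f_n_minus)

lemma n_minus_induct [consumes 1, case_names add scale fs br]:
  assumes "y \<in> n_minus K"
    and "\<And>x y. x \<in> n_minus K \<Longrightarrow> y \<in> n_minus K \<Longrightarrow> P x \<Longrightarrow> P y \<Longrightarrow> P (x + y)"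
    and "\<And>c x. x \<in> n_minus K \<Longrightarrow> P x \<Longrightarrow> P (c *\<^sub>C x)"
    and "\<And>i. P (f_simple K i)"
    and "\<And>x y. x \<in> n_minus K \<Longrightarrow> y \<in> n_minus K \<Longrightarrow> P x \<Longrightarrow> P y \<Longrightarrow> P (br x y)"
  shows "P y"
proof -
  have Pf: "P (f i)" for i by (subst f_fs) (rule assms(3)[OF fs_n_minus assms(4)])
  have "P (0 *\<^sub>C f_simple K (SOME i. True))" by (rule assms(3)[OF fs_n_minus assms(4)])
  then have "P 0" by simp
  have "subalg {y \<in> n_minus K. P y}"
    unfolding subalg_def cvec.subspace_def
    using \<open>P 0\<close> assms(2,3,5) n_minus_br subspace_n_minus by (auto simp: cvec.subspace_0 cvec.subspace_add cvec.subspace_scale)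
  then have "gen (range f) \<subseteq> {y \<in> n_minus K. P y}" by (rule gen_least) (use Pf f_n_minus in auto)
  then show ?thesis using assms(1) by (auto simp: n_minus_def lie_generated_gen)
qed

lemma n_plus_induct [consumes 1, case_names add scale e br]:
  assumes "y \<in> n_plus K"
    and "\<And>x y. x \<in> n_plus K \<Longrightarrow> y \<in> n_plus K \<Longrightarrow> P x \<Longrightarrow> P y \<Longrightarrow> P (x + y)"
    and "\<And>c x. x \<in> n_plus K \<Longrightarrow> P x \<Longrightarrow> P (c *\<^sub>C x)"
    and "\<And>i. P (e i)"
    and "\<And>x y. x \<in> n_plus K \<Longrightarrow> y \<in> n_plus K \<Longrightarrow> P x \<Longrightarrow> P y \<Longrightarrow> P (br x y)"
  shows "P y"
proof -
  have "P (0 *\<^sub>C e (SOME i. True))" by (rule assms(3)[OF e_n_plus assms(4)])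
  then have "P 0" by simp
  have "subalg {y \<in> n_plus K. P y}"
    unfolding subalg_def cvec.subspace_def
    using \<open>P 0\<close> assms(2,3,5) n_plus_br subspace_n_plus by (auto simp: cvec.subspace_0 cvec.subspace_add cvec.subspace_scale)
  then have "gen (range e) \<subseteq> {y \<in> n_plus K. P y}" by (rule gen_least) (use assms(4) e_n_plus in auto)
  then show ?thesis using assms(1) by (auto simp: n_plus_def lie_generated_gen)
qed

lemma n_plus_mon_induct [consumes 1, case_names add scale e br]:
  assumes "y \<in> n_plus K"
    and add: "\<And>x y. x \<in> n_plus K \<Longrightarrow> y \<in> n_plus K \<Longrightarrow> P x \<Longrightarrow> P y \<Longrightarrow> P (x + y)"
    and scale: "\<And>c x. x \<in> n_plus K \<Longrightarrow> P x \<Longrightarrow> P (c *\<^sub>C x)"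
    and e: "\<And>i. P (e i)"
    and br: "\<And>i x. x \<in> n_plus K \<Longrightarrow> P x \<Longrightarrow> P (br (e i) x)"
  shows "P y"
proof -
  have "P (0 *\<^sub>C e (SOME i. True))" by (rule scale[OF e_n_plus e])
  then have P0: "P 0" by simp
  have m: "mon e w \<in> n_plus K" for w by (simp add: n_plus_mons mon_in)
  have Pm: "P (mon e w)" for w
  proof (induction w)
    case (Cons i w) then show ?case using br[OF m[of w]] e by (cases "w = []") (auto simp: mon_Cons)
  qed (simp add: P0)
  have "y \<in> cvec.span (range (mon e))" using assms(1) by (simp add: n_plus_mons mons_def)
  then have "y \<in> n_plus K \<and> P y"
  proof (induction rule: cvec.span_induct_alt)
    case base show ?case using P0 cvec.subspace_0[OF subspace_n_plus] by simp
  next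
    case (step c x y)
    then obtain w where x: "x = mon e w" by auto
    have "c *\<^sub>C x \<in> n_plus K" "P (c *\<^sub>C x)" unfolding x using m Pm scale cvec.subspace_scale[OF subspace_n_plus] by blast+
    then show ?case using step add cvec.subspace_add[OF subspace_n_plus] by blast
  qed
  then show ?thesis ..
qed

lemma n_minus_mon_induct [consumes 1, case_names add scale mon]:
  assumes "y \<in> n_minus K"
    and add: "\<And>x y. x \<in> n_minus K \<Longrightarrow> y \<in> n_minus K \<Longrightarrow> P x \<Longrightarrow> P y \<Longrightarrow> P (x + y)"
    and scale: "\<And>c x. x \<in> n_minus K \<Longrightarrow> P x \<Longrightarrow> P (c *\<^sub>C x)"
    and Pm: "\<And>w. P (mon f w)"
  shows "P y"
proof -
  have m: "mon f w \<in> n_minus K" for w by (simp add: n_minus_mons mon_in)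
  have P0: "P 0" using Pm[of "[]"] by simp
  have "y \<in> cvec.span (range (mon f))" using assms(1) by (simp add: n_minus_mons mons_def)
  then have "y \<in> n_minus K \<and> P y"
  proof (induction rule: cvec.span_induct_alt)
    case base show ?case using P0 cvec.subspace_0[OF subspace_n_minus] by simp
  next
    case (step c x y)
    then obtain w where x: "x = mon f w" by auto
    have "c *\<^sub>C x \<in> n_minus K" "P (c *\<^sub>C x)" unfolding x using m Pm scale cvec.subspace_scale[OF subspace_n_minus] by blast+
    then show ?case using step add cvec.subspace_add[OF subspace_n_minus] by blast
  qed
  then show ?thesis ..
qed

lemma h_n_plus: "h \<in> H \<Longrightarrow> x \<in> n_plus K \<Longrightarrow> br h x \<in> n_plus K"
  and h_n_minus: "h \<in> H \<Longrightarrow> y \<in> n_minus K \<Longrightarrow> br h y \<in> n_minus K"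
  by (simp_all add: n_plus_mons n_minus_mons h_mons sw.h_mons)

lemma h_fs: "h \<in> H \<Longrightarrow> br h (f_simple K i) = (- ip (al i) h) *\<^sub>C f_simple K i"
  by (simp add: f_simple_def scaler hf sroot_al mult.commute)

lemma h_e: "h \<in> H \<Longrightarrow> br h (e i) = ip (al i) h *\<^sub>C e i"
  by (simp add: he sroot_al)

end

section \<open>The maps \<open>B\<close> and \<open>Bi\<close>, and their adjointness for the
  form\<close>

locale bd = km K for K :: "('g::complex_vec, 'i::finite, 'z) bd_algebra_scheme" +
  fixes B Bi :: "'g \<Rightarrow> 'g" and eb fb :: "'g \<Rightarrow> nat \<Rightarrow> 'g" and I1 I2 :: "nat set" and x :: "nat \<Rightarrow> 'g"
  assumes gbd: "gbd_triple K" and isB: "is_B K B" and isBi: "is_B_inv K Bi"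
    and rb: "root_bases K B Bi eb fb" and ob: "adapted_orthonormal_basis K I1 I2 x"
begin

abbreviation "G1 \<equiv> Gam1 K"
abbreviation "G2 \<equiv> Gam2 K"
abbreviation "\<tau> \<equiv> bdT K"
abbreviation "Np \<equiv> n_plus K"
abbreviation "Nm \<equiv> n_minus K"

lemma \<tau>_G2: "i \<in> G1 \<Longrightarrow> \<tau> i \<in> G2" and \<tau>_inj: "i \<in> G1 \<Longrightarrow> j \<in> G1 \<Longrightarrow> \<tau> i = \<tau> j \<longleftrightarrow> i = j"
  and \<tau>_inv: "i \<in> G1 \<Longrightarrow> inv_into G1 \<tau> (\<tau> i) = i" and \<tau>_onto: "j \<in> G2 \<Longrightarrow> \<exists>i\<in>G1. j = \<tau> i"
  and \<tau>_ip: "i \<in> G1 \<Longrightarrow> j \<in> G1 \<Longrightarrow> ip (al (\<tau> i)) (al (\<tau> j)) = ip (al i) (al j)"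
  using gbd by (auto simp: gbd_triple_def bij_betw_def inj_on_eq_iff)

definition D1 where "D1 = {y + h | y h. y \<in> Nm \<and> h \<in> h_span K G1}"
definition D2 where "D2 = {y + h | y h. y \<in> Np \<and> h \<in> h_span K G2}"

lemma h_span_H: "h_span K G \<subseteq> H"
  unfolding h_span_def by (rule cvec.span_minimal[OF _ H(1)]) (auto simp: h_simple_al al_in)

lemma subspace_h_span: "cvec.subspace (h_span K G)" by (simp add: h_span_def)

lemma al_h_span: "i \<in> G \<Longrightarrow> al i \<in> h_span K G"
  by (auto simp: h_span_def h_simple_al[symmetric] intro: cvec.span_base)

lemma subspace_D1: "cvec.subspace D1"
  unfolding D1_def using cvec.subspace_sums[OF subspace_n_minus subspace_h_span] by simp

lemma D1I: "y \<in> Nm \<Longrightarrow> y \<in> D1" "h \<in> h_span K G1 \<Longrightarrow> h \<in> D1"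
  and D2I: "u \<in> Np \<Longrightarrow> u \<in> D2" "h \<in> h_span K G2 \<Longrightarrow> h \<in> D2"
  unfolding D1_def D2_def using cvec.subspace_0[OF subspace_n_minus] cvec.subspace_0[OF subspace_n_plus] cvec.subspace_0[OF subspace_h_span]
  by force+

lemma D1_br_Nm: "z \<in> D1 \<Longrightarrow> y \<in> Nm \<Longrightarrow> br z y \<in> Nm"
proof -
  assume "z \<in> D1" and y: "y \<in> Nm"
  then obtain u h where z: "z = u + h" "u \<in> Nm" "h \<in> h_span K G1" by (auto simp: D1_def)
  then have "br h y \<in> Nm" using h_span_H h_n_minus y by blast
  then show ?thesis using z(2) y by (simp add: z(1) addl n_minus_br cvec.subspace_add subspace_n_minus)
qed

lemma B_lin: "lin_on D1 B" and B_br: "u \<in> D1 \<Longrightarrow> v \<in> D1 \<Longrightarrow> B (br u v) = br (B u) (B v)"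
  using isB by (auto simp: is_B_def lie_hom_on_def lin_on_def D1_def[symmetric])

lemma B_fs: "i \<in> G1 \<Longrightarrow> B (f_simple K i) = f_simple K (\<tau> i)" "i \<notin> G1 \<Longrightarrow> B (f_simple K i) = 0"
  and B_al: "i \<in> G1 \<Longrightarrow> B (al i) = al (\<tau> i)"
  using isB by (auto simp: is_B_def h_simple_al)

lemma Bi_lin: "lin_on D2 Bi" and Bi_br: "u \<in> D2 \<Longrightarrow> v \<in> D2 \<Longrightarrow> Bi (br u v) = br (Bi u) (Bi v)"
  using isBi by (auto simp: is_B_inv_def lie_hom_on_def lin_on_def D2_def[symmetric])

lemma Bi_e: "i \<in> G1 \<Longrightarrow> Bi (e (\<tau> i)) = e i" "j \<notin> G2 \<Longrightarrow> Bi (e j) = 0"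
  and Bi_al: "i \<in> G1 \<Longrightarrow> Bi (al (\<tau> i)) = al i"
  using isBi \<tau>_G2 by (auto simp: is_B_inv_def h_simple_al \<tau>_inv)

lemma B_lin_Nm: "lin_on Nm B" and Bi_lin_Np: "lin_on Np Bi"
  using B_lin Bi_lin D1I(1) D2I(1) unfolding lin_on_def by blast+

lemma B_add: "u \<in> D1 \<Longrightarrow> v \<in> D1 \<Longrightarrow> B (u + v) = B u + B v" and B_scale: "u \<in> D1 \<Longrightarrow> B (c *\<^sub>C u) = c *\<^sub>C B u"
  using B_lin by (auto simp: lin_on_def)
lemma Bi_add: "u \<in> D2 \<Longrightarrow> v \<in> D2 \<Longrightarrow> Bi (u + v) = Bi u + Bi v" and Bi_scale: "u \<in> D2 \<Longrightarrow> Bi (c *\<^sub>C u) = c *\<^sub>C Bi u"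
  using Bi_lin by (auto simp: lin_on_def)

lemma B_0: "B 0 = 0" using lin_on_0[OF B_lin] cvec.subspace_0[OF subspace_D1] by simp
lemma Nm_simps: "u \<in> Nm \<Longrightarrow> v \<in> Nm \<Longrightarrow> u + v \<in> Nm" "u \<in> Nm \<Longrightarrow> c *\<^sub>C u \<in> Nm" "0 \<in> Nm"
  and Np_simps: "u \<in> Np \<Longrightarrow> v \<in> Np \<Longrightarrow> u + v \<in> Np" "u \<in> Np \<Longrightarrow> c *\<^sub>C u \<in> Np" "0 \<in> Np"
  using subspace_n_minus subspace_n_plus by (auto simp: cvec.subspace_add cvec.subspace_scale cvec.subspace_0)

lemma B_Nm: "y \<in> Nm \<Longrightarrow> B y \<in> Nm"
proof (induction rule: n_minus_induct)
  case (fs i) then show ?case by (cases "i \<in> G1") (auto simp: B_fs fs_n_minus Nm_simps)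
qed (auto simp: B_add B_scale B_br D1I Nm_simps n_minus_br)

lemma Bi_Np: "y \<in> Np \<Longrightarrow> Bi y \<in> Np"
proof (induction rule: n_plus_induct)
  case (e i)
  show ?case
  proof (cases "i \<in> G2")
    case True
    then obtain k where "k \<in> G1" "i = \<tau> k" using \<tau>_onto by blast
    then show ?thesis by (simp add: Bi_e e_n_plus)
  qed (simp add: Bi_e Np_simps)
qed (auto simp: Bi_add Bi_scale Bi_br D2I Np_simps n_plus_br)

text \<open>Both sides obey a Leibniz rule along \<open>B\<close>, so the simple generators suffice.
  The bracket with \<open>e i\<close> leaves \<open>n_minus\<close>; that it stays in the domain
  \<open>D1\<close> of \<open>B\<close> has to be carried through the same induction.\<close>

lemma e_B: "y \<in> Nm \<Longrightarrow> i \<in> G1 \<Longrightarrow> br (e i) y \<in> D1 \<and> br (e (\<tau> i)) (B y) = B (br (e i) y)"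
proof (induction rule: n_minus_induct)
  case (add u v)
  then show ?case by (simp add: B_add D1I addr cvec.subspace_add subspace_D1)
next
  case (scale c u)
  then show ?case by (simp add: B_scale D1I scaler cvec.subspace_scale subspace_D1)
next
  case (fs k)
  show ?case
  proof (cases "k \<in> G1")
    case True
    then show ?thesis using fs
      by (auto simp: B_fs e_fs \<tau>_inj B_al D1I al_h_span B_0 cvec.subspace_0 subspace_D1)
  next
    case False
    then have "i \<noteq> k" using fs by auto
    then show ?thesis using False by (simp add: B_fs e_fs zeror B_0 cvec.subspace_0 subspace_D1)
  qed
next
  case (br u v)
  then have IH: "br (e i) u \<in> D1" "br (e i) v \<in> D1"
    "br (e (\<tau> i)) (B u) = B (br (e i) u)" "br (e (\<tau> i)) (B v) = B (br (e i) v)" by auto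
  have m: "br (br (e i) u) v \<in> Nm" "br u (br (e i) v) \<in> Nm"
    using D1_br_Nm[OF IH(1) br(2)] D1_br_Nm[OF IH(2) br(1)] anti[of u "br (e i) v"] cvec.subspace_neg[OF subspace_n_minus] by auto
  have d: "br (e i) (br u v) = br (br (e i) u) v + br u (br (e i) v)" by (rule deriv)
  have "B (br (e i) (br u v)) = br (B (br (e i) u)) (B v) + br (B u) (B (br (e i) v))"
    unfolding d using m IH br by (simp add: B_add B_br D1I)
  also have "\<dots> = br (e (\<tau> i)) (B (br u v))" using br by (simp add: IH(3,4)[symmetric] B_br D1I deriv[of "e (\<tau> i)"])
  finally show ?case using m d Nm_simps D1I by simp
qed

lemma e_B_0: "y \<in> Nm \<Longrightarrow> j \<notin> G2 \<Longrightarrow> br (e j) (B y) = 0"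
proof (induction rule: n_minus_induct)
  case (fs k) then show ?case using \<tau>_G2 by (cases "k \<in> G1") (auto simp: B_fs e_fs zeror)
next
  case (br u v) then show ?case by (simp add: B_br D1I deriv[of "e j"] zerol zeror)
qed (simp_all add: B_add B_scale D1I bisimps)

lemma l_H: "z \<in> l_space K \<Longrightarrow> z \<in> H" by (simp add: l_space_def)
lemma l_al: "z \<in> l_space K \<Longrightarrow> i \<in> G1 \<Longrightarrow> ip (al (\<tau> i)) z = ip (al i) z" by (auto simp: l_space_def ip.diffl)

text \<open>Membership in \<open>l_space K\<close> says that \<alpha> and T\<alpha> take the same
  value there, so \<open>B\<close> preserves the weights for \<open>l_space K\<close>, though not
  those for the full Cartan subalgebra.\<close>

lemma l_B: "y \<in> Nm \<Longrightarrow> z \<in> l_space K \<Longrightarrow> br z (B y) = B (br z y)"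
proof (induction rule: n_minus_induct)
  case (add u v) then show ?case by (simp add: B_add D1I h_n_minus l_H addr)
next
  case (scale c u) then show ?case by (simp add: B_scale D1I h_n_minus l_H scaler)
next
  case (fs k) then show ?case
    by (cases "k \<in> G1") (simp_all add: h_fs[OF l_H] B_scale D1I fs_n_minus B_fs l_al zeror flip: cvec.scale_minus_left)
next
  case (br u v) then show ?case
    by (simp add: B_br D1I h_n_minus l_H n_minus_br B_add deriv[of z])
qed

lemma l_Bi: "u \<in> Np \<Longrightarrow> z \<in> l_space K \<Longrightarrow> br z (Bi u) = Bi (br z u)"
proof (induction rule: n_plus_induct)
  case (add u v) then show ?case by (simp add: Bi_add D2I h_n_plus l_H addr)
next
  case (scale c u) then show ?case by (simp add: Bi_scale D2I h_n_plus l_H scaler)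
next
  case (e k)
  show ?case
  proof (cases "k \<in> G2")
    case True
    then obtain i where "i \<in> G1" "k = \<tau> i" using \<tau>_onto by blast
    then show ?thesis using e by (simp add: h_e[OF l_H] Bi_scale D2I e_n_plus Bi_e l_al)
  qed (use e in \<open>simp add: h_e[OF l_H] Bi_scale D2I e_n_plus Bi_e zeror\<close>)
next
  case (br u v) then show ?case
    by (simp add: Bi_br D2I h_n_plus l_H n_plus_br Bi_add deriv[of z])
qed

text \<open>Each \<alpha> - T\<alpha> has height 0. Hence exponents restricted to
  \<open>l_space K\<close> still know the height, which makes the formal series locally
  finite.\<close>

lemma d_l: "d \<in> l_space K" by (simp add: l_space_def d_in ip.diffl ip_al_d)

lemma Bi_al_br: "i \<in> G1 \<Longrightarrow> u \<in> Np \<Longrightarrow> Bi (br (al (\<tau> i)) u) = br (al i) (Bi u)"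
  by (simp add: Bi_br D2I al_h_span \<tau>_G2 Bi_al)

text \<open>\<open>Bi\<close> on \<open>n_plus\<close> is the transpose of \<open>B\<close> on
  \<open>n_minus\<close>. A leading e in a monomial is moved to the other side by invariance and
  passed through \<open>B\<close> by \<open>e_B\<close> or \<open>e_B_0\<close>.\<close>

lemma adjoint: "u \<in> Np \<Longrightarrow> \<forall>y\<in>Nm. ip (Bi u) y = ip u (B y)"
proof (induction rule: n_plus_mon_induct)
  case (add u v) then show ?case by (simp add: Bi_add D2I ip.addl)
next
  case (scale c u) then show ?case by (simp add: Bi_scale D2I ip.scalel)
next
  case (e j)
  show ?case
  proof
    fix y assume "y \<in> Nm"
    then show "ip (Bi (gen_e K j)) y = ip (gen_e K j) (B y)"
    proof (induction rule: n_minus_mon_induct)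
      case (add u v) then show ?case by (simp add: B_add D1I ip.addr)
    next
      case (scale c u) then show ?case by (simp add: B_scale D1I ip.scaler)
    next
      case (mon w)
      have m: "mon f w \<in> Nm" by (simp add: n_minus_mons mon_in)
      have dB: "br d (B (mon f w)) = (- of_nat (length w)) *\<^sub>C B (mon f w)"
        by (simp only: l_B[OF m d_l] d_monf B_scale[OF D1I(1)[OF m]])
      have de: "br d (gen_e K j) = 1 *\<^sub>C gen_e K j" for j by (simp add: h_e d_in ip_al_d)
      have dBi: "br d (Bi (gen_e K j)) = 1 *\<^sub>C Bi (gen_e K j)"
        using l_Bi[OF e_n_plus d_l, of j] de by simp
      show ?case
      \<comment> \<open>\<open>gen_e K j\<close> has degree 1, and \<open>B\<close> and
        \<open>Bi\<close> preserve degrees, so both pairings vanish unless the word has a single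
        letter.\<close>
      proof (cases "length w = 1")
        case False
        then have n: "(1::complex) + - of_nat (length w) \<noteq> 0"
          by (metis add_uminus_conv_diff eq_iff_diff_eq_0 of_nat_1 of_nat_eq_iff)
        show ?thesis using eigen_orth[OF dBi d_monf n] eigen_orth[OF de dB n] by simp
      next
        case True
        then obtain k where w: "w = [k]" by (cases w) auto
        have "ip (Bi (gen_e K j)) (f_simple K k) = ip (gen_e K j) (B (f_simple K k))"
        proof (cases "j \<in> G2")
          case True
          then obtain i where i: "i \<in> G1" "j = \<tau> i" using \<tau>_onto by auto
          then show ?thesis by (cases "k \<in> G1") (auto simp: Bi_e B_fs ip_e_fs \<tau>_inj ip.zeror)
        next
          case False
          then show ?thesis using \<tau>_G2 by (cases "k \<in> G1") (auto simp: Bi_e B_fs ip_e_fs ip.zeror ip.zerol)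
        qed
        then show ?thesis
          unfolding w mon.simps by (subst (1 2) f_fs) (simp add: B_scale D1I fs_n_minus ip.scaler)
      qed
    qed
  qed
next
  case (br j u)
  show ?case
  proof
    fix y assume y: "y \<in> Nm"
    have inv: "ip (br a b) c = - ip b (br a c)" for a b c using ip_inv[of b a c] anti[of a b] by (simp add: ip.minusl)
    have L: "ip (Bi (br (gen_e K j) u)) y = - ip (Bi u) (br (Bi (gen_e K j)) y)"
      using br by (simp add: Bi_br D2I e_n_plus inv)
    have R: "ip (br (gen_e K j) u) (B y) = - ip u (br (gen_e K j) (B y))" by (rule inv)
    show "ip (Bi (br (gen_e K j) u)) y = ip (br (gen_e K j) u) (B y)"
    proof (cases "j \<in> G2")
      case True
      then obtain i where i: "i \<in> G1" "j = \<tau> i" using \<tau>_onto by auto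
      have eB: "br (gen_e K i) y \<in> D1" "br (gen_e K j) (B y) = B (br (gen_e K i) y)" using e_B[OF y i(1)] i(2) by auto
      then obtain y' h where yh: "br (gen_e K i) y = y' + h" "y' \<in> Nm" "h \<in> h_span K G1" by (auto simp: D1_def)
      have Bh: "B h \<in> H"
      proof -
        have "B ` {h. h \<in> h_span K G1} \<subseteq> H"
        proof safe
          fix h assume "h \<in> h_span K G1"
          then have "h \<in> D1 \<and> B h \<in> H" unfolding h_span_def
          proof (induction rule: cvec.span_induct_alt)
            case base show ?case using B_0 cvec.subspace_0[OF H(1)] cvec.subspace_0[OF subspace_D1] by simp
          next
            case (step c a b)
            then obtain k where k: "k \<in> G1" "a = al k" by (auto simp: h_simple_al)
            then have "a \<in> D1" "B a \<in> H" by (auto simp: D1I al_h_span B_al al_in)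
            then show ?case using step B_add[of "c *\<^sub>C a" b] B_scale[of a c] cvec.subspace_scale[OF subspace_D1, of a c]
              by (auto intro: cvec.subspace_add cvec.subspace_scale H(1) subspace_D1)
          qed
          then show "B h \<in> H" ..
        qed
        then show ?thesis using yh(3) by auto
      qed
      \<comment> \<open>The Cartan part of the bracket and its image under \<open>B\<close> are
        orthogonal to \<open>n_plus\<close>, so the induction hypothesis, which concerns
        \<open>n_minus\<close>, is enough.\<close>
      have "ip (Bi u) (br (gen_e K i) y) = ip (Bi u) y'"
        using yh ip_n_H(1)[OF Bi_Np[OF br(1)], of h] h_span_H by (auto simp: ip.addr)
      also have "\<dots> = ip u (B y')" using br yh by auto
      also have "\<dots> = ip u (B (br (gen_e K i) y))"
        using yh ip_n_H(1)[OF br(1) Bh] by (simp add: B_add D1I ip.addr)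
      finally show ?thesis using L R eB i by (simp add: Bi_e)
    next
      case False
      then show ?thesis using L R e_B_0[OF y False] by (simp add: Bi_e zerol ip.zeror)
    qed
  qed
qed

lemma Bs_Nm: "y \<in> Nm \<Longrightarrow> (B ^^ s) y \<in> Nm" and Bis_Np: "u \<in> Np \<Longrightarrow> (Bi ^^ s) u \<in> Np"
  by (induction s) (simp_all add: B_Nm Bi_Np)

lemma Bs_lin: "lin_on Nm (B ^^ s)" and Bis_lin: "lin_on Np (Bi ^^ s)"
proof -
  show "lin_on Nm (B ^^ s)"
  proof (induction s)
    case 0 show ?case by (simp add: lin_on_def)
  next
    case (Suc s)
    have "(B ^^ s) ` Nm \<subseteq> Nm" using Bs_Nm by auto
    from lin_on_compose[OF Suc this B_lin_Nm] show ?case by (simp add: comp_def)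
  qed
  show "lin_on Np (Bi ^^ s)"
  proof (induction s)
    case 0 show ?case by (simp add: lin_on_def)
  next
    case (Suc s)
    have "(Bi ^^ s) ` Np \<subseteq> Np" using Bis_Np by auto
    from lin_on_compose[OF Suc this Bi_lin_Np] show ?case by (simp add: comp_def)
  qed
qed

lemma l_eigen_B: "y \<in> Nm \<Longrightarrow> z \<in> l_space K \<Longrightarrow> br z y = c *\<^sub>C y \<Longrightarrow> br z ((B ^^ s) y) = c *\<^sub>C (B ^^ s) y"
  by (induction s) (simp_all add: l_B Bs_Nm B_scale D1I)

lemma l_eigen_Bi: "u \<in> Np \<Longrightarrow> z \<in> l_space K \<Longrightarrow> br z u = c *\<^sub>C u \<Longrightarrow> br z ((Bi ^^ s) u) = c *\<^sub>C (Bi ^^ s) u"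
  by (induction s) (simp_all add: l_Bi Bis_Np Bi_scale D2I)

subsection \<open>The orthogonal decomposition of the Cartan subalgebra\<close>

lemma ob_fin: "finite I1" "finite I2" "I1 \<inter> I2 = {}"
  and ob_on: "j \<in> I1 \<union> I2 \<Longrightarrow> k \<in> I1 \<union> I2 \<Longrightarrow> ip (x j) (x k) = (if j = k then 1 else 0)"
  and ob_l: "cvec.span (x ` I1) = l_space K" and ob_h0: "cvec.span (x ` I2) = h0_space K"
  using ob by (auto simp: adapted_orthonormal_basis_def)

lemma x_l: "j \<in> I1 \<Longrightarrow> x j \<in> l_space K" and x_h0: "j \<in> I2 \<Longrightarrow> x j \<in> h0_space K"
  using ob_l ob_h0 by (auto intro: cvec.span_base)

lemma h0_H: "z \<in> h0_space K \<Longrightarrow> z \<in> H" by (simp add: h0_space_def)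

lemma x_H: "j \<in> I1 \<union> I2 \<Longrightarrow> x j \<in> H" using x_l x_h0 l_H h0_H by blast

lemma l_h0: "z \<in> l_space K \<Longrightarrow> y \<in> h0_space K \<Longrightarrow> ip z y = 0" "z \<in> l_space K \<Longrightarrow> y \<in> h0_space K \<Longrightarrow> ip y z = 0"
  by (auto simp: h0_space_def ip_sym)

lemma subspace_l: "cvec.subspace (l_space K)" and subspace_h0: "cvec.subspace (h0_space K)"
  unfolding ob_l[symmetric] ob_h0[symmetric] by simp_all

definition pl :: "'g \<Rightarrow> 'g" where "pl z = (\<Sum>j\<in>I1. ip z (x j) *\<^sub>C x j)"

lemma pl_l: "pl z \<in> l_space K"
  unfolding pl_def by (intro cvec.subspace_sum cvec.subspace_scale subspace_l x_l)

lemma ip_pl: "y \<in> l_space K \<Longrightarrow> ip (pl z) y = ip z y"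
proof -
  assume "y \<in> l_space K"
  then have "y \<in> cvec.span (x ` I1)" by (simp add: ob_l)
  moreover have "ip (pl z) (x k) = ip z (x k)" if "k \<in> I1" for k
  proof -
    have "ip (pl z) (x k) = (\<Sum>j\<in>I1. if j = k then ip z (x k) else 0)"
      unfolding pl_def ip.suml ip.scalel scaleC_complex_def by (rule sum.cong) (use ob_on that in auto)
    then show ?thesis using ob_fin that by simp
  qed
  ultimately show ?thesis using clinear_eq_on_span[OF ip.lin_r ip.lin_r, of y "x ` I1"] by blast
qed

lemma pl_h0: "z \<in> H \<Longrightarrow> z - pl z \<in> h0_space K"
  unfolding h0_space_def using ip_pl pl_l l_H cvec.subspace_diff[OF H(1)] by (auto simp: ip.diffl)

lemma l_int_h0: "z \<in> l_space K \<Longrightarrow> z \<in> h0_space K \<Longrightarrow> z = 0"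
proof (rule H_nondeg)
  assume z: "z \<in> l_space K" "z \<in> h0_space K"
  show "z \<in> H" using z l_H by blast
  fix y assume "y \<in> H"
  then have "ip z (pl y) + ip z (y - pl y) = 0" using z l_h0 pl_l pl_h0 by simp
  then show "ip z y = 0" by (simp add: ip.diffr)
qed

lemma l_eq: "y \<in> l_space K \<Longrightarrow> y' \<in> l_space K \<Longrightarrow> (\<And>z. z \<in> l_space K \<Longrightarrow> ip y z = ip y' z) \<Longrightarrow> y = y'"
proof -
  assume y: "y \<in> l_space K" "y' \<in> l_space K" "\<And>z. z \<in> l_space K \<Longrightarrow> ip y z = ip y' z"
  have "y - y' \<in> l_space K" using y cvec.subspace_diff[OF subspace_l] by blast
  moreover then have "y - y' \<in> h0_space K" using y l_H by (auto simp: h0_space_def ip.diffl)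
  ultimately show ?thesis using l_int_h0 by fastforce
qed

lemma l_proj_pl: "l_proj K z = pl z"
  unfolding l_proj_def
  by (rule the_equality) (use pl_l ip_pl l_eq in auto)

lemma pl_lin: "clinear pl"
  unfolding pl_def by (intro clinear_sum_fun clinearI) (simp_all add: ip.addl ip.scalel scaleC_add_left scaleC_scaleC scaleC_complex_def)

lemma pl_id: "z \<in> l_space K \<Longrightarrow> pl z = z"
  by (rule l_eq) (auto simp: pl_l ip_pl)

text \<open>Parseval's identity for the adapted basis. It gives the value of the Cartan part of the
  Casimir element on a weight vector.\<close>

lemma H_norm: "z \<in> H \<Longrightarrow> (\<Sum>j\<in>I1. ip z (x j) * ip z (x j)) + (\<Sum>j\<in>I2. ip z (x j) * ip z (x j)) = ip z z"
proof -
  assume z: "z \<in> H"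
  define q where "q = (\<Sum>j\<in>I2. ip z (x j) *\<^sub>C x j)"
  have q: "q \<in> h0_space K" unfolding q_def by (intro cvec.subspace_sum cvec.subspace_scale subspace_h0 x_h0)
  have "z - pl z - q = 0"
  proof -
    define r where "r = z - pl z - q"
    have r: "r \<in> h0_space K" unfolding r_def by (rule cvec.subspace_diff[OF subspace_h0 pl_h0[OF z] q])
    have "ip r (x k) = 0" if "k \<in> I2" for k
    proof -
      have "ip q (x k) = (\<Sum>j\<in>I2. if j = k then ip z (x k) else 0)"
        unfolding q_def ip.suml ip.scalel scaleC_complex_def by (rule sum.cong) (use ob_on that in auto)
      moreover have "ip (pl z) (x k) = 0" using l_h0 pl_l x_h0 that by blast
      ultimately show ?thesis using ob_fin that by (simp add: r_def ip.diffl)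
    qed
    then have "ip r y = 0" if "y \<in> h0_space K" for y
      using clinear_eq_on_span[OF ip.lin_r clinear_zero_fun, of y "x ` I2" r] that ob_h0 by auto
    moreover have "ip r y = 0" if "y \<in> l_space K" for y using l_h0 r that by blast
    ultimately have "ip r y = 0" if "y \<in> H" for y
      using pl_h0[OF that] pl_l[of y] by (metis add_0 diff_add_cancel ip.addr)
    then show ?thesis using H_nondeg h0_H[OF r] unfolding r_def by blast
  qed
  then have "z - pl z = q" by simp
  then have "z = pl z + q" by (simp add: diff_eq_eq add.commute)
  then have "ip z z = ip z (pl z) + ip z q" by (metis ip.addr)
  then show ?thesis by (simp add: pl_def q_def ip.sumr ip.scaler scaleC_complex_def)
qed

abbreviation "aa i \<equiv> al i - al (\<tau> i)"

lemma aa_h0: "i \<in> G1 \<Longrightarrow> aa i \<in> h0_space K"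
  by (auto simp: h0_space_def l_al ip.diffl al_in intro: cvec.subspace_diff H(1))

text \<open>A functional separating a vector from the span is represented on
  \<open>h0_space K\<close> by a vector there, through the orthonormal basis. That vector is
  orthogonal to all \<open>aa i\<close>, hence lies in \<open>l_space K\<close>, and pairs to zero
  with the separated vector.\<close>

lemma h0_span: "h0_space K = cvec.span (aa ` G1)"
proof
  show "cvec.span (aa ` G1) \<subseteq> h0_space K" by (rule cvec.span_minimal) (auto simp: aa_h0 subspace_h0)
  show "h0_space K \<subseteq> cvec.span (aa ` G1)"
  proof
    fix h assume h: "h \<in> h0_space K"
    show "h \<in> cvec.span (aa ` G1)"
    proof (rule ccontr)
      assume "h \<notin> cvec.span (aa ` G1)"
      then obtain \<theta> :: "'g \<Rightarrow> complex" where \<theta>: "clinear \<theta>" "\<theta> h = 1" "\<And>u. u \<in> cvec.span (aa ` G1) \<Longrightarrow> \<theta> u = 0"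
        using separating_functional_subspace by blast
      define z where "z = (\<Sum>j\<in>I2. \<theta> (x j) *\<^sub>C x j)"
      have z: "z \<in> h0_space K" unfolding z_def by (intro cvec.subspace_sum cvec.subspace_scale subspace_h0 x_h0)
      have "ip z (x k) = \<theta> (x k)" if "k \<in> I2" for k
      proof -
        have "ip z (x k) = (\<Sum>j\<in>I2. if j = k then \<theta> (x k) else 0)"
          unfolding z_def ip.suml ip.scalel scaleC_complex_def by (rule sum.cong) (use ob_on that in auto)
        then show ?thesis using ob_fin that by simp
      qed
      then have rep: "ip z y = \<theta> y" if "y \<in> h0_space K" for y
        using clinear_eq_on_span[OF ip.lin_r \<theta>(1), of y "x ` I2" z] that ob_h0 by auto
      have "ip (aa i) z = 0" if "i \<in> G1" for i
        using rep[OF aa_h0[OF that]] \<theta>(3)[OF cvec.span_base] that ip_sym by (metis imageI)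
      then have "z \<in> l_space K" using h0_H[OF z] by (simp add: l_space_def)
      then show False using rep[OF h] \<theta>(2) l_h0 h by auto
    qed
  qed
qed

definition cayley_rel where "cayley_rel z y \<longleftrightarrow> y \<in> h0_space K \<and> (\<forall>i\<in>G1. ip (aa i) y = ip (al i + al (\<tau> i)) z)"

lemma cayley_eq: "cayley_rel z y \<Longrightarrow> cayley K z = y"
  unfolding cayley_def
proof (rule the_equality)
  assume y: "cayley_rel z y"
  then show "y \<in> h0_space K \<and> (\<forall>i\<in>G1. ip (aa i) y = ip (al i + al (\<tau> i)) z)" by (simp add: cayley_rel_def)
  fix y' assume y': "y' \<in> h0_space K \<and> (\<forall>i\<in>G1. ip (aa i) y' = ip (al i + al (\<tau> i)) z)"
  have "y' - y \<in> h0_space K" using y y' cvec.subspace_diff[OF subspace_h0] by (simp add: cayley_rel_def)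
  moreover then have "y' - y \<in> l_space K" using y y' h0_H by (auto simp: l_space_def cayley_rel_def ip.diffr)
  ultimately show "y' = y" using l_int_h0 by fastforce
qed

lemma cayley_aa: "i \<in> G1 \<Longrightarrow> cayley_rel (aa i) (- ((al i + al (\<tau> i)) - pl (al i + al (\<tau> i))))"
  unfolding cayley_rel_def
proof
  assume i: "i \<in> G1"
  let ?b = "al i + al (\<tau> i)"
  have bH: "?b \<in> H" using al_in cvec.subspace_add[OF H(1)] by blast
  show "- (?b - pl ?b) \<in> h0_space K" by (rule cvec.subspace_neg[OF subspace_h0 pl_h0[OF bH]])
  show "\<forall>k\<in>G1. ip (aa k) (- (?b - pl ?b)) = ip (al k + al (\<tau> k)) (aa i)"
  proof
    fix k assume k: "k \<in> G1"
    have "ip (aa k) (pl ?b) = 0" using l_h0 aa_h0[OF k] pl_l by blast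
    then have "ip (aa k) (- (?b - pl ?b)) = - ip (aa k) ?b" by (simp add: ip.bisimps)
    also have "\<dots> = ip (al k + al (\<tau> k)) (aa i)"
      using \<tau>_ip[OF k i] ip_sym[of "al (\<tau> k)" "al i"] by (simp add: ip.bisimps)
    finally show "ip (aa k) (- (?b - pl ?b)) = ip (al k + al (\<tau> k)) (aa i)" .
  qed
qed

lemma cayley_rel_lin: "cayley_rel z y \<Longrightarrow> cayley_rel z' y' \<Longrightarrow> cayley_rel (c *\<^sub>C z + z') (c *\<^sub>C y + y')" "cayley_rel 0 0"
  unfolding cayley_rel_def by (auto simp: ip.addr ip.scaler ip.zeror intro!: cvec.subspace_add cvec.subspace_scale cvec.subspace_0 subspace_h0)

text \<open>On the vectors \<open>aa i\<close> spanning \<open>h0_space K\<close>, the operator \<open>(1 - C\<^sub>T) / 2\<close> is the projection of \<open>al i\<close>.\<close>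

lemma half_cayley_induct:
  assumes z: "z \<in> h0_space K"
    and lin: "\<And>c z y z' y'. P z y \<Longrightarrow> P z' y' \<Longrightarrow> P (c *\<^sub>C z + z') (c *\<^sub>C y + y')" and zero: "P 0 0"
    and base: "\<And>i. i \<in> G1 \<Longrightarrow> P (aa i) (al i - pl (al i))"
  shows "P z ((1/2) *\<^sub>C (z - cayley K z))"
proof -
  have "\<exists>y. cayley_rel z y \<and> P z ((1/2) *\<^sub>C (z - y))"
    using z unfolding h0_span
  proof (induction rule: cvec.span_induct_alt)
    case base show ?case using cayley_rel_lin(2) zero by (intro exI[of _ 0]) simp
  next
    case (step c a b)
    then obtain i where i: "i \<in> G1" "a = aa i" by auto
    define y where "y = - ((al i + al (\<tau> i)) - pl (al i + al (\<tau> i)))"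
    have cy: "cayley_rel a y" using cayley_aa i by (simp add: y_def)
    \<comment> \<open>\<open>aa i\<close> lies in \<open>h0_space K\<close>, so \<alpha> and
      T\<alpha> have the same projection to \<open>l_space K\<close>; subtracting the transform
      therefore leaves twice the complementary part of \<alpha>.\<close>
    have "pl (aa i) = 0" by (rule l_int_h0[OF pl_l]) (use pl_h0[OF h0_H[OF aa_h0[OF i(1)]]] aa_h0[OF i(1)] cvec.subspace_diff[OF subspace_h0, of "aa i" "aa i - pl (aa i)"] in simp)
    then have pe: "pl (al (\<tau> i)) = pl (al i)" by (simp add: clinear_diff[OF pl_lin])
    have "a - y = 2 *\<^sub>C (al i - pl (al i))"
    proof -
      have "(2::complex) = 1 + 1" by simp
      then have "2 *\<^sub>C (al i - pl (al i)) = (al i - pl (al i)) + (al i - pl (al i))" by (metis scaleC_add_left scaleC_one)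
      then show ?thesis by (simp add: i y_def clinear_add[OF pl_lin] pe algebra_simps)
    qed
    then have "(1/2) *\<^sub>C (a - y) = al i - pl (al i)" by simp
    then have Pa: "P a ((1/2) *\<^sub>C (a - y))" using assms(4) i by simp
    obtain y' where y': "cayley_rel b y'" "P b ((1/2) *\<^sub>C (b - y'))" using step by blast
    have "(1/2) *\<^sub>C ((c *\<^sub>C a + b) - (c *\<^sub>C y + y')) = c *\<^sub>C ((1/2) *\<^sub>C (a - y)) + (1/2) *\<^sub>C (b - y')"
      by (simp add: scaleC_add_right cvec.scale_right_diff_distrib mult.commute algebra_simps)
    then have "P (c *\<^sub>C a + b) ((1/2) *\<^sub>C ((c *\<^sub>C a + b) - (c *\<^sub>C y + y')))" using lin[OF Pa y'(2)] by simp
    then show ?case using cayley_rel_lin(1)[OF cy y'(1)] by blast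
  qed
  then show ?thesis using cayley_eq by metis
qed

end

section \<open>Dual bases of the root spaces\<close>

context km begin

lemma pos_roots_Q: "\<alpha> \<in> pos_roots K \<Longrightarrow> \<alpha> \<in> Q_plus K" and pos_roots_H: "\<alpha> \<in> pos_roots K \<Longrightarrow> \<alpha> \<in> H"
  by (auto simp: pos_roots_def Q_in)

lemma ht_pos: "\<alpha> \<in> pos_roots K \<Longrightarrow> ht \<alpha> > 0"
  using Q_ht_0[of \<alpha>] by (auto simp: pos_roots_def)

lemma root_space_br: "u \<in> root_space K \<alpha> \<Longrightarrow> h \<in> H \<Longrightarrow> br h u = ip \<alpha> h *\<^sub>C u"
  by (simp add: root_space_def)

lemma root_space_d: "\<alpha> \<in> Q_plus K \<Longrightarrow> u \<in> root_space K \<alpha> \<Longrightarrow> br d u = of_nat (ht \<alpha>) *\<^sub>C u"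
  "\<alpha> \<in> Q_plus K \<Longrightarrow> u \<in> root_space K (- \<alpha>) \<Longrightarrow> br d u = (- of_nat (ht \<alpha>)) *\<^sub>C u"
  using root_space_br[OF _ d_in] ht by (auto simp: ip.minusl)

lemma mon_root_space: "mon e w \<in> root_space K (\<Sum>i\<leftarrow>w. al i)"
  by (simp add: root_space_def h_mon sum_list_al)

lemma ht_sum_list': "ht (\<Sum>i\<leftarrow>w. al i) = length w"
proof (rule ht_unique)
  show "ip (\<Sum>i\<leftarrow>w. al i) d = of_nat (length w)"
    by (induction w) (auto simp: ip.bisimps ip_al_d)
qed

lemma mon_pos_root: "mon e w \<noteq> 0 \<Longrightarrow> w \<noteq> [] \<Longrightarrow> (\<Sum>i\<leftarrow>w. al i) \<in> pos_roots K"
  unfolding pos_roots_def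
proof (intro CollectI conjI Q_sum_list)
  assume m: "mon e w \<noteq> 0" "w \<noteq> []"
  then show "root_space K (\<Sum>i\<leftarrow>w. al i) \<noteq> {0}" using mon_root_space by blast
  have "ht (\<Sum>i\<leftarrow>w. al i) > 0" using m(2) by (simp add: ht_sum_list')
  moreover have "ht 0 = 0" by (rule ht_unique) (simp add: ip.zerol)
  ultimately show "(\<Sum>i\<leftarrow>w. al i) \<noteq> 0" by auto
qed

end

section \<open>Truncated dual bases and transport of the canonical element\<close>

context bd begin

definition R :: "nat \<Rightarrow> 'g set" where "R n = {\<alpha> \<in> pos_roots K. ht \<alpha> \<le> n}"
definition IX :: "nat \<Rightarrow> ('g \<times> nat) set" where "IX n = Sigma (R n) (\<lambda>\<alpha>. {1..root_mult K \<alpha>})"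

lemma R_finite: "finite (R n)"
  unfolding R_def using Q_ht_finite[of n] by (rule finite_subset[rotated]) (auto simp: pos_roots_Q)

lemma IX_finite: "finite (IX n)" unfolding IX_def by (intro finite_SigmaI R_finite) simp

lemma IX_D:
  assumes "(\<alpha>, t) \<in> IX n"
  shows "\<alpha> \<in> pos_roots K" "ht \<alpha> \<le> n" "t \<in> {1..root_mult K \<alpha>}" "eb \<alpha> t \<in> root_space K \<alpha>" "fb \<alpha> t \<in> root_space K (- \<alpha>)"
    "eb \<alpha> t \<in> Np" "fb \<alpha> t \<in> Nm" "br d (eb \<alpha> t) = of_nat (ht \<alpha>) *\<^sub>C eb \<alpha> t" "br d (fb \<alpha> t) = (- of_nat (ht \<alpha>)) *\<^sub>C fb \<alpha> t"
proof -
  show 1: "\<alpha> \<in> pos_roots K" and "ht \<alpha> \<le> n" and t: "t \<in> {1..root_mult K \<alpha>}" using assms by (auto simp: IX_def R_def)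
  have "cvec.span (eb \<alpha> ` {1..root_mult K \<alpha>}) = root_space K \<alpha>" "cvec.span (fb \<alpha> ` {1..root_mult K \<alpha>}) = root_space K (- \<alpha>)"
    using rb 1 by (auto simp: root_bases_def)
  then show 2: "eb \<alpha> t \<in> root_space K \<alpha>" "fb \<alpha> t \<in> root_space K (- \<alpha>)" using t by (metis cvec.span_base imageI)+
  then show 3: "br d (eb \<alpha> t) = of_nat (ht \<alpha>) *\<^sub>C eb \<alpha> t" "br d (fb \<alpha> t) = (- of_nat (ht \<alpha>)) *\<^sub>C fb \<alpha> t"
    using root_space_d pos_roots_Q[OF 1] by auto
  show "eb \<alpha> t \<in> Np" "fb \<alpha> t \<in> Nm" using degree_pos[OF 3(1)] degree_neg[OF 3(2)] ht_pos[OF 1] by auto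
qed

lemma dual: "(\<alpha>, t) \<in> IX n \<Longrightarrow> (\<beta>, s) \<in> IX m \<Longrightarrow> ip (eb \<alpha> t) (fb \<beta> s) = (if \<alpha> = \<beta> \<and> t = s then 1 else 0)"
proof -
  assume a: "(\<alpha>, t) \<in> IX n" "(\<beta>, s) \<in> IX m"
  note A = IX_D[OF a(1)] and B = IX_D[OF a(2)]
  show ?thesis
  proof (cases "\<alpha> = \<beta>")
    case True
    then show ?thesis using rb A(1,3) B(3) by (auto simp: root_bases_def)
  next
    case False
    then obtain h where h: "h \<in> H" "ip \<alpha> h \<noteq> ip \<beta> h" using H_eq pos_roots_H A(1) B(1) by blast
    have "ip (eb \<alpha> t) (fb \<beta> s) = 0"
      using eigen_orth[OF root_space_br[OF A(4) h(1)] root_space_br[OF B(5) h(1)]] h(2) by (simp add: ip.minusl)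
    then show ?thesis using False by simp
  qed
qed

text \<open>An element of degree \<open>m\<close> is a combination of monomials of length
  \<open>m\<close>, and each nonzero one lies in a root space of height \<open>m\<close>, hence
  among the truncated bases. Duality then identifies the coefficients.\<close>

lemma expand_e:
  assumes "br d u = of_nat m *\<^sub>C u" "m > 0" "m \<le> n"
  shows "u = (\<Sum>(\<alpha>, t)\<in>IX n. ip u (fb \<alpha> t) *\<^sub>C eb \<alpha> t)"
proof -
  define EB where "EB = (\<lambda>(\<alpha>, t). eb \<alpha> t) ` IX n"
  have "u \<in> cvec.span {t \<in> T. \<forall>h\<in>{d}. br h t = of_nat m *\<^sub>C t}"
    by (rule eigen_span) (use assms d_in in auto)
  moreover have "{t \<in> T. \<forall>h\<in>{d}. br h t = of_nat m *\<^sub>C t} \<subseteq> cvec.span EB"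
  proof
    fix t assume "t \<in> {t \<in> T. \<forall>h\<in>{d}. br h t = of_nat m *\<^sub>C t}"
    then have t: "t \<in> T" "br d t = of_nat m *\<^sub>C t" by auto
    show "t \<in> cvec.span EB"
    proof (cases "t = 0")
      case False
      have "\<not> t \<in> H" using t d_H[of t] False assms(2) by auto
      moreover have "t \<noteq> mon f w" for w
      proof
        assume w: "t = mon f w"
        then have "of_nat m + of_nat (length w) = (0::complex)" using mon_degree_unique(2)[of w "of_nat m"] t False by auto
        then have "m + length w = 0" by (metis of_nat_add of_nat_eq_0_iff)
        then show False using assms(2) by simp
      qed
      ultimately obtain w where w: "t = mon e w" using t(1) by (auto simp: T_def)
      have "of_nat m = (of_nat (length w) :: complex)" using mon_degree_unique(1)[of w "of_nat m"] t(2) False w by auto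
      then have len: "length w = m" by simp
      then have wn: "w \<noteq> []" using assms(2) by auto
      let ?\<alpha> = "\<Sum>i\<leftarrow>w. al i"
      have \<alpha>: "?\<alpha> \<in> pos_roots K" using mon_pos_root wn False w by auto
      then have aR: "?\<alpha> \<in> R n" using assms(3) len by (simp add: R_def ht_sum_list')
      have "t \<in> cvec.span (eb ?\<alpha> ` {1..root_mult K ?\<alpha>})" using mon_root_space[of w] rb \<alpha> w by (auto simp: root_bases_def)
      moreover have "eb ?\<alpha> ` {1..root_mult K ?\<alpha>} \<subseteq> EB" using aR unfolding EB_def IX_def by force
      ultimately show ?thesis using cvec.span_mono by blast
    qed (simp add: cvec.span_zero)
  qed
  ultimately have uE: "u \<in> cvec.span EB" using cvec.span_minimal[OF _ cvec.subspace_span] by blast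
  have lin: "clinear (\<lambda>u. \<Sum>(\<alpha>, t)\<in>IX n. ip u (fb \<alpha> t) *\<^sub>C eb \<alpha> t)"
    unfolding case_prod_unfold
    by (intro clinear_sum_fun clinearI) (simp_all add: ip.addl ip.scalel scaleC_add_left scaleC_scaleC scaleC_complex_def)
  have "s = (\<Sum>(\<alpha>, t)\<in>IX n. ip s (fb \<alpha> t) *\<^sub>C eb \<alpha> t)" if s: "s \<in> EB" for s
  proof -
    obtain \<beta> k where bk: "(\<beta>, k) \<in> IX n" "s = eb \<beta> k" using s by (auto simp: EB_def)
    have "(\<Sum>(\<alpha>, t)\<in>IX n. ip s (fb \<alpha> t) *\<^sub>C eb \<alpha> t) = (\<Sum>z\<in>IX n. if z = (\<beta>, k) then eb \<beta> k else 0)"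
      by (rule sum.cong[OF refl]) (use dual[OF bk(1)] bk(2) in \<open>auto split: prod.splits\<close>)
    then show ?thesis using bk IX_finite by simp
  qed
  then show ?thesis using clinear_eq_on_span[OF clinear_id_fun lin uE] by blast
qed

text \<open>Deduced from \<open>expand_e\<close> through the form: the difference of both sides has
  degree \<open>- m\<close>, so it can pair nontrivially only with degree \<open>m\<close>, where
  the e-bases already decide.\<close>

lemma expand_f:
  assumes "br d y = (- of_nat m) *\<^sub>C y" "m > 0" "m \<le> n"
  shows "y = (\<Sum>(\<alpha>, t)\<in>IX n. ip (eb \<alpha> t) y *\<^sub>C fb \<alpha> t)"
proof -
  have yN: "y \<in> Nm" by (rule degree_neg[OF assms(1,2)])
  define q where "q = (\<Sum>(\<alpha>, t)\<in>IX n. ip (eb \<alpha> t) y *\<^sub>C fb \<alpha> t)"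
  have qN: "q \<in> Nm" unfolding q_def by (intro cvec.subspace_sum subspace_n_minus) (auto intro!: cvec.subspace_scale subspace_n_minus IX_D(7))
  have eq: "ip (eb \<beta> k) q = ip (eb \<beta> k) y" if bk: "(\<beta>, k) \<in> IX n" for \<beta> k
  proof -
    have "ip (eb \<beta> k) q = (\<Sum>z\<in>IX n. if z = (\<beta>, k) then ip (eb \<beta> k) y else 0)"
      unfolding q_def ip.sumr
      by (rule sum.cong[OF refl]) (use dual[OF bk] in \<open>auto simp: ip.scaler scaleC_complex_def split: prod.splits\<close>)
    then show ?thesis using bk IX_finite by simp
  qed
  have dq: "br d q = (- of_nat m) *\<^sub>C q"
  proof -
    have "br d (ip (eb \<alpha> t) y *\<^sub>C fb \<alpha> t) = (- of_nat m) *\<^sub>C (ip (eb \<alpha> t) y *\<^sub>C fb \<alpha> t)" if "(\<alpha>, t) \<in> IX n" for \<alpha> t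
    proof (cases "ht \<alpha> = m")
      case False
      then have "of_nat (ht \<alpha>) + - of_nat m \<noteq> (0::complex)" by simp
      then have "ip (eb \<alpha> t) y = 0" using eigen_orth[OF IX_D(8)[OF that] assms(1)] by simp
      then show ?thesis by (simp add: zeror)
    qed (simp add: scaler IX_D(9)[OF that])
    then show ?thesis unfolding q_def sumr cvec.scale_sum_right by (intro sum.cong refl) auto
  qed
  have "y - q = 0"
  proof (rule ip_ext)
    fix t assume t: "t \<in> T"
    consider "t \<in> H" | w where "t = mon e w" | w where "t = mon f w" using t by (auto simp: T_def)
    then show "ip (y - q) t = 0"
    proof cases
      case 1 then show ?thesis using ip_n_H(2) yN qN by (simp add: ip.diffl)
    next
      case 3 then show ?thesis using ip_n_n' yN qN by (simp add: ip.diffl n_minus_mons mon_in)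
    next
      case 2
      show ?thesis
      proof (cases "length w = m")
        case True
        have dt: "br d t = of_nat m *\<^sub>C t" using d_mon[of w] 2 True by simp
        have "ip t (y - q) = ip (\<Sum>(\<alpha>, s)\<in>IX n. ip t (fb \<alpha> s) *\<^sub>C eb \<alpha> s) (y - q)"
          using expand_e[OF dt assms(2,3)] by simp
        also have "\<dots> = 0" using eq by (simp add: ip.suml ip.scalel ip.diffr case_prod_unfold)
        finally show ?thesis using ip_sym by metis
      next
        case False
        then have n: "- of_nat m + of_nat (length w) \<noteq> (0::complex)"
          by (metis add.commute add_uminus_conv_diff eq_iff_diff_eq_0 of_nat_eq_iff)
        show ?thesis using eigen_orth[OF assms(1) d_mon n] eigen_orth[OF dq d_mon n] 2 by (simp add: ip.diffl)
      qed
    qed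
  qed
  then show ?thesis by (simp add: q_def)
qed

lemma expand_e_Bi: "(\<alpha>, t) \<in> IX n \<Longrightarrow> u = (Bi ^^ v) (eb \<alpha> t) \<Longrightarrow> u = (\<Sum>(\<beta>, s)\<in>IX n. ip u (fb \<beta> s) *\<^sub>C eb \<beta> s)"
proof -
  assume a: "(\<alpha>, t) \<in> IX n" "u = (Bi ^^ v) (eb \<alpha> t)"
  have "br d u = of_nat (ht \<alpha>) *\<^sub>C u" unfolding a(2) by (rule l_eigen_Bi[OF IX_D(6)[OF a(1)] d_l IX_D(8)[OF a(1)]])
  then show ?thesis using IX_D(2)[OF a(1)] ht_pos[OF IX_D(1)[OF a(1)]] by (intro expand_e)
qed

lemma expand_f_B: "(\<alpha>, t) \<in> IX n \<Longrightarrow> y = (B ^^ v) (fb \<alpha> t) \<Longrightarrow> y = (\<Sum>(\<beta>, s)\<in>IX n. ip (eb \<beta> s) y *\<^sub>C fb \<beta> s)"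
proof -
  assume a: "(\<alpha>, t) \<in> IX n" "y = (B ^^ v) (fb \<alpha> t)"
  have "br d y = (- of_nat (ht \<alpha>)) *\<^sub>C y" unfolding a(2) by (rule l_eigen_B[OF IX_D(7)[OF a(1)] d_l IX_D(9)[OF a(1)]])
  then show ?thesis using IX_D(2)[OF a(1)] ht_pos[OF IX_D(1)[OF a(1)]] by (intro expand_f)
qed

text \<open>\<open>B\<close> preserves weights for \<open>l_space K\<close>, so its matrix connects
  only roots with the same restriction.\<close>

lemma pl_pairing:
  assumes "(\<alpha>, t) \<in> IX n" "(\<beta>, s) \<in> IX n" "ip (eb \<beta> s) (B (fb \<alpha> t)) \<noteq> 0"
  shows "pl \<beta> = pl \<alpha>"
proof (rule l_eq[OF pl_l pl_l])
  fix z assume z: "z \<in> l_space K"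
  have 1: "br z (eb \<beta> s) = ip \<beta> z *\<^sub>C eb \<beta> s" by (rule root_space_br[OF IX_D(4)[OF assms(2)] l_H[OF z]])
  have "br z (fb \<alpha> t) = ip (- \<alpha>) z *\<^sub>C fb \<alpha> t" by (rule root_space_br[OF IX_D(5)[OF assms(1)] l_H[OF z]])
  from l_eigen_B[OF IX_D(7)[OF assms(1)] z this, of 1] have 2: "br z (B (fb \<alpha> t)) = ip (- \<alpha>) z *\<^sub>C B (fb \<alpha> t)" by simp
  have "ip \<beta> z + ip (- \<alpha>) z = 0" using eigen_orth[OF 1 2] assms(3) by blast
  then show "ip (pl \<beta>) z = ip (pl \<alpha>) z" using z by (simp add: ip_pl ip.minusl)
qed

text \<open>Adjointness, stated for the canonical element: applying \<open>B\<close> to the f-side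
  equals applying \<open>Bi\<close> to the e-side. The extra argument of \<open>\<Phi>\<close>
  carries the restricted root, to which the exponential is attached; by \<open>pl_pairing\<close> it
  is unaffected by the change of basis.\<close>

lemma canonical_step:
  fixes \<Phi> :: "'g \<Rightarrow> 'g \<Rightarrow> 'g \<Rightarrow> 'w::complex_vec"
  assumes 1: "\<And>\<gamma> y. y \<in> Nm \<Longrightarrow> lin_on Np (\<lambda>u. \<Phi> \<gamma> u y)" and 2: "\<And>\<gamma> u. u \<in> Np \<Longrightarrow> lin_on Nm (\<Phi> \<gamma> u)"
  shows "(\<Sum>(\<alpha>, t)\<in>IX n. \<Phi> (pl \<alpha>) (eb \<alpha> t) (B (fb \<alpha> t))) = (\<Sum>(\<alpha>, t)\<in>IX n. \<Phi> (pl \<alpha>) (Bi (eb \<alpha> t)) (fb \<alpha> t))"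
proof -
  have "\<Phi> (pl \<alpha>) (eb \<alpha> t) (B (fb \<alpha> t)) = (\<Sum>(\<beta>, s)\<in>IX n. ip (eb \<beta> s) (B (fb \<alpha> t)) *\<^sub>C \<Phi> (pl \<beta>) (eb \<alpha> t) (fb \<beta> s))"
    if at: "(\<alpha>, t) \<in> IX n" for \<alpha> t
  proof -
    have "\<Phi> (pl \<alpha>) (eb \<alpha> t) (B (fb \<alpha> t)) = \<Phi> (pl \<alpha>) (eb \<alpha> t) (\<Sum>z\<in>IX n. ip (eb (fst z) (snd z)) (B (fb \<alpha> t)) *\<^sub>C fb (fst z) (snd z))"
      using expand_f_B[OF at, of "B (fb \<alpha> t)" 1] by (simp add: case_prod_unfold)
    also have "\<dots> = (\<Sum>z\<in>IX n. ip (eb (fst z) (snd z)) (B (fb \<alpha> t)) *\<^sub>C \<Phi> (pl \<alpha>) (eb \<alpha> t) (fb (fst z) (snd z)))"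
      by (rule lin_on_sum[OF 2[OF IX_D(6)[OF at]] subspace_n_minus]) (use IX_D(7) in auto)
    also have "\<dots> = (\<Sum>z\<in>IX n. ip (eb (fst z) (snd z)) (B (fb \<alpha> t)) *\<^sub>C \<Phi> (pl (fst z)) (eb \<alpha> t) (fb (fst z) (snd z)))"
    proof (rule sum.cong[OF refl])
      fix z assume "z \<in> IX n"
      then show "ip (eb (fst z) (snd z)) (B (fb \<alpha> t)) *\<^sub>C \<Phi> (pl \<alpha>) (eb \<alpha> t) (fb (fst z) (snd z))
        = ip (eb (fst z) (snd z)) (B (fb \<alpha> t)) *\<^sub>C \<Phi> (pl (fst z)) (eb \<alpha> t) (fb (fst z) (snd z))"
        using pl_pairing[OF at, of "fst z" "snd z"] by (cases "ip (eb (fst z) (snd z)) (B (fb \<alpha> t)) = 0") auto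
    qed
    finally show ?thesis by (simp add: case_prod_unfold)
  qed
  then have "(\<Sum>(\<alpha>, t)\<in>IX n. \<Phi> (pl \<alpha>) (eb \<alpha> t) (B (fb \<alpha> t)))
      = (\<Sum>z\<in>IX n. \<Sum>z'\<in>IX n. ip (eb (fst z') (snd z')) (B (fb (fst z) (snd z))) *\<^sub>C \<Phi> (pl (fst z')) (eb (fst z) (snd z)) (fb (fst z') (snd z')))"
    unfolding case_prod_unfold by (intro sum.cong refl) auto
  also have "\<dots> = (\<Sum>z'\<in>IX n. \<Sum>z\<in>IX n. ip (eb (fst z') (snd z')) (B (fb (fst z) (snd z))) *\<^sub>C \<Phi> (pl (fst z')) (eb (fst z) (snd z)) (fb (fst z') (snd z')))"
    by (rule sum.swap)
  also have "\<dots> = (\<Sum>z'\<in>IX n. \<Phi> (pl (fst z')) (Bi (eb (fst z') (snd z'))) (fb (fst z') (snd z')))"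
  proof (rule sum.cong[OF refl])
    fix z' assume "z' \<in> IX n"
    then have z': "(fst z', snd z') \<in> IX n" by simp
    have "(\<Sum>z\<in>IX n. ip (eb (fst z') (snd z')) (B (fb (fst z) (snd z))) *\<^sub>C \<Phi> (pl (fst z')) (eb (fst z) (snd z)) (fb (fst z') (snd z')))
      = (\<Sum>z\<in>IX n. ip (Bi (eb (fst z') (snd z'))) (fb (fst z) (snd z)) *\<^sub>C \<Phi> (pl (fst z')) (eb (fst z) (snd z)) (fb (fst z') (snd z')))"
    proof (rule sum.cong[OF refl])
      fix z assume "z \<in> IX n"
      then have "fb (fst z) (snd z) \<in> Nm" using IX_D(7)[of "fst z" "snd z" n] by simp
      then show "ip (eb (fst z') (snd z')) (B (fb (fst z) (snd z))) *\<^sub>C \<Phi> (pl (fst z')) (eb (fst z) (snd z)) (fb (fst z') (snd z'))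
        = ip (Bi (eb (fst z') (snd z'))) (fb (fst z) (snd z)) *\<^sub>C \<Phi> (pl (fst z')) (eb (fst z) (snd z)) (fb (fst z') (snd z'))"
        using adjoint[OF IX_D(6)[OF z']] by simp
    qed
    also have "\<dots> = \<Phi> (pl (fst z')) (\<Sum>z\<in>IX n. ip (Bi (eb (fst z') (snd z'))) (fb (fst z) (snd z)) *\<^sub>C eb (fst z) (snd z)) (fb (fst z') (snd z'))"
      by (rule lin_on_sum[OF 1[OF IX_D(7)[OF z']] subspace_n_plus, symmetric]) (use IX_D(6) in auto)
    also have "\<dots> = \<Phi> (pl (fst z')) (Bi (eb (fst z') (snd z'))) (fb (fst z') (snd z'))"
      using expand_e_Bi[OF z', of "Bi (eb (fst z') (snd z'))" 1] by (simp add: case_prod_unfold)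
    finally show "(\<Sum>z\<in>IX n. ip (eb (fst z') (snd z')) (B (fb (fst z) (snd z))) *\<^sub>C \<Phi> (pl (fst z')) (eb (fst z) (snd z)) (fb (fst z') (snd z')))
      = \<Phi> (pl (fst z')) (Bi (eb (fst z') (snd z'))) (fb (fst z') (snd z'))" .
  qed
  finally show ?thesis by (simp add: case_prod_unfold)
qed

lemma canonical:
  fixes \<Phi> :: "'g \<Rightarrow> 'g \<Rightarrow> 'g \<Rightarrow> 'w::complex_vec"
  assumes 1: "\<And>\<gamma> y. y \<in> Nm \<Longrightarrow> lin_on Np (\<lambda>u. \<Phi> \<gamma> u y)" and 2: "\<And>\<gamma> u. u \<in> Np \<Longrightarrow> lin_on Nm (\<Phi> \<gamma> u)"
  shows "(\<Sum>(\<alpha>, t)\<in>IX n. \<Phi> (pl \<alpha>) ((Bi ^^ v) (eb \<alpha> t)) ((B ^^ s) (fb \<alpha> t))) = (\<Sum>(\<alpha>, t)\<in>IX n. \<Phi> (pl \<alpha>) ((Bi ^^ (v + s)) (eb \<alpha> t)) (fb \<alpha> t))"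
proof (induction s arbitrary: v)
  case (Suc s)
  define \<Psi> where "\<Psi> \<gamma> u y = \<Phi> \<gamma> ((Bi ^^ v) u) ((B ^^ s) y)" for \<gamma> u y
  have "(\<Sum>(\<alpha>, t)\<in>IX n. \<Psi> (pl \<alpha>) (eb \<alpha> t) (B (fb \<alpha> t))) = (\<Sum>(\<alpha>, t)\<in>IX n. \<Psi> (pl \<alpha>) (Bi (eb \<alpha> t)) (fb \<alpha> t))"
  proof (rule canonical_step)
    show "lin_on Np (\<lambda>u. \<Psi> \<gamma> u y)" if "y \<in> Nm" for \<gamma> y
      unfolding \<Psi>_def by (rule lin_on_compose[OF Bis_lin _ 1[OF Bs_Nm[OF that]]]) (use Bis_Np in auto)
    show "lin_on Nm (\<Psi> \<gamma> u)" if "u \<in> Np" for \<gamma> u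
      unfolding \<Psi>_def by (rule lin_on_compose[OF Bs_lin _ 2[OF Bis_Np[OF that]]]) (use Bs_Nm in auto)
  qed
  then show ?case using Suc[of "Suc v"] by (simp add: \<Psi>_def funpow_swap1)
qed simp

lemma br_dual: "(\<alpha>, t) \<in> IX n \<Longrightarrow> br ((Bi ^^ v) (eb \<alpha> t)) (fb \<alpha> t) = ip ((Bi ^^ v) (eb \<alpha> t)) (fb \<alpha> t) *\<^sub>C \<alpha>"
proof -
  assume a: "(\<alpha>, t) \<in> IX n"
  have "br ((Bi ^^ v) (eb \<alpha> t)) (fb \<alpha> t) = (- ip ((Bi ^^ v) (eb \<alpha> t)) (fb \<alpha> t)) *\<^sub>C (- \<alpha>)"
  proof (rule centralize_pairing[OF IX_D(5)[OF a]])
    show "- \<alpha> \<in> H" using pos_roots_H[OF IX_D(1)[OF a]] by (rule H_neg)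
    have "br d ((Bi ^^ v) (eb \<alpha> t)) = of_nat (ht \<alpha>) *\<^sub>C (Bi ^^ v) (eb \<alpha> t)"
      by (rule l_eigen_Bi[OF IX_D(6)[OF a] d_l IX_D(8)[OF a]])
    then show "br d (br ((Bi ^^ v) (eb \<alpha> t)) (fb \<alpha> t)) = 0"
      using IX_D(9)[OF a] by (simp add: deriv[of d] scalel scaler minusr)
  qed
  then show ?thesis by simp
qed

text \<open>
  \<open>PP n v \<gamma>\<close> is the sum of the brackets of \<open>Bi\<^sup>v e\<close> and \<open>f\<close> over the dual bases of the root spaces whose
  root restricts to \<open>\<gamma>\<close> on \<open>l_space K\<close>; it is orthogonal to the vectors \<open>aa i\<close> because a trace is invariant
  under conjugation by \<open>Bi\<close>.
\<close>

definition PP :: "nat \<Rightarrow> nat \<Rightarrow> 'g \<Rightarrow> 'g"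
  where "PP n v \<gamma> = (\<Sum>(\<alpha>, t)\<in>IX n. if pl \<alpha> = \<gamma> then ip ((Bi ^^ v) (eb \<alpha> t)) (fb \<alpha> t) *\<^sub>C \<alpha> else 0)"

lemma PP_l: "v \<ge> 1 \<Longrightarrow> PP n v \<gamma> \<in> l_space K"
  unfolding l_space_def
proof (intro CollectI conjI ballI)
  assume v: "v \<ge> 1"
  show "PP n v \<gamma> \<in> H" unfolding PP_def
    by (intro cvec.subspace_sum H(1))
      (auto simp: cvec.subspace_scale[OF H(1)] cvec.subspace_0[OF H(1)] pos_roots_H[OF IX_D(1)])
  fix i assume i: "i \<in> G1"
  define S where "S k = (\<Sum>(\<alpha>, t)\<in>IX n. if pl \<alpha> = \<gamma> then ip ((Bi ^^ v) (br (al k) (eb \<alpha> t))) (fb \<alpha> t) else 0)" for k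
  have S: "S k = ip (PP n v \<gamma>) (al k)" for k
    unfolding S_def PP_def ip.suml
  proof (rule sum.cong[OF refl])
    fix z assume "z \<in> IX n"
    then obtain \<alpha> t where z: "z = (\<alpha>, t)" "(\<alpha>, t) \<in> IX n" by (cases z) auto
    have "(Bi ^^ v) (br (al k) (eb \<alpha> t)) = ip \<alpha> (al k) *\<^sub>C (Bi ^^ v) (eb \<alpha> t)"
      using Bis_lin[of v] IX_D(6)[OF z(2)] root_space_br[OF IX_D(4)[OF z(2)] al_in] by (simp add: lin_on_def)
    then show "(case z of (\<alpha>, t) \<Rightarrow> if pl \<alpha> = \<gamma> then ip ((Bi ^^ v) (br (al k) (eb \<alpha> t))) (fb \<alpha> t) else 0) =
      ip (case z of (\<alpha>, t) \<Rightarrow> if pl \<alpha> = \<gamma> then ip ((Bi ^^ v) (eb \<alpha> t)) (fb \<alpha> t) *\<^sub>C \<alpha> else 0) (al k)"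
      by (simp add: z(1) ip.scalel ip.zerol scaleC_complex_def mult.commute)
  qed
  \<comment> \<open>One factor \<open>Bi\<close> is split off. It turns the bracket with the image
    root into one with the original root, and adjointness moves it over to the f-side and back; this
    is the place where \<open>v \<ge> 1\<close> matters.\<close>
  obtain v' where v': "v = Suc v'" using v by (cases v) auto
  define \<Phi> where "\<Phi> \<gamma>' u y = (if \<gamma>' = \<gamma> then ip ((Bi ^^ v') (br (al i) u)) y else 0)" for \<gamma>' u y
  have lin: "lin_on Np (\<lambda>u. \<Phi> \<gamma>' u y)" "lin_on Nm (\<Phi> \<gamma>' u)" for \<gamma>' u y
  proof -
    have "lin_on Np (\<lambda>u. ip ((Bi ^^ v') (br (al i) u)) y)"
      using lin_on_compose[OF lin_on_compose[OF clinear_lin_on[OF lin_r[of "al i"]] _ Bis_lin[of v'], where U = Np] _ clinear_lin_on[OF ip.lin_l[of y]], of UNIV]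
        h_n_plus[OF al_in] by auto
    then show "lin_on Np (\<lambda>u. \<Phi> \<gamma>' u y)" by (auto simp: \<Phi>_def lin_on_def)
    show "lin_on Nm (\<Phi> \<gamma>' u)" by (auto simp: \<Phi>_def lin_on_def ip.addr ip.scaler)
  qed
  have "S (\<tau> i) = (\<Sum>(\<alpha>, t)\<in>IX n. \<Phi> (pl \<alpha>) (Bi (eb \<alpha> t)) (fb \<alpha> t))"
    unfolding S_def
  proof (rule sum.cong[OF refl], safe)
    fix \<alpha> t assume a: "(\<alpha>, t) \<in> IX n"
    have "(Bi ^^ v) (br (al (\<tau> i)) (eb \<alpha> t)) = (Bi ^^ v') (br (al i) (Bi (eb \<alpha> t)))"
      using Bi_al_br[OF i IX_D(6)[OF a]] by (simp add: v' funpow_swap1)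
    then show "(if pl \<alpha> = \<gamma> then ip ((Bi ^^ v) (br (al (\<tau> i)) (eb \<alpha> t))) (fb \<alpha> t) else 0) = \<Phi> (pl \<alpha>) (Bi (eb \<alpha> t)) (fb \<alpha> t)"
      by (simp add: \<Phi>_def)
  qed
  also have "\<dots> = (\<Sum>(\<alpha>, t)\<in>IX n. \<Phi> (pl \<alpha>) (eb \<alpha> t) (B (fb \<alpha> t)))"
    by (rule canonical_step[symmetric]) (rule lin)+
  also have "\<dots> = S i"
    unfolding S_def
  proof (rule sum.cong[OF refl], safe)
    fix \<alpha> t assume a: "(\<alpha>, t) \<in> IX n"
    have u: "(Bi ^^ v') (br (al i) (eb \<alpha> t)) \<in> Np" using Bis_Np h_n_plus[OF al_in] IX_D(6)[OF a] by blast
    show "\<Phi> (pl \<alpha>) (eb \<alpha> t) (B (fb \<alpha> t)) = (if pl \<alpha> = \<gamma> then ip ((Bi ^^ v) (br (al i) (eb \<alpha> t))) (fb \<alpha> t) else 0)"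
      using adjoint[OF u] IX_D(7)[OF a] by (simp add: \<Phi>_def v')
  qed
  finally show "ip (al i - al (\<tau> i)) (PP n v \<gamma>) = 0"
    unfolding S by (simp add: ip_sym[of _ "PP n v \<gamma>"] ip.diffr)
qed

end

section \<open>The Casimir operator\<close>

locale bd_verma = bd K B Bi eb fb I1 I2 x + verma K om act vac
  for K :: "('g::complex_vec, 'i::finite, 'z) bd_algebra_scheme" and B Bi eb fb I1 I2 x
    and om :: 'g and act :: "'g \<Rightarrow> 'm \<Rightarrow> 'm::complex_vec" and vac :: 'm
begin

text \<open>The nilpotent part of the Casimir element, cut off at height \<open>n\<close>. On
  vectors of depth at most \<open>n\<close> the omitted terms would vanish, since they lead above
  the highest weight.\<close>

definition Om :: "nat \<Rightarrow> 'm \<Rightarrow> 'm" where "Om n m = (\<Sum>(\<alpha>, t)\<in>IX n. act (fb \<alpha> t) (act (eb \<alpha> t) m))"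

lemma Om_lin: "clinear (Om n)"
  unfolding Om_def case_prod_unfold by (intro clinear_sum_fun clinear_compose[OF act.lin_r act.lin_r])

lemma depth_0:
  assumes "act d m = (ip om d + of_nat k) *\<^sub>C m" "k > 0" shows "m = 0"
proof -
  have "m \<in> cvec.span {t \<in> range fw. \<forall>h\<in>{d}. act h t = (ip om d + of_nat k) *\<^sub>C t}"
    by (rule eigen_fw) (use assms d_in in auto)
  moreover have "{t \<in> range fw. \<forall>h\<in>{d}. act h t = (ip om d + of_nat k) *\<^sub>C t} \<subseteq> {0}"
  proof
    fix t assume "t \<in> {t \<in> range fw. \<forall>h\<in>{d}. act h t = (ip om d + of_nat k) *\<^sub>C t}"
    then obtain w where w: "t = fw w" "act d t = (ip om d + of_nat k) *\<^sub>C t" by auto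
    show "t \<in> {0}"
    proof (rule ccontr)
      assume "t \<notin> {0}"
      then have "ip om d - of_nat (length w) = ip om d + of_nat k" using w d_fw[of w] by auto
      then have "of_nat (length w + k) = (0::complex)" by (simp add: algebra_simps)
      then show False using assms(2) by (simp only: of_nat_eq_0_iff)
    qed
  qed
  ultimately have "m \<in> {0}" using cvec.span_minimal[OF _ cvec.subspace_single_0] by blast
  then show ?thesis by simp
qed

text \<open>Commuting with \<open>f i\<close> yields a bracket on the e-side and one on the f-side.
  By duality they cancel after a shift of the height by one. What remains is the bottom term, where
  the bracket falls into the Cartan subalgebra, and the top term of the truncation, which acts by
  zero at this depth.\<close>

lemma Om_f:
  assumes w: "length w < n"
  shows "Om n (act (f i) (fw w)) = act (f i) (Om n (fw w)) + act (f i) (act (al i) (fw w))"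
proof -
  define m where "m = fw w"
  define z where "z = f i"
  have dz: "br d z = (- 1) *\<^sub>C z" by (simp add: z_def hf[OF d_in] sroot_d)
  have n1: "n \<ge> 1" using w by simp
  have d_ez: "br d (br (eb \<alpha> t) z) = of_nat (ht \<alpha> - 1) *\<^sub>C br (eb \<alpha> t) z" if "(\<alpha>, t) \<in> IX n" for \<alpha> t
  proof -
    have "br d (br (eb \<alpha> t) z) = (of_nat (ht \<alpha>) - 1) *\<^sub>C br (eb \<alpha> t) z"
      using IX_D(8)[OF that] dz by (simp add: deriv[of d] scalel scaler minusr cvec.scale_left_diff_distrib)
    then show ?thesis using ht_pos[OF IX_D(1)[OF that]] by (simp add: of_nat_diff)
  qed
  have d_fz: "br d (br (fb \<alpha> t) z) = (- of_nat (ht \<alpha> + 1)) *\<^sub>C br (fb \<alpha> t) z" if "(\<alpha>, t) \<in> IX n" for \<alpha> t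
    using IX_D(9)[OF that] dz by (simp add: deriv[of d] bisimps scaleC_add_left cvec.scale_left_diff_distrib)
  have comm: "Om n (act z m) = act z (Om n m) + (\<Sum>(\<alpha>, t)\<in>IX n. act (fb \<alpha> t) (act (br (eb \<alpha> t) z) m))
      + (\<Sum>(\<alpha>, t)\<in>IX n. act (br (fb \<alpha> t) z) (act (eb \<alpha> t) m))"
    unfolding Om_def act.sumr case_prod_unfold sum.distrib[symmetric]
    by (intro sum.cong refl) (simp add: act_br act.bisimps)
  define I' where "I' = {p \<in> IX n. ht (fst p) \<ge> 2}"
  have sub: "IX (n - 1) \<subseteq> IX n" "IX 1 \<subseteq> IX n" "I' \<subseteq> IX n" using n1 by (auto simp: IX_def R_def I'_def)
  have fst1: "(\<Sum>(\<alpha>, t)\<in>IX n. act (fb \<alpha> t) (act (br (eb \<alpha> t) z) m))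
     = (\<Sum>(\<alpha>, t)\<in>IX 1. act (fb \<alpha> t) (act (br (eb \<alpha> t) z) m)) + (\<Sum>(\<alpha>, t)\<in>I'. act (fb \<alpha> t) (act (br (eb \<alpha> t) z) m))"
  proof -
    have "IX n = IX 1 \<union> I'" using n1 by (auto simp: IX_def R_def I'_def)
    moreover have "IX 1 \<inter> I' = {}" by (auto simp: IX_def R_def I'_def)
    ultimately show ?thesis using IX_finite finite_subset[OF sub(3) IX_finite] by (simp add: sum.union_disjoint)
  qed
  \<comment> \<open>At height one the bracket is the multiple \<open>ip (eb \<alpha> t) z\<close> of
    the simple root; summing these multiples against the f-basis recovers \<open>z\<close>.\<close>
  have low: "(\<Sum>(\<alpha>, t)\<in>IX 1. act (fb \<alpha> t) (act (br (eb \<alpha> t) z) m)) = act z (act (al i) m)"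
  proof -
    have "act (fb \<alpha> t) (act (br (eb \<alpha> t) z) m) = act (ip (eb \<alpha> t) z *\<^sub>C fb \<alpha> t) (act (al i) m)" if at: "(\<alpha>, t) \<in> IX 1" for \<alpha> t
    proof -
      have atn: "(\<alpha>, t) \<in> IX n" using sub at by blast
      have "ht \<alpha> = 1" using IX_D(2)[OF at] ht_pos[OF IX_D(1)[OF at]] by simp
      then have "br d (br (eb \<alpha> t) z) = 0" using d_ez[OF atn] by simp
      moreover have "z \<in> root_space K (- al i)" by (simp add: z_def root_space_def hf sroot_al ip.minusl)
      ultimately have "br (eb \<alpha> t) z = ip (eb \<alpha> t) z *\<^sub>C al i"
        using centralize_pairing[of z "- al i" "eb \<alpha> t"] H_neg[OF al_in] by simp
      then show ?thesis by (simp add: act.scalel act.scaler)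
    qed
    then have "(\<Sum>(\<alpha>, t)\<in>IX 1. act (fb \<alpha> t) (act (br (eb \<alpha> t) z) m)) = act (\<Sum>(\<alpha>, t)\<in>IX 1. ip (eb \<alpha> t) z *\<^sub>C fb \<alpha> t) (act (al i) m)"
      unfolding case_prod_unfold act.suml by (intro sum.cong refl) auto
    also have "(\<Sum>(\<alpha>, t)\<in>IX 1. ip (eb \<alpha> t) z *\<^sub>C fb \<alpha> t) = z"
      using expand_f[of z 1 1] dz by simp
    finally show ?thesis .
  qed
  \<comment> \<open>A root vector of height \<open>n\<close> lifts a vector of depth less than
    \<open>n\<close> above the highest weight. Dropping these terms makes the range of heights match
    that of the other sum.\<close>
  have top: "(\<Sum>(\<alpha>, t)\<in>IX n. act (br (fb \<alpha> t) z) (act (eb \<alpha> t) m)) = (\<Sum>(\<alpha>, t)\<in>IX (n - 1). act (br (fb \<alpha> t) z) (act (eb \<alpha> t) m))"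
  proof (rule sum.mono_neutral_right[OF IX_finite sub(1)], safe)
    fix \<alpha> t assume a: "(\<alpha>, t) \<in> IX n" "(\<alpha>, t) \<notin> IX (n - 1)"
    then have h: "ht \<alpha> = n" using n1 by (auto simp: IX_def R_def)
    have "act d (act (eb \<alpha> t) m) = act (eb \<alpha> t) (act d m) + act (br d (eb \<alpha> t)) m" using act_br[of d "eb \<alpha> t" m] by simp
    also have "act (eb \<alpha> t) (act d m) = (ip om d - of_nat (length w)) *\<^sub>C act (eb \<alpha> t) m"
      by (simp add: m_def d_fw act.scaler)
    also have "act (br d (eb \<alpha> t)) m = of_nat n *\<^sub>C act (eb \<alpha> t) m" using IX_D(8)[OF a(1)] h by (simp add: act.scalel)
    also have "(ip om d - of_nat (length w)) *\<^sub>C act (eb \<alpha> t) m + of_nat n *\<^sub>C act (eb \<alpha> t) m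
      = (ip om d - of_nat (length w) + of_nat n) *\<^sub>C act (eb \<alpha> t) m" by (simp only: scaleC_add_left)
    also have "ip om d - of_nat (length w) + of_nat n = ip om d + of_nat (n - length w)" using w by (simp add: of_nat_diff)
    finally have "act (eb \<alpha> t) m = 0" by (rule depth_0) (use w in simp)
    then show "act (br (fb \<alpha> t) z) (act (eb \<alpha> t) m) = 0" by (simp add: act.zeror)
  qed
  \<comment> \<open>Both brackets are expanded in the dual bases; by invariance the two coefficient
    matrices are negative transposes of each other.\<close>
  have cancel: "(\<Sum>(\<alpha>, t)\<in>I'. act (fb \<alpha> t) (act (br (eb \<alpha> t) z) m)) + (\<Sum>(\<beta>, s)\<in>IX (n - 1). act (br (fb \<beta> s) z) (act (eb \<beta> s) m)) = 0"
  proof -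
    let ?c = "\<lambda>p q. ip (eb (fst p) (snd p)) (br (fb (fst q) (snd q)) z)"
    have 1: "act (fb \<alpha> t) (act (br (eb \<alpha> t) z) m) = (\<Sum>q\<in>IX (n - 1). (- ?c (\<alpha>, t) q) *\<^sub>C act (fb \<alpha> t) (act (eb (fst q) (snd q)) m))"
      if at: "(\<alpha>, t) \<in> I'" for \<alpha> t
    proof -
      have atn: "(\<alpha>, t) \<in> IX n" and h2: "ht \<alpha> \<ge> 2" using at by (auto simp: I'_def)
      have "br (eb \<alpha> t) z = (\<Sum>(\<beta>, s)\<in>IX (n - 1). ip (br (eb \<alpha> t) z) (fb \<beta> s) *\<^sub>C eb \<beta> s)"
        by (rule expand_e[OF d_ez[OF atn]]) (use h2 IX_D(2)[OF atn] in auto)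
      moreover have "ip (br (eb \<alpha> t) z) y = - ip (eb \<alpha> t) (br y z)" for y
        using ip_inv[of "eb \<alpha> t" z y] anti[of z y] by (simp add: ip.minusr)
      ultimately have "br (eb \<alpha> t) z = (\<Sum>q\<in>IX (n - 1). (- ?c (\<alpha>, t) q) *\<^sub>C eb (fst q) (snd q))"
        by (simp add: case_prod_unfold)
      then have "act (fb \<alpha> t) (act (br (eb \<alpha> t) z) m) = act (fb \<alpha> t) (act (\<Sum>q\<in>IX (n - 1). (- ?c (\<alpha>, t) q) *\<^sub>C eb (fst q) (snd q)) m)"
        by (rule arg_cong)
      then show ?thesis by (simp only: act.suml act.sumr act.scalel act.scaler)
    qed
    have 2: "act (br (fb \<beta> s) z) (act (eb \<beta> s) m) = (\<Sum>p\<in>I'. ?c p (\<beta>, s) *\<^sub>C act (fb (fst p) (snd p)) (act (eb \<beta> s) m))"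
      if bs: "(\<beta>, s) \<in> IX (n - 1)" for \<beta> s
    proof -
      have bsn: "(\<beta>, s) \<in> IX n" using sub bs by blast
      have "br (fb \<beta> s) z = (\<Sum>(\<alpha>, t)\<in>IX n. ip (eb \<alpha> t) (br (fb \<beta> s) z) *\<^sub>C fb \<alpha> t)"
        by (rule expand_f[OF d_fz[OF bsn]]) (use IX_D(2)[OF bs] n1 in auto)
      also have "\<dots> = (\<Sum>(\<alpha>, t)\<in>I'. ip (eb \<alpha> t) (br (fb \<beta> s) z) *\<^sub>C fb \<alpha> t)"
      proof (rule sum.mono_neutral_right[OF IX_finite sub(3)], safe)
        fix \<alpha> t assume a: "(\<alpha>, t) \<in> IX n" "(\<alpha>, t) \<notin> I'"
        then have h: "ht \<alpha> = 1" using ht_pos[OF IX_D(1)[OF a(1)]] by (auto simp: I'_def)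
        have "of_nat (ht \<alpha>) + - of_nat (ht \<beta> + 1) \<noteq> (0::complex)" using ht_pos[OF IX_D(1)[OF bs]] h by simp
        then show "ip (eb \<alpha> t) (br (fb \<beta> s) z) *\<^sub>C fb \<alpha> t = 0"
          using eigen_orth[OF IX_D(8)[OF a(1)] d_fz[OF bsn]] by simp
      qed
      finally have "br (fb \<beta> s) z = (\<Sum>p\<in>I'. ?c p (\<beta>, s) *\<^sub>C fb (fst p) (snd p))" by (simp add: case_prod_unfold)
      then have "act (br (fb \<beta> s) z) (act (eb \<beta> s) m) = act (\<Sum>p\<in>I'. ?c p (\<beta>, s) *\<^sub>C fb (fst p) (snd p)) (act (eb \<beta> s) m)"
        by (rule arg_cong)
      then show ?thesis by (simp only: act.suml act.scalel)
    qed
    have "(\<Sum>(\<alpha>, t)\<in>I'. act (fb \<alpha> t) (act (br (eb \<alpha> t) z) m))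
      = (\<Sum>p\<in>I'. \<Sum>q\<in>IX (n - 1). (- ?c p q) *\<^sub>C act (fb (fst p) (snd p)) (act (eb (fst q) (snd q)) m))"
      by (rule sum.cong[OF refl]) (use 1 in auto)
    moreover have "(\<Sum>(\<beta>, s)\<in>IX (n - 1). act (br (fb \<beta> s) z) (act (eb \<beta> s) m))
      = (\<Sum>q\<in>IX (n - 1). \<Sum>p\<in>I'. ?c p q *\<^sub>C act (fb (fst p) (snd p)) (act (eb (fst q) (snd q)) m))"
      by (rule sum.cong[OF refl]) (use 2 in auto)
    ultimately show ?thesis
      by (simp add: sum_negf) (rule sum.swap)
  qed
  have "Om n (act z m) = act z (Om n m) + act z (act (al i) m)"
    unfolding comm fst1 low top using cancel by (simp add: add.assoc)
  then show ?thesis by (simp add: z_def m_def)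
qed

text \<open>Each further f lowers (\<kappa>, \<kappa>) + 2(\<rho>, \<kappa>) by exactly the term
  that \<open>Om_f\<close> produces, thanks to \<open>rho_al\<close>.\<close>

lemma Om_fw:
  assumes rho: "is_rho K \<rho>"
  shows "length w \<le> n \<Longrightarrow> 2 *\<^sub>C Om n (fw w) =
    (ip om om + 2 * ip \<rho> om - (ip (om - (\<Sum>i\<leftarrow>w. al i)) (om - (\<Sum>i\<leftarrow>w. al i)) + 2 * ip \<rho> (om - (\<Sum>i\<leftarrow>w. al i)))) *\<^sub>C fw w"
proof (induction w)
  case Nil
  have "Om n vac = 0" unfolding Om_def by (rule sum.neutral) (auto simp: vac_n IX_D(6) act.zeror)
  then show ?case by simp
next
  case (Cons i w)
  define k where "k = om - (\<Sum>i\<leftarrow>w. al i)"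
  have k': "om - (\<Sum>j\<leftarrow>i # w. al j) = k - al i" by (simp add: k_def algebra_simps)
  have "2 *\<^sub>C Om n (fw (i # w)) = act (f i) (2 *\<^sub>C Om n (fw w)) + 2 *\<^sub>C act (f i) (act (al i) (fw w))"
    using Om_f[of w n i] Cons(2) by (simp add: act.scaler scaleC_add_right)
  also have "2 *\<^sub>C Om n (fw w) = (ip om om + 2 * ip \<rho> om - (ip k k + 2 * ip \<rho> k)) *\<^sub>C fw w"
    using Cons by (simp add: k_def)
  also have "act (al i) (fw w) = ip k (al i) *\<^sub>C fw w" unfolding k_def by (rule h_fw[OF al_in])
  also have "act (f i) ((ip om om + 2 * ip \<rho> om - (ip k k + 2 * ip \<rho> k)) *\<^sub>C fw w) + 2 *\<^sub>C act (f i) (ip k (al i) *\<^sub>C fw w)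
    = ((ip om om + 2 * ip \<rho> om - (ip k k + 2 * ip \<rho> k)) + 2 * ip k (al i)) *\<^sub>C fw (i # w)"
    by (simp add: act.scaler scaleC_add_left)
  also have "(ip om om + 2 * ip \<rho> om - (ip k k + 2 * ip \<rho> k)) + 2 * ip k (al i)
    = ip om om + 2 * ip \<rho> om - (ip (k - al i) (k - al i) + 2 * ip \<rho> (k - al i))"
    using rho_al[OF rho, of i] ip_sym[of "al i" k] by (simp add: ip.bisimps algebra_simps)
  finally show ?case by (simp only: k')
qed

text \<open>The Cartan part gives (\<kappa>, \<kappa>) + 2(\<rho>, \<kappa>) on weight \<kappa>, and
  twice \<open>Om\<close> is the difference between this number at the highest weight and at
  \<kappa>.\<close>

lemma casimir:
  assumes rho: "is_rho K \<rho>" and m: "m \<in> cvec.span (fw ` {w. length w \<le> n})"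
  shows "(\<Sum>j\<in>I1. act (x j) (act (x j) m)) + (\<Sum>j\<in>I2. act (x j) (act (x j) m)) + 2 *\<^sub>C act \<rho> m + 2 *\<^sub>C Om n m
    = (ip om om + 2 * ip \<rho> om) *\<^sub>C m"
proof -
  have rH: "\<rho> \<in> H" using rho by (simp add: is_rho_def)
  have lin: "clinear (\<lambda>m. (\<Sum>j\<in>I1. act (x j) (act (x j) m)) + (\<Sum>j\<in>I2. act (x j) (act (x j) m)) + 2 *\<^sub>C act \<rho> m + 2 *\<^sub>C Om n m)"
    by (intro clinear_add_fun clinear_sum_fun clinear_scale_fun clinear_compose[OF act.lin_r act.lin_r] act.lin_r Om_lin)
  show ?thesis
  proof (rule clinear_eq_on_span[OF lin clinear_scale_fun[OF clinear_id_fun] m])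
    fix s assume "s \<in> fw ` {w. length w \<le> n}"
    then obtain w where w: "s = fw w" "length w \<le> n" by auto
    define k where "k = om - (\<Sum>i\<leftarrow>w. al i)"
    have kH: "k \<in> H" by (simp add: k_def om_minus_in)
    have hs: "act h s = ip k h *\<^sub>C s" if "h \<in> H" for h unfolding w k_def by (rule h_fw[OF that])
    have "(\<Sum>j\<in>J. act (x j) (act (x j) s)) = (\<Sum>j\<in>J. ip k (x j) * ip k (x j)) *\<^sub>C s" if "J \<subseteq> I1 \<union> I2" for J
      unfolding cvec.scale_sum_left by (rule sum.cong) (use that x_H hs in \<open>auto simp: act.scaler\<close>)
    then have "(\<Sum>j\<in>I1. act (x j) (act (x j) s)) + (\<Sum>j\<in>I2. act (x j) (act (x j) s)) = ip k k *\<^sub>C s"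
      using H_norm[OF kH] by (simp flip: scaleC_add_left)
    moreover have "2 *\<^sub>C act \<rho> s = (2 * ip \<rho> k) *\<^sub>C s" using hs[OF rH] by (simp add: ip_sym)
    moreover have "2 *\<^sub>C Om n s = (ip om om + 2 * ip \<rho> om - (ip k k + 2 * ip \<rho> k)) *\<^sub>C s"
      using Om_fw[OF rho w(2)] by (simp add: w k_def)
    ultimately show "(\<Sum>j\<in>I1. act (x j) (act (x j) s)) + (\<Sum>j\<in>I2. act (x j) (act (x j) s)) + 2 *\<^sub>C act \<rho> s + 2 *\<^sub>C Om n s
      = (ip om om + 2 * ip \<rho> om) *\<^sub>C s"
      by (simp flip: scaleC_add_left)
  qed
qed

lemma span_depth:
  assumes "act d m = (ip om d - of_nat k) *\<^sub>C m" "k \<le> n"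
  shows "m \<in> cvec.span (fw ` {w. length w \<le> n})"
proof -
  have "m \<in> cvec.span {t \<in> range fw. \<forall>h\<in>{d}. act h t = (ip om d - of_nat k) *\<^sub>C t}"
    by (rule eigen_fw) (use assms d_in in auto)
  moreover have "{t \<in> range fw. \<forall>h\<in>{d}. act h t = (ip om d - of_nat k) *\<^sub>C t} \<subseteq> cvec.span (fw ` {w. length w \<le> n})"
  proof
    fix t assume "t \<in> {t \<in> range fw. \<forall>h\<in>{d}. act h t = (ip om d - of_nat k) *\<^sub>C t}"
    then obtain w where w: "t = fw w" "act d t = (ip om d - of_nat k) *\<^sub>C t" by auto
    show "t \<in> cvec.span (fw ` {w. length w \<le> n})"
    proof (cases "t = 0")
      case False
      then have "ip om d - of_nat (length w) = ip om d - of_nat k" using w d_fw[of w] by auto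
      then have "length w = k" by simp
      then show ?thesis using w assms(2) by (auto intro!: cvec.span_base)
    qed (simp add: cvec.span_zero)
  qed
  ultimately show ?thesis using cvec.span_minimal[OF _ cvec.subspace_span] by blast
qed

end

section \<open>Twisted traces\<close>

text \<open>The prefix \<open>tgt\<close> marks the module over which the trace is taken: the source
  of the twisted map and the target of the intertwiners. In the application \<open>mu_l\<close>
  expresses that the total weight is orthogonal to \<open>l_space K\<close>.\<close>

locale twisted = bd_verma K B Bi eb fb I1 I2 x mu act vac + tgt: verma_basis K mu' act' vac' S
  for K :: "('g::complex_vec, 'i::finite, 'z) bd_algebra_scheme" and B Bi eb fb I1 I2 x
    and mu :: 'g and act :: "'g \<Rightarrow> 'm \<Rightarrow> 'm::complex_vec" and vac :: 'm
    and mu' :: 'g and act' :: "'g \<Rightarrow> 'm \<Rightarrow> 'm" and vac' :: 'm and S :: "'m set" +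
  assumes mu_T: "\<And>i. i \<in> Gam1 K \<Longrightarrow> form K mu' (simple K i) = form K mu (simple K (bdT K i))"
    and mu_l: "\<And>z. z \<in> l_space K \<Longrightarrow> form K mu z = form K mu' z"
begin

lemma vB_exists:
  obtains b where "clinear b" "b vac' = vac" "\<And>y m. y \<in> Nm \<Longrightarrow> b (act' y m) = act (B y) (b m)"
proof (rule tgt.free_hom[of UNIV vac "\<lambda>y. act (B y)"])
qed (use that act.lin_r in \<open>auto simp: B_add B_scale B_br D1I act.addl act.scalel act_br\<close>)

definition vB :: "'m \<Rightarrow> 'm" where "vB = (SOME b. clinear b \<and> b vac' = vac \<and> (\<forall>y\<in>Nm. \<forall>m. b (act' y m) = act (B y) (b m)))"

lemma vB: "clinear vB" "vB vac' = vac" "y \<in> Nm \<Longrightarrow> vB (act' y m) = act (B y) (vB m)"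
proof -
  have "\<exists>b. clinear b \<and> b vac' = vac \<and> (\<forall>y\<in>Nm. \<forall>m. b (act' y m) = act (B y) (b m))" using vB_exists by metis
  from someI_ex[OF this] show "clinear vB" "vB vac' = vac" "y \<in> Nm \<Longrightarrow> vB (act' y m) = act (B y) (vB m)"
    unfolding vB_def by blast+
qed

lemma verma_B_eq:
  assumes "M mu' = act'" "M mu = act" "vc mu' = vac'" "vc mu = vac"
  shows "verma_B K B M vc mu' mu = vB"
  unfolding verma_B_def assms
proof (rule the_equality)
  have vBw: "vB (foldr act' xs vac') = foldr act (map B xs) vac" if "xs \<in> lists Nm" for xs
    using that by (induction xs) (auto simp: vB)
  then show "clinear vB \<and> (\<forall>xs\<in>lists Nm. vB (foldr act' xs vac') = foldr act (map B xs) vac)" using vB(1) by blast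
  fix b assume b: "clinear b \<and> (\<forall>xs\<in>lists Nm. b (foldr act' xs vac') = foldr act (map B xs) vac)"
  have "b (tgt.fw w) = vB (tgt.fw w)" for w
  proof -
    have "tgt.fw w = foldr act' (map (gen_f K) w) vac'" by (induction w) auto
    moreover have "map (gen_f K) w \<in> lists Nm" using f_n_minus by (auto simp: in_lists_conv_set)
    ultimately show ?thesis using b vBw by metis
  qed
  then have "b m = vB m" for m
    using clinear_eq_on_span[OF conjunct1[OF b] vB(1), of m "range tgt.fw"] tgt.span_fw by auto
  then show "b = vB" by (rule ext)
qed

lemmas vB_lins = clinear_zero[OF vB(1)] clinear_add[OF vB(1)] clinear_scale[OF vB(1)] clinear_diff[OF vB(1)]

lemma vB_l: "z \<in> l_space K \<Longrightarrow> act z (vB m) = vB (act' z m)"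
proof (induction m rule: tgt.verma_induct)
  case vac then show ?case by (simp add: vB tgt.vac_h vac_h l_H vB_lins mu_l)
next
  case (f i m)
  let ?f = "gen_f K i"
  have "act z (vB (act' ?f m)) = act (B ?f) (act z (vB m)) + act (br z (B ?f)) (vB m)"
    using act_br[of z "B ?f" "vB m"] by (simp add: vB(3) f_n_minus)
  also have "\<dots> = vB (act' ?f (act' z m)) + vB (act' (br z ?f) m)"
    using f by (simp add: vB(3) f_n_minus l_B h_n_minus l_H)
  also have "\<dots> = vB (act' z (act' ?f m))" by (simp add: tgt.act_br[of z ?f m] vB_lins)
  finally show ?case .
qed (simp_all add: act.bisimps tgt.act.bisimps vB_lins)

lemma vB_al: "i \<in> G1 \<Longrightarrow> act (al (\<tau> i)) (vB m) = vB (act' (al i) m)"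
proof (induction m rule: tgt.verma_induct)
  case vac then show ?case by (simp add: vB tgt.vac_h vac_h al_in vB_lins mu_T)
next
  case (f k m)
  let ?f = "gen_f K k"
  have "act (al (\<tau> i)) (vB (act' ?f m)) = act (B ?f) (act (al (\<tau> i)) (vB m)) + act (br (al (\<tau> i)) (B ?f)) (vB m)"
    using act_br[of "al (\<tau> i)" "B ?f" "vB m"] by (simp add: vB(3) f_n_minus)
  also have "br (al (\<tau> i)) (B ?f) = B (br (al i) ?f)" using f by (simp add: B_br D1I al_h_span f_n_minus B_al)
  also have "act (B ?f) (act (al (\<tau> i)) (vB m)) + act (B (br (al i) ?f)) (vB m) = vB (act' ?f (act' (al i) m)) + vB (act' (br (al i) ?f) m)"
    using f by (simp add: vB(3) f_n_minus h_n_minus al_in)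
  also have "\<dots> = vB (act' (al i) (act' ?f m))" by (simp add: tgt.act_br[of "al i" ?f m] vB_lins)
  finally show ?case .
qed (simp_all add: act.bisimps tgt.act.bisimps vB_lins)

lemma vB_D1: "w \<in> D1 \<Longrightarrow> vB (act' w m) = act (B w) (vB m)"
proof -
  assume "w \<in> D1"
  then obtain y h where w: "w = y + h" "y \<in> Nm" "h \<in> h_span K G1" by (auto simp: D1_def)
  have "h \<in> D1 \<and> vB (act' h m) = act (B h) (vB m)"
    using w(3) unfolding h_span_def
  proof (induction rule: cvec.span_induct_alt)
    case base show ?case by (simp add: B_0 act.zerol tgt.act.zerol vB_lins cvec.subspace_0 subspace_D1)
  next
    case (step c a b)
    then obtain k where k: "k \<in> G1" "a = al k" by (auto simp: h_simple_al)
    then have a: "a \<in> D1" "vB (act' a m) = act (B a) (vB m)" by (auto simp: D1I al_h_span B_al vB_al)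
    then have "c *\<^sub>C a \<in> D1" by (simp add: cvec.subspace_scale subspace_D1)
    then show ?case using step a
      by (simp add: B_add B_scale act.addl act.scalel tgt.act.addl tgt.act.scalel vB_lins cvec.subspace_add subspace_D1)
  qed
  then show ?thesis using w by (simp add: B_add D1I act.addl tgt.act.addl vB_lins vB(3))
qed

text \<open>This is the origin of the twist by \<open>Bi\<close>. Passing an e through an f via
  \<open>e_B\<close> leaves an element of \<open>D1\<close>, whose Cartan part is handled by
  \<open>vB_al\<close>; there the condition \<open>mu_T\<close> on the two highest weights is
  used.\<close>

lemma vB_e: "u \<in> Np \<Longrightarrow> \<forall>m. act u (vB m) = vB (act' (Bi u) m)"
proof (induction rule: n_plus_induct)
  case (e j)
  show ?case
  proof
    fix m
    show "act (gen_e K j) (vB m) = vB (act' (Bi (gen_e K j)) m)"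
    proof (induction m rule: tgt.verma_induct)
      case vac
      have "act' (Bi (gen_e K j)) vac' = 0" by (rule tgt.vac_n[OF Bi_Np[OF e_n_plus]])
      then show ?case by (simp add: vB vac_n e_n_plus vB_lins)
    next
      case (f k m)
      let ?f = "gen_f K k" and ?e = "gen_e K j"
      have L: "act ?e (vB (act' ?f m)) = act (B ?f) (act ?e (vB m)) + act (br ?e (B ?f)) (vB m)"
        using act_br[of ?e "B ?f" "vB m"] by (simp add: vB(3) f_n_minus)
      show ?case
      proof (cases "j \<in> G2")
        case True
        then obtain i where i: "i \<in> G1" "j = \<tau> i" using \<tau>_onto by blast
        have eB: "br (gen_e K i) ?f \<in> D1" "br ?e (B ?f) = B (br (gen_e K i) ?f)" using e_B[OF f_n_minus i(1)] i(2) by auto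
        have "act ?e (vB (act' ?f m)) = vB (act' ?f (act' (gen_e K i) m)) + vB (act' (br (gen_e K i) ?f) m)"
          unfolding L eB(2) using f i by (simp add: Bi_e vB(3) f_n_minus vB_D1[OF eB(1)])
        also have "\<dots> = vB (act' (gen_e K i) (act' ?f m))" by (simp add: tgt.act_br[of "gen_e K i" ?f m] vB_lins)
        finally show ?thesis using i by (simp add: Bi_e)
      next
        case False
        then show ?thesis unfolding L e_B_0[OF f_n_minus False] using f by (simp add: Bi_e act.zerol act.zeror tgt.act.zerol vB_lins)
      qed
    qed (simp_all add: act.bisimps tgt.act.bisimps vB_lins)
  qed
next
  case (br u v)
  then show ?case by (simp add: act_br tgt.act_br Bi_br D2I vB_lins)
qed (simp_all add: act.addl act.scalel tgt.act.addl tgt.act.scalel Bi_add Bi_scale D2I vB_lins)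

text \<open>The basis vectors that contribute to the coefficient at the exponent \<theta>.\<close>

definition Sl :: "'g \<Rightarrow> 'm set" where "Sl \<theta> = {b \<in> S. pl (tgt.wt b) = \<theta>}"

lemma Sl_S: "b \<in> Sl \<theta> \<Longrightarrow> b \<in> S" by (simp add: Sl_def)

lemma Sl_l: "b \<in> Sl \<theta> \<Longrightarrow> \<theta> \<in> l_space K" using pl_l by (auto simp: Sl_def)

lemma Sl_ip: "b \<in> Sl \<theta> \<Longrightarrow> z \<in> l_space K \<Longrightarrow> ip (tgt.wt b) z = ip \<theta> z" using ip_pl by (auto simp: Sl_def)

lemma Sl_act: "b \<in> Sl \<theta> \<Longrightarrow> z \<in> l_space K \<Longrightarrow> act' z b = ip \<theta> z *\<^sub>C b"
  using tgt.h_basis[OF Sl_S l_H] Sl_ip by simp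

lemma Sl_finite: "finite (Sl \<theta>)"
  by (rule finite_subset[OF _ tgt.finite_d[of "ip \<theta> d"]]) (use Sl_ip[OF _ d_l] Sl_S in blast)

lemma SlI: "b \<in> S \<Longrightarrow> \<theta> \<in> l_space K \<Longrightarrow> (\<And>z. z \<in> l_space K \<Longrightarrow> ip (tgt.wt b) z = ip \<theta> z) \<Longrightarrow> b \<in> Sl \<theta>"
  unfolding Sl_def using l_eq[OF pl_l] ip_pl by auto

lemma Sl_depth: "b \<in> Sl \<theta> \<Longrightarrow> \<exists>k. ip \<theta> d = ip mu' d - of_nat k"
proof -
  assume b: "b \<in> Sl \<theta>"
  have "ip (mu' - tgt.wt b) d = of_nat (ht (mu' - tgt.wt b))" using ht tgt.wt_Q[OF Sl_S[OF b]] by blast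
  then have "ip \<theta> d = ip mu' d - of_nat (ht (mu' - tgt.wt b))" using Sl_ip[OF b d_l] by (simp add: ip.diffl algebra_simps)
  then show ?thesis by blast
qed

text \<open>If the block at \<theta> is nonempty, the difference inside is the common depth of its
  vectors, a natural number. Absolute value, ceiling and the added 1 make this a number strictly
  above that depth, defined for every \<theta>.\<close>

definition bound :: "'g \<Rightarrow> nat" where "bound \<theta> = nat \<lceil>\<bar>Re (ip mu' d - ip \<theta> d)\<bar>\<rceil> + 1"

text \<open>Raising the exponent by at least \<open>bound \<theta>\<close> leads above the highest
  weight. All iterations of the cyclicity argument end here.\<close>

lemma Sl_empty: "ip \<gamma> d = of_nat n \<Longrightarrow> n \<ge> bound \<theta> \<Longrightarrow> Sl (\<theta> + \<gamma>) = {}"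
proof (rule ccontr)
  assume a: "ip \<gamma> d = of_nat n" "n \<ge> bound \<theta>" "Sl (\<theta> + \<gamma>) \<noteq> {}"
  then obtain b where "b \<in> Sl (\<theta> + \<gamma>)" by auto
  then obtain k where "ip (\<theta> + \<gamma>) d = ip mu' d - of_nat k" using Sl_depth by blast
  then have "ip mu' d - ip \<theta> d = of_nat (n + k)" using a(1) by (simp add: ip.addl algebra_simps)
  then have "Re (ip mu' d - ip \<theta> d) = real (n + k)" by (simp only: complex_Re_of_nat)
  then have "bound \<theta> = nat \<lceil>\<bar>real (n + k)\<bar>\<rceil> + 1" unfolding bound_def by (simp only:)
  then have "bound \<theta> = n + k + 1" by (simp del: of_nat_add)
  then show False using a(2) by simp
qed

lemma Sl_depth_bound: "b \<in> Sl \<theta> \<Longrightarrow> \<exists>k \<le> bound \<theta>. ip \<theta> d = ip mu' d - of_nat k"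
proof -
  assume "b \<in> Sl \<theta>"
  then obtain k where k: "ip \<theta> d = ip mu' d - of_nat k" using Sl_depth by blast
  then have "ip mu' d - ip \<theta> d = of_nat k" by simp
  then have "Re (ip mu' d - ip \<theta> d) = real k" by (simp only: complex_Re_of_nat)
  then have "bound \<theta> = nat \<lceil>\<bar>real k\<bar>\<rceil> + 1" unfolding bound_def by (simp only:)
  then have "k \<le> bound \<theta>" by simp
  then show ?thesis using k by blast
qed

end

section \<open>Traces against intertwiners and their cyclicity\<close>

abbreviation (in bd) "sh \<theta> k \<alpha> \<equiv> \<theta> + of_nat k *\<^sub>C pl \<alpha>"

text \<open>T preserves squared lengths, and \<rho> pairs with a simple root to half of its squared
  length. Hence the term with \<rho> in the Casimir element is a derivative in \<lambda>.\<close>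

lemma (in bd) rho_l: assumes rho: "is_rho K \<rho>" shows "\<rho> \<in> l_space K"
proof -
  have "2 * ip \<rho> (al i) = 2 * ip \<rho> (al (\<tau> i))" if "i \<in> G1" for i
    using rho_al[OF rho] \<tau>_ip[OF that that] by simp
  then show ?thesis using rho by (simp add: l_space_def is_rho_def ip_sym[of _ \<rho>] ip.diffr)
qed

text \<open>\<open>Y \<eta> m\<close> abstracts a matrix entry of the product of intertwiners, with
  values in the tensor factors, and \<open>wa\<close> the action on these values. The other
  instance, for \<open>delta_B\<close>, has \<open>Y \<eta> m = \<eta> m\<close>, scalar values and
  the zero action.\<close>

locale twisted_trace = twisted K B Bi eb fb I1 I2 x mu act vac mu' act' vac' S
  for K :: "('g::complex_vec, 'i::finite, 'z) bd_algebra_scheme" and B Bi eb fb I1 I2 x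
    and mu :: 'g and act :: "'g \<Rightarrow> 'm \<Rightarrow> 'm::complex_vec" and vac :: 'm
    and mu' :: 'g and act' :: "'g \<Rightarrow> 'm \<Rightarrow> 'm" and vac' :: 'm and S :: "'m set" +
  fixes Y :: "('m \<Rightarrow> complex) \<Rightarrow> 'm \<Rightarrow> 'w::complex_vec" and wa :: "'g \<Rightarrow> 'w \<Rightarrow> 'w" and W0 :: "'w set"
  assumes Y_lin: "\<And>\<eta>. clinear \<eta> \<Longrightarrow> clinear (Y \<eta>)"
    and Y_add: "\<And>\<eta> \<eta>' n. clinear \<eta> \<Longrightarrow> clinear \<eta>' \<Longrightarrow> Y (\<lambda>m. \<eta> m + \<eta>' m) n = Y \<eta> n + Y \<eta>' n"
    and Y_scale: "\<And>c \<eta> n. clinear \<eta> \<Longrightarrow> Y (\<lambda>m. c * \<eta> m) n = c *\<^sub>C Y \<eta> n"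
    and Y_int: "\<And>\<eta> u m. clinear \<eta> \<Longrightarrow> Y \<eta> (act u m) = Y (\<lambda>n. \<eta> (act' u n)) m + wa u (Y \<eta> m)"
    and W0: "cvec.subspace W0" and Y_W0: "\<And>\<eta> m. clinear \<eta> \<Longrightarrow> Y \<eta> m \<in> W0"
    and wa_lin: "\<And>u. clinear (wa u)"
    and wa_add: "\<And>u v w. w \<in> W0 \<Longrightarrow> wa (u + v) w = wa u w + wa v w"
    and wa_scale: "\<And>c u w. w \<in> W0 \<Longrightarrow> wa (c *\<^sub>C u) w = c *\<^sub>C wa u w"
    and wa_br: "\<And>u v w. w \<in> W0 \<Longrightarrow> wa (lie K u v) w = wa u (wa v w) - wa v (wa u w)"
begin

definition tt :: "'g \<Rightarrow> ('m \<Rightarrow> 'm) \<Rightarrow> 'w" where "tt \<theta> c = (\<Sum>b\<in>Sl \<theta>. Y (tgt.co b) (c b))"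

definition F :: "'g \<Rightarrow> 'w" where "F \<theta> = tt \<theta> vB"

lemma tt_W0: "tt \<theta> c \<in> W0"
  unfolding tt_def by (intro cvec.subspace_sum W0 Y_W0 tgt.co_lin)

lemma F_W0: "F \<theta> \<in> W0" by (simp add: F_def tt_W0)

lemma tt_cong: "(\<And>b. b \<in> Sl \<theta> \<Longrightarrow> c b = c' b) \<Longrightarrow> tt \<theta> c = tt \<theta> c'"
  unfolding tt_def by (intro sum.cong) auto

lemma Y_lins: "clinear \<eta> \<Longrightarrow> Y \<eta> (a + b) = Y \<eta> a + Y \<eta> b" "clinear \<eta> \<Longrightarrow> Y \<eta> (k *\<^sub>C a) = k *\<^sub>C Y \<eta> a"
  "clinear \<eta> \<Longrightarrow> Y \<eta> 0 = 0" "clinear \<eta> \<Longrightarrow> Y \<eta> (sum g A) = (\<Sum>a\<in>A. Y \<eta> (g a))"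
  using clinear_add[OF Y_lin] clinear_scale[OF Y_lin] clinear_zero[OF Y_lin] clinear_sum[OF Y_lin] by auto

lemma tt_add: "tt \<theta> (\<lambda>m. c m + c' m) = tt \<theta> c + tt \<theta> c'"
  and tt_scale: "tt \<theta> (\<lambda>m. k *\<^sub>C c m) = k *\<^sub>C tt \<theta> c"
  and tt_sum: "tt \<theta> (\<lambda>m. \<Sum>a\<in>A. g a m) = (\<Sum>a\<in>A. tt \<theta> (g a))"
  and tt_0: "tt \<theta> (\<lambda>m. 0) = 0"
  unfolding tt_def by (simp_all add: Y_lins tgt.co_lin sum.distrib cvec.scale_sum_right) (rule sum.swap)

lemma tt_empty: "Sl \<theta> = {} \<Longrightarrow> tt \<theta> c = 0" by (simp add: tt_def)

lemma wa_sum: "wa u (sum g A) = (\<Sum>a\<in>A. wa u (g a))" and wa_0: "wa u 0 = 0"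
  by (rule clinear_sum[OF wa_lin] clinear_zero[OF wa_lin])+

text \<open>An element of weight \<gamma> for \<open>l_space K\<close> maps the block at \<theta>
  into the block at \<open>\<theta> + \<gamma>\<close>, so invariance of the trace can be applied
  block by block. Passing the intertwiners leaves the action on the tensor factors behind.\<close>

lemma cyclic:
  assumes c: "clinear c" and \<gamma>: "\<gamma> \<in> l_space K" and y: "\<And>z. z \<in> l_space K \<Longrightarrow> br z y = ip \<gamma> z *\<^sub>C y"
  shows "tt \<theta> (\<lambda>m. c (act' y m)) = tt (\<theta> + \<gamma>) (\<lambda>m. act y (c m)) - wa y (tt (\<theta> + \<gamma>) c)"
proof (cases "\<theta> \<in> l_space K")
  case False
  then have "\<theta> + \<gamma> \<notin> l_space K" using \<gamma> cvec.subspace_diff[OF subspace_l, of "\<theta> + \<gamma>" \<gamma>] by auto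
  then have "Sl \<theta> = {}" "Sl (\<theta> + \<gamma>) = {}" using False Sl_l by blast+
  then show ?thesis by (simp add: tt_empty wa_0)
next
  case True
  have zy: "act' z (act' y b) = (ip (tgt.wt b) z + ip \<gamma> z) *\<^sub>C act' y b" if "b \<in> S" "z \<in> l_space K" for b z
    using tgt.act_br[of z y b] y[OF that(2)] tgt.h_basis[OF that(1) l_H[OF that(2)]]
    by (simp add: tgt.act.bisimps scaleC_add_left algebra_simps)
  have wts: "ip (tgt.wt b') z = ip (tgt.wt b) z + ip \<gamma> z" if "b \<in> S" "tgt.co b' (act' y b) \<noteq> 0" "z \<in> l_space K" for b b' z
    by (rule tgt.co_eigen[of "l_space K" "act' y b" "\<lambda>z. ip (tgt.wt b) z + ip \<gamma> z"]) (use that zy l_H in auto)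
  have tl: "\<theta> + \<gamma> \<in> l_space K" using True \<gamma> cvec.subspace_add[OF subspace_l] by blast
  have "tt \<theta> (\<lambda>m. c (act' y m)) = (\<Sum>b\<in>Sl \<theta>. (\<lambda>\<eta> n. Y \<eta> (c n)) (tgt.co b) (act' y b))" by (simp add: tt_def)
  also have "\<dots> = (\<Sum>b'\<in>Sl (\<theta> + \<gamma>). (\<lambda>\<eta> n. Y \<eta> (c n)) (\<lambda>m. tgt.co b' (act' y m)) b')"
  proof (rule trace_cyclic)
    show "vec_basis S" "vec_basis S" by (rule tgt.vec_basis_axioms)+
    show "clinear (act' y)" by (rule tgt.act.lin_r)
    show "tgt.co b' (act' y b) = 0" if "b \<in> Sl \<theta>" "b' \<notin> Sl (\<theta> + \<gamma>)" for b b'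
    proof (rule ccontr)
      assume n: "tgt.co b' (act' y b) \<noteq> 0"
      have "b' \<in> Sl (\<theta> + \<gamma>)"
        by (rule SlI[OF tgt.co_in[OF n] tl]) (use wts[OF Sl_S[OF that(1)] n] Sl_ip[OF that(1)] in \<open>simp add: ip.addl\<close>)
      with that(2) show False ..
    qed
    show "tgt.co b' (act' y b) = 0" if "b \<in> S" "b \<notin> Sl \<theta>" "b' \<in> Sl (\<theta> + \<gamma>)" for b b'
    proof (rule ccontr)
      assume n: "tgt.co b' (act' y b) \<noteq> 0"
      have "b \<in> Sl \<theta>"
        by (rule SlI[OF that(1) True]) (use wts[OF that(1) n] Sl_ip[OF that(3)] in \<open>simp add: ip.addl\<close>)
      with that(2) show False ..
    qed
    show "clinear (\<lambda>n. Y \<eta> (c n))" if "clinear \<eta>" for \<eta> by (rule clinear_compose[OF c Y_lin[OF that]])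
  qed (auto simp: Sl_finite Sl_S Y_add Y_scale)
  also have "\<dots> = (\<Sum>b'\<in>Sl (\<theta> + \<gamma>). Y (tgt.co b') (act y (c b')) - wa y (Y (tgt.co b') (c b')))"
    by (rule sum.cong[OF refl]) (simp add: Y_int tgt.co_lin)
  also have "\<dots> = tt (\<theta> + \<gamma>) (\<lambda>m. act y (c m)) - wa y (tt (\<theta> + \<gamma>) c)"
    by (simp add: tt_def sum_subtractf wa_sum)
  finally show ?thesis .
qed

lemma cyclic_H:
  assumes "clinear c" "h \<in> H"
  shows "tt \<theta> (\<lambda>m. c (act' h m)) = tt \<theta> (\<lambda>m. act h (c m)) - wa h (tt \<theta> c)"
  using cyclic[OF assms(1) cvec.subspace_0[OF subspace_l], of h \<theta>] H(3)[OF l_H assms(2)] by (simp add: ip.zerol)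

text \<open>The operators \<open>vB\<close> and \<open>act h o vB\<close> to which the Cartan identities apply.\<close>

definition good :: "('m \<Rightarrow> 'm) \<Rightarrow> bool" where
  "good c \<longleftrightarrow> clinear c \<and> (\<forall>z\<in>l_space K. \<forall>m. c (act' z m) = act z (c m)) \<and> (\<forall>i\<in>G1. \<forall>m. c (act' (al i) m) = act (al (\<tau> i)) (c m))"

lemma good_vB: "good vB" by (simp add: good_def vB(1) vB_l vB_al)

lemma good_h: "good c \<Longrightarrow> h \<in> H \<Longrightarrow> good (\<lambda>m. act h (c m))"
proof -
  assume g: "good c" and h: "h \<in> H"
  have "act h (act k u) = act k (act h u)" if "k \<in> H" for k u
    using act_br[of h k u] H(3)[OF h that] by (simp add: act.zerol)
  then show ?thesis using g clinear_compose[OF _ act.lin_r] l_H al_in by (auto simp: good_def)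
qed

text \<open>Elements of \<open>l_space K\<close> commute with good operators and keep every block,
  so moving one around the trace shows that the values are invariant under
  \<open>l_space K\<close>.\<close>

lemma l_inv: "good c \<Longrightarrow> z \<in> l_space K \<Longrightarrow> wa z (tt \<theta> c) = 0"
  using cyclic_H[of c z \<theta>] l_H by (simp add: good_def)

text \<open>Moved around the trace, \<alpha> comes back as T\<alpha> and leaves its action on the
  tensor factors behind. Only the component of \<alpha> orthogonal to \<open>l_space K\<close>
  counts, by \<open>l_inv\<close>; by \<open>half_cayley_induct\<close> this is the operator (1 -
  C)/2 with the Cayley transform C.\<close>

lemma tt_aa: "good c \<Longrightarrow> i \<in> G1 \<Longrightarrow> tt \<theta> (\<lambda>m. act (aa i) (c m)) = wa (al i - pl (al i)) (tt \<theta> c)"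
proof -
  assume g: "good c" and i: "i \<in> G1"
  have "tt \<theta> (\<lambda>m. act (al (\<tau> i)) (c m)) = tt \<theta> (\<lambda>m. act (al i) (c m)) - wa (al i) (tt \<theta> c)"
    using cyclic_H[of c "al i" \<theta>] g i al_in by (simp add: good_def)
  moreover have "tt \<theta> (\<lambda>m. act (al i) (c m)) = tt \<theta> (\<lambda>m. act (aa i) (c m)) + tt \<theta> (\<lambda>m. act (al (\<tau> i)) (c m))"
    unfolding tt_add[symmetric] by (simp add: act.diffl)
  moreover have "wa (al i - pl (al i)) (tt \<theta> c) + wa (pl (al i)) (tt \<theta> c) = wa (al i) (tt \<theta> c)"
    using wa_add[OF tt_W0, of "al i - pl (al i)" "pl (al i)"] by simp
  ultimately show ?thesis using l_inv[OF g pl_l] by simp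
qed

abbreviation "hc z \<equiv> (1/2) *\<^sub>C (z - cayley K z)"

lemma tt_h0: "good c \<Longrightarrow> z \<in> h0_space K \<Longrightarrow> tt \<theta> (\<lambda>m. act z (c m)) = wa (hc z) (tt \<theta> c)"
proof -
  assume g: "good c" and z: "z \<in> h0_space K"
  have wa0: "wa 0 (tt \<theta> c) = 0" using wa_scale[OF tt_W0, of 0 0] by simp
  show ?thesis
    by (rule half_cayley_induct[OF z, of "\<lambda>z y. tt \<theta> (\<lambda>m. act z (c m)) = wa y (tt \<theta> c)"])
      (use tt_aa[OF g] in \<open>simp_all add: act.addl act.scalel act.zerol tt_add tt_scale tt_0 wa_add wa_scale tt_W0 wa0\<close>)
qed

lemma tt_l: "z \<in> l_space K \<Longrightarrow> tt \<theta> (\<lambda>m. act z (vB m)) = ip \<theta> z *\<^sub>C F \<theta>"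
proof -
  assume z: "z \<in> l_space K"
  have "tt \<theta> (\<lambda>m. act z (vB m)) = tt \<theta> (\<lambda>m. ip \<theta> z *\<^sub>C vB m)"
    by (rule tt_cong) (simp add: vB_l[OF z] Sl_act[OF _ z] vB_lins)
  then show ?thesis by (simp add: tt_scale F_def)
qed

lemma tt_l2: "z \<in> l_space K \<Longrightarrow> tt \<theta> (\<lambda>m. act z (act z (vB m))) = (ip \<theta> z * ip \<theta> z) *\<^sub>C F \<theta>"
proof -
  assume z: "z \<in> l_space K"
  have "tt \<theta> (\<lambda>m. act z (act z (vB m))) = tt \<theta> (\<lambda>m. (ip \<theta> z * ip \<theta> z) *\<^sub>C vB m)"
    by (rule tt_cong) (simp add: vB_l[OF z] Sl_act[OF _ z] vB_lins act.scaler)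
  then show ?thesis by (simp add: tt_scale F_def)
qed

text \<open>Cyclicity is used at the exponent \<open>\<theta> + \<gamma>\<close>, since
  \<open>y\<close> has weight \<open>- \<gamma>\<close>. An f leaves its action behind before it
  meets \<open>B\<close>, so its powers of \<open>B\<close> begin with s = 0.\<close>

lemma tt_f_step:
  assumes y: "y \<in> Nm" and \<gamma>: "\<gamma> \<in> l_space K" and e: "\<And>z. z \<in> l_space K \<Longrightarrow> br z y = (- ip \<gamma> z) *\<^sub>C y"
  shows "tt \<theta> (\<lambda>m. act y (vB m)) = wa y (F \<theta>) + tt (\<theta> + \<gamma>) (\<lambda>m. act (B y) (vB m))"
proof -
  have "tt (\<theta> + \<gamma>) (\<lambda>m. vB (act' y m)) = tt (\<theta> + \<gamma> + - \<gamma>) (\<lambda>m. act y (vB m)) - wa y (tt (\<theta> + \<gamma> + - \<gamma>) vB)"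
    by (rule cyclic[OF vB(1)]) (use \<gamma> e in \<open>simp_all add: cvec.subspace_neg subspace_l ip.minusl\<close>)
  then show ?thesis using y by (simp add: vB(3) F_def)
qed

lemma tt_f_iter:
  assumes y: "y \<in> Nm" and \<gamma>: "\<gamma> \<in> l_space K" and e: "\<And>z. z \<in> l_space K \<Longrightarrow> br z y = (- ip \<gamma> z) *\<^sub>C y"
  shows "tt \<theta> (\<lambda>m. act y (vB m)) = (\<Sum>s<n. wa ((B ^^ s) y) (F (\<theta> + of_nat s *\<^sub>C \<gamma>))) + tt (\<theta> + of_nat n *\<^sub>C \<gamma>) (\<lambda>m. act ((B ^^ n) y) (vB m))"
proof (induction n)
  case (Suc n)
  have "tt (\<theta> + of_nat n *\<^sub>C \<gamma>) (\<lambda>m. act ((B ^^ n) y) (vB m))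
    = wa ((B ^^ n) y) (F (\<theta> + of_nat n *\<^sub>C \<gamma>)) + tt (\<theta> + of_nat n *\<^sub>C \<gamma> + \<gamma>) (\<lambda>m. act (B ((B ^^ n) y)) (vB m))"
    by (rule tt_f_step[OF Bs_Nm[OF y] \<gamma> l_eigen_B[OF y _ e]])
  moreover have "\<theta> + of_nat n *\<^sub>C \<gamma> + \<gamma> = \<theta> + of_nat (Suc n) *\<^sub>C \<gamma>" by (simp add: scaleC_add_left add.assoc add.commute)
  ultimately show ?case using Suc by (simp add: add.assoc)
qed simp

text \<open>The e travels in the other direction: it passes \<open>vB\<close> first, becoming
  \<open>Bi u\<close>, and then goes around. So its powers of \<open>Bi\<close> begin with v = 1. On
  its return it has to be commuted with \<open>y\<close>, which creates the bracket term.\<close>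

lemma tt_fe_step:
  assumes y: "y \<in> Nm" and u: "u \<in> Np" and \<gamma>: "\<gamma> \<in> l_space K" and e: "\<And>z. z \<in> l_space K \<Longrightarrow> br z u = ip \<gamma> z *\<^sub>C u"
  shows "tt \<theta> (\<lambda>m. act y (act u (vB m))) = tt (\<theta> + \<gamma>) (\<lambda>m. act (br (Bi u) y) (vB m)) - wa (Bi u) (tt (\<theta> + \<gamma>) (\<lambda>m. act y (vB m)))
    + tt (\<theta> + \<gamma>) (\<lambda>m. act y (act (Bi u) (vB m)))"
proof -
  have "tt \<theta> (\<lambda>m. act y (act u (vB m))) = tt \<theta> (\<lambda>m. act y (vB (act' (Bi u) m)))" using vB_e[OF u] by simp
  also have "\<dots> = tt (\<theta> + \<gamma>) (\<lambda>m. act (Bi u) (act y (vB m))) - wa (Bi u) (tt (\<theta> + \<gamma>) (\<lambda>m. act y (vB m)))"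
    by (rule cyclic[OF clinear_compose[OF vB(1) act.lin_r] \<gamma>]) (use l_eigen_Bi[OF u _ e, of _ 1] in simp)
  also have "tt (\<theta> + \<gamma>) (\<lambda>m. act (Bi u) (act y (vB m))) = tt (\<theta> + \<gamma>) (\<lambda>m. act (br (Bi u) y) (vB m)) + tt (\<theta> + \<gamma>) (\<lambda>m. act y (act (Bi u) (vB m)))"
    unfolding tt_add[symmetric] by (simp add: act_br)
  finally show ?thesis by (simp add: algebra_simps)
qed

lemma tt_fe_iter:
  assumes y: "y \<in> Nm" and u: "u \<in> Np" and \<gamma>: "\<gamma> \<in> l_space K" and e: "\<And>z. z \<in> l_space K \<Longrightarrow> br z u = ip \<gamma> z *\<^sub>C u"
  shows "tt \<theta> (\<lambda>m. act y (act u (vB m))) =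
    (\<Sum>v\<in>{1..n}. tt (\<theta> + of_nat v *\<^sub>C \<gamma>) (\<lambda>m. act (br ((Bi ^^ v) u) y) (vB m)) - wa ((Bi ^^ v) u) (tt (\<theta> + of_nat v *\<^sub>C \<gamma>) (\<lambda>m. act y (vB m))))
    + tt (\<theta> + of_nat n *\<^sub>C \<gamma>) (\<lambda>m. act y (act ((Bi ^^ n) u) (vB m)))"
proof (induction n)
  case (Suc n)
  have s: "\<theta> + of_nat n *\<^sub>C \<gamma> + \<gamma> = \<theta> + of_nat (Suc n) *\<^sub>C \<gamma>" by (simp add: scaleC_add_left add.assoc add.commute)
  have "tt (\<theta> + of_nat n *\<^sub>C \<gamma>) (\<lambda>m. act y (act ((Bi ^^ n) u) (vB m)))
    = tt (\<theta> + of_nat (Suc n) *\<^sub>C \<gamma>) (\<lambda>m. act (br ((Bi ^^ Suc n) u) y) (vB m)) - wa ((Bi ^^ Suc n) u) (tt (\<theta> + of_nat (Suc n) *\<^sub>C \<gamma>) (\<lambda>m. act y (vB m)))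
    + tt (\<theta> + of_nat (Suc n) *\<^sub>C \<gamma>) (\<lambda>m. act y (act ((Bi ^^ Suc n) u) (vB m)))"
    using tt_fe_step[OF y Bis_Np[OF u] \<gamma> l_eigen_Bi[OF u _ e], of "\<theta> + of_nat n *\<^sub>C \<gamma>" n] unfolding s by simp
  then show ?case unfolding Suc by (simp add: add.assoc)
qed simp

text \<open>Regroups the sum over roots by restriction to \<open>l_space K\<close>, because a single
  root need not lie in that space while the grouped sum does.\<close>

lemma PP_group:
  assumes L: "\<And>\<gamma>. lin_on H (L \<gamma> :: 'g \<Rightarrow> 'w)"
  shows "(\<Sum>(\<alpha>, t)\<in>IX n. ip ((Bi ^^ v) (eb \<alpha> t)) (fb \<alpha> t) *\<^sub>C L (pl \<alpha>) \<alpha>) = (\<Sum>\<gamma>\<in>pl ` R n. L \<gamma> (PP n v \<gamma>))"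
proof -
  let ?k = "\<lambda>p. ip ((Bi ^^ v) (eb (fst p) (snd p))) (fb (fst p) (snd p))"
  have "(\<Sum>\<gamma>\<in>pl ` R n. L \<gamma> (PP n v \<gamma>)) = (\<Sum>\<gamma>\<in>pl ` R n. \<Sum>p\<in>IX n. if pl (fst p) = \<gamma> then ?k p *\<^sub>C L (pl (fst p)) (fst p) else 0)"
  proof (rule sum.cong[OF refl])
    fix \<gamma>
    have "PP n v \<gamma> = (\<Sum>p\<in>IX n. (if pl (fst p) = \<gamma> then ?k p else 0) *\<^sub>C fst p)"
      unfolding PP_def case_prod_unfold by (intro sum.cong refl) auto
    then have "L \<gamma> (PP n v \<gamma>) = (\<Sum>p\<in>IX n. (if pl (fst p) = \<gamma> then ?k p else 0) *\<^sub>C L \<gamma> (fst p))"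
      using lin_on_sum[OF L H(1), where A = "IX n" and k = fst and c = "\<lambda>p. if pl (fst p) = \<gamma> then ?k p else 0"] pos_roots_H IX_D(1) by auto
    also have "\<dots> = (\<Sum>p\<in>IX n. if pl (fst p) = \<gamma> then ?k p *\<^sub>C L (pl (fst p)) (fst p) else 0)"
      by (intro sum.cong refl) auto
    finally show "L \<gamma> (PP n v \<gamma>) = (\<Sum>p\<in>IX n. if pl (fst p) = \<gamma> then ?k p *\<^sub>C L (pl (fst p)) (fst p) else 0)" .
  qed
  also have "\<dots> = (\<Sum>p\<in>IX n. \<Sum>\<gamma>\<in>pl ` R n. if pl (fst p) = \<gamma> then ?k p *\<^sub>C L (pl (fst p)) (fst p) else 0)" by (rule sum.swap)
  also have "\<dots> = (\<Sum>p\<in>IX n. ?k p *\<^sub>C L (pl (fst p)) (fst p))"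
  proof (rule sum.cong[OF refl])
    fix p assume "p \<in> IX n"
    then have "pl (fst p) \<in> pl ` R n" by (auto simp: IX_def)
    then show "(\<Sum>\<gamma>\<in>pl ` R n. if pl (fst p) = \<gamma> then ?k p *\<^sub>C L (pl (fst p)) (fst p) else 0) = ?k p *\<^sub>C L (pl (fst p)) (fst p)"
      using R_finite by simp
  qed
  finally show ?thesis by (simp add: case_prod_unfold)
qed

lemma wa_lin_on: "w \<in> W0 \<Longrightarrow> lin_on U (\<lambda>h. wa h w)"
  by (simp add: lin_on_def wa_add wa_scale)

lemma tt_lin_on: "lin_on U (\<lambda>h. tt \<theta> (\<lambda>m. act h (vB m)))"
  by (simp add: lin_on_def act.addl act.scalel tt_add tt_scale)

abbreviation "kk v \<alpha> t \<equiv> ip ((Bi ^^ v) (eb \<alpha> t)) (fb \<alpha> t)"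

text \<open>The trace with a single root inserted cannot be evaluated directly. Grouped into
  \<open>PP\<close>, the roots lie in \<open>l_space K\<close>, where insertion is a differentiation
  by \<open>tt_l\<close>; the result is linear in the inserted element and is then
  ungrouped.\<close>

lemma diag_terms:
  assumes "v \<ge> 1"
  shows "(\<Sum>(\<alpha>, t)\<in>IX n. tt (sh \<theta> v \<alpha>) (\<lambda>m. act (br ((Bi ^^ v) (eb \<alpha> t)) (fb \<alpha> t)) (vB m)))
    = (\<Sum>(\<alpha>, t)\<in>IX n. (kk v \<alpha> t * ip \<alpha> (sh \<theta> v \<alpha>)) *\<^sub>C F (sh \<theta> v \<alpha>))"
proof -
  have "(\<Sum>(\<alpha>, t)\<in>IX n. tt (sh \<theta> v \<alpha>) (\<lambda>m. act (br ((Bi ^^ v) (eb \<alpha> t)) (fb \<alpha> t)) (vB m)))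
    = (\<Sum>(\<alpha>, t)\<in>IX n. kk v \<alpha> t *\<^sub>C tt (sh \<theta> v \<alpha>) (\<lambda>m. act \<alpha> (vB m)))"
    by (intro sum.cong refl) (auto simp: br_dual act.scalel tt_scale)
  also have "\<dots> = (\<Sum>\<gamma>\<in>pl ` R n. tt (\<theta> + of_nat v *\<^sub>C \<gamma>) (\<lambda>m. act (PP n v \<gamma>) (vB m)))"
    by (rule PP_group[where L = "\<lambda>\<gamma> h. tt (\<theta> + of_nat v *\<^sub>C \<gamma>) (\<lambda>m. act h (vB m))"]) (rule tt_lin_on)
  also have "\<dots> = (\<Sum>\<gamma>\<in>pl ` R n. ip (PP n v \<gamma>) (\<theta> + of_nat v *\<^sub>C \<gamma>) *\<^sub>C F (\<theta> + of_nat v *\<^sub>C \<gamma>))"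
    by (intro sum.cong refl) (simp add: tt_l[OF PP_l[OF assms]] ip_sym)
  also have "\<dots> = (\<Sum>(\<alpha>, t)\<in>IX n. kk v \<alpha> t *\<^sub>C (ip \<alpha> (sh \<theta> v \<alpha>) *\<^sub>C F (sh \<theta> v \<alpha>)))"
    by (rule PP_group[where L = "\<lambda>\<gamma> h. ip h (\<theta> + of_nat v *\<^sub>C \<gamma>) *\<^sub>C F (\<theta> + of_nat v *\<^sub>C \<gamma>)", symmetric])
      (simp add: lin_on_def ip.addl ip.scalel scaleC_add_left scaleC_scaleC scaleC_complex_def)
  finally show ?thesis by (simp add: scaleC_scaleC)
qed

text \<open>Transport of the canonical element collects all powers on the e-side, so the brackets
  become multiples of roots. Grouped, these lie in \<open>l_space K\<close> and annihilate the trace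
  by \<open>l_inv\<close>. In the sum the order of the two actions is therefore immaterial.\<close>

lemma comm_terms:
  assumes "v \<ge> 1"
  shows "(\<Sum>(\<alpha>, t)\<in>IX n. wa (br ((Bi ^^ v) (eb \<alpha> t)) ((B ^^ s) (fb \<alpha> t))) (F (sh \<theta> (s + v) \<alpha>))) = 0"
proof -
  define \<Phi> where "\<Phi> \<gamma> u y = wa (br u y) (F (\<theta> + of_nat (s + v) *\<^sub>C \<gamma>))" for \<gamma> u y
  have "(\<Sum>(\<alpha>, t)\<in>IX n. \<Phi> (pl \<alpha>) ((Bi ^^ v) (eb \<alpha> t)) ((B ^^ s) (fb \<alpha> t))) = (\<Sum>(\<alpha>, t)\<in>IX n. \<Phi> (pl \<alpha>) ((Bi ^^ (v + s)) (eb \<alpha> t)) (fb \<alpha> t))"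
    by (rule canonical) (simp_all add: \<Phi>_def lin_on_def bisimps wa_add wa_scale F_W0)
  also have "\<dots> = (\<Sum>(\<alpha>, t)\<in>IX n. kk (v + s) \<alpha> t *\<^sub>C wa \<alpha> (F (sh \<theta> (s + v) \<alpha>)))"
    by (intro sum.cong refl) (auto simp: \<Phi>_def br_dual wa_scale F_W0)
  also have "\<dots> = (\<Sum>\<gamma>\<in>pl ` R n. wa (PP n (v + s) \<gamma>) (F (\<theta> + of_nat (s + v) *\<^sub>C \<gamma>)))"
    by (rule PP_group[where L = "\<lambda>\<gamma> h. wa h (F (\<theta> + of_nat (s + v) *\<^sub>C \<gamma>))"]) (rule wa_lin_on[OF F_W0])
  also have "\<dots> = 0"
    by (rule sum.neutral) (use l_inv[OF good_vB PP_l] assms in \<open>simp add: F_def\<close>)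
  finally show ?thesis by (simp add: \<Phi>_def)
qed

text \<open>The single number \<open>n\<close> bounds the heights of the roots and the lengths of
  both iterations. The factor 2 of the Casimir element is spent on symmetrizing the products of the
  two actions.\<close>

lemma tt_Om:
  assumes n: "n \<ge> bound \<theta>"
  shows "2 *\<^sub>C tt \<theta> (\<lambda>m. Om n (vB m)) =
    2 *\<^sub>C (\<Sum>v\<in>{1..n}. \<Sum>(\<alpha>, t)\<in>IX n. (kk v \<alpha> t * ip \<alpha> (sh \<theta> v \<alpha>)) *\<^sub>C F (sh \<theta> v \<alpha>))
    - (\<Sum>(\<alpha>, t)\<in>IX n. \<Sum>v\<in>{1..n}. \<Sum>s<n.
        wa ((B ^^ s) (fb \<alpha> t)) (wa ((Bi ^^ v) (eb \<alpha> t)) (F (sh \<theta> (s + v) \<alpha>)))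
      + wa ((Bi ^^ v) (eb \<alpha> t)) (wa ((B ^^ s) (fb \<alpha> t)) (F (sh \<theta> (s + v) \<alpha>))))"
proof -
  let ?F = "\<lambda>s v \<alpha>. F (sh \<theta> (s + v) \<alpha>)"
  let ?E = "\<lambda>v \<alpha> t. (Bi ^^ v) (eb \<alpha> t)" and ?G = "\<lambda>s \<alpha> t. (B ^^ s) (fb \<alpha> t)"
  \<comment> \<open>Adding k times a root raises the height by at least k. This empties the blocks
    in which the remainders of both iterations live.\<close>
  have big: "Sl (sh \<theta> k \<alpha>) = {}" if "(\<alpha>, t) \<in> IX n" "k \<ge> n" for \<alpha> t k
  proof (rule Sl_empty)
    have "ip (pl \<alpha>) d = of_nat (ht \<alpha>)" using ip_pl[OF d_l] ht pos_roots_Q IX_D(1)[OF that(1)] by simp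
    then show "ip (of_nat k *\<^sub>C pl \<alpha>) d = of_nat (k * ht \<alpha>)" by (simp add: ip.scalel scaleC_complex_def)
    have "k * 1 \<le> k * ht \<alpha>" using ht_pos[OF IX_D(1)[OF that(1)]] by (intro mult_le_mono) auto
    then show "bound \<theta> \<le> k * ht \<alpha>" using n that(2) by linarith
  qed
  have one: "tt \<theta> (\<lambda>m. act (fb \<alpha> t) (act (eb \<alpha> t) (vB m))) =
    (\<Sum>v\<in>{1..n}. tt (sh \<theta> v \<alpha>) (\<lambda>m. act (br (?E v \<alpha> t) (fb \<alpha> t)) (vB m)) - (\<Sum>s<n. wa (?E v \<alpha> t) (wa (?G s \<alpha> t) (?F s v \<alpha>))))"
    if at: "(\<alpha>, t) \<in> IX n" for \<alpha> t
  proof -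
    have ez: "br z (eb \<alpha> t) = ip (pl \<alpha>) z *\<^sub>C eb \<alpha> t" if "z \<in> l_space K" for z
      using root_space_br[OF IX_D(4)[OF at] l_H[OF that]] ip_pl[OF that] by simp
    have fz: "br z (fb \<alpha> t) = (- ip (pl \<alpha>) z) *\<^sub>C fb \<alpha> t" if "z \<in> l_space K" for z
      using root_space_br[OF IX_D(5)[OF at] l_H[OF that]] ip_pl[OF that] by (simp add: ip.minusl)
    have ff: "tt (sh \<theta> v \<alpha>) (\<lambda>m. act (fb \<alpha> t) (vB m)) = (\<Sum>s<n. wa (?G s \<alpha> t) (?F s v \<alpha>))" for v
    proof -
      have sh: "sh \<theta> v \<alpha> + of_nat s *\<^sub>C pl \<alpha> = sh \<theta> (s + v) \<alpha>" for s
        by (simp add: scaleC_add_left add.assoc add.commute)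
      have "tt (sh \<theta> v \<alpha>) (\<lambda>m. act (fb \<alpha> t) (vB m)) =
        (\<Sum>s<n. wa (?G s \<alpha> t) (?F s v \<alpha>)) + tt (sh \<theta> (n + v) \<alpha>) (\<lambda>m. act (?G n \<alpha> t) (vB m))"
        using tt_f_iter[OF IX_D(7)[OF at] pl_l fz, where n = n and \<theta> = "sh \<theta> v \<alpha>"] unfolding sh .
      then show ?thesis using tt_empty[OF big[OF at, of "n + v"]] by simp
    qed
    show ?thesis
      using tt_fe_iter[OF IX_D(7)[OF at] IX_D(6)[OF at] pl_l ez, where n = n and \<theta> = \<theta>] tt_empty[OF big[OF at, of n]]
      by (simp add: ff wa_sum)
  qed
  have "tt \<theta> (\<lambda>m. Om n (vB m)) = (\<Sum>(\<alpha>, t)\<in>IX n. tt \<theta> (\<lambda>m. act (fb \<alpha> t) (act (eb \<alpha> t) (vB m))))"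
    unfolding Om_def case_prod_unfold by (rule tt_sum)
  also have "\<dots> = (\<Sum>(\<alpha>, t)\<in>IX n. \<Sum>v\<in>{1..n}. tt (sh \<theta> v \<alpha>) (\<lambda>m. act (br (?E v \<alpha> t) (fb \<alpha> t)) (vB m)) - (\<Sum>s<n. wa (?E v \<alpha> t) (wa (?G s \<alpha> t) (?F s v \<alpha>))))"
    by (rule sum.cong[OF refl]) (use one in auto)
  also have "\<dots> = (\<Sum>v\<in>{1..n}. \<Sum>(\<alpha>, t)\<in>IX n. tt (sh \<theta> v \<alpha>) (\<lambda>m. act (br (?E v \<alpha> t) (fb \<alpha> t)) (vB m)))
    - (\<Sum>(\<alpha>, t)\<in>IX n. \<Sum>v\<in>{1..n}. \<Sum>s<n. wa (?E v \<alpha> t) (wa (?G s \<alpha> t) (?F s v \<alpha>)))"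
    unfolding case_prod_unfold by (subst (2) sum.swap) (simp add: sum_subtractf)
  also have "(\<Sum>v\<in>{1..n}. \<Sum>(\<alpha>, t)\<in>IX n. tt (sh \<theta> v \<alpha>) (\<lambda>m. act (br (?E v \<alpha> t) (fb \<alpha> t)) (vB m)))
    = (\<Sum>v\<in>{1..n}. \<Sum>(\<alpha>, t)\<in>IX n. (kk v \<alpha> t * ip \<alpha> (sh \<theta> v \<alpha>)) *\<^sub>C F (sh \<theta> v \<alpha>))"
    by (rule sum.cong[OF refl]) (rule diag_terms, simp)
  finally have 1: "tt \<theta> (\<lambda>m. Om n (vB m)) = (\<Sum>v\<in>{1..n}. \<Sum>(\<alpha>, t)\<in>IX n. (kk v \<alpha> t * ip \<alpha> (sh \<theta> v \<alpha>)) *\<^sub>C F (sh \<theta> v \<alpha>))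
    - (\<Sum>(\<alpha>, t)\<in>IX n. \<Sum>v\<in>{1..n}. \<Sum>s<n. wa (?E v \<alpha> t) (wa (?G s \<alpha> t) (?F s v \<alpha>)))" .
  \<comment> \<open>Twice a product of two actions is the sum of both orders plus their commutator;
    \<open>comm_terms\<close> removes the commutators.\<close>
  have "2 *\<^sub>C (\<Sum>(\<alpha>, t)\<in>IX n. \<Sum>v\<in>{1..n}. \<Sum>s<n. wa (?E v \<alpha> t) (wa (?G s \<alpha> t) (?F s v \<alpha>)))
    = (\<Sum>(\<alpha>, t)\<in>IX n. \<Sum>v\<in>{1..n}. \<Sum>s<n. (wa (?G s \<alpha> t) (wa (?E v \<alpha> t) (?F s v \<alpha>)) + wa (?E v \<alpha> t) (wa (?G s \<alpha> t) (?F s v \<alpha>)))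
        + wa (br (?E v \<alpha> t) (?G s \<alpha> t)) (?F s v \<alpha>))"
  proof -
    have "(2::complex) = 1 + 1" by simp
    then have two: "2 *\<^sub>C w = w + w" for w :: 'w by (metis scaleC_add_left scaleC_one)
    show ?thesis unfolding cvec.scale_sum_right case_prod_unfold
      by (intro sum.cong refl) (simp add: two wa_br F_W0)
  qed
  also have "\<dots> = (\<Sum>(\<alpha>, t)\<in>IX n. \<Sum>v\<in>{1..n}. \<Sum>s<n. wa (?G s \<alpha> t) (wa (?E v \<alpha> t) (?F s v \<alpha>)) + wa (?E v \<alpha> t) (wa (?G s \<alpha> t) (?F s v \<alpha>)))
      + (\<Sum>(\<alpha>, t)\<in>IX n. \<Sum>v\<in>{1..n}. \<Sum>s<n. wa (br (?E v \<alpha> t) (?G s \<alpha> t)) (?F s v \<alpha>))"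
    unfolding case_prod_unfold by (simp only: sum.distrib)
  also have "(\<Sum>(\<alpha>, t)\<in>IX n. \<Sum>v\<in>{1..n}. \<Sum>s<n. wa (br (?E v \<alpha> t) (?G s \<alpha> t)) (?F s v \<alpha>))
    = (\<Sum>v\<in>{1..n}. \<Sum>s<n. \<Sum>(\<alpha>, t)\<in>IX n. wa (br (?E v \<alpha> t) (?G s \<alpha> t)) (?F s v \<alpha>))"
    unfolding case_prod_unfold by (subst sum.swap, intro sum.cong refl, rule sum.swap)
  also have "\<dots> = 0" by (intro sum.neutral ballI comm_terms) simp
  finally show ?thesis unfolding 1 cvec.scale_right_diff_distrib by simp
qed

theorem trace_identity:
  assumes rho: "is_rho K \<rho>" and n: "n \<ge> bound \<theta>"
  shows "(ip mu mu + 2 * ip \<rho> mu) *\<^sub>C F \<theta> =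
    (\<Sum>j\<in>I1. (ip \<theta> (x j) * ip \<theta> (x j)) *\<^sub>C F \<theta>) + (\<Sum>j\<in>I2. wa (hc (x j)) (wa (hc (x j)) (F \<theta>))) + (2 * ip \<theta> \<rho>) *\<^sub>C F \<theta>
    + 2 *\<^sub>C (\<Sum>v\<in>{1..n}. \<Sum>(\<alpha>, t)\<in>IX n. (kk v \<alpha> t * ip \<alpha> (sh \<theta> v \<alpha>)) *\<^sub>C F (sh \<theta> v \<alpha>))
    - (\<Sum>(\<alpha>, t)\<in>IX n. \<Sum>v\<in>{1..n}. \<Sum>s<n.
        wa ((B ^^ s) (fb \<alpha> t)) (wa ((Bi ^^ v) (eb \<alpha> t)) (F (sh \<theta> (s + v) \<alpha>)))
      + wa ((Bi ^^ v) (eb \<alpha> t)) (wa ((B ^^ s) (fb \<alpha> t)) (F (sh \<theta> (s + v) \<alpha>))))"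
proof -
  have "(ip mu mu + 2 * ip \<rho> mu) *\<^sub>C F \<theta> = tt \<theta> (\<lambda>m. (ip mu mu + 2 * ip \<rho> mu) *\<^sub>C vB m)"
    by (simp add: tt_scale F_def)
  also have "\<dots> = tt \<theta> (\<lambda>m. (\<Sum>j\<in>I1. act (x j) (act (x j) (vB m))) + (\<Sum>j\<in>I2. act (x j) (act (x j) (vB m))) + 2 *\<^sub>C act \<rho> (vB m) + 2 *\<^sub>C Om n (vB m))"
  proof (rule tt_cong)
    fix b assume b: "b \<in> Sl \<theta>"
    then obtain k where k: "k \<le> bound \<theta>" "ip \<theta> d = ip mu' d - of_nat k" using Sl_depth_bound by blast
    \<comment> \<open>\<open>d\<close> lies in \<open>l_space K\<close>, so \<open>vB\<close>
      preserves depth, and the truncated Casimir identity applies to \<open>vB b\<close> once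
      \<open>n\<close> reaches that depth.\<close>
    have "act d (vB b) = (ip mu d - of_nat k) *\<^sub>C vB b"
      by (simp add: vB_l[OF d_l] Sl_act[OF b d_l] vB_lins k(2) mu_l[OF d_l])
    then have "vB b \<in> cvec.span (fw ` {w. length w \<le> n})" by (rule span_depth[OF _ le_trans[OF k(1) n]])
    from casimir[OF rho this, symmetric]
    show "(ip mu mu + 2 * ip \<rho> mu) *\<^sub>C vB b = (\<Sum>j\<in>I1. act (x j) (act (x j) (vB b))) + (\<Sum>j\<in>I2. act (x j) (act (x j) (vB b))) + 2 *\<^sub>C act \<rho> (vB b) + 2 *\<^sub>C Om n (vB b)" .
  qed
  also have "\<dots> = (\<Sum>j\<in>I1. tt \<theta> (\<lambda>m. act (x j) (act (x j) (vB m)))) + (\<Sum>j\<in>I2. tt \<theta> (\<lambda>m. act (x j) (act (x j) (vB m))))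
      + 2 *\<^sub>C tt \<theta> (\<lambda>m. act \<rho> (vB m)) + 2 *\<^sub>C tt \<theta> (\<lambda>m. Om n (vB m))"
    by (simp add: tt_add tt_scale tt_sum)
  also have "(\<Sum>j\<in>I1. tt \<theta> (\<lambda>m. act (x j) (act (x j) (vB m)))) = (\<Sum>j\<in>I1. (ip \<theta> (x j) * ip \<theta> (x j)) *\<^sub>C F \<theta>)"
    by (intro sum.cong refl tt_l2 x_l)
  also have "(\<Sum>j\<in>I2. tt \<theta> (\<lambda>m. act (x j) (act (x j) (vB m)))) = (\<Sum>j\<in>I2. wa (hc (x j)) (wa (hc (x j)) (F \<theta>)))"
  proof (rule sum.cong[OF refl])
    fix j assume j: "j \<in> I2"
    have "tt \<theta> (\<lambda>m. act (x j) (act (x j) (vB m))) = wa (hc (x j)) (tt \<theta> (\<lambda>m. act (x j) (vB m)))"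
      by (rule tt_h0[OF good_h[OF good_vB] x_h0[OF j]]) (use x_H j in simp)
    then show "tt \<theta> (\<lambda>m. act (x j) (act (x j) (vB m))) = wa (hc (x j)) (wa (hc (x j)) (F \<theta>))"
      by (simp add: tt_h0[OF good_vB x_h0[OF j]] F_def)
  qed
  also have "2 *\<^sub>C tt \<theta> (\<lambda>m. act \<rho> (vB m)) = (2 * ip \<theta> \<rho>) *\<^sub>C F \<theta>" by (simp add: tt_l[OF rho_l[OF rho]])
  also note tt_Om[OF n]
  finally show ?thesis by (simp add: add_diff_eq)
qed

end

section \<open>Formal exponential series\<close>

lemma clinear_Sum_any:
  assumes "clinear T" "finite {k. c k \<noteq> 0}"
  shows "T (Sum_any c) = Sum_any (\<lambda>k. T (c k))"
proof -
  have "Sum_any (\<lambda>k. T (c k)) = (\<Sum>k\<in>{k. c k \<noteq> 0}. T (c k))"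
    by (rule Sum_any.expand_superset) (auto simp: assms clinear_zero)
  then show ?thesis by (simp add: Sum_any.expand_set clinear_sum assms)
qed

text \<open>The height of an exponent plays the role of a degree; tame series have bounded height, so the sums below are finite.\<close>

locale heights =
  fixes hgt :: "'g::complex_vec \<Rightarrow> real"
  assumes hgt_add: "hgt (a + b) = hgt a + hgt b"
begin

lemma hgt_0: "hgt 0 = 0" using hgt_add[of 0 0] by simp
lemma hgt_minus: "hgt (- a) = - hgt a" using hgt_add[of a "- a"] hgt_0 by simp
lemma hgt_diff: "hgt (a - b) = hgt a - hgt b" using hgt_add[of a "- b"] hgt_minus by simp

definition tame :: "('g \<Rightarrow> 'w::zero) \<Rightarrow> bool"
  where "tame G \<longleftrightarrow> (\<forall>c. finite {\<theta>. G \<theta> \<noteq> 0 \<and> c \<le> hgt \<theta>})"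

definition loc_fin :: "('k \<Rightarrow> 'u \<Rightarrow> 'w::zero) \<Rightarrow> ('k \<Rightarrow> 'g) \<Rightarrow> bool"
  where "loc_fin A \<gamma> \<longleftrightarrow> (\<forall>c. finite {k. A k \<noteq> (\<lambda>_. 0) \<and> hgt (\<gamma> k) \<le> c})"

text \<open>The operator that applies the maps \<open>A k\<close> to coefficients and multiplies by
  the exponentials with exponents \<open>- \<gamma> k\<close>; evaluating at
  \<open>\<theta> + \<gamma> k\<close> shifts the coefficient function accordingly.\<close>

definition Op :: "('k \<Rightarrow> 'u \<Rightarrow> 'w::comm_monoid_add) \<Rightarrow> ('k \<Rightarrow> 'g) \<Rightarrow> ('g \<Rightarrow> 'u) \<Rightarrow> 'g \<Rightarrow> 'w"
  where "Op A \<gamma> G = (\<lambda>\<theta>. Sum_any (\<lambda>k. A k (G (\<theta> + \<gamma> k))))"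

lemma tame_bound:
  assumes "tame G"
  obtains c where "\<And>\<theta>. G \<theta> \<noteq> 0 \<Longrightarrow> hgt \<theta> \<le> c"
proof
  have fin: "finite {\<theta>. G \<theta> \<noteq> 0 \<and> 0 \<le> hgt \<theta>}" using assms by (simp add: tame_def)
  show "hgt \<theta> \<le> Max (insert 0 (hgt ` {\<theta>. G \<theta> \<noteq> 0 \<and> 0 \<le> hgt \<theta>}))" if "G \<theta> \<noteq> 0" for \<theta>
    by (cases "0 \<le> hgt \<theta>") (use that fin in \<open>auto intro!: Max_ge simp: Max_ge_iff\<close>)
qed

lemma loc_fin_bound:
  assumes "loc_fin A \<gamma>"
  obtains c where "\<And>k. A k \<noteq> (\<lambda>_. 0) \<Longrightarrow> c \<le> hgt (\<gamma> k)"
proof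
  let ?X = "{k. A k \<noteq> (\<lambda>_. 0) \<and> hgt (\<gamma> k) \<le> 0}"
  have fin: "finite ?X" using assms by (simp add: loc_fin_def)
  show "Min (insert 0 ((\<lambda>k. hgt (\<gamma> k)) ` ?X)) \<le> hgt (\<gamma> k)" if "A k \<noteq> (\<lambda>_. 0)" for k
    by (cases "hgt (\<gamma> k) \<le> 0") (use that fin in \<open>auto intro!: Min_le simp: Min_le_iff\<close>)
qed

lemma tame_subset:
  assumes "tame G" "\<And>\<theta>. G' \<theta> \<noteq> 0 \<Longrightarrow> G \<theta> \<noteq> 0"
  shows "tame G'"
  unfolding tame_def
proof
  fix c show "finite {\<theta>. G' \<theta> \<noteq> 0 \<and> c \<le> hgt \<theta>}"
    by (rule finite_subset[of _ "{\<theta>. G \<theta> \<noteq> 0 \<and> c \<le> hgt \<theta>}"]) (use assms in \<open>auto simp: tame_def\<close>)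
qed

lemma tame_add:
  assumes "tame G" "tame (G' :: 'g \<Rightarrow> 'w::complex_vec)"
  shows "tame (G + G')"
  unfolding tame_def
proof
  fix c show "finite {\<theta>. (G + G') \<theta> \<noteq> 0 \<and> c \<le> hgt \<theta>}"
    by (rule finite_subset[of _ "{\<theta>. G \<theta> \<noteq> 0 \<and> c \<le> hgt \<theta>} \<union> {\<theta>. G' \<theta> \<noteq> 0 \<and> c \<le> hgt \<theta>}"])
      (use assms in \<open>auto simp: tame_def\<close>)
qed

lemma tame_0: "tame (0 :: 'g \<Rightarrow> 'w::complex_vec)" by (simp add: tame_def)

lemma tame_sum: "(\<And>j. j \<in> J \<Longrightarrow> tame (G j)) \<Longrightarrow> tame (\<Sum>j\<in>J. G j :: 'g \<Rightarrow> 'w::complex_vec)"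
  by (induction J rule: infinite_finite_induct) (auto intro: tame_add tame_0)

lemma tame_scale: "tame (G :: 'g \<Rightarrow> 'w::complex_vec) \<Longrightarrow> tame (c *\<^sub>C G)"
  by (rule tame_subset) (auto simp: scaleC_fun_def)

lemma tame_diff: "tame (G :: 'g \<Rightarrow> 'w::complex_vec) \<Longrightarrow> tame G' \<Longrightarrow> tame (G - G')"
  using tame_add[of G "- G'"] tame_subset[of G' "- G'"] by simp

lemma Op_fin:
  assumes G: "tame G" and A: "loc_fin A \<gamma>" and lin: "\<And>k. clinear (A k)"
  shows "finite {k. A k (G (\<theta> + \<gamma> k)) \<noteq> 0}"
proof -
  obtain c where c: "\<And>\<theta>. G \<theta> \<noteq> 0 \<Longrightarrow> hgt \<theta> \<le> c" by (rule tame_bound[OF G]) blast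
  have "{k. A k (G (\<theta> + \<gamma> k)) \<noteq> 0} \<subseteq> {k. A k \<noteq> (\<lambda>_. 0) \<and> hgt (\<gamma> k) \<le> c - hgt \<theta>}"
  proof
    fix k assume "k \<in> {k. A k (G (\<theta> + \<gamma> k)) \<noteq> 0}"
    then have n: "A k (G (\<theta> + \<gamma> k)) \<noteq> 0" by simp
    then have "G (\<theta> + \<gamma> k) \<noteq> 0" by (metis clinear_zero[OF lin])
    from c[OF this] n show "k \<in> {k. A k \<noteq> (\<lambda>_. 0) \<and> hgt (\<gamma> k) \<le> c - hgt \<theta>}" by (auto simp: hgt_add)
  qed
  moreover have "finite {k. A k \<noteq> (\<lambda>_. 0) \<and> hgt (\<gamma> k) \<le> c - hgt \<theta>}" using A by (simp add: loc_fin_def)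
  ultimately show ?thesis by (rule finite_subset)
qed

lemma Op_tame:
  assumes G: "tame G" and A: "loc_fin A \<gamma>" and lin: "\<And>k. clinear (A k)"
  shows "tame (Op A \<gamma> G)"
  unfolding tame_def
proof
  fix c
  obtain M where M: "\<And>\<theta>. G \<theta> \<noteq> 0 \<Longrightarrow> hgt \<theta> \<le> M" by (rule tame_bound[OF G]) blast
  obtain m where m: "\<And>k. A k \<noteq> (\<lambda>_. 0) \<Longrightarrow> m \<le> hgt (\<gamma> k)" by (rule loc_fin_bound[OF A]) blast
  let ?X = "{k. A k \<noteq> (\<lambda>_. 0) \<and> hgt (\<gamma> k) \<le> M - c} \<times> {\<eta>. G \<eta> \<noteq> 0 \<and> c + m \<le> hgt \<eta>}"
  have "{\<theta>. Op A \<gamma> G \<theta> \<noteq> 0 \<and> c \<le> hgt \<theta>} \<subseteq> (\<lambda>(k, \<eta>). \<eta> - \<gamma> k) ` ?X"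
  proof
    fix \<theta> assume "\<theta> \<in> {\<theta>. Op A \<gamma> G \<theta> \<noteq> 0 \<and> c \<le> hgt \<theta>}"
    then have \<theta>: "Op A \<gamma> G \<theta> \<noteq> 0" "c \<le> hgt \<theta>" by auto
    from \<theta>(1) obtain k where k: "A k (G (\<theta> + \<gamma> k)) \<noteq> 0"
      unfolding Op_def by (rule Sum_any.not_neutral_obtains_not_neutral)
    then have 1: "G (\<theta> + \<gamma> k) \<noteq> 0" by (metis clinear_zero[OF lin])
    have 2: "A k \<noteq> (\<lambda>_. 0)" using k by auto
    have "(k, \<theta> + \<gamma> k) \<in> ?X" using 1 2 M[OF 1] m[OF 2] \<theta>(2) by (auto simp: hgt_add)
    then show "\<theta> \<in> (\<lambda>(k, \<eta>). \<eta> - \<gamma> k) ` ?X" by (rule rev_image_eqI) simp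
  qed
  moreover have "finite ?X" using G A by (simp add: tame_def loc_fin_def)
  ultimately show "finite {\<theta>. Op A \<gamma> G \<theta> \<noteq> 0 \<and> c \<le> hgt \<theta>}" by (meson finite_imageI finite_subset)
qed

lemma Op_add:
  assumes "tame G" "tame G'" "loc_fin A \<gamma>" and lin: "\<And>k. clinear (A k)"
  shows "Op A \<gamma> (G + G') = Op A \<gamma> G + Op A \<gamma> G'"
proof
  fix \<theta>
  show "Op A \<gamma> (G + G') \<theta> = (Op A \<gamma> G + Op A \<gamma> G') \<theta>"
    using Sum_any.distrib[OF Op_fin[OF assms(1,3) lin] Op_fin[OF assms(2,3) lin], of \<theta> \<theta>]
    by (simp add: Op_def clinear_add[OF lin])
qed

lemma Op_sum:
  assumes "\<And>j. j \<in> J \<Longrightarrow> tame (G j)" "loc_fin A \<gamma>" and lin: "\<And>k. clinear (A k)"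
  shows "Op A \<gamma> (\<Sum>j\<in>J. G j) = (\<Sum>j\<in>J. Op A \<gamma> (G j))"
  using assms(1)
proof (induction J rule: infinite_finite_induct)
  case (insert j J)
  have "Op A \<gamma> (G j + sum G J) = Op A \<gamma> (G j) + Op A \<gamma> (sum G J)"
    using insert by (intro Op_add tame_sum assms(2,3)) auto
  with insert show ?case by (simp add: plus_fun_def)
qed (simp_all add: Op_def fun_eq_iff clinear_zero[OF lin])

lemma Op_scale:
  assumes "tame G" "loc_fin A \<gamma>" and lin: "\<And>k. clinear (A k)"
  shows "Op A \<gamma> (c *\<^sub>C G) = c *\<^sub>C Op A \<gamma> G"
  by (rule ext) (simp add: Op_def scaleC_fun_def clinear_scale[OF lin]
      clinear_Sum_any[OF clinear_scale_fun[OF clinear_id_fun] Op_fin[OF assms]])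

text \<open>The one interchange of infinite summations. As the product of series is an operator of
  this kind in either factor, associativity and the compatibility with the other operators are
  instances. The primed families express the same maps on other value spaces.\<close>

lemma Op_swap:
  assumes G: "tame G" and A: "loc_fin A \<gamma>" "\<And>k. clinear (A k)" and R: "loc_fin R \<beta>" "\<And>j. clinear (R j)"
    and A': "loc_fin A' \<gamma>" "\<And>k. clinear (A' k)" and R': "\<And>j. clinear (R' j)"
    and eq: "\<And>k j u. A k (R j u) = R' j (A' k u)"
  shows "Op A \<gamma> (Op R \<beta> G) = Op R' \<beta> (Op A' \<gamma> G)"
proof
  fix \<theta>
  let ?g = "\<lambda>k j. A k (R j (G (\<theta> + \<gamma> k + \<beta> j)))"
  obtain M where M: "\<And>\<theta>. G \<theta> \<noteq> 0 \<Longrightarrow> hgt \<theta> \<le> M" by (rule tame_bound[OF G]) blast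
  obtain m where m: "\<And>k. A k \<noteq> (\<lambda>_. 0) \<Longrightarrow> m \<le> hgt (\<gamma> k)" by (rule loc_fin_bound[OF A(1)]) blast
  obtain m' where m': "\<And>k. R k \<noteq> (\<lambda>_. 0) \<Longrightarrow> m' \<le> hgt (\<beta> k)" by (rule loc_fin_bound[OF R(1)]) blast
  have nz: "A k \<noteq> (\<lambda>_. 0) \<and> R j \<noteq> (\<lambda>_. 0) \<and> hgt (\<gamma> k) \<le> M - hgt \<theta> - m' \<and> hgt (\<beta> j) \<le> M - hgt \<theta> - m" if g: "?g k j \<noteq> 0" for k j
  proof -
    have 1: "R j (G (\<theta> + \<gamma> k + \<beta> j)) \<noteq> 0" using g by (metis clinear_zero[OF A(2)])
    then have 2: "G (\<theta> + \<gamma> k + \<beta> j) \<noteq> 0" by (metis clinear_zero[OF R(2)])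
    have 3: "A k \<noteq> (\<lambda>_. 0)" "R j \<noteq> (\<lambda>_. 0)" using g 1 by auto
    show ?thesis using 3 M[OF 2] m[OF 3(1)] m'[OF 3(2)] by (auto simp: hgt_add)
  qed
  let ?C = "{k. A k \<noteq> (\<lambda>_. 0) \<and> hgt (\<gamma> k) \<le> M - hgt \<theta> - m'} \<times> {j. R j \<noteq> (\<lambda>_. 0) \<and> hgt (\<beta> j) \<le> M - hgt \<theta> - m}"
  have "Op A \<gamma> (Op R \<beta> G) \<theta> = Sum_any (\<lambda>k. Sum_any (?g k))"
    unfolding Op_def by (rule Sum_any.cong) (simp add: clinear_Sum_any[OF A(2) Op_fin[OF G R]])
  also have "\<dots> = Sum_any (\<lambda>j. Sum_any (\<lambda>k. ?g k j))"
  proof (rule Sum_any.swap)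
    show "finite ?C" using A(1) R(1) by (simp add: loc_fin_def)
    show "{k. \<exists>j. ?g k j \<noteq> 0} \<times> {j. \<exists>k. ?g k j \<noteq> 0} \<subseteq> ?C" using nz by blast
  qed
  also have "\<dots> = Op R' \<beta> (Op A' \<gamma> G) \<theta>"
    unfolding Op_def
  proof (rule Sum_any.cong)
    fix j
    have s: "\<theta> + \<gamma> k + \<beta> j = \<theta> + \<beta> j + \<gamma> k" for k by (simp add: ac_simps)
    show "Sum_any (\<lambda>k. ?g k j) = R' j (Sum_any (\<lambda>k. A' k (G (\<theta> + \<beta> j + \<gamma> k))))"
      by (simp add: clinear_Sum_any[OF R' Op_fin[OF G A']] eq s)
  qed
  finally show "Op A \<gamma> (Op R \<beta> G) \<theta> = Op R' \<beta> (Op A' \<gamma> G) \<theta>" .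
qed

lemma series_mult_Op: "series_mult a G = Op (\<lambda>\<eta> w. a \<eta> *\<^sub>C w) uminus G"
  by (simp add: series_mult_def Op_def)

lemma series_mult_Op': "series_mult a G = Op (\<lambda>\<eta> d. d *\<^sub>C G \<eta>) uminus a"
proof
  fix \<theta> :: 'g
  have "bij (\<lambda>\<eta>. \<theta> - \<eta>)" by (rule bij_betw_byWitness[where f' = "\<lambda>\<eta>. \<theta> - \<eta>"]) (auto simp: diff_diff_eq2)
  then show "series_mult a G \<theta> = Op (\<lambda>\<eta> d. d *\<^sub>C G \<eta>) uminus a \<theta>"
    unfolding series_mult_def Op_def by (rule Sum_any.reindex_cong) (simp add: fun_eq_iff)
qed

lemma loc_fin_l: "tame a \<Longrightarrow> loc_fin (\<lambda>\<eta> (w :: 'w::complex_vec). a \<eta> *\<^sub>C w) uminus"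
  and loc_fin_r: "tame (G :: 'g \<Rightarrow> 'w::complex_vec) \<Longrightarrow> loc_fin (\<lambda>\<eta> d. d *\<^sub>C G \<eta>) uminus"
proof -
  assume a: "tame a"
  show "loc_fin (\<lambda>\<eta> (w :: 'w). a \<eta> *\<^sub>C w) uminus" unfolding loc_fin_def
  proof
    fix c show "finite {\<eta>. (\<lambda>w :: 'w. a \<eta> *\<^sub>C w) \<noteq> (\<lambda>_. 0) \<and> hgt (- \<eta>) \<le> c}"
      by (rule finite_subset[of _ "{\<eta>. a \<eta> \<noteq> 0 \<and> - c \<le> hgt \<eta>}"]) (use a in \<open>auto simp: tame_def hgt_minus\<close>)
  qed
next
  assume G: "tame G"
  show "loc_fin (\<lambda>\<eta> d. d *\<^sub>C G \<eta>) uminus" unfolding loc_fin_def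
  proof
    fix c show "finite {\<eta>. (\<lambda>d. d *\<^sub>C G \<eta>) \<noteq> (\<lambda>_. 0) \<and> hgt (- \<eta>) \<le> c}"
      by (rule finite_subset[of _ "{\<eta>. G \<eta> \<noteq> 0 \<and> - c \<le> hgt \<eta>}"]) (use G in \<open>auto simp: tame_def hgt_minus\<close>)
  qed
qed

lemma lin_l: "clinear (\<lambda>w. c *\<^sub>C w)" by (rule clinear_scale_fun[OF clinear_id_fun])
lemma lin_r: "clinear (\<lambda>d :: complex. d *\<^sub>C w)"
  by (intro clinearI) (simp_all add: scaleC_add_left scaleC_scaleC scaleC_complex_def)

lemma series_mult_tame: "tame a \<Longrightarrow> tame G \<Longrightarrow> tame (series_mult a G)"
  unfolding series_mult_Op by (intro Op_tame loc_fin_l lin_l)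

lemma series_mult_fin: "tame a \<Longrightarrow> tame G \<Longrightarrow> finite {\<eta>. a \<eta> *\<^sub>C G (\<theta> - \<eta>) \<noteq> 0}"
  using Op_fin[OF _ loc_fin_l lin_l, of G a \<theta>] by simp

lemma series_mult_add: "tame a \<Longrightarrow> tame G \<Longrightarrow> tame G' \<Longrightarrow> series_mult a (G + G') = series_mult a G + series_mult a G'"
  and series_mult_scale: "tame a \<Longrightarrow> tame G \<Longrightarrow> series_mult a (c *\<^sub>C G) = c *\<^sub>C series_mult a G"
  unfolding series_mult_Op by (intro Op_add Op_scale loc_fin_l lin_l; assumption)+

lemma series_mult_sum: "tame a \<Longrightarrow> (\<And>j. j \<in> J \<Longrightarrow> tame (G j)) \<Longrightarrow> series_mult a (\<Sum>j\<in>J. G j) = (\<Sum>j\<in>J. series_mult a (G j))"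
  unfolding series_mult_Op by (intro Op_sum loc_fin_l lin_l; assumption)

lemma series_mult_diff: "tame a \<Longrightarrow> tame G \<Longrightarrow> tame G' \<Longrightarrow> series_mult a (G - G') = series_mult a G - series_mult a G'"
  using series_mult_add[of a "G - G'" G'] tame_diff[of G G'] by simp

lemma series_mult_add_l: "tame a \<Longrightarrow> tame a' \<Longrightarrow> tame G \<Longrightarrow> series_mult (a + a') G = series_mult a G + series_mult a' G"
  and series_mult_scale_l: "tame a \<Longrightarrow> tame G \<Longrightarrow> series_mult (c *\<^sub>C a) G = c *\<^sub>C series_mult a G"
  unfolding series_mult_Op' by (intro Op_add Op_scale loc_fin_r lin_r; assumption)+

lemma series_mult_sum_l: "tame G \<Longrightarrow> (\<And>j. j \<in> J \<Longrightarrow> tame (a j)) \<Longrightarrow> series_mult (\<Sum>j\<in>J. a j) G = (\<Sum>j\<in>J. series_mult (a j) G)"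
  unfolding series_mult_Op' by (intro Op_sum loc_fin_r lin_r; assumption)

lemma series_mult_commute: "series_mult a b = series_mult b (a :: 'g \<Rightarrow> complex)"
  by (simp add: series_mult_Op'[of a b] series_mult_Op[of b a] scaleC_complex_def mult.commute)

lemma series_mult_Op_right:
  assumes "tame a" "tame G" "loc_fin A \<gamma>" "\<And>k. clinear (A k)"
  shows "Op A \<gamma> (series_mult a G) = series_mult a (Op A \<gamma> G)"
  unfolding series_mult_Op
  by (rule Op_swap[OF assms(2-4) loc_fin_l[OF assms(1)] lin_l assms(3,4) lin_l]) (simp add: clinear_scale[OF assms(4)])

lemma series_mult_Op_left:
  assumes "tame a" "tame G" "loc_fin A \<gamma>" "\<And>k. clinear (A k)" "loc_fin A' \<gamma>" "\<And>k. clinear (A' k)"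
    and "\<And>k d w. A k (d *\<^sub>C w) = A' k d *\<^sub>C w"
  shows "Op A \<gamma> (series_mult a G) = series_mult (Op A' \<gamma> a) G"
  unfolding series_mult_Op'
  by (rule Op_swap[OF assms(1) assms(3,4) loc_fin_r[OF assms(2)] lin_r assms(5,6) lin_r]) (simp add: assms(7))

lemma series_mult_assoc:
  assumes "tame a" "tame b" "tame G"
  shows "series_mult a (series_mult b G) = series_mult (series_mult a b) G"
  unfolding series_mult_Op[of a]
  by (rule series_mult_Op_left[OF assms(2,3) loc_fin_l[OF assms(1)] lin_l loc_fin_l[OF assms(1)] lin_l])
    (simp add: scaleC_scaleC scaleC_complex_def)

lemma series_mult_1: "series_mult (\<lambda>\<theta>. if \<theta> = 0 then 1 else 0) G = (G :: 'g \<Rightarrow> 'w::complex_vec)"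
proof
  fix \<theta>
  have "series_mult (\<lambda>\<theta>. if \<theta> = 0 then 1 else 0) G \<theta> = (\<Sum>\<eta>\<in>{0}. (if \<eta> = 0 then 1 else 0) *\<^sub>C G (\<theta> - \<eta>))"
    unfolding series_mult_def by (rule Sum_any.expand_superset) auto
  then show "series_mult (\<lambda>\<theta>. if \<theta> = 0 then 1 else 0) G \<theta> = G \<theta>" by (simp add: scaleC_one)
qed

lemma series_inverse_unique:
  fixes D :: "'g \<Rightarrow> complex"
  assumes "tame a" "tame b" "tame D" "series_mult a D = (\<lambda>\<theta>. if \<theta> = 0 then 1 else 0)"
    "series_mult b D = (\<lambda>\<theta>. if \<theta> = 0 then 1 else 0)"
  shows "a = b"
proof -
  have "b = series_mult (series_mult a D) b" by (simp add: assms(4) series_mult_1)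
  also have "\<dots> = series_mult a (series_mult b D)"
    by (simp add: series_mult_assoc[OF assms(1,3,2)] series_mult_commute[of b D])
  also have "\<dots> = a" by (simp add: assms(5) series_mult_commute[of a] series_mult_1)
  finally show ?thesis by simp
qed

lemma series_mult_Leibniz:
  fixes \<xi> :: "'g \<Rightarrow> complex"
  assumes "tame a" "tame G" and \<xi>: "\<And>a b. \<xi> (a + b) = \<xi> a + \<xi> b"
  shows "(\<lambda>\<theta>. \<xi> \<theta> *\<^sub>C series_mult a G \<theta>) = series_mult (\<lambda>\<theta>. \<xi> \<theta> *\<^sub>C a \<theta>) G + series_mult a (\<lambda>\<theta>. \<xi> \<theta> *\<^sub>C G \<theta>)"
proof
  fix \<theta>
  have t: "tame (\<lambda>\<theta>. \<xi> \<theta> *\<^sub>C a \<theta>)" "tame (\<lambda>\<theta>. \<xi> \<theta> *\<^sub>C G \<theta>)" by (rule tame_subset[OF assms(1)] tame_subset[OF assms(2)]; auto)+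
  have "\<xi> \<theta> *\<^sub>C series_mult a G \<theta> = Sum_any (\<lambda>\<eta>. \<xi> \<theta> *\<^sub>C (a \<eta> *\<^sub>C G (\<theta> - \<eta>)))"
    unfolding series_mult_def by (rule clinear_Sum_any[OF lin_l series_mult_fin[OF assms(1,2)]])
  also have "\<dots> = Sum_any (\<lambda>\<eta>. (\<xi> \<eta> *\<^sub>C a \<eta>) *\<^sub>C G (\<theta> - \<eta>) + a \<eta> *\<^sub>C (\<xi> (\<theta> - \<eta>) *\<^sub>C G (\<theta> - \<eta>)))"
  proof (rule Sum_any.cong)
    fix \<eta>
    have "\<xi> \<theta> = \<xi> \<eta> + \<xi> (\<theta> - \<eta>)" using \<xi>[of \<eta> "\<theta> - \<eta>"] by simp
    then show "\<xi> \<theta> *\<^sub>C (a \<eta> *\<^sub>C G (\<theta> - \<eta>)) = (\<xi> \<eta> *\<^sub>C a \<eta>) *\<^sub>C G (\<theta> - \<eta>) + a \<eta> *\<^sub>C (\<xi> (\<theta> - \<eta>) *\<^sub>C G (\<theta> - \<eta>))"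
      by (simp add: scaleC_scaleC scaleC_complex_def algebra_simps flip: scaleC_add_left)
  qed
  also have "\<dots> = (series_mult (\<lambda>\<theta>. \<xi> \<theta> *\<^sub>C a \<theta>) G + series_mult a (\<lambda>\<theta>. \<xi> \<theta> *\<^sub>C G \<theta>)) \<theta>"
    using series_mult_fin[OF t(1) assms(2), of \<theta>] series_mult_fin[OF assms(1) t(2), of \<theta>]
    by (simp add: series_mult_def Sum_any.distrib)
  finally show "\<xi> \<theta> *\<^sub>C series_mult a G \<theta> = (series_mult (\<lambda>\<theta>. \<xi> \<theta> *\<^sub>C a \<theta>) G + series_mult a (\<lambda>\<theta>. \<xi> \<theta> *\<^sub>C G \<theta>)) \<theta>" .
qed

end

text \<open>The inverse is the limit of the geometric series, whose partial sums stabilize at every exponent.\<close>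

lemma (in heights) series_inverse_exists:
  fixes D :: "'g \<Rightarrow> complex"
  assumes C0: "0 \<in> C" and C_add: "\<And>a b. a \<in> C \<Longrightarrow> b \<in> C \<Longrightarrow> a + b \<in> C"
    and C1: "\<And>a. a \<in> C \<Longrightarrow> a \<noteq> 0 \<Longrightarrow> 1 \<le> hgt a"
    and D1: "D \<omega> = 1" and D: "\<And>\<theta>. D \<theta> \<noteq> 0 \<Longrightarrow> \<omega> - \<theta> \<in> C" and tD: "tame D"
  obtains a where "\<And>\<theta>. a \<theta> \<noteq> 0 \<Longrightarrow> - \<omega> - \<theta> \<in> C" "series_mult a D = (\<lambda>\<theta>. if \<theta> = 0 then 1 else 0)"
proof -
  \<comment> \<open>With the leading exponential of \<open>D\<close> divided out, \<open>D\<close>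
    becomes 1 minus \<open>N\<close>, and \<open>N\<close> is supported in heights at most
    -1.\<close>
  define N where "N = (\<lambda>\<eta>. (if \<eta> = 0 then 1 else 0) - D (\<eta> + \<omega>))"
  have N: "- \<eta> \<in> C" "hgt \<eta> \<le> -1" if "N \<eta> \<noteq> 0" for \<eta>
  proof -
    have n0: "\<eta> \<noteq> 0" using that D1 by (auto simp: N_def)
    then have "D (\<eta> + \<omega>) \<noteq> 0" using that by (simp add: N_def)
    from D[OF this] show "- \<eta> \<in> C" by simp
    from C1[OF this] n0 show "hgt \<eta> \<le> -1" by (simp add: hgt_minus)
  qed
  have tN: "tame N" unfolding tame_def
  proof
    fix c
    have "{\<theta>. N \<theta> \<noteq> 0 \<and> c \<le> hgt \<theta>} \<subseteq> insert 0 ((\<lambda>\<theta>. \<theta> - \<omega>) ` {\<theta>. D \<theta> \<noteq> 0 \<and> c + hgt \<omega> \<le> hgt \<theta>})"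
    proof
      fix \<theta> assume "\<theta> \<in> {\<theta>. N \<theta> \<noteq> 0 \<and> c \<le> hgt \<theta>}"
      then have "\<theta> \<noteq> 0 \<Longrightarrow> \<theta> + \<omega> \<in> {\<theta>. D \<theta> \<noteq> 0 \<and> c + hgt \<omega> \<le> hgt \<theta>}" by (auto simp: N_def hgt_add)
      then show "\<theta> \<in> insert 0 ((\<lambda>\<theta>. \<theta> - \<omega>) ` {\<theta>. D \<theta> \<noteq> 0 \<and> c + hgt \<omega> \<le> hgt \<theta>})"
        by (cases "\<theta> = 0") (auto intro: rev_image_eqI)
    qed
    then show "finite {\<theta>. N \<theta> \<noteq> 0 \<and> c \<le> hgt \<theta>}" by (rule finite_subset) (use tD in \<open>simp add: tame_def\<close>)
  qed
  \<comment> \<open>Partial sums of the geometric series in \<open>N\<close>, multiplied by the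
    exponential with exponent \<open>- \<omega>\<close>.\<close>
  define P :: "nat \<Rightarrow> 'g \<Rightarrow> complex" where "P = rec_nat (\<lambda>\<theta>. if \<theta> = - \<omega> then 1 else 0) (\<lambda>_ p \<theta>. (if \<theta> = - \<omega> then 1 else 0) + series_mult N p \<theta>)"
  have P0: "P 0 = (\<lambda>\<theta>. if \<theta> = - \<omega> then 1 else 0)"
    and PS: "P (Suc n) = (\<lambda>\<theta>. (if \<theta> = - \<omega> then 1 else 0) + series_mult N (P n) \<theta>)" for n
    by (simp_all add: P_def)
  have sm_nz: "\<exists>\<eta>. N \<eta> \<noteq> 0 \<and> p (\<theta> - \<eta>) \<noteq> 0" if "series_mult N p \<theta> \<noteq> 0" for p :: "'g \<Rightarrow> complex" and \<theta>
  proof -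
    from that obtain \<eta> where "N \<eta> *\<^sub>C p (\<theta> - \<eta>) \<noteq> 0" unfolding series_mult_def by (rule Sum_any.not_neutral_obtains_not_neutral)
    then show ?thesis by auto
  qed
  have P_supp: "- \<omega> - \<theta> \<in> C" if "P n \<theta> \<noteq> 0" for n \<theta>
    using that
  proof (induction n arbitrary: \<theta>)
    case (Suc n)
    show ?case
    proof (cases "\<theta> = - \<omega>")
      case False
      then have "series_mult N (P n) \<theta> \<noteq> 0" using Suc.prems by (simp add: PS)
      from sm_nz[OF this] obtain \<eta> where "N \<eta> \<noteq> 0" "P n (\<theta> - \<eta>) \<noteq> 0" by auto
      then have "- \<eta> + (- \<omega> - (\<theta> - \<eta>)) \<in> C" using N(1) Suc.IH by (intro C_add) auto
      then show ?thesis by simp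
    qed (simp add: C0)
  qed (auto simp: P0 C0 split: if_splits)
  have sm_cong: "series_mult N p \<theta> = series_mult N q \<theta>"
    if "\<And>\<eta>. hgt \<eta> \<ge> hgt \<theta> + 1 \<Longrightarrow> p \<eta> = q \<eta>" for p q :: "'g \<Rightarrow> complex" and \<theta>
    unfolding series_mult_def
  proof (rule Sum_any.cong)
    fix \<eta> show "N \<eta> *\<^sub>C p (\<theta> - \<eta>) = N \<eta> *\<^sub>C q (\<theta> - \<eta>)"
      using N(2)[of \<eta>] that[of "\<theta> - \<eta>"] by (cases "N \<eta> = 0") (auto simp: hgt_diff)
  qed
  have step: "P (Suc n) \<theta> = P n \<theta>" if "hgt \<theta> > - hgt \<omega> - real (Suc n)" for n \<theta>
    using that
  proof (induction n arbitrary: \<theta>)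
    case 0
    have "series_mult N (P 0) \<theta> = series_mult N (\<lambda>_. 0) \<theta>"
      by (rule sm_cong) (use 0 in \<open>auto simp: P0 hgt_minus\<close>)
    then show ?case by (simp add: PS P0 series_mult_def)
  next
    case (Suc n)
    have "series_mult N (P (Suc n)) \<theta> = series_mult N (P n) \<theta>"
      by (rule sm_cong) (use Suc in auto)
    then show ?case by (simp add: PS[of "Suc n"] PS[of n])
  qed
  have stable: "P (n + k) \<theta> = P n \<theta>" if "hgt \<theta> > - hgt \<omega> - real (Suc n)" for n k \<theta>
    by (induction k) (use that in \<open>auto simp: step\<close>)
  \<comment> \<open>Each power of \<open>N\<close> lowers the height by at least 1, so the
    coefficient at an exponent no longer changes after as many steps as its height lies below that
    of \<open>- \<omega>\<close>.\<close>
  define k where "k = (\<lambda>\<theta>. nat \<lfloor>- hgt \<omega> - hgt \<theta>\<rfloor>)"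
  define a where "a = (\<lambda>\<theta>. P (k \<theta>) \<theta>)"
  have k: "hgt \<theta> > - hgt \<omega> - real (Suc (k \<theta>))" for \<theta> unfolding k_def by linarith
  have a_eq: "a \<theta> = P n \<theta>" if "n \<ge> k \<theta>" for n \<theta>
    using stable[OF k, of \<theta> "n - k \<theta>"] that by (simp add: a_def)
  have a: "a \<theta> = (if \<theta> = - \<omega> then 1 else 0) + series_mult N a \<theta>" for \<theta>
  proof -
    have "series_mult N (P (k \<theta>)) \<theta> = series_mult N a \<theta>"
    proof (rule sm_cong)
      fix \<eta> assume "hgt \<eta> \<ge> hgt \<theta> + 1"
      then have "k \<eta> \<le> k \<theta>" unfolding k_def by linarith
      then show "P (k \<theta>) \<eta> = a \<eta>" by (simp add: a_eq)
    qed
    then show ?thesis using a_eq[of \<theta> "Suc (k \<theta>)"] by (simp add: PS)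
  qed
  have supp: "- \<omega> - \<theta> \<in> C" if "a \<theta> \<noteq> 0" for \<theta> using that P_supp by (simp add: a_def)
  have "series_mult a D = (\<lambda>\<theta>. if \<theta> = 0 then 1 else 0)"
  proof
    fix \<theta>
    have fin: "finite {\<eta>. (if \<eta> = 0 then 1 else 0) *\<^sub>C a (\<theta> - \<omega> - \<eta>) \<noteq> 0}" "finite {\<eta>. N \<eta> *\<^sub>C a (\<theta> - \<omega> - \<eta>) \<noteq> 0}"
    proof -
      show "finite {\<eta>. (if \<eta> = 0 then 1 else 0) *\<^sub>C a (\<theta> - \<omega> - \<eta>) \<noteq> 0}" by (rule finite_subset[of _ "{0}"]) auto
      have "{\<eta>. N \<eta> *\<^sub>C a (\<theta> - \<omega> - \<eta>) \<noteq> 0} \<subseteq> {\<eta>. N \<eta> \<noteq> 0 \<and> hgt \<theta> \<le> hgt \<eta>}"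
      proof
        fix \<eta> assume "\<eta> \<in> {\<eta>. N \<eta> *\<^sub>C a (\<theta> - \<omega> - \<eta>) \<noteq> 0}"
        then have n: "N \<eta> \<noteq> 0" "- \<omega> - (\<theta> - \<omega> - \<eta>) \<in> C" using supp[of "\<theta> - \<omega> - \<eta>"] by auto
        have "0 \<le> hgt (- \<omega> - (\<theta> - \<omega> - \<eta>))" using C1[OF n(2)] hgt_0 by (cases "- \<omega> - (\<theta> - \<omega> - \<eta>) = 0") auto
        then show "\<eta> \<in> {\<eta>. N \<eta> \<noteq> 0 \<and> hgt \<theta> \<le> hgt \<eta>}" using n(1) by (simp add: hgt_diff hgt_minus)
      qed
      then show "finite {\<eta>. N \<eta> *\<^sub>C a (\<theta> - \<omega> - \<eta>) \<noteq> 0}" by (rule finite_subset) (use tN in \<open>simp add: tame_def\<close>)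
    qed
    have "bij (\<lambda>\<eta>. \<eta> + \<omega>)" by (rule bij_betw_byWitness[where f' = "\<lambda>\<eta>. \<eta> - \<omega>"]) auto
    then have "series_mult D a \<theta> = Sum_any (\<lambda>\<eta>. D (\<eta> + \<omega>) *\<^sub>C a (\<theta> - (\<eta> + \<omega>)))"
      unfolding series_mult_def by (rule Sum_any.reindex_cong) (simp add: fun_eq_iff)
    also have "\<dots> = Sum_any (\<lambda>\<eta>. (if \<eta> = 0 then 1 else 0) *\<^sub>C a (\<theta> - \<omega> - \<eta>) + (-1) *\<^sub>C (N \<eta> *\<^sub>C a (\<theta> - \<omega> - \<eta>)))"
      by (rule Sum_any.cong) (simp add: N_def scaleC_complex_def algebra_simps)
    also have "\<dots> = Sum_any (\<lambda>\<eta>. (if \<eta> = 0 then 1 else 0) *\<^sub>C a (\<theta> - \<omega> - \<eta>)) + Sum_any (\<lambda>\<eta>. (-1) *\<^sub>C (N \<eta> *\<^sub>C a (\<theta> - \<omega> - \<eta>)))"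
      by (rule Sum_any.distrib[OF fin(1)]) (rule finite_subset[OF _ fin(2)], auto)
    also have "Sum_any (\<lambda>\<eta>. (if \<eta> = 0 then 1 else 0) *\<^sub>C a (\<theta> - \<omega> - \<eta>)) = a (\<theta> - \<omega>)"
      using fun_cong[OF series_mult_1, of a "\<theta> - \<omega>"] by (simp add: series_mult_def)
    also have "Sum_any (\<lambda>\<eta>. (-1) *\<^sub>C (N \<eta> *\<^sub>C a (\<theta> - \<omega> - \<eta>))) = - series_mult N a (\<theta> - \<omega>)"
      unfolding series_mult_def by (subst clinear_Sum_any[OF lin_l fin(2), symmetric]) (simp add: scaleC_complex_def)
    finally show "series_mult a D \<theta> = (if \<theta> = 0 then 1 else 0)"
      using a[of "\<theta> - \<omega>"] by (simp add: series_mult_commute[of a] algebra_simps)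
  qed
  with supp show thesis by (rule that)
qed

lemma Sum_any_eq_sum: "finite A \<Longrightarrow> (\<And>a. a \<notin> A \<Longrightarrow> g a = 0) \<Longrightarrow> Sum_any g = sum g A"
  by (rule Sum_any.expand_superset) auto

lemma sum_Sigma3:
  assumes "finite A" "\<And>a. finite (P a)" "finite Q"
  shows "sum g (Sigma A (\<lambda>a. P a \<times> Q)) = (\<Sum>a\<in>A. \<Sum>p\<in>P a. \<Sum>q\<in>Q. g (a, p, q))"
  using assms by (simp add: sum.Sigma sum.cartesian_product case_prod_unfold)

section \<open>The scalar series and the operator series of the equation, as operators on
  coefficient functions\<close>

context bd begin

definition hg :: "'g \<Rightarrow> real" where "hg \<theta> = Re (ip \<theta> d)"

sublocale heights hg by unfold_locales (simp add: hg_def ip.addl)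

lemma hg_pl: "hg (pl z) = hg z" by (simp add: hg_def ip_pl d_l)
lemma hg_Q: "z \<in> Q_plus K \<Longrightarrow> hg z = real (ht z)" by (simp add: hg_def ht)
lemma hg_scale: "hg (of_nat k *\<^sub>C z) = real k * hg z" by (simp add: hg_def ip.scalel scaleC_complex_def)

lemma tame_cone:
  assumes "finite \<Theta>" "\<And>\<theta>. G \<theta> \<noteq> 0 \<Longrightarrow> \<exists>\<eta>\<in>\<Theta>. \<exists>\<beta>\<in>Q_plus K. \<theta> = \<eta> - pl \<beta>"
  shows "tame G"
  unfolding tame_def
proof
  fix c :: real
  have "{\<theta>. G \<theta> \<noteq> 0 \<and> c \<le> hg \<theta>} \<subseteq> (\<Union>\<eta>\<in>\<Theta>. (\<lambda>\<beta>. \<eta> - pl \<beta>) ` {\<beta> \<in> Q_plus K. ht \<beta> \<le> nat \<lceil>hg \<eta> - c\<rceil>})"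
  proof
    fix \<theta> assume "\<theta> \<in> {\<theta>. G \<theta> \<noteq> 0 \<and> c \<le> hg \<theta>}"
    then have t: "G \<theta> \<noteq> 0" "c \<le> hg \<theta>" by auto
    obtain \<eta> \<beta> where e: "\<eta> \<in> \<Theta>" "\<beta> \<in> Q_plus K" "\<theta> = \<eta> - pl \<beta>" using assms(2)[OF t(1)] by blast
    then have "real (ht \<beta>) \<le> hg \<eta> - c" using t(2) by (simp add: hgt_diff hg_pl hg_Q)
    then have "ht \<beta> \<le> nat \<lceil>hg \<eta> - c\<rceil>" by linarith
    with e show "\<theta> \<in> (\<Union>\<eta>\<in>\<Theta>. (\<lambda>\<beta>. \<eta> - pl \<beta>) ` {\<beta> \<in> Q_plus K. ht \<beta> \<le> nat \<lceil>hg \<eta> - c\<rceil>})" by auto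
  qed
  then show "finite {\<theta>. G \<theta> \<noteq> 0 \<and> c \<le> hg \<theta>}"
    by (rule finite_subset) (intro finite_UN_I finite_imageI Q_ht_finite assms(1))
qed

lemma tame_partial: "tame G \<Longrightarrow> tame (partial K p G)"
  by (erule tame_subset) (auto simp: partial_def)

lemma l_norm: "y \<in> l_space K \<Longrightarrow> ip z y = (\<Sum>j\<in>I1. ip z (x j) * ip y (x j))"
proof -
  assume "y \<in> l_space K"
  then have "ip z y = ip z (pl y)" by (simp add: pl_id)
  also have "\<dots> = (\<Sum>j\<in>I1. ip z (x j) * ip y (x j))"
    unfolding pl_def by (simp add: ip.sumr ip.scaler scaleC_complex_def mult.commute)
  finally show ?thesis .
qed

definition eA :: "'g \<Rightarrow> 'g \<times> nat \<times> nat \<Rightarrow> 'w::complex_vec \<Rightarrow> 'w" where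
  "eA p = (\<lambda>(\<alpha>, t, v) w. if \<alpha> \<in> pos_roots K \<and> t \<in> {1..root_mult K \<alpha>} \<and> v \<ge> 1
    then (ip ((Bi ^^ v) (eb \<alpha> t)) (fb \<alpha> t) * ip \<alpha> p) *\<^sub>C w else 0)"

definition eg :: "'g \<times> nat \<times> nat \<Rightarrow> 'g" where "eg = (\<lambda>(\<alpha>, t, v). of_nat v *\<^sub>C pl \<alpha>)"

definition sA :: "('g \<Rightarrow> 'w \<Rightarrow> 'w) \<Rightarrow> 'g \<times> nat \<times> nat \<times> nat \<Rightarrow> 'w::complex_vec \<Rightarrow> 'w" where
  "sA wa = (\<lambda>(\<alpha>, t, s, v) w. if \<alpha> \<in> pos_roots K \<and> t \<in> {1..root_mult K \<alpha>} \<and> v \<ge> 1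
    then wa ((B ^^ s) (fb \<alpha> t)) (wa ((Bi ^^ v) (eb \<alpha> t)) w) + wa ((Bi ^^ v) (eb \<alpha> t)) (wa ((B ^^ s) (fb \<alpha> t)) w) else 0)"

definition sg :: "'g \<times> nat \<times> nat \<times> nat \<Rightarrow> 'g" where "sg = (\<lambda>(\<alpha>, t, s, v). of_nat (s + v) *\<^sub>C pl \<alpha>)"

lemma eA_lin: "clinear (eA p k :: 'w::complex_vec \<Rightarrow> 'w)"
proof (cases k)
  case (fields \<alpha> t v)
  show ?thesis
  proof (cases "\<alpha> \<in> pos_roots K \<and> t \<in> {1..root_mult K \<alpha>} \<and> v \<ge> 1")
    case False
    then have "eA p k = (\<lambda>w :: 'w. 0)" by (auto simp: fields eA_def)
    then show ?thesis by (simp add: clinear_zero_fun)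
  qed (simp add: fields eA_def lin_l)
qed

lemma sA_lin: "(\<And>u. clinear (wa u)) \<Longrightarrow> clinear (sA wa k :: 'w::complex_vec \<Rightarrow> 'w)"
proof (cases k)
  case (fields \<alpha> t s v)
  assume wa: "\<And>u. clinear (wa u)"
  show ?thesis
  proof (cases "\<alpha> \<in> pos_roots K \<and> t \<in> {1..root_mult K \<alpha>} \<and> v \<ge> 1")
    case False
    then have "sA wa k = (\<lambda>w :: 'w. 0)" by (auto simp: fields sA_def)
    then show ?thesis by (simp add: clinear_zero_fun)
  qed (simp add: fields sA_def clinear_add_fun[OF clinear_compose[OF wa wa] clinear_compose[OF wa wa]])
qed

text \<open>For v \<ge> 1 the height of (s + v)\<alpha> is at least s + v and at least the height of
  \<alpha>, so a bound on it leaves finitely many index tuples.\<close>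

lemma sg_fin: "finite {(\<alpha>, t, s, v). \<alpha> \<in> pos_roots K \<and> t \<in> {1..root_mult K \<alpha>} \<and> v \<ge> 1 \<and> hg (sg (\<alpha>, t, s, v)) \<le> c}"
    (is "finite ?X")
proof -
  let ?n = "nat \<lceil>c\<rceil>"
  have "?X \<subseteq> Sigma (R ?n) (\<lambda>\<alpha>. {1..root_mult K \<alpha>} \<times> {..?n} \<times> {1..?n})"
  proof
    fix k assume k: "k \<in> ?X"
    obtain \<alpha> t s v where kk: "k = (\<alpha>, t, s, v)" by (cases k)
    with k have m: "\<alpha> \<in> pos_roots K" "t \<in> {1..root_mult K \<alpha>}" "v \<ge> 1" by auto
    have "hg (of_nat (s + v) *\<^sub>C pl \<alpha>) \<le> c" using k by (simp add: kk sg_def)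
    then have le: "real ((s + v) * ht \<alpha>) \<le> c" unfolding hg_scale hg_pl hg_Q[OF pos_roots_Q[OF m(1)]] by simp
    have "(s + v) * 1 \<le> (s + v) * ht \<alpha>" "1 * ht \<alpha> \<le> (s + v) * ht \<alpha>" using ht_pos[OF m(1)] m(3) by (intro mult_le_mono; simp)+
    then have "real (s + v) \<le> c" "real (ht \<alpha>) \<le> c" using le by (metis mult_1 mult_1_right of_nat_le_iff order_trans)+
    then have "s + v \<le> ?n" "ht \<alpha> \<le> ?n" by linarith+
    with m show "k \<in> Sigma (R ?n) (\<lambda>\<alpha>. {1..root_mult K \<alpha>} \<times> {..?n} \<times> {1..?n})" by (simp add: kk R_def)
  qed
  then show ?thesis by (rule finite_subset) (auto intro!: finite_SigmaI R_finite)
qed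

lemma sg_loc_fin:
  assumes "\<And>\<alpha> t s v. \<not> (\<alpha> \<in> pos_roots K \<and> t \<in> {1..root_mult K \<alpha>} \<and> v \<ge> 1) \<Longrightarrow> A (\<alpha>, t, s, v) = (\<lambda>_. 0)"
  shows "loc_fin A sg"
  unfolding loc_fin_def by (intro allI finite_subset[OF _ sg_fin]) (use assms in blast)

lemma sA_loc_fin: "loc_fin (sA wa) sg"
  by (rule sg_loc_fin) (auto simp: sA_def)

lemma eA_loc_fin: "loc_fin (eA p) eg"
  unfolding loc_fin_def
proof
  fix c :: real
  let ?i = "\<lambda>(\<alpha>, t, v). (\<alpha>, t, 0, v) :: 'g \<times> nat \<times> nat \<times> nat"
  have "?i ` {k. eA p k \<noteq> (\<lambda>_. 0) \<and> hg (eg k) \<le> c} \<subseteq>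
    {(\<alpha>, t, s, v). \<alpha> \<in> pos_roots K \<and> t \<in> {1..root_mult K \<alpha>} \<and> v \<ge> 1 \<and> hg (sg (\<alpha>, t, s, v)) \<le> c}"
    by (auto simp: eA_def eg_def sg_def split: if_splits)
  then have "finite (?i ` {k. eA p k \<noteq> (\<lambda>_. 0) \<and> hg (eg k) \<le> c})" by (rule finite_subset[OF _ sg_fin])
  then show "finite {k. eA p k \<noteq> (\<lambda>_. 0) \<and> hg (eg k) \<le> c}" by (rule finite_imageD) (auto simp: inj_on_def)
qed

text \<open>
  \<open>Eop \<rho> p\<close> will turn out to be the multiplication by the derivative of \<open>ln delta_B\<close> in the direction of
  \<open>p\<close>, and \<open>Sop\<close> is the sum of the operators \<open>S_T\<close> over all pairs of tensor factors.
\<close>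

definition Eop :: "'g \<Rightarrow> 'g \<Rightarrow> ('g \<Rightarrow> 'w::complex_vec) \<Rightarrow> 'g \<Rightarrow> 'w" where
  "Eop \<rho> p G = ip \<rho> p *\<^sub>C G + Op (eA p) eg G"

definition Sop :: "('g \<Rightarrow> 'w \<Rightarrow> 'w) \<Rightarrow> ('g \<Rightarrow> 'w::complex_vec) \<Rightarrow> 'g \<Rightarrow> 'w" where
  "Sop wa G = Op (sA wa) sg G - (\<lambda>\<theta>. \<Sum>j\<in>I2. wa ((1/2) *\<^sub>C (x j - cayley K (x j))) (wa ((1/2) *\<^sub>C (x j - cayley K (x j))) (G \<theta>)))"

lemma Eop_tame: "tame G \<Longrightarrow> tame (Eop \<rho> p G)"
  unfolding Eop_def by (intro tame_add tame_scale Op_tame eA_loc_fin eA_lin)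

lemma Eop_add: "tame G \<Longrightarrow> tame G' \<Longrightarrow> Eop \<rho> p (G + G') = Eop \<rho> p G + Eop \<rho> p G'"
  unfolding Eop_def by (simp add: Op_add[OF _ _ eA_loc_fin eA_lin] scaleC_add_right)

lemma Eop_scale: "tame G \<Longrightarrow> Eop \<rho> p (c *\<^sub>C G) = c *\<^sub>C Eop \<rho> p G"
  unfolding Eop_def by (simp add: Op_scale[OF _ eA_loc_fin eA_lin] scaleC_add_right scaleC_scaleC mult.commute)

text \<open>\<open>Eop\<close> acts on values only by scalars, that is, it is multiplication by a
  scalar series and can be moved to the scalar factor. This is what lets \<open>Dp_partial\<close>
  act on a product.\<close>

lemma Eop_mult_left:
  assumes "tame a" "tame G"
  shows "Eop \<rho> p (series_mult a G) = series_mult (Eop \<rho> p a) G"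
proof -
  have "Op (eA p) eg (series_mult a G) = series_mult (Op (eA p) eg a) G"
    by (rule series_mult_Op_left[OF assms eA_loc_fin eA_lin eA_loc_fin eA_lin])
      (auto simp: eA_def scaleC_scaleC scaleC_complex_def)
  then show ?thesis using assms unfolding Eop_def
    by (simp add: series_mult_add_l[OF tame_scale Op_tame[OF _ eA_loc_fin eA_lin]] series_mult_scale_l)
qed

lemma Sop_tame:
  assumes "tame G" and lin: "\<And>u. clinear (wa u)"
  shows "tame (Sop wa G)"
  unfolding Sop_def
  by (intro tame_diff Op_tame sA_loc_fin sA_lin assms, rule tame_subset[OF assms(1)])
    (auto simp: clinear_zero[OF lin] intro: ccontr)

lemma Sop_mult:
  assumes a: "tame a" and G: "tame G" and lin: "\<And>u. clinear (wa u)"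
  shows "Sop wa (series_mult a G) = series_mult a (Sop wa G)"
proof -
  let ?T = "\<lambda>w. \<Sum>j\<in>I2. wa ((1/2) *\<^sub>C (x j - cayley K (x j))) (wa ((1/2) *\<^sub>C (x j - cayley K (x j))) w)"
  have T: "clinear ?T" by (intro clinear_sum_fun clinear_compose[OF lin lin])
  have "(\<lambda>\<theta>. ?T (series_mult a G \<theta>)) = series_mult a (\<lambda>\<theta>. ?T (G \<theta>))"
    using clinear_Sum_any[OF T series_mult_fin[OF a G]] clinear_scale[OF T] by (simp add: series_mult_def fun_eq_iff)
  moreover have "tame (\<lambda>\<theta>. ?T (G \<theta>))" by (rule tame_subset[OF G]) (use clinear_zero[OF T] in auto)
  ultimately show ?thesis unfolding Sop_def
    by (simp add: series_mult_Op_right[OF a G sA_loc_fin sA_lin[OF lin]] series_mult_diff[OF a Op_tame[OF G sA_loc_fin sA_lin[OF lin]]])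
qed

end

context twisted begin

lemma Sl_cone: "b \<in> Sl \<theta> \<Longrightarrow> \<exists>\<beta>\<in>Q_plus K. \<theta> = pl mu' - pl \<beta>"
proof
  assume b: "b \<in> Sl \<theta>"
  show "mu' - tgt.wt b \<in> Q_plus K" by (rule tgt.wt_Q[OF Sl_S[OF b]])
  show "\<theta> = pl mu' - pl (mu' - tgt.wt b)" using b by (simp add: Sl_def clinear_diff[OF pl_lin])
qed

lemma Sl_shift_empty:
  assumes "\<alpha> \<in> pos_roots K" "k * ht \<alpha> \<ge> bound \<theta>" shows "Sl (sh \<theta> k \<alpha>) = {}"
proof (rule Sl_empty)
  show "ip (of_nat k *\<^sub>C pl \<alpha>) d = of_nat (k * ht \<alpha>)"
    using ip_pl[OF d_l] ht[OF pos_roots_Q[OF assms(1)]] by (simp add: ip.scalel scaleC_complex_def)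
qed (rule assms(2))

end

context twisted_trace begin

lemma F_0: "Sl \<theta> = {} \<Longrightarrow> F \<theta> = 0" by (simp add: F_def tt_empty)

lemma F_l: "F \<theta> \<noteq> 0 \<Longrightarrow> \<theta> \<in> l_space K" using F_0 Sl_l by fastforce

lemma F_cone: "F \<theta> \<noteq> 0 \<Longrightarrow> \<exists>\<beta>\<in>Q_plus K. \<theta> = pl mu' - pl \<beta>" using F_0 Sl_cone by fastforce

lemma F_tame: "tame F" by (rule tame_cone[of "{pl mu'}"]) (use F_cone in auto)

lemma F_shift_0:
  assumes "\<alpha> \<in> pos_roots K" "k \<ge> 1" "k \<ge> bound \<theta> \<or> ht \<alpha> \<ge> bound \<theta>"
  shows "F (sh \<theta> k \<alpha>) = 0"
proof (rule F_0[OF Sl_shift_empty[OF assms(1)]])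
  have "k * 1 \<le> k * ht \<alpha>" "1 * ht \<alpha> \<le> k * ht \<alpha>" using ht_pos[OF assms(1)] assms(2) by (intro mult_le_mono; simp)+
  then show "bound \<theta> \<le> k * ht \<alpha>" using assms(3) by linarith
qed

text \<open>Coefficientwise restatement of \<open>trace_identity\<close>: at \<theta> the truncation
  \<open>bound \<theta>\<close> already captures every nonzero term of the infinite sums, and the
  factors (\<alpha>, \<theta> + v\<alpha>) are expanded into partial derivatives.\<close>

lemma operator_identity:
  assumes rho: "is_rho K \<rho>"
  shows "(\<Sum>j\<in>I1. partial K (x j) (partial K (x j) F)) + 2 *\<^sub>C (\<Sum>j\<in>I1. Eop \<rho> (x j) (partial K (x j) F)) - Sop wa F
    = (ip mu mu + 2 * ip \<rho> mu) *\<^sub>C F"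
proof
  fix \<theta>
  define n where "n = bound \<theta>"
  let ?G = "\<lambda>v \<alpha>. F (sh \<theta> v \<alpha>)"
  have E: "Op (eA (x j)) eg (partial K (x j) F) \<theta> =
    (\<Sum>v\<in>{1..n}. \<Sum>(\<alpha>, t)\<in>IX n. (kk v \<alpha> t * (ip \<alpha> (x j) * ip (sh \<theta> v \<alpha>) (x j))) *\<^sub>C ?G v \<alpha>)" for j
  proof -
    let ?g = "\<lambda>(\<alpha>, t, v). eA (x j) (\<alpha>, t, v) (partial K (x j) F (\<theta> + eg (\<alpha>, t, v)))"
    have "Sum_any ?g = sum ?g (Sigma (R n) (\<lambda>\<alpha>. {1..root_mult K \<alpha>} \<times> {1..n}))"
    proof (rule Sum_any_eq_sum)
      show "finite (Sigma (R n) (\<lambda>\<alpha>. {1..root_mult K \<alpha>} \<times> {1..n}))" by (auto intro!: finite_SigmaI R_finite)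
      fix a assume a: "a \<notin> Sigma (R n) (\<lambda>\<alpha>. {1..root_mult K \<alpha>} \<times> {1..n})"
      obtain \<alpha> t v where e: "a = (\<alpha>, t, v)" by (cases a)
      show "?g a = 0"
      proof (cases "\<alpha> \<in> pos_roots K \<and> t \<in> {1..root_mult K \<alpha>} \<and> v \<ge> 1")
        case True
        then have "?G v \<alpha> = 0" using a by (intro F_shift_0) (auto simp: e R_def n_def)
        then show ?thesis using clinear_zero[OF eA_lin] by (simp add: e eg_def partial_def)
      qed (auto simp: e eA_def)
    qed
    also have "\<dots> = (\<Sum>\<alpha>\<in>R n. \<Sum>t\<in>{1..root_mult K \<alpha>}. \<Sum>v\<in>{1..n}. ?g (\<alpha>, t, v))"
      by (rule sum_Sigma3[OF R_finite]) auto
    also have "\<dots> = (\<Sum>\<alpha>\<in>R n. \<Sum>t\<in>{1..root_mult K \<alpha>}. \<Sum>v\<in>{1..n}. (kk v \<alpha> t * (ip \<alpha> (x j) * ip (sh \<theta> v \<alpha>) (x j))) *\<^sub>C ?G v \<alpha>)"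
      by (intro sum.cong refl) (simp add: eA_def eg_def partial_def R_def scaleC_scaleC mult.assoc)
    also have "\<dots> = (\<Sum>(\<alpha>, t)\<in>IX n. \<Sum>v\<in>{1..n}. (kk v \<alpha> t * (ip \<alpha> (x j) * ip (sh \<theta> v \<alpha>) (x j))) *\<^sub>C ?G v \<alpha>)"
      unfolding IX_def by (rule sum.Sigma[OF R_finite]) simp
    finally show ?thesis unfolding Op_def by (simp add: case_prod_unfold sum.swap[of _ "IX n"])
  qed
  have "(\<Sum>j\<in>I1. Eop \<rho> (x j) (partial K (x j) F)) \<theta> =
    (\<Sum>j\<in>I1. (ip \<rho> (x j) * ip \<theta> (x j)) *\<^sub>C F \<theta>)
    + (\<Sum>j\<in>I1. \<Sum>v\<in>{1..n}. \<Sum>(\<alpha>, t)\<in>IX n. (kk v \<alpha> t * (ip \<alpha> (x j) * ip (sh \<theta> v \<alpha>) (x j))) *\<^sub>C ?G v \<alpha>)"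
    by (simp add: Eop_def scaleC_fun_def fun_cong[OF partial_def, of _ _ _ \<theta>] scaleC_scaleC E sum.distrib sum_fun_apply)
  also have "(\<Sum>j\<in>I1. (ip \<rho> (x j) * ip \<theta> (x j)) *\<^sub>C F \<theta>) = ip \<theta> \<rho> *\<^sub>C F \<theta>"
    unfolding cvec.scale_sum_left[symmetric] using l_norm[OF rho_l[OF rho], of \<theta>] by (simp add: mult.commute)
  also have "(\<Sum>j\<in>I1. \<Sum>v\<in>{1..n}. \<Sum>(\<alpha>, t)\<in>IX n. (kk v \<alpha> t * (ip \<alpha> (x j) * ip (sh \<theta> v \<alpha>) (x j))) *\<^sub>C ?G v \<alpha>)
    = (\<Sum>v\<in>{1..n}. \<Sum>p\<in>IX n. \<Sum>j\<in>I1. (kk v (fst p) (snd p) * (ip (fst p) (x j) * ip (\<theta> + of_nat v *\<^sub>C pl (fst p)) (x j))) *\<^sub>C ?G v (fst p))"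
    unfolding case_prod_unfold by (subst sum.swap) (intro sum.cong refl sum.swap)
  also have "\<dots> = (\<Sum>v\<in>{1..n}. \<Sum>p\<in>IX n. (kk v (fst p) (snd p) * ip (fst p) (\<theta> + of_nat v *\<^sub>C pl (fst p))) *\<^sub>C ?G v (fst p))"
  proof (intro sum.cong refl)
    fix v p
    show "(\<Sum>j\<in>I1. (kk v (fst p) (snd p) * (ip (fst p) (x j) * ip (\<theta> + of_nat v *\<^sub>C pl (fst p)) (x j))) *\<^sub>C ?G v (fst p))
      = (kk v (fst p) (snd p) * ip (fst p) (\<theta> + of_nat v *\<^sub>C pl (fst p))) *\<^sub>C ?G v (fst p)"
    \<comment> \<open>A nonzero coefficient has its exponent in \<open>l_space K\<close>, and only
      there do the basis vectors indexed by \<open>I1\<close> suffice to expand the pairing.\<close>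
    proof (cases "?G v (fst p) = 0")
      case False
      from l_norm[OF F_l[OF this], of "fst p"] show ?thesis
        by (simp only: cvec.scale_sum_left[symmetric] sum_distrib_left[symmetric])
    qed simp
  qed
  also have "\<dots> = (\<Sum>v\<in>{1..n}. \<Sum>(\<alpha>, t)\<in>IX n. (kk v \<alpha> t * ip \<alpha> (sh \<theta> v \<alpha>)) *\<^sub>C ?G v \<alpha>)"
    unfolding case_prod_unfold ..
  finally have 1: "(\<Sum>j\<in>I1. Eop \<rho> (x j) (partial K (x j) F)) \<theta> = ip \<theta> \<rho> *\<^sub>C F \<theta>
    + (\<Sum>v\<in>{1..n}. \<Sum>(\<alpha>, t)\<in>IX n. (kk v \<alpha> t * ip \<alpha> (sh \<theta> v \<alpha>)) *\<^sub>C ?G v \<alpha>)" .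
  have 2: "Op (sA wa) sg F \<theta> = (\<Sum>(\<alpha>, t)\<in>IX n. \<Sum>v\<in>{1..n}. \<Sum>s<n.
        wa ((B ^^ s) (fb \<alpha> t)) (wa ((Bi ^^ v) (eb \<alpha> t)) (?G (s + v) \<alpha>))
      + wa ((Bi ^^ v) (eb \<alpha> t)) (wa ((B ^^ s) (fb \<alpha> t)) (?G (s + v) \<alpha>)))"
  proof -
    let ?g = "\<lambda>(\<alpha>, t, s, v). sA wa (\<alpha>, t, s, v) (F (\<theta> + sg (\<alpha>, t, s, v)))"
    let ?S = "\<lambda>\<alpha> t s v. wa ((B ^^ s) (fb \<alpha> t)) (wa ((Bi ^^ v) (eb \<alpha> t)) (?G (s + v) \<alpha>))
      + wa ((Bi ^^ v) (eb \<alpha> t)) (wa ((B ^^ s) (fb \<alpha> t)) (?G (s + v) \<alpha>))"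
    have "Sum_any ?g = sum ?g (Sigma (R n) (\<lambda>\<alpha>. {1..root_mult K \<alpha>} \<times> {..<n} \<times> {1..n}))"
    proof (rule Sum_any_eq_sum)
      show "finite (Sigma (R n) (\<lambda>\<alpha>. {1..root_mult K \<alpha>} \<times> {..<n} \<times> {1..n}))" by (auto intro!: finite_SigmaI R_finite)
      fix a assume a: "a \<notin> Sigma (R n) (\<lambda>\<alpha>. {1..root_mult K \<alpha>} \<times> {..<n} \<times> {1..n})"
      obtain \<alpha> t s v where e: "a = (\<alpha>, t, s, v)" by (cases a)
      show "?g a = 0"
      proof (cases "\<alpha> \<in> pos_roots K \<and> t \<in> {1..root_mult K \<alpha>} \<and> v \<ge> 1")
        case True
        then have "?G (s + v) \<alpha> = 0" using a by (intro F_shift_0) (auto simp: e R_def n_def)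
        then show ?thesis using clinear_zero[OF sA_lin[OF wa_lin]] by (simp add: e sg_def del: of_nat_add)
      qed (auto simp: e sA_def)
    qed
    also have "\<dots> = (\<Sum>\<alpha>\<in>R n. \<Sum>t\<in>{1..root_mult K \<alpha>}. \<Sum>s<n. \<Sum>v\<in>{1..n}. ?g (\<alpha>, t, s, v))"
      by (subst sum_Sigma3[OF R_finite]) (auto simp: sum.cartesian_product case_prod_unfold)
    also have "\<dots> = (\<Sum>\<alpha>\<in>R n. \<Sum>t\<in>{1..root_mult K \<alpha>}. \<Sum>s<n. \<Sum>v\<in>{1..n}. ?S \<alpha> t s v)"
      by (intro sum.cong refl) (simp add: sA_def sg_def R_def del: of_nat_add)
    also have "\<dots> = (\<Sum>(\<alpha>, t)\<in>IX n. \<Sum>s<n. \<Sum>v\<in>{1..n}. ?S \<alpha> t s v)"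
      unfolding IX_def by (rule sum.Sigma[OF R_finite]) simp
    also have "\<dots> = (\<Sum>(\<alpha>, t)\<in>IX n. \<Sum>v\<in>{1..n}. \<Sum>s<n. ?S \<alpha> t s v)"
      unfolding case_prod_unfold by (rule sum.cong[OF refl sum.swap])
    finally show ?thesis unfolding Op_def by (simp add: case_prod_unfold)
  qed
  have 3: "(\<Sum>j\<in>I1. partial K (x j) (partial K (x j) F)) \<theta> = (\<Sum>j\<in>I1. (ip \<theta> (x j) * ip \<theta> (x j)) *\<^sub>C F \<theta>)"
    by (simp add: partial_def scaleC_scaleC sum_fun_apply)
  have "((\<Sum>j\<in>I1. partial K (x j) (partial K (x j) F)) + 2 *\<^sub>C (\<Sum>j\<in>I1. Eop \<rho> (x j) (partial K (x j) F)) - Sop wa F) \<theta>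
    = (\<Sum>j\<in>I1. partial K (x j) (partial K (x j) F)) \<theta> + 2 *\<^sub>C (\<Sum>j\<in>I1. Eop \<rho> (x j) (partial K (x j) F)) \<theta> - Sop wa F \<theta>"
    by (simp only: minus_apply plus_fun_apply scaleC_fun_def)
  also have "\<dots> = (ip mu mu + 2 * ip \<rho> mu) *\<^sub>C F \<theta>"
    unfolding 1 3 trace_identity[OF rho order_refl, of \<theta>, folded n_def] Sop_def minus_apply 2
    by (simp add: scaleC_add_right scaleC_scaleC algebra_simps)
  finally show "((\<Sum>j\<in>I1. partial K (x j) (partial K (x j) F)) + 2 *\<^sub>C (\<Sum>j\<in>I1. Eop \<rho> (x j) (partial K (x j) F)) - Sop wa F) \<theta>
    = ((ip mu mu + 2 * ip \<rho> mu) *\<^sub>C F) \<theta>" by (simp add: scaleC_fun_def)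
qed

end

section \<open>The leading block, and the link with \<open>trace_series\<close>\<close>

context twisted begin

text \<open>Only multiples of the highest weight vector have depth 0. Therefore the trace without
  intertwiners has leading coefficient 1 and can be inverted.\<close>

lemma vac_Sl:
  obtains b0 c where "Sl (pl mu') = {b0}" "b0 = c *\<^sub>C vac'" "c \<noteq> 0"
proof -
  have one: "\<exists>c. c \<noteq> 0 \<and> b = c *\<^sub>C vac'" if b: "b \<in> Sl (pl mu')" for b
  proof -
    have "pl (mu' - tgt.wt b) = 0" using b by (simp add: Sl_def clinear_diff[OF pl_lin])
    moreover have Q: "mu' - tgt.wt b \<in> Q_plus K" by (rule tgt.wt_Q[OF Sl_S[OF b]])
    ultimately have "ip (mu' - tgt.wt b) d = 0" using ip_pl[OF d_l, of "mu' - tgt.wt b"] by (simp add: ip.zerol)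
    then have "mu' - tgt.wt b = 0" using Q_ht_0[OF Q] ht[OF Q] by simp
    then have "act' h b = ip mu' h *\<^sub>C b" if "h \<in> H" for h using tgt.h_basis[OF Sl_S[OF b] that] by simp
    then have "b \<in> cvec.span {t \<in> range tgt.fw. \<forall>h\<in>H. act' h t = ip mu' h *\<^sub>C t}"
      by (intro tgt.eigen_fw) auto
    moreover have "{t \<in> range tgt.fw. \<forall>h\<in>H. act' h t = ip mu' h *\<^sub>C t} \<subseteq> cvec.span {vac'}"
    proof
      fix t assume "t \<in> {t \<in> range tgt.fw. \<forall>h\<in>H. act' h t = ip mu' h *\<^sub>C t}"
      then obtain w where w: "t = tgt.fw w" "act' d t = ip mu' d *\<^sub>C t" using d_in by auto
      show "t \<in> cvec.span {vac'}"
      proof (cases "t = 0 \<or> w = []")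
        case True
        then show ?thesis using w(1) by (auto intro: cvec.span_base cvec.span_zero)
      next
        case False
        then have "ip mu' d - of_nat (length w) = ip mu' d" using w tgt.d_fw[of w] by (auto simp: cvec.scale_cancel_right)
        then show ?thesis using False by simp
      qed
    qed
    ultimately have "b \<in> cvec.span {vac'}" using cvec.span_minimal[OF _ cvec.subspace_span] by blast
    then obtain c where "b = c *\<^sub>C vac'" by (auto simp: cvec.span_singleton)
    with tgt.S_nz[OF Sl_S[OF b]] show ?thesis by auto
  qed
  have "{b. tgt.co b vac' \<noteq> 0} \<noteq> {}"
    using tgt.co_sum[of "{}" vac'] tgt.vac_nz by auto
  then obtain b0 where b0: "tgt.co b0 vac' \<noteq> 0" by auto
  have b0S: "b0 \<in> Sl (pl mu')"
  proof (rule SlI[OF tgt.co_in[OF b0] pl_l])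
    fix z assume z: "z \<in> l_space K"
    show "ip (tgt.wt b0) z = ip (pl mu') z"
      unfolding ip_pl[OF z] by (rule tgt.co_eigen[OF _ tgt.vac_h b0]) (use l_H z in auto)
  qed
  obtain c0 where c0: "c0 \<noteq> 0" "b0 = c0 *\<^sub>C vac'" using one[OF b0S] by auto
  have "b = b0" if b: "b \<in> Sl (pl mu')" for b
  proof -
    obtain c where c: "c \<noteq> 0" "b = c *\<^sub>C vac'" using one[OF b] by auto
    then have "b = (c / c0) *\<^sub>C b0" using c0 by (simp add: scaleC_scaleC)
    then have "tgt.co b0 b = c / c0"
      using tgt.co_basis[OF Sl_S[OF b0S], of b0] by (simp add: clinear_scale[OF tgt.co_lin] scaleC_complex_def)
    then show ?thesis using tgt.co_basis[OF Sl_S[OF b], of b0] c(1) c0(1) by (auto split: if_splits)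
  qed
  with b0S have "Sl (pl mu') = {b0}" by blast
  then show thesis using c0 that by blast
qed

lemma trace_diagonal:
  assumes "S = (SOME S. weight_basis K act' S)"
  shows "trace_series K act' diag \<theta> = (\<Sum>b\<in>Sl \<theta>. diag (tgt.co b) b)"
proof -
  have "{b \<in> S. \<exists>\<kappa>\<in>H. b \<in> weight_space K act' \<kappa> \<and> l_proj K \<kappa> = \<theta>} = Sl \<theta>"
    unfolding Sl_def l_proj_pl using tgt.wt tgt.wt_eq by blast
  then show ?thesis unfolding trace_series_def Let_def assms[symmetric] tgt.co_def by simp
qed

end

lemma (in twisted_trace) trace_series_F:
  assumes "S = (SOME S. weight_basis K act' S)"
  shows "trace_series K act' (\<lambda>\<eta> b. Y \<eta> (vB b)) = F"
  by (rule ext) (simp add: trace_diagonal[OF assms] F_def tt_def)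

section \<open>The trace without intertwiners and its logarithmic derivative\<close>

locale bd_family = bd K B Bi eb fb I1 I2 x
  for K :: "('g::complex_vec, 'i::finite, 'z) bd_algebra_scheme" and B Bi eb fb I1 I2 x +
  fixes M :: "'g \<Rightarrow> 'g \<Rightarrow> 'm \<Rightarrow> 'm::complex_vec" and vc :: "'g \<Rightarrow> 'm" and \<rho> :: 'g
  assumes vf: "verma_family K M vc" and rho: "is_rho K \<rho>"
begin

text \<open>The same choice of a weight basis as in \<open>trace_series\<close>, which makes the
  comparison with the block sums an unfolding.\<close>

definition bs :: "'g \<Rightarrow> 'm set" where "bs \<omega> = (SOME S. weight_basis K (M \<omega>) S)"

lemma verma_M: assumes "\<omega> \<in> H" shows "verma K \<omega> (M \<omega>) (vc \<omega>)"
  using vf assms by unfold_locales (simp_all add: verma_family_def)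

lemma basis_M: assumes "\<omega> \<in> H" shows "verma_basis K \<omega> (M \<omega>) (vc \<omega>) (bs \<omega>)"
proof -
  interpret verma K \<omega> "M \<omega>" "vc \<omega>" by (rule verma_M[OF assms])
  show ?thesis by unfold_locales (use weight_basis_exists in \<open>simp add: bs_def someI_ex\<close>)
qed

text \<open>\<open>Dp 0\<close> is the inverse of \<open>delta_B\<close>; the other \<open>Dp p\<close> serve to differentiate it.\<close>

definition Dp :: "'g \<Rightarrow> 'g \<Rightarrow> complex"
  where "Dp p = trace_series K (M (p - \<rho>)) (\<lambda>\<eta> b. \<eta> (verma_B K B M vc (p - \<rho>) (p - \<rho>) b))"

text \<open>Here both highest weights are \<open>p - \<rho>\<close>. The required condition on them
  is that \<open>p - \<rho>\<close> lies in \<open>l_space K\<close>, which restricts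
  \<open>p\<close> to that space.\<close>

lemma scalar_trace:
  assumes p: "p \<in> l_space K"
  shows "twisted_trace K B Bi eb fb I1 I2 x (p - \<rho>) (M (p - \<rho>)) (vc (p - \<rho>)) (p - \<rho>) (M (p - \<rho>)) (vc (p - \<rho>)) (bs (p - \<rho>))
    (\<lambda>\<eta> m. \<eta> m) (\<lambda>_ _. 0 :: complex) UNIV"
proof -
  have pr: "p - \<rho> \<in> l_space K" by (rule cvec.subspace_diff[OF subspace_l p rho_l[OF rho]])
  interpret verma_basis K "p - \<rho>" "M (p - \<rho>)" "vc (p - \<rho>)" "bs (p - \<rho>)" by (rule basis_M[OF l_H[OF pr]])
  show ?thesis
  proof unfold_locales
    fix i assume "i \<in> Gam1 K"
    with l_al[OF pr this] show "ip (p - \<rho>) (al i) = ip (p - \<rho>) (al (\<tau> i))" by (simp add: ip_sym[of "p - \<rho>"])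
  qed (simp_all add: scaleC_complex_def clinear_zero_fun clinear_add clinear_scale)
qed

lemma Dp_F:
  assumes p: "p \<in> l_space K"
  shows "Dp p = twisted_trace.F K B I1 x (M (p - \<rho>)) (vc (p - \<rho>)) (M (p - \<rho>)) (vc (p - \<rho>)) (bs (p - \<rho>)) (\<lambda>\<eta> m. \<eta> m)"
proof -
  interpret A: twisted_trace K B Bi eb fb I1 I2 x "p - \<rho>" "M (p - \<rho>)" "vc (p - \<rho>)" "p - \<rho>" "M (p - \<rho>)" "vc (p - \<rho>)" "bs (p - \<rho>)"
    "\<lambda>\<eta> m. \<eta> m" "\<lambda>_ _. 0 :: complex" UNIV by (rule scalar_trace[OF p])
  show ?thesis unfolding Dp_def A.verma_B_eq[where M = M and vc = vc, OF refl refl refl refl] by (rule A.trace_series_F[OF bs_def])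
qed

text \<open>The shift by \<rho> completes the square in the Casimir eigenvalue, so that its
  dependence on \<open>p\<close> is exactly (p, p).\<close>

lemma Dp_identity:
  assumes p: "p \<in> l_space K"
  shows "(\<Sum>j\<in>I1. partial K (x j) (partial K (x j) (Dp p))) + 2 *\<^sub>C (\<Sum>j\<in>I1. Eop \<rho> (x j) (partial K (x j) (Dp p)))
    = (ip p p - ip \<rho> \<rho>) *\<^sub>C Dp p"
proof -
  interpret A: twisted_trace K B Bi eb fb I1 I2 x "p - \<rho>" "M (p - \<rho>)" "vc (p - \<rho>)" "p - \<rho>" "M (p - \<rho>)" "vc (p - \<rho>)" "bs (p - \<rho>)"
    "\<lambda>\<eta> m. \<eta> m" "\<lambda>_ _. 0 :: complex" UNIV by (rule scalar_trace[OF p])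
  have "Sop (\<lambda>_ _. 0) (Dp p) = 0"
    by (rule ext) (simp add: Sop_def Op_def sA_def case_prod_unfold cong: if_cong)
  moreover have "ip (p - \<rho>) (p - \<rho>) + 2 * ip \<rho> (p - \<rho>) = ip p p - ip \<rho> \<rho>"
    by (simp add: ip.diffl ip.diffr ip_sym[of \<rho> p])
  ultimately show ?thesis using A.operator_identity[OF rho] unfolding Dp_F[OF p, symmetric] by simp
qed

lemma Dp_tame: "p \<in> l_space K \<Longrightarrow> tame (Dp p)"
  and Dp_cone: "p \<in> l_space K \<Longrightarrow> Dp p \<theta> \<noteq> 0 \<Longrightarrow> \<exists>\<beta>\<in>Q_plus K. \<theta> = p - \<rho> - pl \<beta>"
  and Dp_1: "p \<in> l_space K \<Longrightarrow> Dp p (p - \<rho>) = 1"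
proof -
  assume p: "p \<in> l_space K"
  interpret A: twisted_trace K B Bi eb fb I1 I2 x "p - \<rho>" "M (p - \<rho>)" "vc (p - \<rho>)" "p - \<rho>" "M (p - \<rho>)" "vc (p - \<rho>)" "bs (p - \<rho>)"
    "\<lambda>\<eta> m. \<eta> m" "\<lambda>_ _. 0 :: complex" UNIV by (rule scalar_trace[OF p])
  have pl: "pl (p - \<rho>) = p - \<rho>" by (rule pl_id[OF cvec.subspace_diff[OF subspace_l p rho_l[OF rho]]])
  show "tame (Dp p)" unfolding Dp_F[OF p] by (rule A.F_tame)
  show "\<exists>\<beta>\<in>Q_plus K. \<theta> = p - \<rho> - pl \<beta>" if "Dp p \<theta> \<noteq> 0" using A.F_cone[of \<theta>] that unfolding Dp_F[OF p] pl by blast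
  obtain b c where b: "A.Sl (p - \<rho>) = {b}" "b = c *\<^sub>C vc (p - \<rho>)" "c \<noteq> 0" using A.vac_Sl unfolding pl by blast
  have "A.vB b = b" by (simp add: b(2) A.vB_lins A.vB(2))
  then show "Dp p (p - \<rho>) = 1" unfolding Dp_F[OF p] A.F_def A.tt_def b(1)
    using A.tgt.co_basis[OF A.Sl_S, of b "p - \<rho>" b] b(1) by simp
qed

text \<open>As modules over \<open>n_minus\<close> the two Verma modules are isomorphic by freeness.
  The isomorphism conjugates the twisted maps into each other and shifts all weights by
  \<open>p\<close>, so the traces agree up to this translation.\<close>

lemma Dp_shift:
  assumes p: "p \<in> l_space K"
  shows "Dp p (\<theta> + p) = Dp 0 \<theta>"
proof -
  let ?a = "p - \<rho>" and ?z = "- \<rho>"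
  have l0: "0 \<in> l_space K" by (rule cvec.subspace_0[OF subspace_l])
  interpret A: twisted_trace K B Bi eb fb I1 I2 x ?a "M ?a" "vc ?a" ?a "M ?a" "vc ?a" "bs ?a"
    "\<lambda>\<eta> m. \<eta> m" "\<lambda>_ _. 0 :: complex" UNIV by (rule scalar_trace[OF p])
  interpret Z: twisted_trace K B Bi eb fb I1 I2 x ?z "M ?z" "vc ?z" ?z "M ?z" "vc ?z" "bs ?z"
    "\<lambda>\<eta> m. \<eta> m" "\<lambda>_ _. 0 :: complex" UNIV by (rule scalar_trace[OF l0, unfolded diff_0])
  obtain \<psi> where \<psi>: "clinear \<psi>" "\<psi> (vc ?z) = vc ?a" "\<And>y m. y \<in> Nm \<Longrightarrow> \<psi> (M ?z y m) = M ?a y (\<psi> m)"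
    by (rule Z.free_hom[of UNIV "vc ?a" "M ?a"])
      (auto simp: A.act.lin_r A.act.addl A.act.scalel A.act_br)
  obtain \<phi> where \<phi>: "clinear \<phi>" "\<phi> (vc ?a) = vc ?z" "\<And>y m. y \<in> Nm \<Longrightarrow> \<phi> (M ?a y m) = M ?z y (\<phi> m)"
    by (rule A.free_hom[of UNIV "vc ?z" "M ?z"])
      (auto simp: Z.act.lin_r Z.act.addl Z.act.scalel Z.act_br)
  note lins = clinear_zero[OF \<psi>(1)] clinear_add[OF \<psi>(1)] clinear_scale[OF \<psi>(1)]
    clinear_zero[OF \<phi>(1)] clinear_add[OF \<phi>(1)] clinear_scale[OF \<phi>(1)] clinear_diff[OF \<phi>(1)] A.vB_lins Z.vB_lins
  have inv: "\<phi> (\<psi> m) = m" for m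
    by (induction m rule: Z.verma_induct) (simp_all add: lins \<psi> \<phi> f_n_minus)
  have conj: "A.vB m = \<psi> (Z.vB (\<phi> m))" for m
    by (induction m rule: A.verma_induct) (simp_all add: lins \<psi> \<phi> f_n_minus A.vB Z.vB B_Nm)
  have wt: "M ?z h (\<phi> m) = \<phi> (M ?a h m) - ip p h *\<^sub>C \<phi> m" if h: "h \<in> H" for h m
  proof (induction m rule: A.verma_induct)
    case (f i m)
    then have "\<phi> (M ?a h m) = M ?z h (\<phi> m) + ip p h *\<^sub>C \<phi> m" by simp
    then show ?case
      using h by (simp only: A.h_act_f Z.h_act_f lins \<phi>(3) f_n_minus Z.act.bisimps) simp
  qed (simp_all add: lins A.act.bisimps Z.act.bisimps A.vac_h Z.vac_h h \<phi>(2) scaleC_add_right scaleC_scaleC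
      ip.diffl ip.zerol ip.minusl cvec.scale_left_diff_distrib cvec.scale_right_diff_distrib mult.commute)
  have wt_b: "ip (Z.tgt.wt b') h = ip (A.tgt.wt b) h - ip p h"
    if "b \<in> bs ?a" "Z.tgt.co b' (\<phi> b) \<noteq> 0" "h \<in> l_space K" for b b' h
  proof (rule Z.tgt.co_eigen[of "l_space K" "\<phi> b" "\<lambda>h. ip (A.tgt.wt b) h - ip p h"])
    show "M ?z k (\<phi> b) = (ip (A.tgt.wt b) k - ip p k) *\<^sub>C \<phi> b" if "k \<in> l_space K" for k
      using wt[OF l_H[OF that], of b] A.tgt.h_basis[OF \<open>b \<in> bs ?a\<close> l_H[OF that]] by (simp add: lins cvec.scale_left_diff_distrib)
  qed (use that l_H in auto)
  have "Dp p (\<theta> + p) = (\<Sum>b\<in>A.Sl (\<theta> + p). (\<lambda>\<eta> n. \<eta> (\<psi> (Z.vB n))) (A.tgt.co b) (\<phi> b))"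
    unfolding Dp_F[OF p] by (simp add: A.F_def A.tt_def conj)
  also have "\<dots> = (\<Sum>b'\<in>Z.Sl \<theta>. (\<lambda>\<eta> n. \<eta> (\<psi> (Z.vB n))) (\<lambda>m. Z.tgt.co b' (\<phi> m)) b')"
  proof (rule trace_cyclic[OF A.tgt.vec_basis_axioms Z.tgt.vec_basis_axioms \<phi>(1)])
    show "Z.tgt.co b' (\<phi> b) = 0" if b: "b \<in> A.Sl (\<theta> + p)" and b': "b' \<notin> Z.Sl \<theta>" for b b'
    proof (rule ccontr)
      assume n: "Z.tgt.co b' (\<phi> b) \<noteq> 0"
      have "\<theta> \<in> l_space K" using cvec.subspace_diff[OF subspace_l A.Sl_l[OF b] p] by simp
      then have "b' \<in> Z.Sl \<theta>"
        by (rule Z.SlI[OF Z.tgt.co_in[OF n]]) (use wt_b[OF A.Sl_S[OF b] n] A.Sl_ip[OF b] in \<open>simp add: ip.addl\<close>)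
      with b' show False ..
    qed
    show "Z.tgt.co b' (\<phi> b) = 0" if b: "b \<in> bs ?a" "b \<notin> A.Sl (\<theta> + p)" and b': "b' \<in> Z.Sl \<theta>" for b b'
    proof (rule ccontr)
      assume n: "Z.tgt.co b' (\<phi> b) \<noteq> 0"
      have "\<theta> + p \<in> l_space K" by (rule cvec.subspace_add[OF subspace_l Z.Sl_l[OF b'] p])
      then have "b \<in> A.Sl (\<theta> + p)"
        by (rule A.SlI[OF b(1)]) (use wt_b[OF b(1) n] Z.Sl_ip[OF b'] in \<open>simp add: ip.addl\<close>)
      with b(2) show False ..
    qed
    show "clinear (\<lambda>n. \<eta> (\<psi> (Z.vB n)))" if "clinear \<eta>" for \<eta> :: "'m \<Rightarrow> complex"
      by (rule clinear_compose[OF Z.vB(1) clinear_compose[OF \<psi>(1) that]])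
  qed (auto simp: A.Sl_finite Z.Sl_finite A.Sl_S Z.Sl_S scaleC_complex_def)
  also have "\<dots> = Dp 0 \<theta>"
    unfolding Dp_F[OF l0, unfolded diff_0] by (simp add: Z.F_def Z.tt_def inv)
  finally show ?thesis .
qed

end

lemma Sum_any_sum:
  assumes "finite A" "\<And>a. a \<in> A \<Longrightarrow> finite {k. g a k \<noteq> 0}"
  shows "(\<Sum>a\<in>A. Sum_any (g a)) = Sum_any (\<lambda>k. \<Sum>a\<in>A. g a k)"
  using assms
proof (induction A rule: finite_induct)
  case (insert a A)
  have "{k. (\<Sum>a\<in>A. g a k) \<noteq> 0} \<subseteq> (\<Union>a\<in>A. {k. g a k \<noteq> 0})" by (auto intro: ccontr sum.neutral)
  then have "finite {k. (\<Sum>a\<in>A. g a k) \<noteq> 0}" by (rule finite_subset) (use insert in auto)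
  with insert show ?case by (simp add: Sum_any.distrib)
qed simp

context bd_family begin

lemma Eop_shift: "Eop \<rho> q G (\<theta> + p) = Eop \<rho> q (\<lambda>\<theta>. G (\<theta> + p)) \<theta>"
  by (simp add: Eop_def Op_def scaleC_fun_def ac_simps)

text \<open>Compares the identities for \<open>Dp p\<close> and \<open>Dp 0\<close>, which is a shift of \<open>Dp p\<close>.\<close>

lemma Dp_partial:
  assumes k: "k \<in> I1"
  shows "partial K (x k) (Dp 0) = - Eop \<rho> (x k) (Dp 0)"
proof
  fix \<theta>
  let ?p = "x k" and ?D = "Dp 0"
  have p: "?p \<in> l_space K" and l0: "0 \<in> l_space K" using x_l[OF k] cvec.subspace_0[OF subspace_l] by auto
  have sh: "(\<lambda>\<theta>. partial K q (Dp ?p) (\<theta> + ?p)) = partial K q ?D + ip ?p q *\<^sub>C ?D" for q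
    by (rule ext) (simp add: partial_def Dp_shift[OF p] ip.addl scaleC_fun_def scaleC_add_left)
  have E: "Eop \<rho> q (partial K q (Dp ?p)) (\<theta> + ?p) = Eop \<rho> q (partial K q ?D) \<theta> + ip ?p q * Eop \<rho> q ?D \<theta>" for q
    unfolding Eop_shift sh using Dp_tame[OF l0]
    by (simp add: Eop_add tame_partial tame_scale Eop_scale) (simp add: scaleC_fun_def scaleC_complex_def)
  have P: "partial K q (partial K q (Dp ?p)) (\<theta> + ?p) =
      partial K q (partial K q ?D) \<theta> + 2 * ip ?p q * partial K q ?D \<theta> + ip ?p q * ip ?p q * ?D \<theta>" for q
    by (simp add: partial_def Dp_shift[OF p] ip.addl scaleC_complex_def algebra_simps)
  have id0: "(\<Sum>j\<in>I1. partial K (x j) (partial K (x j) ?D) \<theta>) + 2 * (\<Sum>j\<in>I1. Eop \<rho> (x j) (partial K (x j) ?D) \<theta>) = - ip \<rho> \<rho> * ?D \<theta>"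
    using fun_cong[OF Dp_identity[OF l0], of \<theta>] by (simp add: sum_fun_apply scaleC_fun_def scaleC_complex_def ip.zerol)
  have "(\<Sum>j\<in>I1. partial K (x j) (partial K (x j) (Dp ?p)) (\<theta> + ?p)) + 2 * (\<Sum>j\<in>I1. Eop \<rho> (x j) (partial K (x j) (Dp ?p)) (\<theta> + ?p))
      = (ip ?p ?p - ip \<rho> \<rho>) * ?D \<theta>"
    using fun_cong[OF Dp_identity[OF p], of "\<theta> + ?p"] by (simp add: sum_fun_apply scaleC_fun_def scaleC_complex_def Dp_shift[OF p])
  then have "(\<Sum>j\<in>I1. partial K (x j) (partial K (x j) ?D) \<theta>) + 2 * (\<Sum>j\<in>I1. ip ?p (x j) * partial K (x j) ?D \<theta>)
      + (\<Sum>j\<in>I1. ip ?p (x j) * ip ?p (x j)) * ?D \<theta> + 2 * (\<Sum>j\<in>I1. Eop \<rho> (x j) (partial K (x j) ?D) \<theta>)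
      + 2 * (\<Sum>j\<in>I1. ip ?p (x j) * Eop \<rho> (x j) ?D \<theta>) = (ip ?p ?p - ip \<rho> \<rho>) * ?D \<theta>"
    unfolding P E by (simp add: sum.distrib sum_distrib_left sum_distrib_right algebra_simps)
  \<comment> \<open>Difference of the two identities: the terms quadratic in \<open>x k\<close>
    cancel against its norm in the eigenvalue, and the terms linear in it remain. Orthonormality
    then leaves the direction \<open>k\<close> alone.\<close>
  moreover have "A + B = 0" if "S1 + 2 * S2 = - R * D" "S1 + 2 * A + N * D + 2 * S2 + 2 * B = (N - R) * D"
    for S1 S2 A B N R D :: complex using that by algebra
  ultimately have "(\<Sum>j\<in>I1. ip ?p (x j) * partial K (x j) ?D \<theta>) + (\<Sum>j\<in>I1. ip ?p (x j) * Eop \<rho> (x j) ?D \<theta>) = 0"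
    using id0 unfolding l_norm[OF p, symmetric] by blast
  moreover have "(\<Sum>j\<in>I1. ip ?p (x j) * g j) = g k" for g :: "nat \<Rightarrow> complex"
  proof -
    have "(\<Sum>j\<in>I1. ip ?p (x j) * g j) = (\<Sum>j\<in>I1. if j = k then g k else 0)"
      by (rule sum.cong) (use k ob_on in auto)
    then show ?thesis using k ob_fin by simp
  qed
  ultimately have "partial K ?p ?D \<theta> + Eop \<rho> ?p ?D \<theta> = 0" by simp
  then show "partial K ?p ?D \<theta> = (- Eop \<rho> ?p ?D) \<theta>" by (simp add: eq_neg_iff_add_eq_0)
qed

text \<open>\<open>series_inverse\<close> is a definite description, so both existence and
  uniqueness among series supported in cones are needed. The inverse has its leading exponent at
  \<rho>.\<close>

lemma delta_B_Dp: "tame (delta_B K B M vc \<rho>)" "series_mult (delta_B K B M vc \<rho>) (Dp 0) = (\<lambda>\<theta>. if \<theta> = 0 then 1 else 0)"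
proof -
  have l0: "0 \<in> l_space K" by (rule cvec.subspace_0[OF subspace_l])
  have tame: "tame a" if "cone_supported K a" for a
    using that tame_cone unfolding cone_supported_def l_proj_pl by blast
  let ?P = "\<lambda>a. cone_supported K a \<and> series_mult a (Dp 0) = (\<lambda>\<theta>. if \<theta> = 0 then 1 else 0)"
  obtain a where a: "\<And>\<theta>. a \<theta> \<noteq> 0 \<Longrightarrow> - (- \<rho>) - \<theta> \<in> pl ` Q_plus K" "series_mult a (Dp 0) = (\<lambda>\<theta>. if \<theta> = 0 then 1 else 0)"
  proof (rule series_inverse_exists[of "pl ` Q_plus K" "Dp 0" "- \<rho>"])
    show "0 \<in> pl ` Q_plus K" by (rule image_eqI[of _ pl 0, OF clinear_zero[OF pl_lin, symmetric] Q_0])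
    show "a + b \<in> pl ` Q_plus K" if ab: "a \<in> pl ` Q_plus K" "b \<in> pl ` Q_plus K" for a b
    proof -
      obtain \<beta> \<beta>' where "\<beta> \<in> Q_plus K" "a = pl \<beta>" "\<beta>' \<in> Q_plus K" "b = pl \<beta>'" using ab by blast
      then show ?thesis by (intro image_eqI[of _ _ "\<beta> + \<beta>'"] Q_add) (simp_all add: clinear_add[OF pl_lin])
    qed
    show "1 \<le> hg a" if a: "a \<in> pl ` Q_plus K" "a \<noteq> 0" for a
    proof -
      obtain \<beta> where \<beta>: "\<beta> \<in> Q_plus K" "a = pl \<beta>" using a(1) by blast
      then have "\<beta> \<noteq> 0" using a(2) clinear_zero[OF pl_lin] by auto
      then have "ht \<beta> \<noteq> 0" using Q_ht_0[OF \<beta>(1)] by blast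
      then show ?thesis using \<beta> by (simp add: hg_pl hg_Q)
    qed
    show "Dp 0 (- \<rho>) = 1" using Dp_1[OF l0] by simp
    show "- \<rho> - \<theta> \<in> pl ` Q_plus K" if "Dp 0 \<theta> \<noteq> 0" for \<theta> using Dp_cone[OF l0 that] by auto
    show "tame (Dp 0)" by (rule Dp_tame[OF l0])
    fix a assume "\<And>\<theta>. a \<theta> \<noteq> 0 \<Longrightarrow> - (- \<rho>) - \<theta> \<in> pl ` Q_plus K" "series_mult a (Dp 0) = (\<lambda>\<theta>. if \<theta> = 0 then 1 else 0)"
    then show thesis by (rule that)
  qed
  have "\<exists>!a. ?P a"
  proof (rule ex1I[of _ a], intro conjI)
    show "cone_supported K a"
      unfolding cone_supported_def l_proj_pl
    proof (intro exI[of _ "{\<rho>}"] conjI allI impI)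
      fix \<theta> assume "a \<theta> \<noteq> 0"
      then obtain \<beta> where "\<beta> \<in> Q_plus K" "\<rho> - \<theta> = pl \<beta>" using a(1) by auto
      then show "\<exists>\<eta>\<in>{\<rho>}. \<exists>\<beta>\<in>Q_plus K. \<theta> = \<eta> - pl \<beta>" by (auto simp: algebra_simps)
    qed (use rho_l[OF rho] in auto)
    then show "b = a" if "?P b" for b
      using that a(2) series_inverse_unique[OF tame tame Dp_tame[OF l0], of b a] by blast
  qed (rule a(2))
  from theI'[OF this] have "?P (delta_B K B M vc \<rho>)"
    unfolding delta_B_def series_inverse_def Dp_def diff_0 .
  then show "tame (delta_B K B M vc \<rho>)" "series_mult (delta_B K B M vc \<rho>) (Dp 0) = (\<lambda>\<theta>. if \<theta> = 0 then 1 else 0)"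
    using tame by auto
qed

text \<open>The identity is pulled back to \<open>F\<close> written as the product of
  \<open>Dp 0\<close> and \<open>FF\<close>. The operator applied to \<open>Dp 0\<close> alone
  contributes the number - (\<rho>, \<rho>), the mixed terms cancel, and the common factor
  \<open>Dp 0\<close> is removed at the end by multiplying with its inverse.\<close>

lemma normalized_identity:
  fixes wa :: "'g \<Rightarrow> 'w \<Rightarrow> 'w::complex_vec"
  assumes F: "tame F" and lin: "\<And>u. clinear (wa u)"
    and id: "(\<Sum>j\<in>I1. partial K (x j) (partial K (x j) F)) + 2 *\<^sub>C (\<Sum>j\<in>I1. Eop \<rho> (x j) (partial K (x j) F)) - Sop wa F = c *\<^sub>C F"
  defines "FF \<equiv> series_mult (delta_B K B M vc \<rho>) F"
  shows "(\<Sum>j\<in>I1. partial K (x j) (partial K (x j) FF)) - Sop wa FF = (c + ip \<rho> \<rho>) *\<^sub>C FF"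
proof -
  let ?\<delta> = "delta_B K B M vc \<rho>" and ?D = "Dp 0"
  note l0 = cvec.subspace_0[OF subspace_l]
  note tD = Dp_tame[OF l0]
  have tFF: "tame FF" unfolding FF_def by (rule series_mult_tame[OF delta_B_Dp(1) F])
  have F_eq: "F = series_mult ?D FF"
    unfolding FF_def by (simp add: series_mult_assoc[OF tD delta_B_Dp(1) F] series_mult_commute[of ?D] delta_B_Dp(2) series_mult_1)
  have L: "partial K q (series_mult a G) = series_mult (partial K q a) G + series_mult a (partial K q G)"
    if "tame a" "tame G" for q a and G :: "'g \<Rightarrow> 'w"
    using series_mult_Leibniz[OF that, of "\<lambda>\<theta>. ip \<theta> q"] by (simp add: partial_def ip.addl)
  have pp: "partial K q (G + G') = partial K q G + partial K q G'" for q and G G' :: "'g \<Rightarrow> 'w"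
    by (rule ext) (simp add: partial_def scaleC_add_right)
  have two: "2 *\<^sub>C w = w + w" for w :: "'g \<Rightarrow> 'w" using scaleC_add_left[of 1 1 w] by (simp add: scaleC_one)
  let ?\<Delta> = "\<lambda>G :: 'g \<Rightarrow> complex. (\<Sum>j\<in>I1. partial K (x j) (partial K (x j) G) + 2 *\<^sub>C Eop \<rho> (x j) (partial K (x j) G))"
  have j: "partial K (x j) (partial K (x j) F) + 2 *\<^sub>C Eop \<rho> (x j) (partial K (x j) F)
    = series_mult (partial K (x j) (partial K (x j) ?D) + 2 *\<^sub>C Eop \<rho> (x j) (partial K (x j) ?D)) FF
      + series_mult ?D (partial K (x j) (partial K (x j) FF))" if "j \<in> I1" for j
  proof -
    let ?q = "x j"
    define A where "A = series_mult (partial K ?q (partial K ?q ?D)) FF"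
    define B' where "B' = series_mult (partial K ?q ?D) (partial K ?q FF)"
    define C where "C = series_mult ?D (partial K ?q (partial K ?q FF))"
    define E where "E = series_mult (Eop \<rho> ?q (partial K ?q ?D)) FF"
    note ts = tD tFF tame_partial tame_scale Eop_tame
    have 1: "partial K ?q F = series_mult (partial K ?q ?D) FF + series_mult ?D (partial K ?q FF)"
      unfolding F_eq by (rule L[OF tD tFF])
    have 2: "partial K ?q (partial K ?q F) = (A + B') + (B' + C)"
      unfolding 1 pp A_def B'_def C_def by (simp add: L ts)
    have 3: "Eop \<rho> ?q (partial K ?q F) = E + series_mult (Eop \<rho> ?q ?D) (partial K ?q FF)"
      unfolding 1 E_def by (simp add: Eop_add series_mult_tame ts Eop_mult_left)
    \<comment> \<open>\<open>B'\<close> occurs twice in the Leibniz expansion of the second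
      derivative, and this term, which enters with the factor 2, cancels both occurrences.\<close>
    have 4: "series_mult (Eop \<rho> ?q ?D) (partial K ?q FF) = - B'"
    proof -
      have "Eop \<rho> ?q ?D = (- 1) *\<^sub>C partial K ?q ?D"
        using Dp_partial[OF that] by (simp add: fun_eq_iff scaleC_fun_def scaleC_complex_def)
      then have "series_mult (Eop \<rho> ?q ?D) (partial K ?q FF) = (- 1) *\<^sub>C B'"
        unfolding B'_def by (simp only: series_mult_scale_l[OF tame_partial[OF tD] tame_partial[OF tFF]])
      then show ?thesis by simp
    qed
    have 5: "series_mult (partial K ?q (partial K ?q ?D) + 2 *\<^sub>C Eop \<rho> ?q (partial K ?q ?D)) FF = A + 2 *\<^sub>C E"
      unfolding A_def E_def by (simp add: series_mult_add_l series_mult_scale_l ts)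
    show ?thesis unfolding 2 3 4 5 C_def[symmetric] two by (simp only: algebra_simps) simp
  qed
  have t2: "tame (partial K q (partial K q ?D) + 2 *\<^sub>C Eop \<rho> q (partial K q ?D))" "tame (partial K q (partial K q FF))" for q
    by (intro tame_add tame_scale Eop_tame tame_partial tD tFF)+
  have D\<Delta>: "?\<Delta> ?D = (- ip \<rho> \<rho>) *\<^sub>C ?D"
    using Dp_identity[OF l0] by (simp add: sum.distrib cvec.scale_sum_right ip.zerol)
  have "(\<Sum>j\<in>I1. partial K (x j) (partial K (x j) F)) + 2 *\<^sub>C (\<Sum>j\<in>I1. Eop \<rho> (x j) (partial K (x j) F))
    = (\<Sum>j\<in>I1. series_mult (partial K (x j) (partial K (x j) ?D) + 2 *\<^sub>C Eop \<rho> (x j) (partial K (x j) ?D)) FF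
      + series_mult ?D (partial K (x j) (partial K (x j) FF)))"
    unfolding cvec.scale_sum_right sum.distrib[symmetric] by (rule sum.cong[OF refl j])
  also have "\<dots> = series_mult ((- ip \<rho> \<rho>) *\<^sub>C ?D) FF + series_mult ?D (\<Sum>j\<in>I1. partial K (x j) (partial K (x j) FF))"
    unfolding D\<Delta>[symmetric] series_mult_sum_l[OF tFF t2(1)] series_mult_sum[OF tD t2(2)] by (rule sum.distrib)
  also have "series_mult ((- ip \<rho> \<rho>) *\<^sub>C ?D) FF = (- ip \<rho> \<rho>) *\<^sub>C F"
    by (simp only: series_mult_scale_l[OF tD tFF] F_eq[symmetric])
  finally have "(- ip \<rho> \<rho>) *\<^sub>C F + series_mult ?D (\<Sum>j\<in>I1. partial K (x j) (partial K (x j) FF)) - Sop wa F = c *\<^sub>C F"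
    by (rule subst) (rule id)
  moreover have "Sop wa F = series_mult ?D (Sop wa FF)" unfolding F_eq by (rule Sop_mult[OF tD tFF lin])
  ultimately have "series_mult ?D (\<Sum>j\<in>I1. partial K (x j) (partial K (x j) FF)) - series_mult ?D (Sop wa FF) = (c + ip \<rho> \<rho>) *\<^sub>C F"
    by (simp only: scaleC_add_left cvec.scale_minus_left) (simp add: algebra_simps)
  then have "series_mult ?D ((\<Sum>j\<in>I1. partial K (x j) (partial K (x j) FF)) - Sop wa FF) = (c + ip \<rho> \<rho>) *\<^sub>C F"
    by (simp only: series_mult_diff[OF tD tame_sum[OF t2(2)] Sop_tame[OF tFF lin]])
  then have "series_mult ?\<delta> (series_mult ?D ((\<Sum>j\<in>I1. partial K (x j) (partial K (x j) FF)) - Sop wa FF)) = (c + ip \<rho> \<rho>) *\<^sub>C FF"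
    unfolding FF_def by (simp only: series_mult_scale[OF delta_B_Dp(1) F])
  moreover have "tame ((\<Sum>j\<in>I1. partial K (x j) (partial K (x j) FF)) - Sop wa FF)"
    by (rule tame_diff[OF tame_sum[OF t2(2)] Sop_tame[OF tFF lin]])
  ultimately show ?thesis
    by (simp only: series_mult_assoc[OF delta_B_Dp(1) tD] delta_B_Dp(2) series_mult_1)
qed

text \<open>Summed over all pairs of positions, including equal ones, the operators on two factors
  are products of two total actions on the tensor product.\<close>

lemma S_T_Sop:
  assumes G: "tame G" and bil: "cbilinear act"
  shows "(\<Sum>l<r. \<Sum>n<r. S_T K B Bi eb fb I2 x act l n G) = Sop (wact act r) G"
proof
  fix \<theta>
  let ?s = "\<lambda>l n (\<alpha>, t, s, v) w. if \<alpha> \<in> pos_roots K \<and> t \<in> {1..root_mult K \<alpha>} \<and> v \<ge> 1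
      then on_factors act l n ((B ^^ s) (fb \<alpha> t)) ((Bi ^^ v) (eb \<alpha> t)) w
         + on_factors act l n ((Bi ^^ v) (eb \<alpha> t)) ((B ^^ s) (fb \<alpha> t)) w else 0"
  let ?y = "\<lambda>j. (1/2) *\<^sub>C (x j - cayley K (x j))"
  have ofl: "clinear (on_factors act l n a b)" for l n a b
    unfolding on_factors_def by (rule clinear_compose[OF on_factor_lin on_factor_lin])
  have ex: "exp_mult K (- (of_nat k *\<^sub>C \<alpha>)) G \<theta> = G (sh \<theta> k \<alpha>)" for k \<alpha>
    by (simp add: exp_mult_def l_proj_pl clinear_scale[OF pl_lin] clinear_minus[OF pl_lin])
  have S: "S_T K B Bi eb fb I2 x act l n G \<theta> = Sum_any (\<lambda>k. ?s l n k (G (\<theta> + sg k))) - (\<Sum>j\<in>I2. on_factors act l n (?y j) (?y j) (G \<theta>))" for l n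
    unfolding S_T_def Let_def ex sg_def by (simp only: case_prod_unfold fst_conv snd_conv)
  have sl: "clinear (?s l n k)" for l n k
  proof (cases k)
    case (fields \<alpha> t s v)
    show ?thesis
    proof (cases "\<alpha> \<in> pos_roots K \<and> t \<in> {1..root_mult K \<alpha>} \<and> v \<ge> 1")
      case False
      then have "?s l n k = (\<lambda>w. 0)" by (auto simp: fields)
      then show ?thesis by (simp add: clinear_zero_fun)
    qed (simp add: fields clinear_add_fun[OF ofl ofl])
  qed
  have "loc_fin (?s l n) sg" for l n by (rule sg_loc_fin) auto
  then have fin: "finite {k. ?s l n k (G (\<theta> + sg k)) \<noteq> 0}" for l n by (rule Op_fin[OF G _ sl])
  have finl: "finite {k. (\<Sum>n<r. ?s l n k (G (\<theta> + sg k))) \<noteq> 0}" for l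
  proof (rule finite_subset)
    show "{k. (\<Sum>n<r. ?s l n k (G (\<theta> + sg k))) \<noteq> 0} \<subseteq> (\<Union>n\<in>{..<r}. {k. ?s l n k (G (\<theta> + sg k)) \<noteq> 0})"
      by (auto intro: ccontr sum.neutral)
  qed (use fin in auto)
  have "(\<Sum>l<r. \<Sum>n<r. Sum_any (\<lambda>k. ?s l n k (G (\<theta> + sg k)))) = (\<Sum>l<r. Sum_any (\<lambda>k. \<Sum>n<r. ?s l n k (G (\<theta> + sg k))))"
    by (intro sum.cong refl Sum_any_sum fin) simp
  also have "\<dots> = Sum_any (\<lambda>k. \<Sum>l<r. \<Sum>n<r. ?s l n k (G (\<theta> + sg k)))"
    by (intro Sum_any_sum finl) simp
  also have "\<dots> = Op (sA (wact act r)) sg G \<theta>"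
    unfolding Op_def
  proof (rule Sum_any.cong)
    fix k show "(\<Sum>l<r. \<Sum>n<r. ?s l n k (G (\<theta> + sg k))) = sA (wact act r) k (G (\<theta> + sg k))"
      by (cases k) (auto simp: sA_def wact_wact[OF bil] sum.distrib)
  qed
  finally have 1: "(\<Sum>l<r. \<Sum>n<r. Sum_any (\<lambda>k. ?s l n k (G (\<theta> + sg k)))) = Op (sA (wact act r)) sg G \<theta>" .
  have "(\<Sum>l<r. \<Sum>n<r. \<Sum>j\<in>I2. on_factors act l n (?y j) (?y j) (G \<theta>)) = (\<Sum>l<r. \<Sum>j\<in>I2. \<Sum>n<r. on_factors act l n (?y j) (?y j) (G \<theta>))"
    by (intro sum.cong refl sum.swap)
  also have "\<dots> = (\<Sum>j\<in>I2. wact act r (?y j) (wact act r (?y j) (G \<theta>)))"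
    unfolding wact_wact[OF bil] by (rule sum.swap)
  finally have 2: "(\<Sum>l<r. \<Sum>n<r. \<Sum>j\<in>I2. on_factors act l n (?y j) (?y j) (G \<theta>)) = (\<Sum>j\<in>I2. wact act r (?y j) (wact act r (?y j) (G \<theta>)))" .
  show "(\<Sum>l<r. \<Sum>n<r. S_T K B Bi eb fb I2 x act l n G) \<theta> = Sop (wact act r) G \<theta>"
    unfolding sum_fun_apply S sum_subtractf 1 2 Sop_def minus_apply ..
qed

end

section \<open>The product of intertwiners as an instance of the twisted trace\<close>

locale intertwiner_chain = bd_family K B Bi eb fb I1 I2 x M vc \<rho>
  for K :: "('g::complex_vec, 'i::finite, 'z) bd_algebra_scheme" and B Bi eb fb I1 I2 x
    and M :: "'g \<Rightarrow> 'g \<Rightarrow> 'm \<Rightarrow> 'm::complex_vec" and vc :: "'g \<Rightarrow> 'm" and \<rho> :: 'g +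
  fixes act :: "'g \<Rightarrow> 'v \<Rightarrow> 'v::complex_vec" and r :: nat and V :: "nat \<Rightarrow> 'v set" and v :: "nat \<Rightarrow> 'v"
    and \<nu> :: "nat \<Rightarrow> 'g" and \<mu> :: 'g
  assumes modV: "lie_module K act" and catO: "\<And>i. i < r \<Longrightarrow> category_O K act (V i)"
    and \<nu>_H: "\<And>i. i < r \<Longrightarrow> \<nu> i \<in> cart K"
    and v: "\<And>i. i < r \<Longrightarrow> v i \<in> V i \<inter> weight_space K act (\<nu> i)"
    and \<nu>_l: "\<And>y. y \<in> l_space K \<Longrightarrow> form K (\<Sum>i<r. \<nu> i) y = 0"
    and \<mu>_H: "\<mu> \<in> cart K"
    and \<mu>_T: "\<And>i. i \<in> Gam1 K \<Longrightarrow> form K (\<mu> - (\<Sum>i<r. \<nu> i)) (simple K i) = form K \<mu> (simple K (bdT K i))"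
    and irr: "\<And>i. i < r \<Longrightarrow> graded_dual_irreducible K (M (\<mu> - (\<Sum>j\<in>{i..<r}. \<nu> j)))"
begin

text \<open>The highest weights along the chain: the i-th intertwiner goes from
  \<open>M (om (Suc i))\<close> to \<open>M (om i)\<close> with the factor \<open>V i\<close>. The
  chain starts from \<open>om r = \<mu>\<close> and ends at \<open>om 0\<close>, over which the
  trace is taken.\<close>

definition om :: "nat \<Rightarrow> 'g" where "om i = \<mu> - (\<Sum>j\<in>{i..<r}. \<nu> j)"

lemma om_r: "om r = \<mu>" by (simp add: om_def)
lemma om_0: "om 0 = \<mu> - (\<Sum>i<r. \<nu> i)" by (simp add: om_def lessThan_atLeast0)
lemma om_Suc: "i < r \<Longrightarrow> om (Suc i) = om i + \<nu> i" by (simp add: om_def sum.atLeast_Suc_lessThan)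

lemma om_H: "om i \<in> H"
  unfolding om_def using \<nu>_H by (intro cvec.subspace_diff[OF H(1)] \<mu>_H cvec.subspace_sum[OF H(1)]) auto

lemma bil: "cbilinear act" using modV by (simp add: lie_module_def)

abbreviation \<Phi> :: "nat \<Rightarrow> 'm \<Rightarrow> ('m, 'v) mtens"
  where "\<Phi> i \<equiv> intertwiner K M vc act (V i) (\<mu> - (\<Sum>j\<in>{i<..<r}. \<nu> j)) (\<nu> i) (v i)"

lemma \<Phi>:
  assumes i: "i < r"
  shows "clinear (\<Phi> i)" "\<Phi> i m \<in> mspan 1" "\<Phi> i (M (om (Suc i)) y m) = mtens_act (M (om i)) act y (\<Phi> i m)"
proof -
  interpret S: verma_basis K "om i" "M (om i)" "vc (om i)" "bs (om i)" by (rule basis_M[OF om_H])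
  interpret verma K "om (Suc i)" "M (om (Suc i))" "vc (om (Suc i))" by (rule verma_M[OF om_H])
  interpret intertwining K "om i" "M (om i)" "vc (om i)" "bs (om i)" act "V i" "v i" "\<nu> i" "om (Suc i)" "M (om (Suc i))" "vc (om (Suc i))"
    by unfold_locales (use irr[OF i] modV catO[OF i] \<nu>_H[OF i] v[OF i] om_Suc[OF i] in \<open>simp_all add: om_def\<close>)
  have "{i<..<r} = {Suc i..<r}" by auto
  then have "\<Phi> i = intertwiner K M vc act (V i) (om (Suc i)) (\<nu> i) (v i)" by (simp add: om_def)
  then have "is_int (\<Phi> i)" using intertwiner_spec[of M vc] by simp
  then show "clinear (\<Phi> i)" "\<Phi> i m \<in> mspan 1" "\<Phi> i (M (om (Suc i)) y m) = mtens_act (M (om i)) act y (\<Phi> i m)"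
    using span_mspan unfolding is_int_def by blast+
qed

text \<open>The index descends from \<open>r\<close>, because \<open>foldr\<close> applies the last
  intertwiner first. The number of tensor factors is tracked along the way, since the action on
  factors is well behaved only for the correct length.\<close>

lemma foldr_intertwiners:
  assumes "k \<le> r"
  defines "P \<equiv> \<lambda>m. foldr (\<lambda>i. apply_first (\<Phi> i)) [k..<r] (mpure m [])"
  shows "clinear P \<and> (\<forall>m. P m \<in> mspan (r - k)) \<and> (\<forall>y m. P (M \<mu> y m) = mtens_act (M (om k)) act y (P m))"
  using assms(1) unfolding P_def
proof (induction k rule: inc_induct)
  case base
  interpret verma K \<mu> "M \<mu>" "vc \<mu>" by (rule verma_M[OF \<mu>_H])
  have "clinear (act y)" for y using bil by (simp add: cbilinear_def)
  then show ?case by (simp add: mpure_lin mpure_mspan om_r mtens_act_mpure act.lin_r)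
next
  case (step k)
  interpret verma K "om k" "M (om k)" "vc (om k)" by (rule verma_M[OF om_H])
  interpret S: verma K "om (Suc k)" "M (om (Suc k))" "vc (om (Suc k))" by (rule verma_M[OF om_H])
  define Q where "Q = (\<lambda>m. foldr (\<lambda>i. apply_first (\<Phi> i)) [Suc k..<r] (mpure m []))"
  have e: "(\<lambda>m. foldr (\<lambda>i. apply_first (\<Phi> i)) [k..<r] (mpure m [])) = (\<lambda>m. apply_first (\<Phi> k) (Q m))"
    using step.hyps by (simp add: Q_def upt_conv_Cons)
  have Q: "clinear Q" "Q m \<in> mspan (r - Suc k)" "Q (M \<mu> y m) = mtens_act (M (om (Suc k))) act y (Q m)" for y m
    using step.IH unfolding Q_def by auto
  have "apply_first (\<Phi> k) (Q m) \<in> mspan (r - k)" for m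
    using apply_first_mspan[OF bil \<Phi>(1,2)[OF step.hyps(2)] Q(2)] step.hyps by (simp add: Suc_diff_Suc)
  moreover have "apply_first (\<Phi> k) (Q (M \<mu> y m)) = mtens_act (M (om k)) act y (apply_first (\<Phi> k) (Q m))" for y m
    unfolding Q(3) by (rule apply_first_act[OF bil \<Phi>(1,2)[OF step.hyps(2)] S.act.lin_r act.lin_r \<Phi>(3)[OF step.hyps(2)] Q(2)])
  moreover have "clinear (\<lambda>m. apply_first (\<Phi> k) (Q m))" by (rule clinear_compose[OF Q(1) apply_first_lin])
  ultimately show ?case unfolding fun_cong[OF e] e by blast
qed

abbreviation IP :: "'m \<Rightarrow> ('m, 'v) mtens" where "IP \<equiv> intertwiner_product K M vc act r V \<nu> v \<mu>"

lemma IP: "clinear IP" "IP m \<in> mspan r" "IP (M \<mu> y m) = mtens_act (M (om 0)) act y (IP m)"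
  using foldr_intertwiners[of 0] by (simp_all add: intertwiner_product_def[abs_def])

lemma chain_trace:
  "twisted_trace K B Bi eb fb I1 I2 x \<mu> (M \<mu>) (vc \<mu>) (om 0) (M (om 0)) (vc (om 0)) (bs (om 0))
    (\<lambda>\<eta> m. contract \<eta> (IP m)) (wact act r) (tspan r)"
proof -
  interpret A: verma K \<mu> "M \<mu>" "vc \<mu>" by (rule verma_M[OF \<mu>_H])
  interpret verma_basis K "om 0" "M (om 0)" "vc (om 0)" "bs (om 0)" by (rule basis_M[OF om_H])
  show ?thesis
  proof (intro twisted_trace.intro twisted.intro bd_verma.intro twisted_axioms.intro twisted_trace_axioms.intro)
    show "ip (om 0) (al i) = ip \<mu> (al (\<tau> i))" if "i \<in> G1" for i using \<mu>_T[OF that] by (simp add: om_0)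
    show "ip \<mu> z = ip (om 0) z" if "z \<in> l_space K" for z using \<nu>_l[OF that] by (simp add: om_0 ip.diffl)
    show "clinear (\<lambda>m. contract \<eta> (IP m))" for \<eta> :: "'m \<Rightarrow> complex" by (rule clinear_compose[OF IP(1) contract_lin])
    show "contract (\<lambda>m. \<eta> m + \<eta>' m) (IP n) = contract \<eta> (IP n) + contract \<eta>' (IP n)" if "clinear \<eta>" "clinear \<eta>'" for \<eta> \<eta>' n
      by (rule contract_add[OF that IP(2)])
    show "contract (\<lambda>m. c * \<eta> m) (IP n) = c *\<^sub>C contract \<eta> (IP n)" if "clinear \<eta>" for c \<eta> n
      by (rule contract_scale[OF that IP(2)])
    show "contract \<eta> (IP (M \<mu> u m)) = contract (\<lambda>n. \<eta> (M (om 0) u n)) (IP m) + wact act r u (contract \<eta> (IP m))"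
      if "clinear \<eta>" for \<eta> u m
      unfolding IP(3) by (rule contract_mtens_act[where actM = "M (om 0)", OF bil IP(2) that act.lin_r])
    show "contract \<eta> (IP m) \<in> tspan r" if "clinear \<eta>" for \<eta> m by (rule contract_tspan[OF that IP(2)])
    show "wact act r (lie K u u') w = wact act r u (wact act r u' w) - wact act r u' (wact act r u w)" if "w \<in> tspan r" for u u' w
      by (rule wact_br[OF bil _ that]) (use modV in \<open>simp add: lie_module_def\<close>)
  qed (simp_all add: bd_axioms A.verma_axioms verma_basis_axioms subspace_tspan wact_tspan[OF bil] wact_lin wact_add[OF bil] wact_scale[OF bil])
qed

lemma difference_equation:
  defines "\<F> \<equiv> trace_FF K B \<rho> M vc act r V \<nu> v \<mu>"
  shows "(\<Sum>j\<in>I1. partial K (x j) (partial K (x j) \<F>)) - (\<Sum>l<r. \<Sum>n<r. S_T K B Bi eb fb I2 x act l n \<F>)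
    = form K (\<mu> + \<rho>) (\<mu> + \<rho>) *\<^sub>C \<F>"
proof -
  interpret A: twisted_trace K B Bi eb fb I1 I2 x \<mu> "M \<mu>" "vc \<mu>" "om 0" "M (om 0)" "vc (om 0)" "bs (om 0)"
    "\<lambda>\<eta> m. contract \<eta> (IP m)" "wact act r" "tspan r" by (rule chain_trace)
  have "trace_F K B M vc act r V \<nu> v \<mu> = A.F"
    unfolding trace_F_def Let_def om_0[symmetric] A.verma_B_eq[where M = M and vc = vc, OF refl refl refl refl]
    by (rule A.trace_series_F[OF bs_def])
  then have F: "\<F> = series_mult (delta_B K B M vc \<rho>) A.F" by (simp add: \<F>_def trace_FF_def)
  have t: "tame \<F>" unfolding F by (rule series_mult_tame[OF delta_B_Dp(1) A.F_tame])
  \<comment> \<open>The summand (\<rho>, \<rho>) contributed by the normalization completes the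
    square in the Casimir eigenvalue.\<close>
  have "ip \<mu> \<mu> + 2 * ip \<rho> \<mu> + ip \<rho> \<rho> = ip (\<mu> + \<rho>) (\<mu> + \<rho>)"
    by (simp add: ip.addl ip.addr ip_sym[of \<mu> \<rho>])
  with normalized_identity[OF A.F_tame A.wa_lin A.operator_identity[OF rho]] show ?thesis
    unfolding S_T_Sop[OF t bil] unfolding F by simp
qed

end

theorem theorem3p2:
  fixes K :: "('g::complex_vec, 'i::finite) bd_algebra"
    and B Bi :: "'g \<Rightarrow> 'g"
    and eb fb :: "'g \<Rightarrow> nat \<Rightarrow> 'g"
    and I1 I2 :: "nat set" and x :: "nat \<Rightarrow> 'g"
    and \<rho> \<mu> :: 'g
    and M :: "'g \<Rightarrow> 'g \<Rightarrow> 'm \<Rightarrow> 'm::complex_vec" and vac :: "'g \<Rightarrow> 'm"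
    and act :: "'g \<Rightarrow> 'v \<Rightarrow> 'v::complex_vec"
    and r :: nat and V :: "nat \<Rightarrow> 'v set" and v :: "nat \<Rightarrow> 'v" and \<nu> :: "nat \<Rightarrow> 'g"
  assumes "symmetrizable_kac_moody K"
    and "gbd_triple K" and "nondegenerate_triple K"
    and "is_B K B" and "is_B_inv K Bi" and "root_bases K B Bi eb fb"
    and "adapted_orthonormal_basis K I1 I2 x"
    and "is_rho K \<rho>"
    and "verma_family K M vac"
    and "r \<ge> 1"
    and "lie_module K act" and "\<And>i. i < r \<Longrightarrow> category_O K act (V i)"
    and "\<And>i. i < r \<Longrightarrow> \<nu> i \<in> cart K"
    and "\<And>i. i < r \<Longrightarrow> v i \<in> V i \<inter> weight_space K act (\<nu> i)"
    and "\<And>y. y \<in> l_space K \<Longrightarrow> form K (\<Sum>i<r. \<nu> i) y = 0"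
    and "\<mu> \<in> cart K"
    and "\<And>i. i \<in> Gam1 K \<Longrightarrow>
      form K (\<mu> - (\<Sum>i<r. \<nu> i)) (simple K i) = form K \<mu> (simple K (bdT K i))"
    and "\<And>i. i < r \<Longrightarrow> graded_dual_irreducible K (M (\<mu> - (\<Sum>j\<in>{i..<r}. \<nu> j)))"
  defines "\<F> \<equiv> trace_FF K B \<rho> M vac act r V \<nu> v \<mu>"
  shows "(\<Sum>j\<in>I1. partial K (x j) (partial K (x j) \<F>))
       - (\<Sum>l<r. \<Sum>n<r. S_T K B Bi eb fb I2 x act l n \<F>)
       = form K (\<mu> + \<rho>) (\<mu> + \<rho>) *\<^sub>C \<F>"
proof -
  interpret intertwiner_chain K B Bi eb fb I1 I2 x M vac \<rho> act r V v \<nu> \<mu>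
    by unfold_locales (use assms(1-18) in simp_all)
  show ?thesis unfolding \<F>_def by (rule difference_equation)
qed

end
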